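(* Let $0\le\vartheta\le1$, $0<n<+\infty$, $0\le j<+\infty$, $0\le\vartheta n-j\le\frac d2$, with $\vartheta\ne1$ if $n=j+\frac d2$; let $r\in[2,+\infty]$ be defined by $\frac1r=\frac12-\frac{\vartheta n-j}d$. Let $S(j,n,\vartheta)$ be the sharp constant of the Sobolev inequality $$H^n\subset\mathcal L^{2,r,j},\qquad\|D^jf\|_{\mathcal L^r}\le S\,\sqrt{\|f\|^2_{\mathcal L^2}+\|D^nf\|^2_{\mathcal L^2}}\quad\text{for some } S\in[0,+\infty)\text{ and all } f\in H^n.$$ Then $$S(j,n,\vartheta)\ge S_-(j,n,\vartheta\,|\,\varepsilon)\quad\text{for all }\varepsilon>0,$$ which implies $S(j,n,\vartheta)\ge S_-(j,n,\vartheta):=\sup_{\varepsilon\in(0,+\infty)}S_-(j,n,\vartheta\,|\,\varepsilon)$. Here $$S_-(j,n,\vartheta\,|\,\varepsilon):=\sqrt{(1-\vartheta)^{1-\vartheta}\vartheta^\vartheta}\;\frac{Y(j,n,\vartheta\,|\,\varepsilon)}{U(j,n\,|\,\varepsilon)^{1-\vartheta}\,V(j,n\,|\,\varepsilon)^\vartheta},$$ $$U(j,n\,|\,\varepsilon):=\left(\frac{2\pi^{d/2}}{\Gamma(d/2)}\int_0^{+\infty}d\xi\,\frac{\xi^{2n-2j+d-1}K^2_{n-j}(\xi)}{(\xi^2+\varepsilon^2)^{2n-j}}\right)^{1/2},\quad V(j,n\,|\,\varepsilon):=\left(\frac{2\pi^{d/2}}{\Gamma(d/2)}\int_0^{+\infty}d\xi\,\frac{\xi^{4n-2j+d-1}K^2_{n-j}(\xi)}{(\xi^2+\varepsilon^2)^{2n-j}}\right)^{1/2},$$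 $$Y(j,n,\vartheta\,|\,\varepsilon):=\left(\frac{2\pi^{d/2}}{\Gamma(d/2)}\int_0^{+\infty}d\rho\,\rho^{d-1}|M_{jn\varepsilon}(\rho)|^r\right)^{1/r}$$ (to be read as $\sup_{\rho\ge0}|M_{jn\varepsilon}(\rho)|$ if $r=+\infty$), where $M_{jn\varepsilon}\in C([0,+\infty),\mathbb R)$ is $$M_{jn\varepsilon}(\rho):=\int_0^{+\infty}d\xi\,\frac{J_{d/2-1}(\rho\xi)}{(\rho\xi)^{d/2-1}}\,\frac{\xi^{n+d-1}K_{n-j}(\xi)}{(\xi^2+\varepsilon^2)^{n-j/2}}.$$
   Context: Fix $d\in\{1,2,3,\dots\}$; functions are complex-valued on $\mathbb R^d$. $\mathcal S$ is the Schwartz space; the Fourier transform is $\mathcal F\varphi(k)=(2\pi)^{-d/2}\int_{\mathbb R^d}e^{-ik\cdot x}\varphi(x)\,dx$. $\Phi:=\{\phi\in\mathcal S:\int x_{i_1}\cdots x_{i_m}\phi(x)dx=0 \text{ for all } m\ge 0, i_1,\dots,i_m\}$ and $\Psi:=\{\psi\in\mathcal S: \partial_{i_1\cdots i_m}\psi(0)=0\text{ for all } m\ge0,i_1,\dots,i_m\}$ are closed subspaces of $\mathcal S$ with $\mathcal F\Phi=\Psi$; $\Phi',\Psi'$ are their topological duals. $\mathcal F:\Phi'\to\Psi'$ is the bijection $\langle\mathcal Ff,\psi\rangle:=\langle f,\mathcal F^{-1}\psi_R\rangle$, $\psi_R(k)=\psi(-k)$. For $s\in\mathbb R$ and $g\in\Psi'$,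 $|k|^sg\in\Psi'$ is $\langle|k|^sg,\psi\rangle:=\langle g,|k|^s\psi\rangle$, and $D^s:\Phi'\to\Phi'$ is the bijection $D^sf:=\mathcal F^{-1}(|k|^s\mathcal Ff)$ (so $D=\sqrt{-\Delta}$). $\mathcal L^p:=L^p(\mathbb R^d,\mathbb C)$ for $p\in[1,+\infty)$, while $\mathcal L^\infty:=C_0(\mathbb R^d,\mathbb C)$ (continuous functions vanishing at infinity, sup norm). A function $f\in\mathcal L^p$ is identified with the element $\phi\mapsto\int f\phi$ of $\Phi'$ (this map is injective). $H^n:=\{f\in\mathcal L^2:D^nf\in\mathcal L^2\}$, $\mathcal L^{2,r,j}:=\{f\in\mathcal L^2:D^jf\in\mathcal L^r\}$. Convention: $0^0:=1$. The sharp constant of an inequality is the smallest constant for which it holds; under the stated conditions on $j,n,\vartheta$ the Sobolev inequality above is known to hold. $J_\nu$ is the Bessel function of the first kind, $K_\mu$ the modified Bessel function of the second kind (Macdonald function). At $\rho=0$, $J_{d/2-1}(\rho\xi)/(\rho\xi)^{d/2-1}$ is understood as $\lim_{s\to0^+}J_{d/2-1}(s)/s^{d/2-1}=1/(2^{d/2-1}\Gamma(d/2))$. *)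

theory Defs
  imports "HOL-Analysis.Analysis"
begin

type_synonym 'd cfun = "real ^ 'd \<Rightarrow> complex"
type_synonym 'd functional = "'d cfun \<Rightarrow> complex"

section \<open>Test functions and their duals\<close>

text \<open>A list \<open>[i\<^sub>1, \<dots>, i\<^sub>m]\<close> of indices stands for the derivative
  \<open>\<partial>\<^bsub>i\<^sub>1 \<dots> i\<^sub>m\<^esub>\<close> or for the monomial \<open>x\<^bsub>i\<^sub>1\<^esub> \<dots> x\<^bsub>i\<^sub>m\<^esub>\<close>.\<close>

fun iter_partial :: "'d::finite list \<Rightarrow> 'd cfun \<Rightarrow> 'd cfun" where
  "iter_partial [] f = f"
| "iter_partial (i # is) f = (\<lambda>x. frechet_derivative (iter_partial is f) (at x) (axis i 1))"

definition monomial :: "'d::finite list \<Rightarrow> real ^ 'd \<Rightarrow> real" where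
  "monomial is x = prod_list (map (\<lambda>i. x $ i) is)"

definition smooth :: "'d::finite cfun \<Rightarrow> bool" where
  "smooth f \<longleftrightarrow> (\<forall>is x. iter_partial is f differentiable (at x))"

definition schwartz :: "'d::finite cfun set" where
  "schwartz = {f. smooth f \<and>
     (\<forall>m is. bounded (range (\<lambda>x. (1 + norm x) ^ m *\<^sub>R iter_partial is f x)))}"

definition schwartz_seminorm :: "nat \<Rightarrow> 'd::finite list \<Rightarrow> 'd cfun \<Rightarrow> real" where
  "schwartz_seminorm m is f = (SUP x. (1 + norm x) ^ m * norm (iter_partial is f x))"

definition schwartz_topology :: "'d::finite cfun topology" where
  "schwartz_topology = topology_generated_by
     {{f \<in> schwartz. schwartz_seminorm m is (\<lambda>x. f x - g x) < e} | m is g e.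
        g \<in> schwartz \<and> 0 < e}"

definition Phi :: "'d::finite cfun set" where
  "Phi = {f \<in> schwartz. \<forall>is. (LINT x|lborel. complex_of_real (monomial is x) * f x) = 0}"

definition Psi :: "'d::finite cfun set" where
  "Psi = {f \<in> schwartz. \<forall>is. iter_partial is f 0 = 0}"

text \<open>Functionals on a space of test functions are normalised to be \<open>undefined\<close> outside of it,
  so that they are equal as soon as they agree on all test functions.\<close>

definition dual :: "'d::finite cfun set \<Rightarrow> 'd functional set" where
  "dual X = {F \<in> extensional X.
     (\<forall>f\<in>X. \<forall>g\<in>X. F (\<lambda>x. f x + g x) = F f + F g) \<and>
     (\<forall>c. \<forall>f\<in>X. F (\<lambda>x. c * f x) = c * F f) \<and>
     continuous_map (subtopology schwartz_topology X) euclidean F}"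

section \<open>Fourier transform and fractional derivatives\<close>

definition fourier :: "'d::finite cfun \<Rightarrow> 'd cfun" where
  "fourier f k = complex_of_real ((2 * pi) powr (- real CARD('d) / 2)) *
     (LINT x|lborel. exp (- \<i> * complex_of_real (k \<bullet> x)) * f x)"

definition fourier_inv :: "'d::finite cfun \<Rightarrow> 'd cfun" where
  "fourier_inv = inv_into schwartz fourier"

definition fourier_dual :: "'d::finite functional \<Rightarrow> 'd functional" where
  "fourier_dual F = (\<lambda>f\<in>Psi. F (fourier_inv (\<lambda>k. f (- k))))"

text \<open>The value \<open>0 powr s = 0\<close> at the origin is harmless, as test functions in
  \<^term>\<open>Psi\<close> vanish there.\<close>

definition abs_power_mult :: "real \<Rightarrow> 'd::finite functional \<Rightarrow> 'd functional" where
  "abs_power_mult s G = (\<lambda>f\<in>Psi. G (\<lambda>k. complex_of_real (norm k powr s) * f k))"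

definition frac_deriv :: "real \<Rightarrow> 'd::finite functional \<Rightarrow> 'd functional" where
  "frac_deriv s F = inv_into (dual Phi) fourier_dual (abs_power_mult s (fourier_dual F))"

section \<open>Lebesgue and Sobolev spaces as subspaces of the dual of \<open>Phi\<close>\<close>

text \<open>For \<open>p = \<infinity>\<close> these are the continuous functions vanishing at infinity.\<close>

definition Lp_fun :: "ennreal \<Rightarrow> 'd::finite cfun set" where
  "Lp_fun p = (if p = \<infinity> then {f. continuous_on UNIV f \<and> (f \<longlongrightarrow> 0) at_infinity}
     else {f \<in> borel_measurable lborel. integrable lborel (\<lambda>x. norm (f x) powr enn2real p)})"

definition Lp_fun_norm :: "ennreal \<Rightarrow> 'd::finite cfun \<Rightarrow> real" where
  "Lp_fun_norm p f = (if p = \<infinity> then (SUP x. norm (f x))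
     else (LINT x|lborel. norm (f x) powr enn2real p) powr (1 / enn2real p))"

definition functional_of :: "'d::finite cfun \<Rightarrow> 'd functional" where
  "functional_of f = (\<lambda>g\<in>Phi. LINT x|lborel. f x * g x)"

definition Lp :: "ennreal \<Rightarrow> 'd::finite functional set" where
  "Lp p = functional_of ` Lp_fun p"

text \<open>The representing function is determined almost everywhere, so its choice is immaterial.\<close>

definition Lp_norm :: "ennreal \<Rightarrow> 'd::finite functional \<Rightarrow> real" where
  "Lp_norm p F = Lp_fun_norm p (SOME f. f \<in> Lp_fun p \<and> functional_of f = F)"

definition H_space :: "real \<Rightarrow> 'd::finite functional set" where
  "H_space n = {F \<in> Lp 2. frac_deriv n F \<in> Lp 2}"

definition L2_space :: "ennreal \<Rightarrow> real \<Rightarrow> 'd::finite functional set" where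
  "L2_space r j = {F \<in> Lp 2. frac_deriv j F \<in> Lp r}"

text \<open>The dimension enters through the type argument. The infimum is taken in the extended reals,
  hence it is \<open>\<infinity>\<close> if the inequality holds with no finite constant; otherwise it is the
  smallest admissible constant, since the inequality is preserved under limits of constants.\<close>

definition sobolev_inequality :: "'d::finite itself \<Rightarrow> real \<Rightarrow> real \<Rightarrow> ennreal \<Rightarrow> real \<Rightarrow> bool" where
  "sobolev_inequality (T :: 'd itself) j n r S \<longleftrightarrow>
     (H_space n :: 'd functional set) \<subseteq> L2_space r j \<and>
     (\<forall>F \<in> (H_space n :: 'd functional set).
        Lp_norm r (frac_deriv j F) \<le> S * sqrt ((Lp_norm 2 F)\<^sup>2 + (Lp_norm 2 (frac_deriv n F))\<^sup>2))"

definition sobolev_sharp_constant :: "'d::finite itself \<Rightarrow> real \<Rightarrow> real \<Rightarrow> ennreal \<Rightarrow> ereal" where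
  "sobolev_sharp_constant T j n r = Inf {ereal S | S. 0 \<le> S \<and> sobolev_inequality T j n r S}"

section \<open>Bessel functions on the positive half-line\<close>

text \<open>\<^term>\<open>rGamma\<close> is the entire function \<open>1 / \<Gamma>\<close>, with zeros at the poles of \<open>\<Gamma>\<close>.\<close>

definition bessel_J :: "real \<Rightarrow> real \<Rightarrow> real" where
  "bessel_J \<nu> x = (\<Sum>m. (- 1) ^ m * rGamma (\<nu> + real m + 1) / fact m * (x / 2) powr (2 * real m + \<nu>))"

definition bessel_I :: "real \<Rightarrow> real \<Rightarrow> real" where
  "bessel_I \<nu> x = (\<Sum>m. rGamma (\<nu> + real m + 1) / fact m * (x / 2) powr (2 * real m + \<nu>))"

definition macdonald_K :: "real \<Rightarrow> real \<Rightarrow> real" where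
  "macdonald_K \<mu> x =
     (let Q = (\<lambda>\<nu>. pi / 2 * (bessel_I (- \<nu>) x - bessel_I \<nu> x) / sin (\<nu> * pi))
      in if \<mu> \<in> \<int> then Lim (at \<mu>) Q else Q \<mu>)"

text \<open>\<open>J\<^sub>\<nu>(s) / s\<^sup>\<nu>\<close>, extended to \<open>s = 0\<close> by its limit.\<close>

definition bessel_J_quotient :: "real \<Rightarrow> real \<Rightarrow> real" where
  "bessel_J_quotient \<nu> s =
     (if s = 0 then 1 / (2 powr \<nu> * Gamma (\<nu> + 1)) else bessel_J \<nu> s / s powr \<nu>)"

section \<open>The lower bound\<close>

text \<open>Power of a nonnegative real with \<open>0\<^sup>0 = 1\<close>, whereas \<open>0 powr 0 = 0\<close>.\<close>

definition rpow :: "real \<Rightarrow> real \<Rightarrow> real" where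
  "rpow a b = (if b = 0 then 1 else a powr b)"

definition sphere_factor :: "nat \<Rightarrow> real" where
  "sphere_factor d = 2 * pi powr (real d / 2) / Gamma (real d / 2)"

definition U_bound :: "nat \<Rightarrow> real \<Rightarrow> real \<Rightarrow> real \<Rightarrow> real" where
  "U_bound d j n \<epsilon> = sqrt (sphere_factor d *
     (LINT \<xi>:{0<..}|lborel. \<xi> powr (2 * n - 2 * j + real d - 1) * (macdonald_K (n - j) \<xi>)\<^sup>2 /
        (\<xi>\<^sup>2 + \<epsilon>\<^sup>2) powr (2 * n - j)))"

definition V_bound :: "nat \<Rightarrow> real \<Rightarrow> real \<Rightarrow> real \<Rightarrow> real" where
  "V_bound d j n \<epsilon> = sqrt (sphere_factor d *
     (LINT \<xi>:{0<..}|lborel. \<xi> powr (4 * n - 2 * j + real d - 1) * (macdonald_K (n - j) \<xi>)\<^sup>2 /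
        (\<xi>\<^sup>2 + \<epsilon>\<^sup>2) powr (2 * n - j)))"

definition M_fun :: "nat \<Rightarrow> real \<Rightarrow> real \<Rightarrow> real \<Rightarrow> real \<Rightarrow> real" where
  "M_fun d j n \<epsilon> \<rho> =
     (LINT \<xi>:{0<..}|lborel. bessel_J_quotient (real d / 2 - 1) (\<rho> * \<xi>) *
        (\<xi> powr (n + real d - 1) * macdonald_K (n - j) \<xi> / (\<xi>\<^sup>2 + \<epsilon>\<^sup>2) powr (n - j / 2)))"

definition Y_bound :: "nat \<Rightarrow> real \<Rightarrow> real \<Rightarrow> ennreal \<Rightarrow> real \<Rightarrow> real" where
  "Y_bound d j n r \<epsilon> =
     (if r = \<infinity> then (SUP \<rho>\<in>{0..}. \<bar>M_fun d j n \<epsilon> \<rho>\<bar>)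
      else (sphere_factor d *
        (LINT \<rho>:{0<..}|lborel. \<rho> powr (real d - 1) * \<bar>M_fun d j n \<epsilon> \<rho>\<bar> powr enn2real r))
          powr (1 / enn2real r))"

text \<open>The dependence on \<open>\<theta>\<close> of \<^term>\<open>Y_bound\<close> is only through the exponent \<open>r\<close>.\<close>

definition S_minus :: "nat \<Rightarrow> real \<Rightarrow> real \<Rightarrow> real \<Rightarrow> ennreal \<Rightarrow> real \<Rightarrow> real" where
  "S_minus d j n \<theta> r \<epsilon> = sqrt (rpow (1 - \<theta>) (1 - \<theta>) * rpow \<theta> \<theta>) *
     (Y_bound d j n r \<epsilon> / (rpow (U_bound d j n \<epsilon>) (1 - \<theta>) * rpow (V_bound d j n \<epsilon>) \<theta>))"

end

theory Submission
  imports Defs "HOL-Probability.Probability" "HOL-Real_Asymp.Real_Asymp"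
begin

text \<open>Every element of \<open>H\<^sup>n\<close> bounds the sharp constant from below by the quotient of the two sides of the
inequality. The bound in question comes from functions whose Fourier transform is radial,
\<open>u(k) = w(\<lambda>|k|)\<close> with \<open>\<lambda> > 0\<close> and \<open>w(\<xi>) = \<xi>\<^bsup>n-j\<^esup> K\<^bsub>n-j\<^esub>(\<xi>) / (\<xi>\<^sup>2 + \<epsilon>\<^sup>2)\<^bsup>n-j/2\<^esup>\<close>.
If \<open>f\<close> is the transform of \<open>u\<close>, then \<open>D\<^sup>s f\<close> is the transform of \<open>|k|\<^sup>s u\<close>. In polar coordinates the
\<open>L\<^sup>2\<close> norms of \<open>u\<close> and \<open>|k|\<^sup>n u\<close> become \<open>U\<close> and \<open>V\<close>, up to powers of \<open>\<lambda>\<close>, while \<open>D\<^sup>j f\<close> is radial, with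
profile the Bessel transform \<open>M\<close>, so that its \<open>L\<^sup>r\<close> norm is \<open>Y\<close> up to a power of \<open>\<lambda>\<close>. The relation
between \<open>r\<close> and \<open>\<theta>\<close> makes these powers combine, and with \<open>t = \<lambda>\<^bsup>2n\<^esup>\<close> every admissible constant
satisfies \<open>Y \<le> S (t\<^sup>\<theta> U\<^sup>2 + t\<^bsup>\<theta>-1\<^esup> V\<^sup>2)\<^bsup>1/2\<^esup>\<close>. Minimising the right-hand side over \<open>t\<close> gives the bound
(\<open>optimize_dilation\<close>). The norms of \<open>f\<close> and \<open>D\<^sup>n f\<close> stand on the larger side, which is why Plancherel's
theorem can be replaced by the inequality \<open>fourier_L2_bound\<close>.

Three points need a development of their own.

\<^item> The operator \<open>D\<^sup>s\<close> acts on functionals on \<open>\<Phi>\<close>. By Fourier inversion for Schwartz functions the transform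
  maps \<open>\<Phi>\<close> to \<open>\<Psi>\<close> and back, and \<open>|k|\<^sup>s\<close> multiplies \<open>\<Psi>\<close> into itself, because a function in \<open>\<Psi>\<close> vanishes to
  infinite order at the origin (\<open>norm_powr_mult_Psi\<close>). The multiplication formula
  \<open>\<integral> \<F>u \<phi> = \<integral> u \<F>\<phi>\<close> then identifies \<open>D\<^sup>s\<close> on transforms (\<open>frac_deriv_functional_of_fourier\<close>).
\<^item> The norm of a functional is that of some representing function, so representatives have to agree almost
  everywhere (\<open>functional_of_eq_imp_AE_eq\<close>). All moments of a function in \<open>\<Phi>\<close> vanish, so \<open>\<Phi>\<close> contains no
  approximate identity. It does contain the difference of two dilates of one, if their Fourier
  transforms are constant to infinite order at the origin. Spreading one of the two dilates over all of
  space removes its contribution, since functions in \<open>L\<^sup>p\<close> are small in an average sense.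
\<^item> The Bessel functions are given by power series. The radial Fourier transform is computed by integrating
  the cosine series termwise, with constants fixed by Gaussian moments (\<open>radial_fourier\<close>). The Macdonald
  function is identified with a positive integral by means of Wronskians (\<open>macdonald_K_integral\<close>), from
  which its decay and its singularity at the origin can be read off (\<open>macdonald_K_bound\<close>).\<close>

section \<open>Schwartz functions vanishing to infinite order\<close>

text \<open>Chiefly for integrals that depend on a parameter: a bound of second order on the remainder of the integrand
is integrated, so no theorem on differentiation under the integral sign enters.\<close>

lemma has_derivative_from_quadratic_remainder:
  fixes f :: "'a::real_normed_vector \<Rightarrow> 'b::real_normed_vector"
  assumes D: "bounded_linear D" and "\<delta> > 0"
    and rem: "\<And>h. norm h \<le> \<delta> \<Longrightarrow> norm (f (x + h) - f x - D h) \<le> C * (norm h)\<^sup>2"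
  shows "(f has_derivative D) (at x)"
  unfolding has_derivative_at
proof (intro conjI D, rule Lim_null_comparison)
  show "((\<lambda>h. \<bar>C\<bar> * norm h) \<longlongrightarrow> 0) (at (0::'a))" by (auto intro!: tendsto_eq_intros)
  have "eventually (\<lambda>h. norm h \<le> \<delta> \<and> h \<noteq> 0) (at (0::'a))"
    unfolding eventually_at using \<open>\<delta> > 0\<close> by (intro exI[of _ \<delta>]) auto
  thus "\<forall>\<^sub>F h in at 0. norm (norm (f (x + h) - f x - D h) / norm h) \<le> \<bar>C\<bar> * norm h"
  proof eventually_elim
    fix h :: 'a assume h: "norm h \<le> \<delta> \<and> h \<noteq> 0"
    have "norm (f (x + h) - f x - D h) \<le> \<bar>C\<bar> * (norm h)\<^sup>2"
      using rem[of h] h by (meson abs_ge_self mult_right_mono order_trans zero_le_power2)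
    thus "norm (norm (f (x + h) - f x - D h) / norm h) \<le> \<bar>C\<bar> * norm h"
      using h by (simp add: divide_simps power2_eq_square)
  qed
qed

text \<open>The step by which \<^const>\<open>iter_partial\<close> recurses.\<close>

definition partial_deriv :: "'d::finite \<Rightarrow> 'd cfun \<Rightarrow> 'd cfun" where
  "partial_deriv i f = (\<lambda>x. frechet_derivative f (at x) (axis i 1))"

text \<open>One notion for two spaces: \<open>Z = {}\<close> gives the Schwartz space and \<open>Z = {0}\<close> gives \<open>\<Psi>\<close>, so that closure
properties have to be proved only once.\<close>

definition schwartz_flat_on :: "(real ^ 'd) set \<Rightarrow> 'd::finite cfun set" where
  "schwartz_flat_on Z = {f \<in> schwartz. \<forall>is. \<forall>z\<in>Z. iter_partial is f z = 0}"

lemma schwartz_eq_flat: "schwartz = schwartz_flat_on {}"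
  by (simp add: schwartz_flat_on_def)

lemma Psi_eq_flat: "Psi = schwartz_flat_on {0}"
  by (simp add: schwartz_flat_on_def Psi_def)

lemma iter_partial_Cons: "iter_partial (i # is) f = partial_deriv i (iter_partial is f)"
  by (simp add: partial_deriv_def)

lemma iter_partial_append: "iter_partial (is @ js) f = iter_partial is (iter_partial js f)"
  by (induction "is") auto

lemma partial_deriv_eqI: "(f has_derivative f') (at x) \<Longrightarrow> partial_deriv i f x = f' (axis i 1)"
  unfolding partial_deriv_def using frechet_derivative_at by metis

text \<open>Membership is a greatest fixed point: a set of differentiable, rapidly decreasing functions that vanish
on \<open>Z\<close> and that is closed under partial derivatives contains all iterated derivatives of its elements. This
avoids Leibniz formulas for products.\<close>

lemma schwartz_flat_coinduct:
  fixes C :: "'d::finite cfun set"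
  assumes "f \<in> C"
    and diff: "\<And>g x. g \<in> C \<Longrightarrow> g differentiable (at x)"
    and closed: "\<And>g i. g \<in> C \<Longrightarrow> partial_deriv i g \<in> C"
    and bound: "\<And>g m. g \<in> C \<Longrightarrow> \<exists>B. \<forall>x. (1 + norm x) ^ m * norm (g x) \<le> B"
    and flat: "\<And>g z. g \<in> C \<Longrightarrow> z \<in> Z \<Longrightarrow> g z = 0"
  shows "f \<in> schwartz_flat_on Z"
proof -
  have C: "iter_partial is f \<in> C" for "is"
    by (induction "is") (use \<open>f \<in> C\<close> closed in \<open>auto simp: iter_partial_Cons simp del: iter_partial.simps(2)\<close>)
  have "bounded (range (\<lambda>x. (1 + norm x) ^ m *\<^sub>R iter_partial is f x))" for m "is"
    using bound[OF C, of m "is"] unfolding bounded_iff by (auto simp: power_abs)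
  thus ?thesis unfolding schwartz_flat_on_def schwartz_def smooth_def
    using diff[OF C] flat[OF C] by auto
qed

lemma schwartz_flat_bound:
  assumes "f \<in> schwartz_flat_on Z" shows "\<exists>B\<ge>0. \<forall>x. (1 + norm x) ^ m * norm (f x) \<le> B"
proof -
  have "bounded (range (\<lambda>x. (1 + norm x) ^ m *\<^sub>R iter_partial [] f x))"
    using assms unfolding schwartz_flat_on_def schwartz_def by blast
  then obtain B where B: "\<And>x. norm ((1 + norm x) ^ m *\<^sub>R f x) \<le> B" unfolding bounded_iff by auto
  hence "(1 + norm x) ^ m * norm (f x) \<le> B" for x using B[of x] by (simp add: power_abs)
  moreover have "B \<ge> 0" using B[of 0] norm_ge_zero order_trans by blast
  ultimately show ?thesis by blast
qed

lemma schwartz_flat_differentiable: "f \<in> schwartz_flat_on Z \<Longrightarrow> f differentiable (at x)"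
  unfolding schwartz_flat_on_def schwartz_def smooth_def using iter_partial.simps(1) by (metis (mono_tags, lifting) mem_Collect_eq)

lemma schwartz_flat_partial: assumes "f \<in> schwartz_flat_on Z" shows "partial_deriv i f \<in> schwartz_flat_on Z"
proof -
  have e: "iter_partial is (partial_deriv i f) = iter_partial (is @ [i]) f" for "is"
    by (simp add: iter_partial_append partial_deriv_def)
  show ?thesis using assms unfolding schwartz_flat_on_def schwartz_def smooth_def mem_Collect_eq e by blast
qed

lemma schwartz_flat_zero: "f \<in> schwartz_flat_on Z \<Longrightarrow> z \<in> Z \<Longrightarrow> f z = 0"
  unfolding schwartz_flat_on_def using iter_partial.simps(1) by (metis (mono_tags, lifting) mem_Collect_eq)

lemma has_derivative_partial_derivs:
  fixes f :: "'d::finite cfun"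
  assumes "f differentiable (at x)"
  shows "(f has_derivative (\<lambda>h. \<Sum>i\<in>UNIV. (h $ i) *\<^sub>R partial_deriv i f x)) (at x)"
proof -
  have D: "(f has_derivative frechet_derivative f (at x)) (at x)"
    using assms frechet_derivative_works by blast
  have "frechet_derivative f (at x) h = (\<Sum>i\<in>UNIV. (h $ i) *\<^sub>R partial_deriv i f x)" for h
  proof -
    have "frechet_derivative f (at x) h = frechet_derivative f (at x) (\<Sum>i\<in>UNIV. (h $ i) *\<^sub>R axis i 1)"
      using basis_expansion[of h] by (simp add: scalar_mult_eq_scaleR)
    also have "\<dots> = (\<Sum>i\<in>UNIV. (h $ i) *\<^sub>R partial_deriv i f x)"
      unfolding partial_deriv_def
      by (simp add: linear_sum[OF has_derivative_linear[OF D]] linear_scale[OF has_derivative_linear[OF D]])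
    finally show ?thesis .
  qed
  hence "frechet_derivative f (at x) = (\<lambda>h. \<Sum>i\<in>UNIV. (h $ i) *\<^sub>R partial_deriv i f x)" by (rule ext)
  with D show ?thesis by (simp only:)
qed

lemma schwartz_flat_has_derivative:
  "f \<in> schwartz_flat_on Z \<Longrightarrow> (f has_derivative (\<lambda>h. \<Sum>i\<in>UNIV. (h $ i) *\<^sub>R partial_deriv i f x)) (at x)"
  by (intro has_derivative_partial_derivs schwartz_flat_differentiable)

lemma sum_axis_scaleR: "(\<Sum>i\<in>UNIV. (axis j 1 $ i) *\<^sub>R (c i :: 'a::real_vector)) = c (j::'d::finite)"
proof -
  have "(\<Sum>i\<in>UNIV. (axis j 1 $ i) *\<^sub>R c i) = (\<Sum>i\<in>UNIV. if i = j then c i else 0)"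
    by (intro sum.cong) (auto simp: axis_def)
  thus ?thesis by simp
qed

text \<open>The module generated by \<open>G\<close> over the polynomials in the coordinates.\<close>

inductive_set coord_span :: "'d::finite cfun set \<Rightarrow> 'd cfun set" for G where
  base: "g \<in> G \<Longrightarrow> g \<in> coord_span G"
| coord: "g \<in> coord_span G \<Longrightarrow> (\<lambda>x. complex_of_real (x $ i) * g x) \<in> coord_span G"
| lincomb: "f \<in> coord_span G \<Longrightarrow> g \<in> coord_span G \<Longrightarrow> (\<lambda>x. a * f x + b * g x) \<in> coord_span G"

text \<open>For functions of \<open>(norm k)\<^sup>2\<close> each derivative produces a coordinate factor. Allowing such factors makes a
family of generators closed under derivatives, which is what coinduction asks for.\<close>

lemma coord_span_subset_schwartz_flat:
  fixes G :: "'d::finite cfun set"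
  assumes diff: "\<And>g x. g \<in> G \<Longrightarrow> g differentiable (at x)"
    and partial: "\<And>g i. g \<in> G \<Longrightarrow> partial_deriv i g \<in> coord_span G"
    and bound: "\<And>g m. g \<in> G \<Longrightarrow> \<exists>B. \<forall>x. (1 + norm x) ^ m * norm (g x) \<le> B"
    and flat: "\<And>g z. g \<in> G \<Longrightarrow> z \<in> Z \<Longrightarrow> g z = 0"
  shows "coord_span G \<subseteq> schwartz_flat_on Z"
proof
  have 1: "(\<forall>x. f differentiable (at x)) \<and> (\<forall>i. partial_deriv i f \<in> coord_span G) \<and> (\<forall>m. \<exists>B. \<forall>x. (1 + norm x) ^ m * norm (f x) \<le> B) \<and> (\<forall>z\<in>Z. f z = 0)"
    if "f \<in> coord_span G" for f
    using that
  proof induction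
    case (base g)
    thus ?case using assms by blast
  next
    case (coord g j)
    have c: "((\<lambda>x. complex_of_real (x $ j)) has_derivative (\<lambda>h. complex_of_real (h $ j))) (at x)" for x :: "real ^ 'd"
      by (intro bounded_linear.has_derivative[OF bounded_linear_of_real] bounded_linear_imp_has_derivative bounded_linear_vec_nth)
    have D: "((\<lambda>x. complex_of_real (x $ j) * g x) has_derivative
        (\<lambda>h. complex_of_real (x $ j) * (\<Sum>i\<in>UNIV. (h $ i) *\<^sub>R partial_deriv i g x) + complex_of_real (h $ j) * g x)) (at x)" for x
      using coord.IH by (intro has_derivative_mult c has_derivative_partial_derivs) blast
    have "partial_deriv i (\<lambda>x. complex_of_real (x $ j) * g x) = (\<lambda>x. 1 * (complex_of_real (x $ j) * partial_deriv i g x) + complex_of_real (axis i 1 $ j) * g x)" for i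
      by (rule ext, subst partial_deriv_eqI[OF D]) (simp add: sum_axis_scaleR)
    moreover have "(\<lambda>x. 1 * (complex_of_real (x $ j) * partial_deriv i g x) + complex_of_real (axis i 1 $ j) * g x) \<in> coord_span G" for i
      using coord.IH coord.hyps by (intro coord_span.lincomb coord_span.coord) auto
    ultimately have p2: "partial_deriv i (\<lambda>x. complex_of_real (x $ j) * g x) \<in> coord_span G" for i by (simp only:)
    have p3: "\<exists>B. \<forall>x. (1 + norm x) ^ m * norm (complex_of_real (x $ j) * g x) \<le> B" for m
    proof -
      obtain B where B: "\<And>x. (1 + norm x) ^ Suc m * norm (g x) \<le> B" using coord.IH by blast
      have "(1 + norm x) ^ m * norm (complex_of_real (x $ j) * g x) \<le> B" for x
      proof -
        have "norm (complex_of_real (x $ j) * g x) \<le> (1 + norm x) * norm (g x)"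
          unfolding norm_mult using component_le_norm_cart[of x j] by (intro mult_right_mono) auto
        hence "(1 + norm x) ^ m * norm (complex_of_real (x $ j) * g x) \<le> (1 + norm x) ^ m * ((1 + norm x) * norm (g x))"
          by (intro mult_left_mono) auto
        also have "\<dots> = (1 + norm x) ^ Suc m * norm (g x)" by simp
        also have "\<dots> \<le> B" by (rule B)
        finally show ?thesis .
      qed
      thus ?thesis by blast
    qed
    have p4: "\<forall>z\<in>Z. complex_of_real (z $ j) * g z = 0" using coord.IH by simp
    have p1: "\<forall>x. (\<lambda>x. complex_of_real (x $ j) * g x) differentiable at x" using D differentiableI by blast
    show ?case by (intro conjI allI p1[rule_format] p2 p3 p4)
  next
    case (lincomb f g a b)
    have D: "((\<lambda>x. a * f x + b * g x) has_derivative (\<lambda>h. a * (\<Sum>i\<in>UNIV. (h $ i) *\<^sub>R partial_deriv i f x) + b * (\<Sum>i\<in>UNIV. (h $ i) *\<^sub>R partial_deriv i g x))) (at x)" for x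
      using lincomb.IH by (intro has_derivative_add has_derivative_mult_right has_derivative_partial_derivs) blast+
    have "partial_deriv i (\<lambda>x. a * f x + b * g x) = (\<lambda>x. a * partial_deriv i f x + b * partial_deriv i g x)" for i
      by (rule ext, subst partial_deriv_eqI[OF D]) (simp add: sum_axis_scaleR)
    moreover have "(\<lambda>x. a * partial_deriv i f x + b * partial_deriv i g x) \<in> coord_span G" for i
      using lincomb.IH by (intro coord_span.lincomb) auto
    ultimately have p2: "partial_deriv i (\<lambda>x. a * f x + b * g x) \<in> coord_span G" for i by (simp only:)
    have p3: "\<exists>B. \<forall>x. (1 + norm x) ^ m * norm (a * f x + b * g x) \<le> B" for m
    proof -
      obtain B1 where B1: "\<And>x. (1 + norm x) ^ m * norm (f x) \<le> B1" using lincomb.IH by blast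
      obtain B2 where B2: "\<And>x. (1 + norm x) ^ m * norm (g x) \<le> B2" using lincomb.IH by blast
      have "(1 + norm x) ^ m * norm (a * f x + b * g x) \<le> norm a * B1 + norm b * B2" for x
      proof -
        have "norm (a * f x + b * g x) \<le> norm a * norm (f x) + norm b * norm (g x)"
          by (metis norm_mult norm_triangle_ineq)
        hence "(1 + norm x) ^ m * norm (a * f x + b * g x) \<le> (1 + norm x) ^ m * (norm a * norm (f x) + norm b * norm (g x))"
          by (intro mult_left_mono) auto
        also have "\<dots> = norm a * ((1 + norm x) ^ m * norm (f x)) + norm b * ((1 + norm x) ^ m * norm (g x))"
          by (simp add: algebra_simps)
        also have "\<dots> \<le> norm a * B1 + norm b * B2" using B1 B2 by (intro add_mono mult_left_mono) auto
        finally show ?thesis .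
      qed
      thus ?thesis by blast
    qed
    have p4: "\<forall>z\<in>Z. a * f z + b * g z = 0" using lincomb.IH by simp
    have p1: "\<forall>x. (\<lambda>x. a * f x + b * g x) differentiable at x" using D differentiableI by blast
    show ?case by (intro conjI allI p1[rule_format] p2 p3 p4)
  qed
  fix f assume "f \<in> coord_span G"
  thus "f \<in> schwartz_flat_on Z"
    by (rule schwartz_flat_coinduct) (use 1 in blast)+
qed

lemma coord_span_schwartz_flat:
  fixes Z :: "(real ^ 'd::finite) set"
  shows "coord_span (schwartz_flat_on Z) \<subseteq> schwartz_flat_on Z"
proof (rule coord_span_subset_schwartz_flat)
  fix g assume g: "g \<in> schwartz_flat_on Z"
  show "g differentiable (at x)" for x by (rule schwartz_flat_differentiable[OF g])
  show "partial_deriv i g \<in> coord_span (schwartz_flat_on Z)" for i by (intro coord_span.base schwartz_flat_partial g)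
  show "\<exists>B. \<forall>x. (1 + norm x) ^ m * norm (g x) \<le> B" for m using schwartz_flat_bound[OF g] by blast
  show "g z = 0" if "z \<in> Z" for z by (rule schwartz_flat_zero[OF g that])
qed

lemma schwartz_flat_lincomb:
  assumes "f \<in> schwartz_flat_on Z" "g \<in> schwartz_flat_on Z"
  shows "(\<lambda>x. a * f x + b * g x) \<in> schwartz_flat_on Z"
  by (rule subsetD[OF coord_span_schwartz_flat]) (intro coord_span.lincomb coord_span.base assms)

lemma schwartz_flat_cmult: "f \<in> schwartz_flat_on Z \<Longrightarrow> (\<lambda>x. c * f x) \<in> schwartz_flat_on Z"
  using schwartz_flat_lincomb[of f Z f c 0] by simp

lemma schwartz_flat_coord:
  fixes f :: "'d::finite cfun"
  assumes "f \<in> schwartz_flat_on Z"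
  shows "(\<lambda>x. complex_of_real (x $ j) * f x) \<in> schwartz_flat_on Z"
  by (rule subsetD[OF coord_span_schwartz_flat]) (intro coord_span.coord coord_span.base assms)

lemma schwartz_flat_has_derivative_reflect:
  assumes "f \<in> schwartz_flat_on Z"
  shows "((\<lambda>x. f (- x)) has_derivative (\<lambda>h. \<Sum>i\<in>UNIV. ((- h) $ i) *\<^sub>R partial_deriv i f (- x))) (at x)"
proof (rule has_derivative_compose[where f = uminus and f' = uminus and g = f])
  show "(uminus has_derivative uminus) (at x)"
    by (rule bounded_linear_imp_has_derivative) (intro bounded_linear_minus bounded_linear_ident)
  show "(f has_derivative (\<lambda>h. \<Sum>i\<in>UNIV. (h $ i) *\<^sub>R partial_deriv i f (- x))) (at (- x))"
    by (rule schwartz_flat_has_derivative[OF assms])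
qed

lemma schwartz_flat_reflect:
  assumes "f \<in> schwartz_flat_on Z"
  shows "(\<lambda>x. f (- x)) \<in> schwartz_flat_on (uminus ` Z)"
proof (rule schwartz_flat_coinduct[where C = "{\<lambda>x. f (- x) | f. f \<in> schwartz_flat_on Z}"])
  fix h x assume "h \<in> {\<lambda>x. f (- x) | f. f \<in> schwartz_flat_on Z}"
  then obtain f where h: "h = (\<lambda>x. f (- x))" and f: "f \<in> schwartz_flat_on Z" by blast
  note D = schwartz_flat_has_derivative_reflect[OF f]
  show "h differentiable (at x)" unfolding h using D differentiableI by blast
  fix i
  have "partial_deriv i h = (\<lambda>x. (\<lambda>y. - 1 * partial_deriv i f y) (- x))"
    unfolding h using sum_axis_scaleR[of i "\<lambda>k. partial_deriv k f (- x)" for x]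
    by (intro ext, subst partial_deriv_eqI[OF D]) (simp add: sum_negf)
  thus "partial_deriv i h \<in> {\<lambda>x. f (- x) | f. f \<in> schwartz_flat_on Z}"
    using schwartz_flat_cmult[OF schwartz_flat_partial[OF f, of i], of "- 1"]
    by (intro CollectI exI[of _ "\<lambda>y. - 1 * partial_deriv i f y"] conjI)
next
  fix h m assume "h \<in> {\<lambda>x. f (- x) | f. f \<in> schwartz_flat_on Z}"
  then obtain f where h: "h = (\<lambda>x. f (- x))" and f: "f \<in> schwartz_flat_on Z" by blast
  obtain B where "\<And>x. (1 + norm x) ^ m * norm (f x) \<le> B" using schwartz_flat_bound[OF f, of m] by blast
  hence "(1 + norm (- x)) ^ m * norm (f (- x)) \<le> B" for x by blast
  thus "\<exists>B. \<forall>x. (1 + norm x) ^ m * norm (h x) \<le> B" unfolding h by auto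
qed (use assms in \<open>auto simp: schwartz_flat_zero\<close>)

lemma Psi_reflect: "f \<in> Psi \<Longrightarrow> (\<lambda>x. f (- x)) \<in> Psi"
  using schwartz_flat_reflect[of f "{0}"] by (simp add: Psi_eq_flat)

section \<open>Powers of the norm as multipliers\<close>

text \<open>A function that vanishes at the origin is bounded by \<open>norm k\<close> times a bound on its gradient. Induction on
the order applies, as the partial derivatives lie in \<open>\<Psi>\<close> again.\<close>

lemma Psi_flat_bound:
  fixes f :: "'d::finite cfun"
  assumes "f \<in> Psi" shows "\<exists>C\<ge>0. \<forall>k. norm (f k) \<le> C * norm k ^ N"
  using assms
proof (induction N arbitrary: f)
  case 0
  thus ?case using schwartz_flat_bound[of f "{0}" 0] by (simp add: Psi_eq_flat)
next
  case (Suc N)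
  have "\<exists>C. \<forall>i. C i \<ge> 0 \<and> (\<forall>k. norm (partial_deriv i f k) \<le> C i * norm k ^ N)"
    using Suc.IH[OF schwartz_flat_partial[OF Suc.prems[unfolded Psi_eq_flat], folded Psi_eq_flat]] by metis
  then obtain C where C: "\<And>i. C i \<ge> 0" "\<And>i k. norm (partial_deriv i f k) \<le> C i * norm k ^ N" by blast
  have "norm (f k) \<le> (\<Sum>i\<in>UNIV. C i) * norm k ^ Suc N" for k
  proof -
    have "norm (f k - f 0) \<le> ((\<Sum>i\<in>UNIV. C i) * norm k ^ N) * norm (k - 0)"
    proof (rule differentiable_bound[of "cball 0 (norm k)"])
      fix x :: "real ^ 'd" assume x: "x \<in> cball 0 (norm k)"
      show "(f has_derivative (\<lambda>h. \<Sum>i\<in>UNIV. (h $ i) *\<^sub>R partial_deriv i f x)) (at x within cball 0 (norm k))"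
        using Suc.prems schwartz_flat_has_derivative has_derivative_at_withinI unfolding Psi_eq_flat by blast
      show "onorm (\<lambda>h. \<Sum>i\<in>UNIV. (h $ i) *\<^sub>R partial_deriv i f x) \<le> (\<Sum>i\<in>UNIV. C i) * norm k ^ N"
      proof (rule onorm_le)
        fix h :: "real ^ 'd"
        have "norm (\<Sum>i\<in>UNIV. (h $ i) *\<^sub>R partial_deriv i f x) \<le> (\<Sum>i\<in>UNIV. C i * norm k ^ N * norm h)"
        proof (rule order_trans[OF norm_sum sum_mono])
          fix i
          have "norm (partial_deriv i f x) \<le> C i * norm x ^ N" by (rule C)
          also have "\<dots> \<le> C i * norm k ^ N" using x C(1) by (intro mult_left_mono power_mono) auto
          finally have "\<bar>h $ i\<bar> * norm (partial_deriv i f x) \<le> norm h * (C i * norm k ^ N)"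
            using component_le_norm_cart[of h i] by (intro mult_mono) auto
          thus "norm ((h $ i) *\<^sub>R partial_deriv i f x) \<le> C i * norm k ^ N * norm h" by (simp add: mult_ac)
        qed
        thus "norm (\<Sum>i\<in>UNIV. (h $ i) *\<^sub>R partial_deriv i f x) \<le> (\<Sum>i\<in>UNIV. C i) * norm k ^ N * norm h"
          by (simp add: sum_distrib_right)
      qed
    qed auto
    moreover have "f 0 = 0" using Suc.prems schwartz_flat_zero[of f "{0}" 0] by (simp add: Psi_eq_flat)
    ultimately show ?thesis by (simp add: mult_ac)
  qed
  thus ?case using C(1) by (intro exI[of _ "\<Sum>i\<in>UNIV. C i"]) (auto intro: sum_nonneg)
qed

text \<open>Negative powers of the norm are absorbed near the origin by the infinite order of vanishing, positive ones
at infinity by the rapid decrease.\<close>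

lemma Psi_norm_powr_bound:
  fixes f :: "'d::finite cfun"
  assumes "f \<in> Psi" shows "\<exists>B. \<forall>k. (1 + norm k) ^ m * (norm k powr a * norm (f k)) \<le> B"
proof -
  \<comment> \<open>An integer order dominating \<open>a\<close> in both directions.\<close>
  define N where "N = nat \<lceil>\<bar>a\<bar>\<rceil>"
  have N: "\<bar>a\<bar> \<le> real N" unfolding N_def by linarith
  obtain C where C: "C \<ge> 0" "\<And>k. norm (f k) \<le> C * norm k ^ N" using Psi_flat_bound[OF assms, of N] by blast
  obtain B where B: "B \<ge> 0" "\<And>k. (1 + norm k) ^ (m + N) * norm (f k) \<le> B"
    using schwartz_flat_bound[of f "{0}" "m + N"] assms by (auto simp: Psi_eq_flat)
  have "(1 + norm k) ^ m * (norm k powr a * norm (f k)) \<le> 2 ^ m * C + B" for k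
  proof (cases "norm k \<le> 1")
    case True
    have "norm k powr a * norm (f k) \<le> C"
    proof (cases "k = 0")
      case False
      have "norm k powr a * norm (f k) \<le> norm k powr a * (C * norm k powr N)"
        using C(2)[of k] False by (intro mult_left_mono) (auto simp: powr_realpow)
      also have "\<dots> = C * norm k powr (a + N)" by (simp add: powr_add)
      also have "norm k powr (a + N) \<le> norm k powr 0" using False True N by (intro powr_mono') auto
      hence "C * norm k powr (a + N) \<le> C * 1" using C(1) False by (intro mult_left_mono) auto
      finally show ?thesis by simp
    qed (use C in auto)
    hence "(1 + norm k) ^ m * (norm k powr a * norm (f k)) \<le> 2 ^ m * C"
      using True C by (intro mult_mono power_mono) auto
    thus ?thesis using B(1) by simp
  next
    case False
    have "norm k powr a \<le> norm k powr N" using False N by (intro powr_mono) auto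
    also have "\<dots> = norm k ^ N" using False by (subst powr_realpow) auto
    also have "\<dots> \<le> (1 + norm k) ^ N" by (intro power_mono) auto
    finally have "(1 + norm k) ^ m * (norm k powr a * norm (f k)) \<le> (1 + norm k) ^ m * ((1 + norm k) ^ N * norm (f k))"
      by (intro mult_left_mono mult_right_mono) auto
    also have "\<dots> = (1 + norm k) ^ (m + N) * norm (f k)" by (simp add: power_add)
    also have "\<dots> \<le> B" by (rule B)
    finally show ?thesis using C(1) by (simp add: add_increasing)
  qed
  thus ?thesis by blast
qed

definition norm_powr_mult :: "real \<Rightarrow> 'd::finite cfun \<Rightarrow> 'd cfun" where
  "norm_powr_mult a f = (\<lambda>k. complex_of_real (norm k powr a) * f k)"

text \<open>The exponent \<open>a - 2\<close> is paired with a coordinate factor, so that the derivative is again a combination of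
powers of the norm times functions in \<open>\<Psi>\<close>. At the origin everything is quadratically small.\<close>

lemma norm_powr_mult_has_derivative:
  fixes f :: "'d::finite cfun"
  assumes f: "f \<in> Psi"
  shows "(norm_powr_mult a f has_derivative (\<lambda>h. \<Sum>i\<in>UNIV. (h $ i) *\<^sub>R
     (norm_powr_mult (a - 2) (\<lambda>k. complex_of_real a * (complex_of_real (k $ i) * f k)) k + norm_powr_mult a (partial_deriv i f) k))) (at k)"
proof (cases "k = 0")
  case True
  obtain B where B: "\<And>k. (1 + norm k) ^ 0 * (norm k powr (a - 2) * norm (f k)) \<le> B"
    using Psi_norm_powr_bound[OF f, of 0 "a - 2"] by blast
  have "(norm_powr_mult a f has_derivative (\<lambda>h. 0)) (at 0)"
  proof (rule has_derivative_from_quadratic_remainder[where C = B and \<delta> = 1])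
    fix h :: "real ^ 'd"
    have "norm (norm_powr_mult a f h) = norm h powr (a - 2 + 2) * norm (f h)"
      by (simp add: norm_powr_mult_def norm_mult)
    also have "\<dots> = (norm h powr (a - 2) * norm (f h)) * (norm h)\<^sup>2"
      using powr_add[of "norm h" "a - 2" 2] by (cases "h = 0") (simp_all add: powr_numeral)
    also have "\<dots> \<le> B * (norm h)\<^sup>2" using B[of h] by (intro mult_right_mono) auto
    finally show "norm (norm_powr_mult a f (0 + h) - norm_powr_mult a f 0 - 0) \<le> B * (norm h)\<^sup>2"
      by (simp add: norm_powr_mult_def)
  qed auto
  thus ?thesis using True by (simp add: norm_powr_mult_def)
next
  case False
  have n: "(norm has_derivative (\<lambda>h. k \<bullet> h / norm k)) (at k)"
    using has_derivative_norm[OF False] by (simp add: sgn_div_norm inner_commute divide_inverse mult_ac)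
  have "((\<lambda>k. norm k powr a) has_derivative (\<lambda>h. a * norm k powr (a - 2) * (k \<bullet> h))) (at k)"
  proof -
    have "((\<lambda>k. norm k powr a) has_derivative (\<lambda>h. (k \<bullet> h / norm k) * (a * norm k powr (a - 1)))) (at k)"
      using has_derivative_compose[OF n has_real_derivative_powr[of "norm k" a, unfolded has_field_derivative_def]] False
      by (simp add: mult_ac)
    moreover have "norm k powr (a - 1) = norm k powr (a - 2) * norm k"
      using powr_add[of "norm k" "a - 2" 1] False by simp
    ultimately show ?thesis using False by (simp add: mult_ac)
  qed
  hence c: "((\<lambda>k. complex_of_real (norm k powr a)) has_derivative (\<lambda>h. complex_of_real (a * norm k powr (a - 2) * (k \<bullet> h)))) (at k)"
    by (rule bounded_linear.has_derivative[OF bounded_linear_of_real])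
  have D: "(norm_powr_mult a f has_derivative (\<lambda>h. complex_of_real (norm k powr a) * (\<Sum>i\<in>UNIV. (h $ i) *\<^sub>R partial_deriv i f k)
     + complex_of_real (a * norm k powr (a - 2) * (k \<bullet> h)) * f k)) (at k)"
    unfolding norm_powr_mult_def
    by (rule has_derivative_mult[OF c schwartz_flat_has_derivative[OF f[unfolded Psi_eq_flat]]])
  have "complex_of_real (norm k powr a) * (\<Sum>i\<in>UNIV. (h $ i) *\<^sub>R partial_deriv i f k)
     + complex_of_real (a * norm k powr (a - 2) * (k \<bullet> h)) * f k = (\<Sum>i\<in>UNIV. (h $ i) *\<^sub>R
     (norm_powr_mult (a - 2) (\<lambda>k. complex_of_real a * (complex_of_real (k $ i) * f k)) k + norm_powr_mult a (partial_deriv i f) k))" for h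
    unfolding inner_vec_def norm_powr_mult_def
    by (simp add: sum_distrib_left sum_distrib_right sum.distrib[symmetric] scaleR_conv_of_real algebra_simps)
  thus ?thesis using D by simp
qed

text \<open>A partial derivative of \<open>|k|\<^sup>a g\<close> is a sum of two functions of the same form, with exponents \<open>a - 2\<close> and \<open>a\<close>.\<close>

theorem norm_powr_mult_Psi:
  fixes f :: "'d::finite cfun"
  assumes "f \<in> Psi" shows "norm_powr_mult a f \<in> Psi"
proof -
  let ?G = "{norm_powr_mult a f | a f. f \<in> (Psi :: 'd cfun set)}"
  have base: "norm_powr_mult b h \<in> coord_span ?G" if "h \<in> Psi" for b h using that by (intro coord_span.base) blast
  have "coord_span ?G \<subseteq> schwartz_flat_on {0}"
  proof (rule coord_span_subset_schwartz_flat)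
    fix g assume "g \<in> ?G"
    then obtain a f where g: "g = norm_powr_mult a f" and f: "f \<in> Psi" by blast
    note D = norm_powr_mult_has_derivative[OF f, of a]
    show "g differentiable (at x)" for x unfolding g using D differentiableI by blast
    show "partial_deriv i g \<in> coord_span ?G" for i
    proof -
      let ?h = "\<lambda>k. complex_of_real a * (complex_of_real (k $ i) * f k)"
      have m: "?h \<in> Psi" "partial_deriv i f \<in> Psi"
        using f by (auto simp: Psi_eq_flat intro!: schwartz_flat_cmult schwartz_flat_coord schwartz_flat_partial)
      have "partial_deriv i g = (\<lambda>k. 1 * norm_powr_mult (a - 2) ?h k + 1 * norm_powr_mult a (partial_deriv i f) k)"
        unfolding g by (rule ext, subst partial_deriv_eqI[OF D]) (simp add: sum_axis_scaleR)
      thus ?thesis using coord_span.lincomb[OF base[OF m(1)] base[OF m(2)], of 1 "a - 2" 1 a] by (simp only:)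
    qed
    have "norm (g k) = norm k powr a * norm (f k)" for k by (simp add: g norm_powr_mult_def norm_mult)
    thus "\<exists>B. \<forall>k. (1 + norm k) ^ m * norm (g k) \<le> B" for m
      using Psi_norm_powr_bound[OF f, of m a] by (simp only:)
    show "g z = 0" if "z \<in> {0}" for z using that by (simp add: g norm_powr_mult_def)
  qed
  thus ?thesis using base[OF assms, of a] unfolding Psi_eq_flat by (rule subsetD)
qed

section \<open>Gaussian integrals\<close>

lemma lborel_prod_Basis:
  fixes f :: "'a::euclidean_space \<Rightarrow> real \<Rightarrow> complex"
  assumes "\<And>b. b \<in> Basis \<Longrightarrow> integrable lborel (f b)"
  shows "integrable lborel (\<lambda>x. \<Prod>b\<in>Basis. f b (x \<bullet> b))"
    and "(LINT x|lborel. (\<Prod>b\<in>Basis. f b (x \<bullet> b))) = (\<Prod>b\<in>Basis. (LINT t|lborel. f b t))"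
proof -
  interpret P: product_sigma_finite "\<lambda>_::'a. lborel :: real measure" by standard
  have f [measurable]: "f b \<in> borel_measurable borel" if "b \<in> Basis" for b
    using borel_measurable_integrable[OF assms[OF that]] by simp
  have m: "(\<lambda>x. \<Prod>b\<in>Basis. f b (x \<bullet> b)) \<in> borel_measurable borel"
    by measurable
  have e: "(\<Prod>b\<in>Basis. f b ((\<Sum>b\<in>Basis. y b *\<^sub>R b) \<bullet> b)) = (\<Prod>b\<in>Basis. f b (y b))" for y
    by (intro prod.cong) auto
  have T: "(\<lambda>f. \<Sum>b\<in>Basis. f b *\<^sub>R b) \<in> measurable (\<Pi>\<^sub>M b\<in>(Basis::'a set). lborel) borel"
    by measurable
  show "integrable lborel (\<lambda>x. \<Prod>b\<in>Basis. f b (x \<bullet> b))"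
    by (subst lborel_eq, subst integrable_distr_eq[OF T m]) (use P.product_integrable_prod[of Basis f] assms in \<open>simp add: e\<close>)
  show "(LINT x|lborel. (\<Prod>b\<in>Basis. f b (x \<bullet> b))) = (\<Prod>b\<in>Basis. (LINT t|lborel. f b t))"
    by (subst lborel_eq, subst integral_distr[OF T m]) (use P.product_integral_prod[of Basis f] assms in \<open>simp add: e\<close>)
qed

lemma gaussian_fourier_1d:
  shows "integrable lborel (\<lambda>t. exp (\<i> * complex_of_real (t * x)) * complex_of_real (exp (- t\<^sup>2 / 2)))"
    and "(LINT t|lborel. exp (\<i> * complex_of_real (t * x)) * complex_of_real (exp (- t\<^sup>2 / 2)))
      = complex_of_real (sqrt (2 * pi) * exp (- x\<^sup>2 / 2))"
proof -
  have i: "integrable lborel (\<lambda>t. sqrt (2 * pi) * std_normal_density t)"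
    by (intro integrable_mult_right integrable_normal_density) simp
  have e: "sqrt (2 * pi) * std_normal_density t = exp (- t\<^sup>2 / 2)" for t
    by (simp add: std_normal_density_def)
  have i': "integrable lborel (\<lambda>t. exp (- t\<^sup>2 / 2) :: real)" using i unfolding e .
  show "integrable lborel (\<lambda>t. exp (\<i> * complex_of_real (t * x)) * complex_of_real (exp (- t\<^sup>2 / 2)))"
    by (rule Bochner_Integration.integrable_bound[OF i']) (auto simp: norm_mult)
  have "complex_of_real (exp (- x\<^sup>2 / 2)) = (LINT t|lborel. std_normal_density t *\<^sub>R iexp (x * t))"
    using char_std_normal_distribution unfolding char_def fun_eq_iff
    by (subst (asm) integral_density) (auto simp: eq_commute)
  also have "\<dots> = (LINT t|lborel. complex_of_real (1 / sqrt (2 * pi)) * (exp (\<i> * complex_of_real (t * x)) * complex_of_real (exp (- t\<^sup>2 / 2))))"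
    by (intro Bochner_Integration.integral_cong) (auto simp: std_normal_density_def scaleR_conv_of_real mult_ac)
  also have "\<dots> = complex_of_real (1 / sqrt (2 * pi)) * (LINT t|lborel. exp (\<i> * complex_of_real (t * x)) * complex_of_real (exp (- t\<^sup>2 / 2)))"
    by simp
  finally show "(LINT t|lborel. exp (\<i> * complex_of_real (t * x)) * complex_of_real (exp (- t\<^sup>2 / 2)))
      = complex_of_real (sqrt (2 * pi) * exp (- x\<^sup>2 / 2))"
    by (simp add: field_simps)
qed

text \<open>Both the Gaussian and the character factorise over the coordinates.\<close>

lemma gaussian_fourier:
  fixes x :: "'a::euclidean_space"
  shows "integrable lborel (\<lambda>k. exp (\<i> * complex_of_real (k \<bullet> x)) * complex_of_real (exp (- (norm k)\<^sup>2 / 2)))"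
    and "(LINT k|lborel. exp (\<i> * complex_of_real (k \<bullet> x)) * complex_of_real (exp (- (norm k)\<^sup>2 / 2)))
      = complex_of_real ((2 * pi) powr (DIM('a) / 2) * exp (- (norm x)\<^sup>2 / 2))"
proof -
  let ?f = "\<lambda>b t. exp (\<i> * complex_of_real (t * (x \<bullet> b))) * complex_of_real (exp (- t\<^sup>2 / 2))"
  have e: "(\<Prod>b\<in>Basis. ?f b (k \<bullet> b)) = exp (\<i> * complex_of_real (k \<bullet> x)) * complex_of_real (exp (- (norm k)\<^sup>2 / 2))" for k :: 'a
  proof -
    have "(\<Prod>b\<in>Basis. ?f b (k \<bullet> b)) = exp (\<Sum>b\<in>Basis. \<i> * complex_of_real ((k \<bullet> b) * (x \<bullet> b))) * complex_of_real (exp (\<Sum>b\<in>Basis. - (k \<bullet> b)\<^sup>2 / 2))"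
      by (simp only: prod.distrib exp_sum[OF finite_Basis] of_real_prod)
    also have "(\<Sum>b\<in>Basis. \<i> * complex_of_real ((k \<bullet> b) * (x \<bullet> b))) = \<i> * complex_of_real (k \<bullet> x)"
      by (subst euclidean_inner) (simp add: sum_distrib_left)
    also have "(\<Sum>b\<in>Basis. - (k \<bullet> b)\<^sup>2 / 2) = - (norm k)\<^sup>2 / 2"
      by (subst power2_norm_eq_inner, subst euclidean_inner) (simp add: sum_negf sum_divide_distrib power2_eq_square)
    finally show ?thesis .
  qed
  show "integrable lborel (\<lambda>k. exp (\<i> * complex_of_real (k \<bullet> x)) * complex_of_real (exp (- (norm k)\<^sup>2 / 2)))"
    using lborel_prod_Basis(1)[of ?f] gaussian_fourier_1d(1) unfolding e by blast
  have "(LINT k|lborel. exp (\<i> * complex_of_real (k \<bullet> x)) * complex_of_real (exp (- (norm k)\<^sup>2 / 2)))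
     = (\<Prod>b\<in>Basis. (LINT t|lborel. ?f b t))"
    using lborel_prod_Basis(2)[of ?f] gaussian_fourier_1d(1) unfolding e by blast
  also have "\<dots> = (\<Prod>b\<in>Basis. complex_of_real (sqrt (2 * pi) * exp (- (x \<bullet> b)\<^sup>2 / 2)))"
    by (intro prod.cong refl gaussian_fourier_1d(2))
  also have "\<dots> = complex_of_real (\<Prod>b\<in>Basis. sqrt (2 * pi) * exp (- (x \<bullet> b)\<^sup>2 / 2))" by simp
  also have "(\<Prod>b\<in>Basis. sqrt (2 * pi) * exp (- (x \<bullet> b)\<^sup>2 / 2)) = sqrt (2 * pi) ^ DIM('a) * exp (\<Sum>b\<in>Basis. - (x \<bullet> b)\<^sup>2 / 2)"
    by (simp only: prod.distrib exp_sum[OF finite_Basis] prod_constant)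
  also have "(\<Sum>b\<in>Basis. - (x \<bullet> b)\<^sup>2 / 2) = - (norm x)\<^sup>2 / 2"
    by (subst power2_norm_eq_inner, subst euclidean_inner) (simp add: sum_negf sum_divide_distrib power2_eq_square)
  also have "sqrt (2 * pi) ^ DIM('a) = (2 * pi) powr (DIM('a) / 2)"
    by (subst powr_realpow[symmetric]) (simp_all add: powr_half_sqrt[symmetric] powr_powr)
  finally show "(LINT k|lborel. exp (\<i> * complex_of_real (k \<bullet> x)) * complex_of_real (exp (- (norm k)\<^sup>2 / 2)))
      = complex_of_real ((2 * pi) powr (DIM('a) / 2) * exp (- (norm x)\<^sup>2 / 2))" .
qed

lemma gaussian_integral:
  shows "integrable lborel (\<lambda>k::'a::euclidean_space. exp (- (norm k)\<^sup>2 / 2))"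
    and "(LINT k|lborel. exp (- (norm (k::'a))\<^sup>2 / 2)) = (2 * pi) powr (DIM('a::euclidean_space) / 2)"
proof -
  show i: "integrable lborel (\<lambda>k::'a. exp (- (norm k)\<^sup>2 / 2))"
    using integrable_norm[OF gaussian_fourier(1)[of 0]] by (simp add: norm_mult)
  have "complex_of_real (LINT k|lborel. exp (- (norm (k::'a))\<^sup>2 / 2)) = complex_of_real ((2 * pi) powr (DIM('a) / 2))"
    using gaussian_fourier(2)[of "0::'a"] integral_complex_of_real[of lborel "\<lambda>k::'a. exp (- (norm k)\<^sup>2 / 2)"] by simp
  thus "(LINT k|lborel. exp (- (norm (k::'a))\<^sup>2 / 2)) = (2 * pi) powr (DIM('a::euclidean_space) / 2)"
    by (simp only: of_real_eq_iff)
qed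

text \<open>Under the Gaussian measure, \<open>k \<bullet> x\<close> is distributed like \<open>norm x\<close> times a standard normal variable, since
the characteristic functions agree. So the moments are those of the normal distribution.\<close>

lemma gaussian_inner_moment:
  fixes x :: "'a::euclidean_space"
  shows "(LINT k|lborel. (k \<bullet> x) ^ (2 * m) * exp (- (norm k)\<^sup>2 / 2))
     = (2 * pi) powr (DIM('a) / 2) * (norm x ^ (2 * m) * (fact (2 * m) / (2 ^ m * fact m)))"
proof -
  define c where "c = (2 * pi) powr (DIM('a) / 2)"
  have c: "c > 0" by (simp add: c_def)
  let ?g = "\<lambda>k::'a. exp (- (norm k)\<^sup>2 / 2) / c"
  \<comment> \<open>The Gaussian probability measure, and the laws of \<open>k \<bullet> x\<close> and of a scaled normal variable.\<close>
  define N where "N = density lborel (\<lambda>k. ennreal (?g k))"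
  define M1 where "M1 = distr N borel (\<lambda>k. k \<bullet> x)"
  define M2 where "M2 = distr std_normal_distribution borel (\<lambda>z. norm x * z)"
  have gi: "integrable lborel ?g" using gaussian_integral(1) by (intro integrable_divide) auto
  have [measurable]: "?g \<in> borel_measurable borel" by measurable
  have "emeasure N (space N) = (\<integral>\<^sup>+k. ennreal (?g k) \<partial>lborel)"
    by (simp add: N_def emeasure_density)
  also have "\<dots> = ennreal (LINT k|lborel. ?g k)"
    using c by (intro nn_integral_eq_integral[OF gi]) auto
  also have "(LINT k|lborel. ?g k) = 1"
    using c by (simp only: integral_divide_zero gaussian_integral(2) c_def[symmetric]) simp
  finally have "emeasure N (space N) = 1" by simp
  then interpret N: prob_space N by (rule prob_spaceI)
  have sN: "sets N = sets borel" by (simp add: N_def)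
  have mx: "(\<lambda>k. k \<bullet> x) \<in> measurable N borel" unfolding measurable_cong_sets[OF sN refl] by measurable
  have mz: "(\<lambda>z. norm x * z) \<in> measurable std_normal_distribution borel" by measurable
  interpret M1: real_distribution M1 unfolding M1_def real_distribution_def real_distribution_axioms_def
    using N.prob_space_distr[OF mx] by simp
  interpret S: real_distribution std_normal_distribution by (rule real_dist_normal_dist)
  interpret M2: real_distribution M2 unfolding M2_def real_distribution_def real_distribution_axioms_def
    using S.prob_space_distr[OF mz] by simp
  have "char M1 = char M2"
  proof
    fix t
    have "char M1 t = (LINT k|N. iexp (t * (k \<bullet> x)))"
      unfolding char_def M1_def by (subst integral_distr[OF mx]) simp_all
    also have "\<dots> = (LINT k|lborel. ?g k *\<^sub>R iexp (t * (k \<bullet> x)))"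
      unfolding N_def using c by (subst integral_density) auto
    also have "\<dots> = (LINT k|lborel. complex_of_real (1 / c) * (exp (\<i> * complex_of_real (k \<bullet> (t *\<^sub>R x))) * complex_of_real (exp (- (norm k)\<^sup>2 / 2))))"
      by (intro Bochner_Integration.integral_cong) (auto simp: scaleR_conv_of_real)
    also have "\<dots> = complex_of_real (1 / c) * complex_of_real (c * exp (- (norm (t *\<^sub>R x))\<^sup>2 / 2))"
      unfolding integral_mult_right_zero gaussian_fourier(2) c_def ..
    also have "\<dots> = complex_of_real (exp (- (norm x * t)\<^sup>2 / 2))" using c by (simp add: power_mult_distrib mult_ac)
    also have "\<dots> = char std_normal_distribution (norm x * t)" by (simp add: char_std_normal_distribution)
    also have "\<dots> = char M2 t" unfolding char_def M2_def by (subst integral_distr[OF mz]) (simp_all add: mult_ac)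
    finally show "char M1 t = char M2 t" .
  qed
  hence eq: "M1 = M2" by (intro Levy_uniqueness M1.real_distribution_axioms M2.real_distribution_axioms)
  have "(LINT k|lborel. (k \<bullet> x) ^ (2 * m) * exp (- (norm k)\<^sup>2 / 2)) = (LINT k|lborel. c * (?g k *\<^sub>R ((k \<bullet> x) ^ (2 * m))))"
    using c by (intro Bochner_Integration.integral_cong) auto
  also have "\<dots> = c * (LINT k|lborel. ?g k *\<^sub>R ((k \<bullet> x) ^ (2 * m)))" by simp
  also have "(LINT k|lborel. ?g k *\<^sub>R ((k \<bullet> x) ^ (2 * m))) = (LINT k|N. (k \<bullet> x) ^ (2 * m))"
    unfolding N_def using c by (subst integral_density) auto
  also have "\<dots> = (LINT y|M1. y ^ (2 * m))" unfolding M1_def by (subst integral_distr[OF mx]) simp_all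
  also have "\<dots> = (LINT z|std_normal_distribution. norm x ^ (2 * m) * z ^ (2 * m))"
    unfolding eq M2_def by (subst integral_distr[OF mz]) (simp_all add: power_mult_distrib)
  also have "\<dots> = norm x ^ (2 * m) * (fact (2 * m) / (2 ^ m * fact m))"
    using std_normal_distribution_even_moments[of m] by simp
  finally show ?thesis by (simp add: c_def)
qed

section \<open>Polar coordinates\<close>

lemma nn_integral_lborel_scaleR:
  fixes f :: "'a::euclidean_space \<Rightarrow> ennreal"
  assumes [measurable]: "f \<in> borel_measurable borel" and "c \<noteq> 0"
  shows "(\<integral>\<^sup>+x. f x \<partial>lborel) = ennreal (\<bar>c\<bar> ^ DIM('a)) * (\<integral>\<^sup>+x. f (t + c *\<^sub>R x) \<partial>lborel)"
  by (subst lborel_affine[OF assms(2), of t]) (simp add: nn_integral_density nn_integral_distr nn_integral_cmult)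

text \<open>Polar coordinates without surface measure: by homogeneity, the mass of a ball under the density \<open>p\<close> is
determined by that of the unit ball, and this determines the image of the measure under the norm.\<close>

lemma homogeneous_polar_measure:
  fixes p :: "'a::euclidean_space \<Rightarrow> real"
  assumes [measurable]: "p \<in> borel_measurable borel" and p0: "\<And>x. p x \<ge> 0"
    and hom: "\<And>c x. c > 0 \<Longrightarrow> p (c *\<^sub>R x) = c ^ a * p x"
    and P: "(\<integral>\<^sup>+x. ennreal (p x) * indicator (cball 0 1) x \<partial>lborel) = ennreal P" "P \<ge> 0"
  shows "distr (density lborel (\<lambda>x. ennreal (p x))) borel norm
    = density lborel (\<lambda>r. ennreal (indicator {0<..} r * (real (a + DIM('a)) * P * r ^ (a + DIM('a) - 1))))"
    (is "?M1 = ?M2")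
proof -
  let ?D = "a + DIM('a)"
  have D: "?D > 0" by simp
  have M1: "emeasure ?M1 {..r} = (if r \<le> 0 then 0 else ennreal (P * r ^ ?D))" for r
  proof -
    have "emeasure ?M1 {..r} = (\<integral>\<^sup>+x. ennreal (p x) * indicator (norm -` {..r}) x \<partial>lborel)"
    proof -
      have "norm -` {..r} = cball (0::'a) r" by auto
      thus ?thesis by (simp add: emeasure_distr emeasure_density)
    qed
    also have "\<dots> = (\<integral>\<^sup>+x. ennreal (p x) * indicator (cball 0 r) x \<partial>lborel)"
      by (intro nn_integral_cong) (auto simp: indicator_def)
    also have "\<dots> = (if r \<le> 0 then 0 else ennreal (P * r ^ ?D))"
    proof (cases "r \<le> 0")
      case True
      have "AE x in lborel. x \<noteq> (0::'a)" by (rule AE_lborel_singleton)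
      hence "AE x in lborel. ennreal (p x) * indicator (cball 0 r) x = 0"
        by eventually_elim (use True in \<open>auto simp: indicator_def dest: order_trans\<close>)
      from nn_integral_cong_AE[OF this] show ?thesis using True by simp
    next
      case False
      have "(\<integral>\<^sup>+x. ennreal (p x) * indicator (cball 0 r) x \<partial>lborel) =
        ennreal (\<bar>r\<bar> ^ DIM('a)) * (\<integral>\<^sup>+x. ennreal (p (0 + r *\<^sub>R x)) * indicator (cball 0 r) (0 + r *\<^sub>R x) \<partial>lborel)"
      proof (rule nn_integral_lborel_scaleR)
        have [measurable]: "cball (0::'a) r \<in> sets borel" by simp
        show "(\<lambda>x. ennreal (p x) * indicator (cball 0 r) x) \<in> borel_measurable borel" by measurable
      qed (use False in auto)
      also have "(\<integral>\<^sup>+x. ennreal (p (0 + r *\<^sub>R x)) * indicator (cball 0 r) (0 + r *\<^sub>R x) \<partial>lborel) =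
        (\<integral>\<^sup>+x. ennreal (r ^ a) * (ennreal (p x) * indicator (cball 0 1) x) \<partial>lborel)"
        using False hom[of r] p0 by (intro nn_integral_cong) (auto simp: indicator_def ennreal_mult[symmetric] mult_le_cancel_left1)
      also have "\<dots> = ennreal (r ^ a) * ennreal P"
      proof (subst nn_integral_cmult)
        have [measurable]: "cball (0::'a) 1 \<in> sets borel" by simp
        show "(\<lambda>x. ennreal (p x) * indicator (cball 0 1) x) \<in> borel_measurable lborel" by measurable
      qed (simp add: P)
      also have "ennreal (\<bar>r\<bar> ^ DIM('a)) * (ennreal (r ^ a) * ennreal P) = ennreal (P * r ^ ?D)"
        using False P(2) by (simp add: ennreal_mult[symmetric] power_add mult_ac)
      finally show ?thesis using False by simp
    qed
    finally show ?thesis .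
  qed
  have M2: "emeasure ?M2 {..r} = (if r \<le> 0 then 0 else ennreal (P * r ^ ?D))" for r
  proof -
    have "emeasure ?M2 {..r} = (\<integral>\<^sup>+t. ennreal (indicator {0<..} t * (real ?D * P * t ^ (?D - 1))) * indicator {..r} t \<partial>lborel)"
      by (simp add: emeasure_density)
    also have "\<dots> = (\<integral>\<^sup>+t. ennreal (real ?D * P * t ^ (?D - 1)) * indicator {0..r} t \<partial>lborel)"
      using AE_lborel_singleton[of "0::real"]
      by (intro nn_integral_cong_AE, eventually_elim) (auto simp: indicator_def)
    also have "\<dots> = (if r \<le> 0 then 0 else ennreal (P * r ^ ?D))"
    proof (cases "r \<le> 0")
      case True
      have "AE t in lborel. t \<noteq> (0::real)" by (rule AE_lborel_singleton)
      hence "AE t in lborel. ennreal (real ?D * P * t ^ (?D - 1)) * indicator {0..r} t = 0"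
        by eventually_elim (use True in \<open>auto simp: indicator_def\<close>)
      from nn_integral_cong_AE[OF this] show ?thesis using True by simp
    next
      case False
      have "(\<integral>\<^sup>+t. ennreal (real ?D * P * t ^ (?D - 1)) * indicator {0..r} t \<partial>lborel) = ennreal (P * r ^ ?D - P * 0 ^ ?D)"
      proof (rule nn_integral_FTC_Icc)
        show "\<And>t. t \<in> {0..r} \<Longrightarrow> DERIV (\<lambda>t. P * t ^ ?D) t :> real ?D * P * t ^ (?D - 1)"
          by (auto intro!: derivative_eq_intros simp: mult_ac)
      qed (use False P(2) in auto)
      thus ?thesis using False zero_power[OF D, where ?'a = real] by simp
    qed
    finally show ?thesis .
  qed
  show ?thesis
  proof (rule measure_eqI_generator_eq[where E = "range atMost" and \<Omega> = UNIV and A = "\<lambda>i::nat. {..real i}"])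
    show "Int_stable (range (atMost :: real \<Rightarrow> real set))" by (auto simp: Int_stable_def)
    show "\<And>X. X \<in> range atMost \<Longrightarrow> emeasure ?M1 X = emeasure ?M2 X" using M1 M2 by auto
    show "sets ?M1 = sigma_sets UNIV (range atMost)" "sets ?M2 = sigma_sets UNIV (range atMost)"
      by (simp_all add: borel_eq_atMost)
    show "(\<Union>i::nat. {..real i}) = UNIV" using real_arch_simple by auto
    show "emeasure ?M1 {..real i} \<noteq> \<infinity>" for i using M1 by simp
  qed auto
qed

lemma homogeneous_polar:
  fixes p :: "'a::euclidean_space \<Rightarrow> real" and w :: "real \<Rightarrow> 'b::{banach, second_countable_topology}"
  assumes [measurable]: "p \<in> borel_measurable borel" and p0: "\<And>x. p x \<ge> 0"
    and hom: "\<And>c x. c > 0 \<Longrightarrow> p (c *\<^sub>R x) = c ^ a * p x"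
    and P: "integrable lborel (\<lambda>x. p x * indicator (cball 0 1) x)"
  shows "\<exists>c\<ge>0. \<forall>w::real \<Rightarrow> 'b. w \<in> borel_measurable borel \<longrightarrow>
     (set_integrable lborel {0<..} (\<lambda>r. r ^ (a + DIM('a) - 1) *\<^sub>R w r) \<longrightarrow> integrable lborel (\<lambda>x. p x *\<^sub>R w (norm x))) \<and>
     (LINT x|lborel. p x *\<^sub>R w (norm x)) = c *\<^sub>R (LINT r:{0<..}|lborel. r ^ (a + DIM('a) - 1) *\<^sub>R w r)"
proof -
  define P where "P = (LINT x|lborel. p x * indicator (cball 0 1) x)"
  define c where "c = real (a + DIM('a)) * P"
  have P0: "P \<ge> 0" unfolding P_def using p0 by (intro integral_nonneg_AE) auto
  hence c0: "c \<ge> 0" by (simp add: c_def)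
  have "(\<integral>\<^sup>+x. ennreal (p x) * indicator (cball 0 1) x \<partial>lborel) = (\<integral>\<^sup>+x. ennreal (p x * indicator (cball 0 1) x) \<partial>lborel)"
    by (intro nn_integral_cong) (auto simp: indicator_def)
  also have "\<dots> = ennreal P" unfolding P_def using p0 P by (intro nn_integral_eq_integral) auto
  finally have eq: "distr (density lborel (\<lambda>x. ennreal (p x))) borel norm
    = density lborel (\<lambda>r. ennreal (indicator {0<..} r * (c * r ^ (a + DIM('a) - 1))))"
    unfolding c_def by (intro homogeneous_polar_measure assms P0) auto
  have nn: "indicator {0<..} r * (c * r ^ (a + DIM('a) - 1)) \<ge> 0" for r :: real
    using c0 by (auto simp: indicator_def)
  have "(set_integrable lborel {0<..} (\<lambda>r. r ^ (a + DIM('a) - 1) *\<^sub>R w r) \<longrightarrow> integrable lborel (\<lambda>x. p x *\<^sub>R w (norm x))) \<and>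
     (LINT x|lborel. p x *\<^sub>R w (norm x)) = c *\<^sub>R (LINT r:{0<..}|lborel. r ^ (a + DIM('a) - 1) *\<^sub>R w r)"
    if [measurable]: "w \<in> borel_measurable borel" for w :: "real \<Rightarrow> 'b"
  proof (intro conjI impI)
    have n: "norm \<in> measurable (density lborel (\<lambda>x. ennreal (p x))) borel" by measurable
    have s: "(indicator {0<..} r * (c * r ^ (a + DIM('a) - 1))) *\<^sub>R w r = c *\<^sub>R (indicator {0<..} r *\<^sub>R (r ^ (a + DIM('a) - 1) *\<^sub>R w r))" for r
      by (simp add: mult_ac)
    { assume "set_integrable lborel {0<..} (\<lambda>r. r ^ (a + DIM('a) - 1) *\<^sub>R w r)"
      hence "integrable lborel (\<lambda>r. (indicator {0<..} r * (c * r ^ (a + DIM('a) - 1))) *\<^sub>R w r)"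
        unfolding s set_integrable_def by (rule integrable_scaleR_right)
      hence "integrable (density lborel (\<lambda>r. ennreal (indicator {0<..} r * (c * r ^ (a + DIM('a) - 1))))) w"
        using nn by (subst integrable_density) auto
      hence "integrable (density lborel (\<lambda>x. ennreal (p x))) (\<lambda>x. w (norm x))"
        unfolding eq[symmetric] by (subst (asm) integrable_distr_eq[OF n]) auto
      thus "integrable lborel (\<lambda>x. p x *\<^sub>R w (norm x))"
        using p0 by (subst (asm) integrable_density) auto }
    have "(LINT x|lborel. p x *\<^sub>R w (norm x)) = (LINT x|density lborel (\<lambda>x. ennreal (p x)). w (norm x))"
      using p0 by (subst integral_density) auto
    also have "\<dots> = (LINT r|density lborel (\<lambda>r. ennreal (indicator {0<..} r * (c * r ^ (a + DIM('a) - 1)))). w r)"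
      unfolding eq[symmetric] by (subst integral_distr[OF n]) auto
    also have "\<dots> = (LINT r|lborel. (indicator {0<..} r * (c * r ^ (a + DIM('a) - 1))) *\<^sub>R w r)"
      using nn by (subst integral_density) auto
    also have "\<dots> = (LINT r|lborel. c *\<^sub>R (indicator {0<..} r *\<^sub>R (r ^ (a + DIM('a) - 1) *\<^sub>R w r)))"
      unfolding s ..
    also have "\<dots> = c *\<^sub>R (LINT r:{0<..}|lborel. r ^ (a + DIM('a) - 1) *\<^sub>R w r)"
      unfolding set_lebesgue_integral_def by (rule integral_scaleR_right)
    finally show "(LINT x|lborel. p x *\<^sub>R w (norm x)) = c *\<^sub>R (LINT r:{0<..}|lborel. r ^ (a + DIM('a) - 1) *\<^sub>R w r)" .
  qed
  thus ?thesis using c0 by blast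
qed

section \<open>Bessel--Clifford functions\<close>

lemma integral_dominated_convergence_within:
  fixes s :: "'b::first_countable_topology \<Rightarrow> 'a \<Rightarrow> 'c::{banach, second_countable_topology}"
  assumes f: "f \<in> borel_measurable M" and s: "\<And>y. y \<in> S - {x} \<Longrightarrow> s y \<in> borel_measurable M"
    and w: "integrable M w" and lim: "AE t in M. ((\<lambda>y. s y t) \<longlongrightarrow> f t) (at x within S)"
    and bound: "\<And>y. y \<in> S - {x} \<Longrightarrow> AE t in M. norm (s y t) \<le> w t"
  shows "((\<lambda>y. integral\<^sup>L M (s y)) \<longlongrightarrow> integral\<^sup>L M f) (at x within S)"
  unfolding tendsto_at_iff_sequentially comp_def
proof (intro allI impI)
  fix X :: "nat \<Rightarrow> 'b" assume X: "\<forall>i. X i \<in> S - {x}" "X \<longlonglongrightarrow> x"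
  show "(\<lambda>i. integral\<^sup>L M (s (X i))) \<longlonglongrightarrow> integral\<^sup>L M f"
  proof (rule integral_dominated_convergence[OF f _ w])
    show "s (X i) \<in> borel_measurable M" for i using s X by auto
    show "AE t in M. norm (s (X i) t) \<le> w t" for i using bound X by auto
    show "AE t in M. (\<lambda>i. s (X i) t) \<longlonglongrightarrow> f t"
      using lim by eventually_elim (use X in \<open>auto simp: tendsto_at_iff_sequentially comp_def\<close>)
  qed
qed

lemma has_real_derivative_from_quadratic_remainder:
  fixes f :: "real \<Rightarrow> real"
  assumes "\<delta> > 0" and "\<And>h. \<bar>h\<bar> \<le> \<delta> \<Longrightarrow> \<bar>f (x + h) - f x - h * D\<bar> \<le> C * h\<^sup>2"
  shows "(f has_real_derivative D) (at x)"
  unfolding has_field_derivative_def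
proof (rule has_derivative_from_quadratic_remainder[OF bounded_linear_mult_right assms(1)])
  show "norm (f (x + h) - f x - D * h) \<le> C * (norm h)\<^sup>2" if "norm h \<le> \<delta>" for h
    using assms(2)[of h] that by (simp add: mult.commute)
qed

definition bessel_coeff :: "real \<Rightarrow> nat \<Rightarrow> real" where
  "bessel_coeff \<nu> m = rGamma (\<nu> + real m + 1) / fact m"

text \<open>The Bessel--Clifford function, an entire function of \<open>z\<close> with \<open>I\<^sub>\<nu>(x) = (x/2)\<^sup>\<nu> C\<^sub>\<nu>(x\<^sup>2/4)\<close> and
\<open>J\<^sub>\<nu>(x) = (x/2)\<^sup>\<nu> C\<^sub>\<nu>(-x\<^sup>2/4)\<close>. Working with it removes fractional powers from series manipulations.\<close>

definition bessel_clifford :: "real \<Rightarrow> real \<Rightarrow> real" where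
  "bessel_clifford \<nu> z = (\<Sum>m. bessel_coeff \<nu> m * z ^ m)"

lemma summable_bessel_coeff: "summable (\<lambda>m. bessel_coeff \<nu> m * z ^ m)"
proof (rule summable_ratio_test)
  show "(1/2::real) < 1" by simp
  fix m :: nat assume m: "nat \<lceil>\<bar>\<nu>\<bar> + 2 * \<bar>z\<bar>\<rceil> \<le> m"
  hence m': "\<bar>\<nu>\<bar> + 2 * \<bar>z\<bar> \<le> real m" by linarith
  have "\<bar>rGamma (\<nu> + real m + 1)\<bar> = (\<nu> + real m + 1) * \<bar>rGamma (\<nu> + real m + 1 + 1)\<bar>"
    using m' by (subst rGamma_plus1[symmetric]) (simp add: abs_mult)
  moreover have "\<bar>rGamma (\<nu> + real m + 1 + 1)\<bar> \<le> (\<nu> + real m + 1) * \<bar>rGamma (\<nu> + real m + 1 + 1)\<bar>"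
    using m' by (intro mult_le_cancel_right1[THEN iffD2]) auto
  ultimately have g: "\<bar>rGamma (\<nu> + real (Suc m) + 1)\<bar> \<le> \<bar>rGamma (\<nu> + real m + 1)\<bar>"
    by (simp add: add_ac)
  have "\<bar>z\<bar> / real (Suc m) \<le> 1/2" using m' by (simp add: field_simps)
  hence "(\<bar>z\<bar> / real (Suc m)) * (\<bar>rGamma (\<nu> + real (Suc m) + 1)\<bar> / fact m * \<bar>z\<bar> ^ m)
      \<le> (1/2) * (\<bar>rGamma (\<nu> + real m + 1)\<bar> / fact m * \<bar>z\<bar> ^ m)"
    using g by (intro mult_mono divide_right_mono mult_right_mono) auto
  moreover have "norm (bessel_coeff \<nu> (Suc m) * z ^ Suc m)
      = (\<bar>z\<bar> / real (Suc m)) * (\<bar>rGamma (\<nu> + real (Suc m) + 1)\<bar> / fact m * \<bar>z\<bar> ^ m)"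
    by (simp add: bessel_coeff_def abs_mult power_abs)
  moreover have "norm (bessel_coeff \<nu> m * z ^ m) = \<bar>rGamma (\<nu> + real m + 1)\<bar> / fact m * \<bar>z\<bar> ^ m"
    by (simp add: bessel_coeff_def abs_mult power_abs)
  ultimately show "norm (bessel_coeff \<nu> (Suc m) * z ^ Suc m) \<le> 1/2 * norm (bessel_coeff \<nu> m * z ^ m)"
    by linarith
qed

lemma has_real_derivative_bessel_clifford: "(bessel_clifford \<nu> has_real_derivative bessel_clifford (\<nu> + 1) z) (at z)"
proof -
  have "diffs (bessel_coeff \<nu>) = bessel_coeff (\<nu> + 1)"
    by (auto simp: diffs_def bessel_coeff_def fun_eq_iff add_ac simp del: of_nat_Suc)
      (simp add: add_ac)
  thus ?thesis
    using termdiffs_strong_converges_everywhere[OF summable_bessel_coeff[of \<nu>], of z]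
    by (simp add: bessel_clifford_def[abs_def])
qed

lemma isCont_bessel_clifford: "isCont (bessel_clifford \<nu>) z"
  using DERIV_isCont has_real_derivative_bessel_clifford by blast

lemma bessel_clifford_0: "bessel_clifford \<nu> 0 = rGamma (\<nu> + 1)"
  unfolding bessel_clifford_def using suminf_finite[of "{0::nat}" "\<lambda>m. bessel_coeff \<nu> m * 0 ^ m"]
  by (simp add: bessel_coeff_def)

lemma bessel_clifford_recurrence: "bessel_clifford (\<nu> - 1) z = \<nu> * bessel_clifford \<nu> z + z * bessel_clifford (\<nu> + 1) z"
proof -
  have S: "(\<lambda>m. bessel_coeff \<mu> m * z ^ m) sums bessel_clifford \<mu> z" for \<mu>
    unfolding bessel_clifford_def using summable_bessel_coeff by (rule summable_sums)
  have "(\<lambda>m. (case m of 0 \<Rightarrow> 0 | Suc m \<Rightarrow> z * (bessel_coeff (\<nu> + 1) m * z ^ m))) sums (z * bessel_clifford (\<nu> + 1) z)"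
    using sums_mult[OF S[of "\<nu> + 1"], of z] sums_Suc_iff[of "\<lambda>m. (case m of 0 \<Rightarrow> 0 | Suc m \<Rightarrow> z * (bessel_coeff (\<nu> + 1) m * z ^ m))"]
    by simp
  hence "(\<lambda>m. \<nu> * (bessel_coeff \<nu> m * z ^ m) + (case m of 0 \<Rightarrow> 0 | Suc m \<Rightarrow> z * (bessel_coeff (\<nu> + 1) m * z ^ m)))
      sums (\<nu> * bessel_clifford \<nu> z + z * bessel_clifford (\<nu> + 1) z)"
    by (intro sums_add sums_mult S)
  also have "(\<lambda>m. \<nu> * (bessel_coeff \<nu> m * z ^ m) + (case m of 0 \<Rightarrow> 0 | Suc m \<Rightarrow> z * (bessel_coeff (\<nu> + 1) m * z ^ m)))
      = (\<lambda>m. bessel_coeff (\<nu> - 1) m * z ^ m)"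
  proof
    fix m show "\<nu> * (bessel_coeff \<nu> m * z ^ m) + (case m of 0 \<Rightarrow> 0 | Suc m \<Rightarrow> z * (bessel_coeff (\<nu> + 1) m * z ^ m))
      = bessel_coeff (\<nu> - 1) m * z ^ m"
    proof (cases m)
      case 0
      show ?thesis using rGamma_plus1[of \<nu>] by (simp add: 0 bessel_coeff_def)
    next
      case (Suc k)
      have "bessel_coeff (\<nu> - 1) m = rGamma (\<nu> + real m) / fact m"
        by (simp add: bessel_coeff_def)
      also have "\<dots> = (\<nu> + real m) * rGamma (\<nu> + real m + 1) / fact m"
        using rGamma_plus1[of "\<nu> + real m"] by simp
      finally have "bessel_coeff (\<nu> - 1) m = \<nu> * bessel_coeff \<nu> m + bessel_coeff (\<nu> + 1) k"
        unfolding bessel_coeff_def Suc fact_Suc by (simp add: divide_simps del: of_nat_Suc) (simp add: algebra_simps)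
      thus ?thesis by (simp add: Suc algebra_simps)
    qed
  qed
  finally show ?thesis using sums_unique2 S by blast
qed

section \<open>The Macdonald function as an integral\<close>

text \<open>For \<open>x > 0\<close> and \<open>z = x\<^sup>2/4\<close> this is \<open>2 (x/2)\<^sup>p K\<^sub>p(x)\<close>; see \<open>macdonald_K_integral\<close>.\<close>

definition macdonald_integral :: "real \<Rightarrow> real \<Rightarrow> real" where
  "macdonald_integral p z = (LINT t:{0<..}|lborel. t powr (p - 1) * exp (- t - z / t))"

lemma Gamma_set_integral:
  assumes "p > (0::real)"
  shows "set_integrable lborel {0<..} (\<lambda>t. t powr (p - 1) * exp (- t))"
    and "(LINT t:{0<..}|lborel. t powr (p - 1) * exp (- t)) = Gamma p"
proof -
  have eq: "ennreal (indicator {0<..} t *\<^sub>R (t powr (p - 1) * exp (- t))) = ennreal (indicator {0..} t * t powr (p - 1) / exp t)" for t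
    by (auto simp: indicator_def exp_minus field_simps)
  have nn: "(\<integral>\<^sup>+t. ennreal (indicator {0<..} t *\<^sub>R (t powr (p - 1) * exp (- t))) \<partial>lborel) = ennreal (Gamma p)"
    unfolding eq using Gamma_conv_nn_integral_real[OF assms] by simp
  have "has_bochner_integral lborel (\<lambda>t. indicator {0<..} t *\<^sub>R (t powr (p - 1) * exp (- t))) (Gamma p)"
    by (rule has_bochner_integral_nn_integral) (use nn assms in \<open>auto simp: less_imp_le\<close>)
  thus "set_integrable lborel {0<..} (\<lambda>t. t powr (p - 1) * exp (- t))"
    "(LINT t:{0<..}|lborel. t powr (p - 1) * exp (- t)) = Gamma p"
    by (auto simp: set_integrable_def set_lebesgue_integral_def has_bochner_integral_iff)
qed

lemma exp_minus_le_powr: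
  assumes "(a::real) \<ge> 0" shows "\<exists>C\<ge>0. \<forall>y>0. exp (- y) \<le> C * y powr (- a)"
proof -
  have "exp (- y) \<le> (a powr a + 1) * y powr (- a)" if "y > 0" for y :: real
  proof (cases "a = 0")
    case False
    hence a: "a > 0" using assms by simp
    have "y / a \<le> exp (y / a)" using exp_ge_add_one_self[of "y/a"] by linarith
    hence "(y / a) powr a \<le> exp (y / a) powr a" using a that by (intro powr_mono2) auto
    also have "\<dots> = exp y" using a by (simp add: powr_def)
    finally have "exp (-y) \<le> a powr a * y powr (-a)" using a that
      by (simp add: powr_divide exp_minus powr_minus field_simps)
    also have "\<dots> \<le> (a powr a + 1) * y powr (-a)" by (intro mult_right_mono) auto
    finally show ?thesis .
  qed (use that in auto)
  thus ?thesis by (intro exI[of _ "a powr a + 1"]) (auto intro: add_nonneg_nonneg)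
qed

text \<open>A factor \<open>exp (- z / t)\<close> is traded for a power of \<open>t / z\<close>. The integral of the right-hand side is a Gamma
function, whose argument can be made positive by the choice of \<open>a\<close>.\<close>

lemma macdonald_integral_integrand_bound:
  assumes "(a::real) \<ge> 0"
  shows "\<exists>C\<ge>0. \<forall>p. \<forall>z>0. \<forall>t>0. t powr (p - 1 :: real) * exp (- t - z / t) \<le> C * z powr (- a) * (t powr (p + a - 1) * exp (- t))"
proof -
  obtain C where C: "C \<ge> 0" "\<And>y. y > 0 \<Longrightarrow> exp (- y) \<le> C * y powr (- a)"
    using exp_minus_le_powr[OF assms] by auto
  have "t powr (p - 1) * exp (- t - z / t) \<le> C * z powr (- a) * (t powr (p + a - 1) * exp (- t))"
    if "z > 0" "t > 0" for p z t :: real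
  proof -
    have "exp (- t - z / t) = exp (- t) * exp (- (z/t))" by (simp add: mult_exp_exp)
    also have "\<dots> \<le> exp (- t) * (C * (z / t) powr (- a))"
      using C(2)[of "z/t"] that by (intro mult_left_mono) auto
    also have "(z / t) powr (- a) = z powr (- a) * t powr a"
      using that by (simp add: powr_divide powr_minus field_simps)
    finally have "t powr (p - 1) * exp (- t - z / t) \<le> t powr (p - 1) * (exp (- t) * (C * (z powr (- a) * t powr a)))"
      by (intro mult_left_mono) auto
    also have "\<dots> = C * z powr (- a) * ((t powr (p - 1) * t powr a) * exp (- t))" by (simp add: mult_ac)
    also have "t powr (p - 1) * t powr a = t powr (p + a - 1)" by (simp add: powr_add[symmetric] algebra_simps)
    finally show ?thesis .
  qed
  with C(1) show ?thesis by blast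
qed

lemma set_integrable_macdonald_integral:
  assumes "(z::real) > 0" shows "set_integrable lborel {0<..} (\<lambda>t. t powr (p - 1) * exp (- t - z / t))"
proof -
  define a where "a = \<bar>p\<bar> + 1"
  obtain C where C: "C \<ge> 0" "\<forall>t>0. t powr (p - 1) * exp (- t - z / t) \<le> C * z powr (- a) * (t powr (p + a - 1) * exp (- t))"
    using macdonald_integral_integrand_bound[of a] assms by (auto simp: a_def)
  have "set_integrable lborel {0<..} (\<lambda>t. (C * z powr (- a)) * (t powr (p + a - 1) * exp (- t)))"
    by (intro set_integrable_mult_right Gamma_set_integral) (auto simp: a_def)
  thus ?thesis unfolding set_integrable_def
    by (rule Bochner_Integration.integrable_bound) (use C in \<open>auto simp: indicator_def\<close>)
qed

lemma macdonald_integral_bound: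
  assumes "a \<ge> 0" "p + a > 0"
  shows "\<exists>C. \<forall>z>0. \<bar>macdonald_integral p z\<bar> \<le> C * z powr (- a)"
proof -
  obtain C where C: "C \<ge> 0" "\<forall>z>0. \<forall>t>0. t powr (p - 1) * exp (- t - z / t) \<le> C * z powr (- a) * (t powr (p + a - 1) * exp (- t))"
    using macdonald_integral_integrand_bound[of a] assms by blast
  have "\<bar>macdonald_integral p z\<bar> \<le> (C * Gamma (p + a)) * z powr (- a)" if "z > 0" for z
  proof -
    have "macdonald_integral p z \<le> (LINT t:{0<..}|lborel. (C * z powr (- a)) * (t powr (p + a - 1) * exp (- t)))"
      unfolding macdonald_integral_def using assms that C
      by (intro set_integral_mono set_integrable_macdonald_integral set_integrable_mult_right Gamma_set_integral) auto
    also have "\<dots> = (C * Gamma (p + a)) * z powr (- a)"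
      using Gamma_set_integral(2)[OF assms(2)] by simp
    moreover have "macdonald_integral p z \<ge> 0"
      unfolding macdonald_integral_def set_lebesgue_integral_def by (intro integral_nonneg_AE) auto
    ultimately show ?thesis by linarith
  qed
  thus ?thesis by blast
qed

lemma exp_quadratic_remainder:
  fixes x y :: real shows "\<bar>exp (x + y) - exp x - y * exp x\<bar> \<le> y\<^sup>2 / 2 * exp (x + \<bar>y\<bar>)"
proof -
  obtain t where t: "\<bar>t\<bar> \<le> \<bar>y\<bar>" "exp y = (\<Sum>m<2. y ^ m / fact m) + exp t / fact 2 * y ^ 2"
    using Maclaurin_exp_le[of y 2] by auto
  have "exp (x + y) - exp x - y * exp x = exp x * (exp y - 1 - y)" by (simp add: exp_add algebra_simps)
  also have "exp y - 1 - y = exp t / 2 * y\<^sup>2" using t(2) by (simp add: eval_nat_numeral)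
  also have "\<bar>exp x * (exp t / 2 * y\<^sup>2)\<bar> = y\<^sup>2 / 2 * exp (x + t)" by (simp add: exp_add abs_mult)
  also have "\<dots> \<le> y\<^sup>2 / 2 * exp (x + \<bar>y\<bar>)" using t(1) by (intro mult_left_mono) auto
  finally show ?thesis .
qed

lemma has_real_derivative_macdonald_integral:
  assumes "z > 0" shows "(macdonald_integral p has_real_derivative - macdonald_integral (p - 1) z) (at z)"
proof (rule has_real_derivative_from_quadratic_remainder)
  show "z / 2 > 0" using assms by simp
  fix h assume h: "\<bar>h\<bar> \<le> z / 2"
  have zh: "z + h > 0" using h assms by linarith
  let ?k = "\<lambda>t. t powr (p - 1) * exp (- t - (z + h) / t) - t powr (p - 1) * exp (- t - z / t) - h * (- (t powr (p - 1 - 1) * exp (- t - z / t)))"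
  have I: "set_integrable lborel {0<..} (\<lambda>t. h * (- (t powr (p - 1 - 1) * exp (- t - z / t))))"
    using set_integrable_macdonald_integral[OF assms, of "p - 1"] by (intro set_integrable_mult_right) (auto simp: set_integrable_def)
  have J: "set_integrable lborel {0<..} ?k"
    by (intro set_integral_diff I set_integrable_macdonald_integral zh assms)
  have "(LINT t:{0<..}|lborel. h * (- (t powr (p - 1 - 1) * exp (- t - z / t)))) = h * - macdonald_integral (p - 1) z"
    unfolding macdonald_integral_def by (subst set_integral_mult_right) (simp add: set_lebesgue_integral_def)
  hence eq: "macdonald_integral p (z + h) - macdonald_integral p z - h * - macdonald_integral (p - 1) z = (LINT t:{0<..}|lborel. ?k t)"
    by (subst set_integral_diff set_integral_diff(2), (intro set_integral_diff I set_integrable_macdonald_integral zh assms)+)+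
       (simp add: macdonald_integral_def)
  have "\<bar>LINT t:{0<..}|lborel. ?k t\<bar> \<le> (LINT t:{0<..}|lborel. h\<^sup>2 / 2 * (t powr (p - 2 - 1) * exp (- t - (z / 2) / t)))"
  proof -
    have arr: "X * ((- h / t)\<^sup>2 / 2 * E) = h\<^sup>2 / 2 * ((X / t\<^sup>2) * E)" for X E t :: real
    proof -
      have sq: "(- h / t)\<^sup>2 = h\<^sup>2 * inverse (t\<^sup>2)" by (simp add: divide_inverse power_mult_distrib power_inverse)
      show ?thesis unfolding sq unfolding divide_inverse by (simp only: mult.assoc mult.commute mult.left_commute)
    qed
    have "\<bar>?k t\<bar> \<le> h\<^sup>2 / 2 * (t powr (p - 2 - 1) * exp (- t - (z / 2) / t))" if t: "t > 0" for t
    proof -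
      have e: "t powr (p - 1 - 1) = t powr (p - 1) / t" "t powr (p - 2 - 1) = t powr (p - 1) / t^2"
        using t powr_diff[of t "p - 1" 1] powr_diff[of t "p - 1" 2] by (simp_all add: algebra_simps powr_numeral)
      have "?k t = t powr (p - 1) * (exp ((- t - z / t) + (- h / t)) - exp (- t - z / t) - (- h / t) * exp (- t - z / t))"
        unfolding e by (simp add: algebra_simps add_divide_distrib)
      also have "\<bar>\<dots>\<bar> \<le> t powr (p - 1) * ((- h / t)\<^sup>2 / 2 * exp ((- t - z / t) + \<bar>- h / t\<bar>))"
        unfolding abs_mult using exp_quadratic_remainder[of "- t - z / t" "- h / t"] by (intro mult_mono) auto
      also have "\<dots> \<le> t powr (p - 1) * ((- h / t)\<^sup>2 / 2 * exp (- t - (z / 2) / t))"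
        using h t by (intro mult_left_mono) (auto simp: field_simps)
      also have "\<dots> = h\<^sup>2 / 2 * (t powr (p - 2 - 1) * exp (- t - (z / 2) / t))"
        unfolding e by (rule arr)
      finally show ?thesis .
    qed
    moreover have "set_integrable lborel {0<..} (\<lambda>t. h\<^sup>2 / 2 * (t powr (p - 2 - 1) * exp (- t - (z / 2) / t)))"
      using assms by (intro set_integrable_mult_right set_integrable_macdonald_integral) auto
    ultimately show ?thesis unfolding set_lebesgue_integral_def set_integrable_def
      by (intro integral_abs_bound[THEN order_trans] integral_mono integrable_abs)
        (use J in \<open>auto simp: set_integrable_def indicator_def\<close>)
  qed
  also have "\<dots> = (macdonald_integral (p - 2) (z / 2) / 2) * h\<^sup>2" unfolding macdonald_integral_def by simp
  finally show "\<bar>macdonald_integral p (z + h) - macdonald_integral p z - h * - macdonald_integral (p - 1) z\<bar> \<le> (macdonald_integral (p - 2) (z / 2) / 2) * h\<^sup>2"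
    unfolding eq .
qed

lemma set_lebesgue_integral_inversion:
  fixes f :: "real \<Rightarrow> real"
  assumes "z > 0" and f: "set_integrable lborel {0<..} f"
    and g: "set_integrable lborel {0<..} (\<lambda>s. z / s\<^sup>2 * f (z / s))"
  shows "(LINT t:{0<..}|lborel. f t) = (LINT s:{0<..}|lborel. z / s\<^sup>2 * f (z / s))"
proof -
  have img: "(\<lambda>s. z / s) ` {0<..} = {0<..}"
  proof safe
    fix x :: real assume "x > 0" thus "x \<in> (\<lambda>s. z / s) ` {0<..}"
      using assms by (intro image_eqI[of _ _ "z / x"]) auto
  qed (use assms in auto)
  have inj: "inj_on (\<lambda>s. z / s) {0<..}" using assms by (auto simp: inj_on_def)
  have der: "((\<lambda>s. z / s) has_field_derivative - (z / s\<^sup>2)) (at s within {0<..})" if "s \<in> {0<..}" for s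
    using that by (auto intro!: derivative_eq_intros simp: power2_eq_square)
  have F: "f absolutely_integrable_on {0<..}"
    using f integrable_completion[OF borel_measurable_integrable[OF f[unfolded set_integrable_def]]]
    by (simp add: set_integrable_def)
  note cv = has_absolute_integral_change_of_variables_real[OF _ der inj, of f, simplified img]
  have "integral {0<..} (\<lambda>s. \<bar>- (z / s\<^sup>2)\<bar> *\<^sub>R f (z / s)) = integral {0<..} f"
    using cv[of "integral {0<..} f"] F by auto
  also have "(\<lambda>s. \<bar>- (z / s\<^sup>2)\<bar> *\<^sub>R f (z / s)) = (\<lambda>s. z / s\<^sup>2 * f (z / s))"
    using assms by (auto simp: abs_mult)
  finally show ?thesis
    using set_borel_integral_eq_integral(2)[OF f] set_borel_integral_eq_integral(2)[OF g] by simp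
qed

text \<open>The substitution \<open>t = z/s\<close> exchanges the two exponential factors. It reflects \<open>K\<^bsub>-p\<^esub> = K\<^sub>p\<close>.\<close>

lemma macdonald_integral_symmetric:
  assumes z: "z > 0" shows "macdonald_integral (- p) z = z powr (- p) * macdonald_integral p z"
proof -
  have eq: "z / s\<^sup>2 * ((z / s) powr (- p - 1) * exp (- (z / s) - z / (z / s)))
      = z powr (- p) * (s powr (p - 1) * exp (- s - z / s))" if "s > 0" for s
  proof -
    have "(z / s) powr (- p - 1) = z powr (- p) / z * (s powr (p + 1))"
      using z that by (simp add: powr_divide powr_diff powr_minus field_simps powr_add)
    also have "s powr (p + 1) = s powr (p - 1) * s\<^sup>2"
      using that powr_add[of s "p - 1" 2] by (simp add: powr_numeral algebra_simps)
    finally have "(z / s) powr (- p - 1) = z powr (- p) / z * (s powr (p - 1) * s\<^sup>2)" .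
    moreover have "- (z / s) - z / (z / s) = - s - z / s" using that z by simp
    ultimately show ?thesis using that z by simp
  qed
  have g: "set_integrable lborel {0<..} (\<lambda>s. z / s\<^sup>2 * ((z / s) powr (- p - 1) * exp (- (z / s) - z / (z / s))))"
    using set_integrable_mult_right[OF set_integrable_macdonald_integral[OF z, of p], of "z powr (- p)"]
    by (subst set_integrable_cong[OF refl refl, where f' = "\<lambda>s. z powr (- p) * (s powr (p - 1) * exp (- s - z / s))"])
       (use eq in auto)
  show ?thesis
    unfolding macdonald_integral_def
    by (subst set_lebesgue_integral_inversion[OF z set_integrable_macdonald_integral[OF z] g])
       (subst set_integral_mult_right[symmetric], rule set_lebesgue_integral_cong, simp, use eq in simp)
qed

text \<open>The integral of the derivative of \<open>t\<^sup>p exp (- t - z/t)\<close> over the half-line vanishes.\<close>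

lemma macdonald_integral_recurrence:
  assumes z: "z > 0" shows "macdonald_integral (p + 1) z = p * macdonald_integral p z + z * macdonald_integral (p - 1) z"
proof -
  let ?e = "\<lambda>q t. t powr (q - 1) * exp (- t - z / t)"
  let ?f = "\<lambda>t. p * ?e p t + z * ?e (p - 1) t - ?e (p + 1) t"
  let ?F = "\<lambda>t. t powr p * exp (- t - z / t)"
  have I: "set_integrable lborel {0<..} ?f"
    by (intro set_integral_add set_integral_diff set_integrable_mult_right set_integrable_macdonald_integral z)
  have e: "einterval 0 \<infinity> = {0<..}" by (auto simp: einterval_def)
  define q where "q = p + (\<bar>p\<bar> + 1)"
  have q: "q > 0" by (simp add: q_def)
  obtain C where bnd: "\<And>t. t > 0 \<Longrightarrow> ?F t \<le> C * (t powr q * exp (- t))"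
  proof -
    obtain C where "\<forall>p. \<forall>z>0. \<forall>t>0. t powr (p - 1) * exp (- t - z / t) \<le> C * z powr (- (\<bar>p\<^sub>0\<bar> + 1)) * (t powr (p + (\<bar>p\<^sub>0\<bar> + 1) - 1) * exp (- t))"
      if "p\<^sub>0 = p" for p\<^sub>0 using macdonald_integral_integrand_bound[of "\<bar>p\<bar> + 1"] by auto
    from this[OF refl] have "\<forall>t>0. t powr (p + 1 - 1) * exp (- t - z / t) \<le> C * z powr (- (\<bar>p\<bar> + 1)) * (t powr (p + 1 + (\<bar>p\<bar> + 1) - 1) * exp (- t))"
      using z by blast
    thus thesis using that[of "C * z powr (- (\<bar>p\<bar> + 1))"] by (simp add: q_def algebra_simps)
  qed
  have "(LBINT t=0..\<infinity>. ?f t) = 0 - 0"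
  proof (rule interval_integral_FTC_integrable[where F = ?F])
    fix t :: real assume "0 < ereal t"
    hence t: "t > 0" by simp
    have D: "(?F has_real_derivative (p * t powr (p - 1) * exp (- t - z / t) + t powr p * (exp (- t - z / t) * (- 1 + z / t\<^sup>2)))) (at t)"
      using t by (auto intro!: derivative_eq_intros simp: power2_eq_square)
    have "t powr p / t\<^sup>2 = t powr (p - 1 - 1)"
      using t powr_diff[of t p 2] by (simp add: powr_numeral algebra_simps)
    have "p * t powr (p - 1) * exp (- t - z / t) + t powr p * (exp (- t - z / t) * (- 1 + z / t\<^sup>2))
        = p * ?e p t + z * ((t powr p / t\<^sup>2) * exp (- t - z / t)) - ?e (p + 1) t"
      by (simp add: algebra_simps)
    hence "p * t powr (p - 1) * exp (- t - z / t) + t powr p * (exp (- t - z / t) * (- 1 + z / t\<^sup>2)) = ?f t"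
      unfolding \<open>t powr p / t\<^sup>2 = t powr (p - 1 - 1)\<close> .
    hence "(?F has_real_derivative ?f t) (at t)" using D by (simp only:)
    thus "(?F has_vector_derivative ?f t) (at t)"
      unfolding has_real_derivative_iff_has_vector_derivative .
    show "isCont ?f t" using t by (auto intro!: continuous_intros)
  next
    show "set_integrable lborel (einterval 0 \<infinity>) ?f" using I e by simp
    have "(?F \<longlongrightarrow> 0) (at_right 0)"
    proof (rule Lim_null_comparison)
      show "((\<lambda>t. C * (t powr q * exp (- t))) \<longlongrightarrow> 0) (at_right 0)" using q by real_asymp
      show "\<forall>\<^sub>F t in at_right 0. norm (?F t) \<le> C * (t powr q * exp (- t))"
        using bnd by (auto intro: eventually_mono[OF eventually_at_right_less])
    qed
    thus "((?F \<circ> real_of_ereal) \<longlongrightarrow> 0) (at_right 0)"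
      by (simp add: ereal_tendsto_simps zero_ereal_def)
    have "(?F \<longlongrightarrow> 0) at_top"
    proof (rule Lim_null_comparison)
      show "((\<lambda>t. C * (t powr q * exp (- t))) \<longlongrightarrow> 0) at_top" using q by real_asymp
      show "\<forall>\<^sub>F t in at_top. norm (?F t) \<le> C * (t powr q * exp (- t))"
        using bnd by (auto intro: eventually_mono[OF eventually_gt_at_top[of 0]])
    qed
    thus "((?F \<circ> real_of_ereal) \<longlongrightarrow> 0) (at_left \<infinity>)"
      by (simp add: ereal_tendsto_simps)
  qed auto
  hence "(LINT t:{0<..}|lborel. ?f t) = 0"
    by (simp add: interval_lebesgue_integral_def e)
  moreover have "(LINT t:{0<..}|lborel. ?f t) = p * macdonald_integral p z + z * macdonald_integral (p - 1) z - macdonald_integral (p + 1) z"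
    unfolding macdonald_integral_def
    by (subst set_integral_diff set_integral_add set_integral_diff(2) set_integral_add(2),
        (intro set_integral_add set_integral_diff set_integrable_mult_right set_integrable_macdonald_integral z)+)+
       (simp add: algebra_simps)
  ultimately show ?thesis by simp
qed

text \<open>Needed at integer orders, where the Macdonald function is defined by a limit in the order.\<close>

lemma isCont_macdonald_integral_order:
  assumes z: "z > 0" shows "isCont (\<lambda>p. macdonald_integral p z) q"
proof -
  have "((\<lambda>p. macdonald_integral p z) \<longlongrightarrow> macdonald_integral q z) (at q within {q-1<..<q+1})"
    unfolding macdonald_integral_def set_lebesgue_integral_def
  proof (rule integral_dominated_convergence_within[where w = "\<lambda>t. indicator {0<..} t *\<^sub>R (t powr ((q + 1) - 1) * exp (- t - z / t)) + indicator {0<..} t *\<^sub>R (t powr ((q - 1) - 1) * exp (- t - z / t))"])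
    show "integrable lborel (\<lambda>t. indicator {0<..} t *\<^sub>R (t powr ((q + 1) - 1) * exp (- t - z / t)) + indicator {0<..} t *\<^sub>R (t powr ((q - 1) - 1) * exp (- t - z / t)))"
      using set_integrable_macdonald_integral[OF z, of "q + 1"] set_integrable_macdonald_integral[OF z, of "q - 1"]
      unfolding set_integrable_def by (rule Bochner_Integration.integrable_add)
    show "AE t in lborel. ((\<lambda>p. indicat_real {0<..} t *\<^sub>R (t powr (p - 1) * exp (- t - z / t))) \<longlongrightarrow>
        indicat_real {0<..} t *\<^sub>R (t powr (q - 1) * exp (- t - z / t))) (at q within {q-1<..<q+1})"
      by (intro AE_I2) (auto simp: indicator_def intro!: tendsto_intros)
    fix p assume p: "p \<in> {q-1<..<q+1} - {q}"
    have "t powr (p - 1) \<le> t powr ((q + 1) - 1) + t powr ((q - 1) - 1)" if "t > 0" for t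
    proof (cases "t \<ge> 1")
      case True
      have "t powr (p - 1) \<le> t powr ((q + 1) - 1)" using True p by (intro powr_mono) auto
      thus ?thesis by (simp add: add_increasing2)
    next
      case False
      have "t powr (p - 1) \<le> t powr ((q - 1) - 1)" using False that p by (intro powr_mono') auto
      thus ?thesis by (simp add: add_increasing)
    qed
    hence "t powr (p - 1) * exp (- t - z / t) \<le> t powr ((q + 1) - 1) * exp (- t - z / t) + t powr ((q - 1) - 1) * exp (- t - z / t)"
      if "t > 0" for t using that by (subst distrib_right[symmetric], intro mult_right_mono) auto
    thus "AE t in lborel. norm (indicat_real {0<..} t *\<^sub>R (t powr (p - 1) * exp (- t - z / t)))
         \<le> indicat_real {0<..} t *\<^sub>R (t powr ((q + 1) - 1) * exp (- t - z / t)) + indicat_real {0<..} t *\<^sub>R (t powr ((q - 1) - 1) * exp (- t - z / t))"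
      by (intro AE_I2) (auto simp: indicator_def)
  qed auto
  thus ?thesis by (simp add: isCont_def at_within_open[of q "{q-1<..<q+1}"])
qed

lemma macdonald_integral_at_right_0:
  assumes p: "p > 0" shows "(macdonald_integral p \<longlongrightarrow> Gamma p) (at_right 0)"
proof -
  have "(macdonald_integral p \<longlongrightarrow> (LINT t:{0<..}|lborel. t powr (p - 1) * exp (- t))) (at_right 0)"
    unfolding macdonald_integral_def[abs_def] set_lebesgue_integral_def
  proof (rule integral_dominated_convergence_within[where w = "\<lambda>t. indicator {0<..} t *\<^sub>R (t powr (p - 1) * exp (- t))"])
    show "integrable lborel (\<lambda>t. indicat_real {0<..} t *\<^sub>R (t powr (p - 1) * exp (- t)))"
      using Gamma_set_integral(1)[OF p] by (simp add: set_integrable_def)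
    have "((\<lambda>y. t powr (p - 1) * exp (- t - y / t)) \<longlongrightarrow> t powr (p - 1) * exp (- t - 0 / t)) (at_right 0)" if "t > 0" for t
      using that by (intro tendsto_intros) auto
    thus "AE t in lborel. ((\<lambda>y. indicat_real {0<..} t *\<^sub>R (t powr (p - 1) * exp (- t - y / t))) \<longlongrightarrow>
        indicat_real {0<..} t *\<^sub>R (t powr (p - 1) * exp (- t))) (at_right 0)"
      by (intro AE_I2) (auto simp: indicator_def)
    fix y :: real assume "y \<in> {0<..} - {0}"
    thus "AE t in lborel. norm (indicat_real {0<..} t *\<^sub>R (t powr (p - 1) * exp (- t - y / t))) \<le> indicat_real {0<..} t *\<^sub>R (t powr (p - 1) * exp (- t))"
      by (intro AE_I2) (auto simp: indicator_def intro!: mult_left_mono)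
  qed auto
  thus ?thesis using Gamma_set_integral(2)[OF p] by simp
qed

lemma constant_from_zero_derivative:
  fixes f :: "real \<Rightarrow> real"
  assumes "\<And>z. z > 0 \<Longrightarrow> (f has_real_derivative 0) (at z)" "(f \<longlongrightarrow> L) (at_right 0)" "z > 0"
  shows "f z = L"
proof -
  obtain c where c: "\<And>x. x > 0 \<Longrightarrow> f x = c"
    using has_field_derivative_zero_constant[of "{0<..}" f] assms(1)
    by (metis convex_real_interval(3) greaterThan_iff has_field_derivative_at_within)
  have "(f \<longlongrightarrow> c) (at_right 0)"
    by (rule tendsto_eventually) (use c in \<open>auto simp: eventually_at_right_less eventually_mono[OF eventually_at_right_less]\<close>)
  hence "L = c" using tendsto_unique[OF _ assms(2)] by simp
  thus ?thesis using c assms by simp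
qed

text \<open>The Wronskian of \<open>I\<^bsub>-\<nu>\<^esub>\<close> and \<open>I\<^sub>\<nu>\<close>. Its derivative vanishes by the three-term recurrence, and its value is
read off at the origin.\<close>

lemma bessel_clifford_Wronskian:
  assumes "z > 0"
  shows "bessel_clifford (- \<nu>) z * bessel_clifford (\<nu> - 1) z - z * bessel_clifford (1 - \<nu>) z * bessel_clifford \<nu> z = rGamma (1 - \<nu>) * rGamma \<nu>"
proof (rule constant_from_zero_derivative[OF _ _ assms])
  fix z :: real
  show "((\<lambda>z. bessel_clifford (- \<nu>) z * bessel_clifford (\<nu> - 1) z - z * bessel_clifford (1 - \<nu>) z * bessel_clifford \<nu> z) has_real_derivative 0) (at z)"
  proof (rule DERIV_cong)
    have r: "bessel_clifford (- \<nu>) z = (1 - \<nu>) * bessel_clifford (1 - \<nu>) z + z * bessel_clifford (2 - \<nu>) z"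
      using bessel_clifford_recurrence[of "1 - \<nu>" z] by simp
    show "((\<lambda>z. bessel_clifford (- \<nu>) z * bessel_clifford (\<nu> - 1) z - z * bessel_clifford (1 - \<nu>) z * bessel_clifford \<nu> z) has_real_derivative
       (bessel_clifford (- \<nu> + 1) z * bessel_clifford (\<nu> - 1) z + bessel_clifford (\<nu> - 1 + 1) z * bessel_clifford (- \<nu>) z) -
       ((1 * bessel_clifford (1 - \<nu>) z + bessel_clifford (1 - \<nu> + 1) z * z) * bessel_clifford \<nu> z + bessel_clifford (\<nu> + 1) z * (z * bessel_clifford (1 - \<nu>) z))) (at z)"
      by (intro DERIV_diff DERIV_mult DERIV_ident has_real_derivative_bessel_clifford)
    show "(bessel_clifford (- \<nu> + 1) z * bessel_clifford (\<nu> - 1) z + bessel_clifford (\<nu> - 1 + 1) z * bessel_clifford (- \<nu>) z) -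
       ((1 * bessel_clifford (1 - \<nu>) z + bessel_clifford (1 - \<nu> + 1) z * z) * bessel_clifford \<nu> z + bessel_clifford (\<nu> + 1) z * (z * bessel_clifford (1 - \<nu>) z)) = 0"
      unfolding r bessel_clifford_recurrence[of \<nu> z] by (simp add: algebra_simps)
  qed
  have "isCont (\<lambda>z. bessel_clifford (- \<nu>) z * bessel_clifford (\<nu> - 1) z - z * bessel_clifford (1 - \<nu>) z * bessel_clifford \<nu> z) 0"
    by (intro continuous_intros isCont_bessel_clifford)
  hence "((\<lambda>z. bessel_clifford (- \<nu>) z * bessel_clifford (\<nu> - 1) z - z * bessel_clifford (1 - \<nu>) z * bessel_clifford \<nu> z) \<longlongrightarrow> 
     bessel_clifford (- \<nu>) 0 * bessel_clifford (\<nu> - 1) 0 - 0 * bessel_clifford (1 - \<nu>) 0 * bessel_clifford \<nu> 0) (at_right 0)"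
    unfolding isCont_def by (rule tendsto_within_subset) auto
  thus "((\<lambda>z. bessel_clifford (- \<nu>) z * bessel_clifford (\<nu> - 1) z - z * bessel_clifford (1 - \<nu>) z * bessel_clifford \<nu> z) \<longlongrightarrow> rGamma (1 - \<nu>) * rGamma \<nu>) (at_right 0)"
    by (simp add: bessel_clifford_0 add.commute)
qed

text \<open>The Wronskian of \<open>K\<^sub>\<nu>\<close> and \<open>I\<^sub>\<nu>\<close>. The range of \<open>\<nu>\<close> makes the limit at the origin visible: both integrals tend
to Gamma values, and the second summand carries a vanishing power of \<open>z\<close>.\<close>

lemma macdonald_integral_Wronskian:
  assumes \<nu>: "0 < \<nu>" "\<nu> < 1" and z: "z > 0"
  shows "macdonald_integral \<nu> z * bessel_clifford (\<nu> - 1) z + macdonald_integral (1 - \<nu>) z * z powr \<nu> * bessel_clifford \<nu> z = 1"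
proof (rule constant_from_zero_derivative[OF _ _ z])
  fix z :: real assume z: "z > 0"
  let ?W = "\<lambda>z. macdonald_integral \<nu> z * bessel_clifford (\<nu> - 1) z + macdonald_integral (1 - \<nu>) z * z powr \<nu> * bessel_clifford \<nu> z"
  have 1: "macdonald_integral (\<nu> - 1) z = z powr (\<nu> - 1) * macdonald_integral (1 - \<nu>) z"
    using macdonald_integral_symmetric[OF z, of "1 - \<nu>"] by simp
  have 2: "macdonald_integral (- \<nu>) z = z powr (- \<nu>) * macdonald_integral \<nu> z" by (rule macdonald_integral_symmetric[OF z])
  have 3: "z powr \<nu> = z * z powr (\<nu> - 1)" using z powr_add[of z 1 "\<nu> - 1"] by simp
  have 4: "z powr \<nu> * z powr (- \<nu>) = 1" using z by (simp add: powr_add[symmetric])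
  have d1: "(macdonald_integral \<nu> has_real_derivative - (z powr (\<nu> - 1) * macdonald_integral (1 - \<nu>) z)) (at z)"
    using has_real_derivative_macdonald_integral[OF z, of \<nu>] 1 by simp
  have d2: "(macdonald_integral (1 - \<nu>) has_real_derivative - (z powr (- \<nu>) * macdonald_integral \<nu> z)) (at z)"
    using has_real_derivative_macdonald_integral[OF z, of "1 - \<nu>"] 2 by simp
  have d3: "(bessel_clifford (\<nu> - 1) has_real_derivative bessel_clifford \<nu> z) (at z)"
    using has_real_derivative_bessel_clifford[of "\<nu> - 1" z] by simp
  have "(?W has_real_derivative
      (- (z powr (\<nu> - 1) * macdonald_integral (1 - \<nu>) z) * bessel_clifford (\<nu> - 1) z + bessel_clifford \<nu> z * macdonald_integral \<nu> z)
      + ((- (z powr (- \<nu>) * macdonald_integral \<nu> z) * z powr \<nu> + (\<nu> * z powr (\<nu> - 1)) * macdonald_integral (1 - \<nu>) z) * bessel_clifford \<nu> z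
         + bessel_clifford (\<nu> + 1) z * (macdonald_integral (1 - \<nu>) z * z powr \<nu>))) (at z)"
    using z by (intro DERIV_add DERIV_mult' DERIV_mult d1 d2 d3 has_real_derivative_bessel_clifford has_real_derivative_powr)
  moreover have "(- (z powr (\<nu> - 1) * macdonald_integral (1 - \<nu>) z) * bessel_clifford (\<nu> - 1) z + bessel_clifford \<nu> z * macdonald_integral \<nu> z)
      + ((- (z powr (- \<nu>) * macdonald_integral \<nu> z) * z powr \<nu> + (\<nu> * z powr (\<nu> - 1)) * macdonald_integral (1 - \<nu>) z) * bessel_clifford \<nu> z
         + bessel_clifford (\<nu> + 1) z * (macdonald_integral (1 - \<nu>) z * z powr \<nu>)) = 
      bessel_clifford \<nu> z * macdonald_integral \<nu> z * (1 - z powr \<nu> * z powr (- \<nu>)) +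
      macdonald_integral (1 - \<nu>) z * (\<nu> * z powr (\<nu> - 1) * bessel_clifford \<nu> z + z powr \<nu> * bessel_clifford (\<nu> + 1) z
         - z powr (\<nu> - 1) * bessel_clifford (\<nu> - 1) z)"
    by (simp add: algebra_simps)
  moreover have "\<dots> = 0"
    unfolding 4 unfolding 3 bessel_clifford_recurrence[of \<nu> z] by (simp add: algebra_simps)
  ultimately show "(?W has_real_derivative 0) (at z)" by simp
next
  have A: "(bessel_clifford \<mu> \<longlongrightarrow> rGamma (\<mu> + 1)) (at_right 0)" for \<mu>
    using isCont_bessel_clifford[where \<nu> = \<mu> and z = 0] unfolding isCont_def bessel_clifford_0 by (rule tendsto_within_subset) auto
  have p: "((\<lambda>z. z powr \<nu>) \<longlongrightarrow> 0) (at_right (0::real))" using \<nu> by real_asymp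
  have g: "Gamma \<nu> * rGamma (\<nu> - 1 + 1) + Gamma (1 - \<nu>) * 0 * rGamma (\<nu> + 1) = 1"
    using less_imp_neq[OF Gamma_real_pos[OF \<nu>(1)]] by (simp add: rGamma_inverse_Gamma)
  have "((\<lambda>z. macdonald_integral \<nu> z * bessel_clifford (\<nu> - 1) z + macdonald_integral (1 - \<nu>) z * z powr \<nu> * bessel_clifford \<nu> z) \<longlongrightarrow>
     Gamma \<nu> * rGamma (\<nu> - 1 + 1) + Gamma (1 - \<nu>) * 0 * rGamma (\<nu> + 1)) (at_right 0)"
    using \<nu> by (intro tendsto_intros macdonald_integral_at_right_0 A p) auto
  thus "((\<lambda>z. macdonald_integral \<nu> z * bessel_clifford (\<nu> - 1) z + macdonald_integral (1 - \<nu>) z * z powr \<nu> * bessel_clifford \<nu> z) \<longlongrightarrow> 1) (at_right 0)"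
    unfolding g .
qed

lemma rGamma_reflection_real: "rGamma (1 - x) * rGamma x = sin (pi * x) / (pi::real)"
proof -
  have "complex_of_real (rGamma x * rGamma (1 - x)) = complex_of_real (sin (pi * x) / pi)"
    using rGamma_reflection_complex[of "of_real x"]
    by (simp add: rGamma_complex_of_real[symmetric] sin_of_real[symmetric])
  thus ?thesis by (simp only: of_real_eq_iff mult.commute)
qed

text \<open>The Wronskian identities for \<open>\<nu>\<close> and \<open>1 - \<nu>\<close> are linear equations for the integrals of orders \<open>\<nu>\<close> and \<open>1 - \<nu>\<close>.
Their determinant is the Wronskian of \<open>I\<^bsub>-\<nu>\<^esub>\<close> and \<open>I\<^sub>\<nu>\<close>, that is \<open>sin (\<pi>\<nu>) / \<pi>\<close>.\<close>

lemma macdonald_integral_eq_series_unit: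
  assumes \<nu>: "0 < \<nu>" "\<nu> < 1" and z: "z > 0"
  shows "macdonald_integral \<nu> z * (sin (pi * \<nu>) / pi) = bessel_clifford (- \<nu>) z - z powr \<nu> * bessel_clifford \<nu> z"
proof -
  let ?y = "macdonald_integral \<nu> z" and ?y1 = "macdonald_integral (1 - \<nu>) z"
  have W1: "?y * bessel_clifford (\<nu> - 1) z + ?y1 * z powr \<nu> * bessel_clifford \<nu> z = 1"
    using macdonald_integral_Wronskian[OF \<nu> z] .
  \<comment> \<open>Together with \<open>W1\<close> a linear system for \<open>?y\<close> and \<open>?y1\<close>, solved below by determinants.\<close>
  have W2: "?y1 * bessel_clifford (- \<nu>) z + ?y * z powr (1 - \<nu>) * bessel_clifford (1 - \<nu>) z = 1"
    using macdonald_integral_Wronskian[of "1 - \<nu>" z] \<nu> z by simp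
  have zz: "z powr \<nu> * z powr (1 - \<nu>) = z" using z by (simp add: powr_add[symmetric])
  have "?y * (sin (pi * \<nu>) / pi) = ?y * (bessel_clifford (- \<nu>) z * bessel_clifford (\<nu> - 1) z - z * bessel_clifford (1 - \<nu>) z * bessel_clifford \<nu> z)"
    by (simp add: bessel_clifford_Wronskian[OF z] rGamma_reflection_real)
  also have "\<dots> = bessel_clifford (- \<nu>) z * (?y * bessel_clifford (\<nu> - 1) z + ?y1 * z powr \<nu> * bessel_clifford \<nu> z)
      - z powr \<nu> * bessel_clifford \<nu> z * (?y1 * bessel_clifford (- \<nu>) z + ?y * z powr (1 - \<nu>) * bessel_clifford (1 - \<nu>) z)"
    by (subst zz[symmetric]) (simp add: algebra_simps)
  finally show ?thesis unfolding W1 W2 by simp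
qed

text \<open>Both sides satisfy the same three-term recurrence in the order. The case \<open>k = 0\<close> provides the second starting
value; it follows from the case \<open>k = 1\<close> by the symmetry in the order.\<close>

lemma macdonald_integral_eq_series:
  assumes z: "z > 0" and "real k - 1 < \<nu>" "\<nu> < real k"
  shows "macdonald_integral \<nu> z * (sin (pi * \<nu>) / pi) = bessel_clifford (- \<nu>) z - z powr \<nu> * bessel_clifford \<nu> z"
  using assms(2,3)
proof (induction k arbitrary: \<nu> rule: less_induct)
  case (less k)
  consider "k = 0" | "k = 1" | k' where "k = Suc (Suc k')" by (metis One_nat_def not0_implies_Suc)
  thus ?case
  proof cases
    case 1
    have "macdonald_integral (- \<nu>) z * (sin (pi * (- \<nu>)) / pi) = bessel_clifford \<nu> z - z powr (- \<nu>) * bessel_clifford (- \<nu>) z"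
      using macdonald_integral_eq_series_unit[of "- \<nu>" z] less.prems 1 z by simp
    moreover have "macdonald_integral \<nu> z = z powr \<nu> * macdonald_integral (- \<nu>) z" using macdonald_integral_symmetric[OF z, of "- \<nu>"] by simp
    ultimately have "macdonald_integral \<nu> z * (sin (pi * \<nu>) / pi) = z powr \<nu> * (- (bessel_clifford \<nu> z - z powr (- \<nu>) * bessel_clifford (- \<nu>) z))"
      by (simp add: algebra_simps)
    also have "\<dots> = (z powr \<nu> * z powr (- \<nu>)) * bessel_clifford (- \<nu>) z - z powr \<nu> * bessel_clifford \<nu> z" by (simp add: algebra_simps)
    also have "z powr \<nu> * z powr (- \<nu>) = 1" using z by (simp add: powr_add[symmetric])
    finally show ?thesis by simp
  next
    case 2
    thus ?thesis using macdonald_integral_eq_series_unit less.prems z by simp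
  next
    case (3 k')
    define p where "p = \<nu> - 1"
    have a: "macdonald_integral p z * (sin (pi * p) / pi) = bessel_clifford (- p) z - z powr p * bessel_clifford p z"
      using less.IH[of "Suc k'" p] less.prems 3 by (simp add: p_def)
    have b: "macdonald_integral (p - 1) z * (sin (pi * (p - 1)) / pi) = bessel_clifford (1 - p) z - z powr (p - 1) * bessel_clifford (p - 1) z"
      using less.IH[of "k'" "p - 1"] less.prems 3 by (simp add: p_def)
    have s: "sin (pi * (p + 1)) = - sin (pi * p)" "sin (pi * (p + 1)) = sin (pi * (p - 1))"
      by (simp_all add: algebra_simps sin_diff)
    have "macdonald_integral (p + 1) z * (sin (pi * (p + 1)) / pi) = p * macdonald_integral p z * (sin (pi * (p + 1)) / pi) + z * macdonald_integral (p - 1) z * (sin (pi * (p + 1)) / pi)"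
      unfolding macdonald_integral_recurrence[OF z] by (simp add: algebra_simps)
    also have "p * macdonald_integral p z * (sin (pi * (p + 1)) / pi) = - p * (bessel_clifford (- p) z - z powr p * bessel_clifford p z)"
      unfolding s(1) a[symmetric] by simp
    also have "z * macdonald_integral (p - 1) z * (sin (pi * (p + 1)) / pi) = z * (bessel_clifford (1 - p) z - z powr (p - 1) * bessel_clifford (p - 1) z)"
      unfolding s(2) b[symmetric] by simp
    also have "- p * (bessel_clifford (- p) z - z powr p * bessel_clifford p z) + z * (bessel_clifford (1 - p) z - z powr (p - 1) * bessel_clifford (p - 1) z)
       = (- p * bessel_clifford (- p) z + z * bessel_clifford (1 - p) z) - (z * z powr (p - 1) * bessel_clifford (p - 1) z - p * z powr p * bessel_clifford p z)"
      by (simp add: algebra_simps)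
    also have "- p * bessel_clifford (- p) z + z * bessel_clifford (1 - p) z = bessel_clifford (- (p + 1)) z"
      using bessel_clifford_recurrence[of "- p" z] unfolding minus_add_distrib by simp
    also have "z * z powr (p - 1) = z powr p" using z powr_add[of z 1 "p - 1"] by simp
    also have "z powr p * bessel_clifford (p - 1) z - p * z powr p * bessel_clifford p z = z powr (p + 1) * bessel_clifford (p + 1) z"
      unfolding bessel_clifford_recurrence[of p z] using z by (simp add: powr_add algebra_simps)
    finally show ?thesis by (simp add: p_def)
  qed
qed

lemma bessel_I_eq:
  assumes x: "x > 0" shows "bessel_I \<nu> x = (x / 2) powr \<nu> * bessel_clifford \<nu> (x\<^sup>2 / 4)"
proof -
  have "(x / 2) powr (2 * real m + \<nu>) = (x / 2) powr \<nu> * (x\<^sup>2 / 4) ^ m" for m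
  proof -
    have "(x / 2) powr (2 * real m + \<nu>) = (x / 2) powr real (2 * m) * (x / 2) powr \<nu>" by (simp add: powr_add)
    also have "(x / 2) powr real (2 * m) = ((x / 2) ^ 2) ^ m" using x by (subst powr_realpow) (simp_all add: power_mult)
    finally show ?thesis by (simp add: power_divide)
  qed
  hence "bessel_I \<nu> x = (\<Sum>m. (x / 2) powr \<nu> * (bessel_coeff \<nu> m * (x\<^sup>2 / 4) ^ m))"
    unfolding bessel_I_def bessel_coeff_def by (simp add: mult_ac)
  thus ?thesis unfolding bessel_clifford_def by (simp add: suminf_mult[OF summable_bessel_coeff])
qed

text \<open>At non-integer orders this is the series identity. At integer orders both sides are limits from non-integer
orders, the integral being continuous in the order.\<close>

theorem macdonald_K_integral:
  assumes x: "x > 0" and \<mu>: "\<mu> \<ge> 0"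
  shows "macdonald_K \<mu> x = (x / 2) powr (- \<mu>) / 2 * macdonald_integral \<mu> (x\<^sup>2 / 4)"
proof -
  define z where "z = x\<^sup>2 / 4"
  have z: "z > 0" using x by (simp add: z_def)
  let ?Q = "\<lambda>\<nu>. pi / 2 * (bessel_I (- \<nu>) x - bessel_I \<nu> x) / sin (\<nu> * pi)"
  let ?R = "\<lambda>\<nu>. (x / 2) powr (- \<nu>) / 2 * macdonald_integral \<nu> z"
  have eq: "?Q \<nu> = ?R \<nu>" if \<nu>: "\<nu> \<notin> \<int>" "\<nu> > -1" for \<nu>
  proof -
    \<comment> \<open>The window of the series identity that contains \<open>\<nu>\<close>; orders above \<open>-1\<close> suffice for a neighbourhood of \<open>\<mu> \<ge> 0\<close>.\<close>
    define k where "k = nat \<lceil>\<nu>\<rceil>"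
    have "real k - 1 < \<nu> \<and> \<nu> \<le> real k" unfolding k_def using \<nu>(2) by linarith
    moreover have "\<nu> \<noteq> real k" using \<nu>(1) by auto
    ultimately have k: "real k - 1 < \<nu>" "\<nu> < real k" by auto
    have s: "sin (\<nu> * pi) \<noteq> 0" using \<nu>(1) by (auto simp: sin_zero_iff_int2)
    have "(x / 2) powr \<nu> = (x / 2) powr (- \<nu>) * z powr \<nu>"
    proof -
      have "z = (x / 2) powr 2" using x by (simp add: z_def powr_numeral power_divide)
      hence "z powr \<nu> = (x / 2) powr (2 * \<nu>)" by (simp add: powr_powr)
      thus ?thesis using x by (simp add: powr_add[symmetric])
    qed
    hence "bessel_I (- \<nu>) x - bessel_I \<nu> x = (x / 2) powr (- \<nu>) * (bessel_clifford (- \<nu>) z - z powr \<nu> * bessel_clifford \<nu> z)"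
      unfolding bessel_I_eq[OF x] z_def[symmetric] by (simp add: algebra_simps)
    also have "\<dots> = (x / 2) powr (- \<nu>) * (macdonald_integral \<nu> z * (sin (pi * \<nu>) / pi))"
      using macdonald_integral_eq_series[OF z k] by simp
    finally show ?thesis using s by (simp add: field_simps)
  qed
  show ?thesis
  proof (cases "\<mu> \<in> \<int>")
    case False
    thus ?thesis using eq[of \<mu>] \<mu> by (simp add: macdonald_K_def z_def)
  next
    case True
    have "isCont ?R \<mu>" using x by (intro continuous_intros isCont_macdonald_integral_order z) auto
    hence "(?R \<longlongrightarrow> ?R \<mu>) (at \<mu>)" by (simp add: isCont_def)
    moreover have "eventually (\<lambda>\<nu>. ?R \<nu> = ?Q \<nu>) (at \<mu>)"
    proof -
      have "\<nu> \<notin> \<int>" if "\<nu> \<noteq> \<mu>" "\<bar>\<nu> - \<mu>\<bar> < 1" for \<nu>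
      proof
        assume "\<nu> \<in> \<int>"
        then obtain a b where ab: "\<nu> = of_int a" "\<mu> = of_int b" using True by (auto elim!: Ints_cases)
        have "\<bar>real_of_int (a - b)\<bar> < 1" using that(2) by (simp add: ab)
        hence "a = b" by linarith
        thus False using that(1) ab by simp
      qed
      hence "?R \<nu> = ?Q \<nu>" if "\<nu> \<noteq> \<mu>" "\<bar>\<nu> - \<mu>\<bar> < 1" for \<nu>
        using that \<mu> by (intro eq[symmetric]) auto
      thus ?thesis unfolding eventually_at
        by (intro exI[of _ 1]) (simp add: dist_real_def)
    qed
    ultimately have "(?Q \<longlongrightarrow> ?R \<mu>) (at \<mu>)" by (rule Lim_transform_eventually)
    hence "Lim (at \<mu>) ?Q = ?R \<mu>" by (intro tendsto_Lim) auto
    thus ?thesis using True by (simp add: macdonald_K_def z_def)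
  qed
qed

text \<open>Allowing every exponent \<open>p \<ge> \<mu>\<close> covers both ends: \<open>p\<close> near \<open>\<mu>\<close> describes the singularity at the origin, and
large \<open>p\<close> the decay at infinity. The condition \<open>p > 0\<close> accounts for the logarithm at \<open>\<mu> = 0\<close>.\<close>

lemma macdonald_K_bound:
  assumes "\<mu> \<ge> 0" "p \<ge> \<mu>" "p > 0"
  shows "\<exists>C\<ge>0. \<forall>x>0. \<bar>macdonald_K \<mu> x\<bar> \<le> C * x powr (- p)"
proof -
  define a where "a = (p - \<mu>) / 2"
  obtain C where C: "\<And>z. z > 0 \<Longrightarrow> \<bar>macdonald_integral \<mu> z\<bar> \<le> C * z powr (- a)"
  proof -
    have "a \<ge> 0" "\<mu> + a = (\<mu> + p) / 2" using assms by (simp_all add: a_def field_simps)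
    hence "a \<ge> 0" "\<mu> + a > 0" using assms by simp_all
    from macdonald_integral_bound[OF this] show thesis using that by blast
  qed
  have "\<bar>macdonald_K \<mu> x\<bar> \<le> (\<bar>C\<bar> * 2 powr p / 2) * x powr (- p)" if x: "x > 0" for x
  proof -
    have e: "(x\<^sup>2 / 4) powr (- a) = (x / 2) powr (- (p - \<mu>))"
    proof -
      have "x\<^sup>2 / 4 = (x / 2) powr 2" using x by (simp add: powr_numeral power_divide)
      hence "(x\<^sup>2 / 4) powr (- a) = (x / 2) powr (2 * - a)" by (simp only: powr_powr)
      moreover have "2 * - a = - (p - \<mu>)" by (simp add: a_def field_simps)
      ultimately show ?thesis by (simp only:)
    qed
    have "\<bar>macdonald_K \<mu> x\<bar> = (x / 2) powr (- \<mu>) / 2 * \<bar>macdonald_integral \<mu> (x\<^sup>2 / 4)\<bar>"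
      unfolding macdonald_K_integral[OF x assms(1)] by (simp add: abs_mult)
    also have "\<dots> \<le> (x / 2) powr (- \<mu>) / 2 * (\<bar>C\<bar> * (x\<^sup>2 / 4) powr (- a))"
    proof (rule mult_left_mono)
      have "\<bar>macdonald_integral \<mu> (x\<^sup>2 / 4)\<bar> \<le> C * (x\<^sup>2 / 4) powr (- a)" using C[of "x\<^sup>2 / 4"] x by simp
      also have "\<dots> \<le> \<bar>C\<bar> * (x\<^sup>2 / 4) powr (- a)" by (intro mult_right_mono) auto
      finally show "\<bar>macdonald_integral \<mu> (x\<^sup>2 / 4)\<bar> \<le> \<bar>C\<bar> * (x\<^sup>2 / 4) powr (- a)" .
    qed auto
    finally have "\<bar>macdonald_K \<mu> x\<bar> \<le> (x / 2) powr (- \<mu>) / 2 * (\<bar>C\<bar> * (x / 2) powr (- (p - \<mu>)))"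
      unfolding e .
    also have "(x / 2) powr (- \<mu>) / 2 * (\<bar>C\<bar> * (x / 2) powr (- (p - \<mu>))) =
       \<bar>C\<bar> / 2 * ((x / 2) powr (- \<mu>) * (x / 2) powr (- (p - \<mu>)))" by simp
    finally have "\<bar>macdonald_K \<mu> x\<bar> \<le> \<bar>C\<bar> / 2 * ((x / 2) powr (- \<mu>) * (x / 2) powr (- (p - \<mu>)))" .
    moreover have "(x / 2) powr (- \<mu>) * (x / 2) powr (- (p - \<mu>)) = (x / 2) powr (- p)"
      unfolding powr_add[symmetric] by simp
    moreover have "(x / 2) powr (- p) = 2 powr p * x powr (- p)"
      using x by (simp add: powr_divide powr_minus_divide)
    ultimately have "\<bar>macdonald_K \<mu> x\<bar> \<le> \<bar>C\<bar> / 2 * (2 powr p * x powr (- p))" by (simp only:)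
    thus ?thesis by simp
  qed
  thus ?thesis by (intro exI[of _ "\<bar>C\<bar> * 2 powr p / 2"]) auto
qed

lemma borel_measurable_macdonald_K:
  assumes "\<mu> \<ge> 0" shows "set_borel_measurable borel {0<..} (macdonald_K \<mu>)"
proof -
  have "continuous_on {0<..} (\<lambda>x. (x / 2) powr (- \<mu>) / 2 * macdonald_integral \<mu> (x\<^sup>2 / 4))"
  proof (rule continuous_on_mult)
    show "continuous_on {0<..} (\<lambda>x::real. (x / 2) powr (- \<mu>) / 2)"
      by (intro continuous_intros) auto
    have "continuous_on {0<..} (macdonald_integral \<mu>)"
      using DERIV_isCont[OF has_real_derivative_macdonald_integral] by (intro continuous_at_imp_continuous_on) auto
    moreover have "continuous_on {0<..} (\<lambda>x::real. x\<^sup>2 / 4)" by (intro continuous_intros) auto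
    ultimately show "continuous_on {0<..} (\<lambda>x. macdonald_integral \<mu> (x\<^sup>2 / 4))"
      by (rule continuous_on_compose2) auto
  qed
  hence "continuous_on {0<..} (macdonald_K \<mu>)"
    by (rule continuous_on_eq) (simp add: macdonald_K_integral assms)
  thus ?thesis unfolding set_borel_measurable_def
    by (intro borel_measurable_continuous_on_indicator) auto
qed

section \<open>Fourier transforms of radial functions\<close>

lemma lborel_integral_affine:
  fixes f :: "'a::euclidean_space \<Rightarrow> 'b::{banach, second_countable_topology}"
  assumes [measurable]: "f \<in> borel_measurable borel" and c: "c \<noteq> 0"
  shows "(LINT x|lborel. f x) = \<bar>c\<bar> ^ DIM('a) *\<^sub>R (LINT x|lborel. f (t + c *\<^sub>R x))"
    and "integrable lborel f \<longleftrightarrow> integrable lborel (\<lambda>x. f (t + c *\<^sub>R x))"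
proof -
  have T [measurable]: "(\<lambda>x::'a. t + c *\<^sub>R x) \<in> measurable lborel borel" by measurable
  have "(LINT x|lborel. f x) = (LINT x|density (distr lborel borel (\<lambda>x. t + c *\<^sub>R x)) (\<lambda>_. ennreal (\<bar>c\<bar> ^ DIM('a))). f x)"
    by (subst lborel_affine[OF c, of t]) simp
  also have "\<dots> = \<bar>c\<bar> ^ DIM('a) *\<^sub>R (LINT x|lborel. f (t + c *\<^sub>R x))"
    by (subst integral_density, simp_all, subst integral_distr[OF T], simp_all)
  finally show "(LINT x|lborel. f x) = \<bar>c\<bar> ^ DIM('a) *\<^sub>R (LINT x|lborel. f (t + c *\<^sub>R x))" .
  have "integrable lborel f \<longleftrightarrow> integrable (density (distr lborel borel (\<lambda>x. t + c *\<^sub>R x)) (\<lambda>_. ennreal (\<bar>c\<bar> ^ DIM('a)))) f"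
    by (subst lborel_affine[OF c, of t]) simp
  also have "\<dots> \<longleftrightarrow> integrable (distr lborel borel (\<lambda>x. t + c *\<^sub>R x)) (\<lambda>x. \<bar>c\<bar> ^ DIM('a) *\<^sub>R f x)"
    by (subst integrable_density) simp_all
  also have "\<dots> \<longleftrightarrow> integrable (distr lborel borel (\<lambda>x. t + c *\<^sub>R x)) f"
  proof
    assume "integrable (distr lborel borel (\<lambda>x. t + c *\<^sub>R x)) (\<lambda>x. \<bar>c\<bar> ^ DIM('a) *\<^sub>R f x)"
    hence "integrable (distr lborel borel (\<lambda>x. t + c *\<^sub>R x)) (\<lambda>x. inverse (\<bar>c\<bar> ^ DIM('a)) *\<^sub>R (\<bar>c\<bar> ^ DIM('a) *\<^sub>R f x))"
      by (rule integrable_scaleR_right)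
    also have "(\<lambda>x. inverse (\<bar>c\<bar> ^ DIM('a)) *\<^sub>R (\<bar>c\<bar> ^ DIM('a) *\<^sub>R f x)) = f"
      using c by (simp add: fun_eq_iff)
    finally show "integrable (distr lborel borel (\<lambda>x. t + c *\<^sub>R x)) f" .
  qed (intro integrable_scaleR_right)
  also have "\<dots> \<longleftrightarrow> integrable lborel (\<lambda>x. f (t + c *\<^sub>R x))"
    by (subst integrable_distr_eq[OF T]) simp_all
  finally show "integrable lborel f \<longleftrightarrow> integrable lborel (\<lambda>x. f (t + c *\<^sub>R x))" .
qed

lemma lborel_integral_reflect:
  fixes f :: "'a::euclidean_space \<Rightarrow> 'b::{banach, second_countable_topology}"
  assumes "f \<in> borel_measurable borel"
  shows "(LINT x|lborel. f (- x)) = (LINT x|lborel. f x)"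
  using lborel_integral_affine(1)[OF assms, of "-1" 0] by simp

lemma bessel_J_quotient_eq:
  assumes "s \<ge> 0" shows "bessel_J_quotient \<nu> s = 2 powr (- \<nu>) * bessel_clifford \<nu> (- (s\<^sup>2 / 4))"
proof (cases "s = 0")
  case True
  have z: "- (0\<^sup>2 / 4) = (0::real)" by simp
  have "2 powr (- \<nu>) * inverse (Gamma (\<nu> + 1)) = 1 / (2 powr \<nu> * Gamma (\<nu> + 1))"
    unfolding powr_minus by (simp only: divide_inverse mult_1 inverse_mult_distrib)
  thus ?thesis unfolding True z by (simp only: bessel_J_quotient_def bessel_clifford_0 rGamma_inverse_Gamma if_True simp_thms)
next
  case False
  hence s: "s > 0" using assms by simp
  have pw: "(s / 2) powr (2 * real m + \<nu>) = (s / 2) powr \<nu> * (s\<^sup>2 / 4) ^ m" for m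
  proof -
    have "(s / 2) powr (2 * real m + \<nu>) = (s / 2) powr real (2 * m) * (s / 2) powr \<nu>" by (simp add: powr_add)
    also have "(s / 2) powr real (2 * m) = ((s / 2) ^ 2) ^ m" using s by (subst powr_realpow) (simp_all add: power_mult)
    finally show ?thesis by (simp add: power_divide)
  qed
  have "(- 1) ^ m * rGamma (\<nu> + real m + 1) / fact m * (s / 2) powr (2 * real m + \<nu>)
     = (s / 2) powr \<nu> * (bessel_coeff \<nu> m * (- (s\<^sup>2 / 4)) ^ m)" for m :: nat
  proof -
    have "(- (s\<^sup>2 / 4)) ^ m = (- 1) ^ m * (s\<^sup>2 / 4) ^ m" by (rule power_minus)
    with pw[of m] show ?thesis
      by (simp only: bessel_coeff_def times_divide_eq_left times_divide_eq_right mult_ac)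
  qed
  hence "bessel_J \<nu> s = (\<Sum>m. (s / 2) powr \<nu> * (bessel_coeff \<nu> m * (- (s\<^sup>2 / 4)) ^ m))"
    unfolding bessel_J_def by simp
  also have "\<dots> = (s / 2) powr \<nu> * bessel_clifford \<nu> (- (s\<^sup>2 / 4))"
    unfolding bessel_clifford_def by (rule suminf_mult[OF summable_bessel_coeff])
  finally have J: "bessel_J \<nu> s = (s / 2) powr \<nu> * bessel_clifford \<nu> (- (s\<^sup>2 / 4))" .
  have "(s / 2) powr \<nu> = s powr \<nu> * 2 powr (- \<nu>)" using s by (simp add: powr_divide powr_minus_divide)
  thus ?thesis using s unfolding bessel_J_quotient_def J by simp
qed

lemma gaussian_radial_integral:
  assumes q: "(q::real) > 0"
  shows "set_integrable lborel {0<..} (\<lambda>r. r powr (2 * q - 1) * exp (- r\<^sup>2 / 2))"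
    and "(LINT r:{0<..}|lborel. r powr (2 * q - 1) * exp (- r\<^sup>2 / 2)) = 2 powr (q - 1) * Gamma q"
proof -
  let ?f = "\<lambda>t::real. t powr (q - 1) * exp (- t)"
  let ?g = "\<lambda>r::real. r powr (2 * q - 1) * exp (- r\<^sup>2 / 2)"
  have img: "(\<lambda>r::real. r\<^sup>2 / 2) ` {0<..} = {0<..}"
  proof safe
    fix x :: real assume "x > 0" thus "x \<in> (\<lambda>s. s\<^sup>2 / 2) ` {0<..}"
      by (intro image_eqI[of _ _ "sqrt (2 * x)"]) auto
  qed auto
  have inj: "inj_on (\<lambda>r::real. r\<^sup>2 / 2) {0<..}"
    by (auto simp: inj_on_def power2_eq_iff_nonneg)
  have der: "((\<lambda>r. r\<^sup>2 / 2) has_field_derivative r) (at r within {0<..})" if "r \<in> {0<..}" for r :: real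
    by (auto intro!: derivative_eq_intros)
  have e: "\<bar>r\<bar> *\<^sub>R ?f (r\<^sup>2 / 2) = 2 powr (1 - q) * ?g r" if r: "r > 0" for r
  proof -
    have "(r\<^sup>2 / 2) powr (q - 1) = (r powr 2) powr (q - 1) / 2 powr (q - 1)"
      using r by (simp add: powr_divide powr_numeral)
    also have "(r powr 2) powr (q - 1) = r powr (2 * q - 2)" by (simp add: powr_powr algebra_simps)
    finally have 0: "(r\<^sup>2 / 2) powr (q - 1) = r powr (2 * q - 2) / 2 powr (q - 1)" .
    have "2 powr (1 - q) = 1 / 2 powr (q - 1)" using powr_minus_divide[of 2 "q - 1"] by simp
    hence 1: "(r\<^sup>2 / 2) powr (q - 1) = r powr (2 * q - 2) * 2 powr (1 - q)" unfolding 0 by simp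
    have 2: "r * r powr (2 * q - 2) = r powr (2 * q - 1)" using r powr_add[of r 1 "2 * q - 2"] by simp
    have "\<bar>r\<bar> *\<^sub>R ?f (r\<^sup>2 / 2) = 2 powr (1 - q) * ((r * r powr (2 * q - 2)) * exp (- r\<^sup>2 / 2))"
      using r unfolding 1 by simp
    thus ?thesis unfolding 2 .
  qed
  have F: "?f absolutely_integrable_on {0<..}" "integral {0<..} ?f = Gamma q"
    using Gamma_set_integral[OF q] set_borel_integral_eq_integral(2)[OF Gamma_set_integral(1)[OF q]]
      integrable_completion[OF borel_measurable_integrable[OF Gamma_set_integral(1)[OF q, unfolded set_integrable_def]]]
    by (simp_all add: set_integrable_def)
  note cv = has_absolute_integral_change_of_variables_real[OF _ der inj, of ?f "Gamma q", unfolded img]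
  have G: "(\<lambda>r. \<bar>r\<bar> *\<^sub>R ?f (r\<^sup>2 / 2)) absolutely_integrable_on {0<..}" "integral {0<..} (\<lambda>r. \<bar>r\<bar> *\<^sub>R ?f (r\<^sup>2 / 2)) = Gamma q"
    using cv F by auto
  have m: "(\<lambda>r. indicator {0<..} r *\<^sub>R (2 powr (1 - q) * ?g r)) \<in> borel_measurable lborel" by measurable
  have "set_integrable lebesgue {0<..} (\<lambda>r. 2 powr (1 - q) * ?g r)"
    using G(1) by (subst set_integrable_cong[OF refl refl, where f' = "\<lambda>r. \<bar>r\<bar> *\<^sub>R ?f (r\<^sup>2 / 2)"]) (use e in auto)
  hence I: "set_integrable lborel {0<..} (\<lambda>r. 2 powr (1 - q) * ?g r)"
    unfolding set_integrable_def using integrable_completion[OF m] by simp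
  from set_integrable_mult_right[OF this, of "2 powr (q - 1)"]
  show J: "set_integrable lborel {0<..} ?g" by (simp add: mult.assoc[symmetric] powr_add[symmetric])
  have "(LINT r:{0<..}|lborel. 2 powr (1 - q) * ?g r) = integral {0<..} (\<lambda>r. 2 powr (1 - q) * ?g r)"
    by (rule set_borel_integral_eq_integral(2)[OF I])
  also have "\<dots> = integral {0<..} (\<lambda>r. \<bar>r\<bar> *\<^sub>R ?f (r\<^sup>2 / 2))"
    by (intro Henstock_Kurzweil_Integration.integral_cong) (use e in auto)
  also have "\<dots> = Gamma q" by (rule G)
  finally have G: "2 powr (1 - q) * (LINT r:{0<..}|lborel. ?g r) = Gamma q" by simp
  have "2 powr (q - 1) * 2 powr (1 - q) = (1::real)" by (simp add: powr_add[symmetric])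
  hence "(LINT r:{0<..}|lborel. ?g r) = (2 powr (q - 1) * 2 powr (1 - q)) * (LINT r:{0<..}|lborel. ?g r)"
    by (simp only: mult_1_left)
  thus "(LINT r:{0<..}|lborel. ?g r) = 2 powr (q - 1) * Gamma q" unfolding mult.assoc G .
qed

text \<open>The density \<open>(k \<bullet> x)\<^bsup>2m\<^esup>\<close> is homogeneous, so the integral is a constant times the radial one. The constant
does not depend on \<open>w\<close> and is found by inserting a Gaussian.\<close>

lemma inner_power_polar:
  fixes x :: "'a::euclidean_space" and w :: "real \<Rightarrow> real"
  assumes w [measurable]: "w \<in> borel_measurable borel"
  defines "\<nu> \<equiv> real DIM('a) / 2 - 1"
  shows "set_integrable lborel {0<..} (\<lambda>r. r ^ (2 * m + DIM('a) - 1) * w r) \<longrightarrow> integrable lborel (\<lambda>k. (k \<bullet> x) ^ (2 * m) * w (norm k))"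
    and "(LINT k|lborel. (k \<bullet> x) ^ (2 * m) * w (norm k)) = 
     fact (2 * m) * (2 * pi) powr (DIM('a) / 2) * 2 powr (- \<nu>) * bessel_coeff \<nu> m * ((norm x)\<^sup>2 / 4) ^ m
      * (LINT r:{0<..}|lborel. r ^ (2 * m + DIM('a) - 1) * w r)"
proof -
  let ?D = "2 * m + DIM('a)"
  have Ip: "integrable lborel (\<lambda>k::'a. (k \<bullet> x) ^ (2 * m) * indicator (cball 0 1) k)"
  proof -
    have "integrable lborel (\<lambda>k::'a. indicator (cball 0 1) k *\<^sub>R (k \<bullet> x) ^ (2 * m))"
      by (intro borel_integrable_compact continuous_intros) auto
    thus ?thesis by (simp add: mult.commute)
  qed
  obtain c where c: "\<And>w::real \<Rightarrow> real. w \<in> borel_measurable borel \<Longrightarrow>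
     (set_integrable lborel {0<..} (\<lambda>r. r ^ (?D - 1) *\<^sub>R w r) \<longrightarrow> integrable lborel (\<lambda>k. (k \<bullet> x) ^ (2 * m) *\<^sub>R w (norm k))) \<and>
     (LINT k|lborel. (k \<bullet> x) ^ (2 * m) *\<^sub>R w (norm k)) = c *\<^sub>R (LINT r:{0<..}|lborel. r ^ (?D - 1) *\<^sub>R w r)"
    using homogeneous_polar[OF _ _ _ Ip, of "2 * m", where 'b = real] by (auto simp: power_mult_distrib zero_le_even_power)
  have D: "?D > 0" by simp
  define q where "q = real ?D / 2"
  have q: "q > 0" "q = \<nu> + real m + 1" using D by (simp_all add: q_def \<nu>_def field_simps del: of_nat_add add_gr_0) 
  have pw: "r ^ (?D - 1) = r powr (2 * q - 1)" if "r > 0" for r :: real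
  proof -
    have "real (?D - 1) = 2 * q - 1" unfolding q_def by (subst of_nat_diff) (use D in linarith, simp)
    thus ?thesis using that powr_realpow[of r "?D - 1"] by (simp only:)
  qed
  have "(2 * pi) powr (DIM('a) / 2) * (norm x ^ (2 * m) * (fact (2 * m) / (2 ^ m * fact m)))
      = c * (LINT r:{0<..}|lborel. r ^ (?D - 1) * exp (- r\<^sup>2 / 2))"
    using c[of "\<lambda>r. exp (- r\<^sup>2 / 2)"] gaussian_inner_moment[of x m] by simp
  also have "(LINT r:{0<..}|lborel. r ^ (?D - 1) * exp (- r\<^sup>2 / 2)) = (LINT r:{0<..}|lborel. r powr (2 * q - 1) * exp (- r\<^sup>2 / 2))"
    by (intro set_lebesgue_integral_cong) (use pw in auto)
  also have "\<dots> = 2 powr (q - 1) * Gamma q" by (rule gaussian_radial_integral[OF q(1)])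
  finally have e: "(2 * pi) powr (DIM('a) / 2) * (norm x ^ (2 * m) * (fact (2 * m) / (2 ^ m * fact m))) = c * (2 powr (q - 1) * Gamma q)" .
  have g: "Gamma q > 0" using q by (intro Gamma_real_pos)
  have p2: "2 powr (q - 1) = 2 powr \<nu> * 2 ^ m" unfolding q(2) by (simp add: powr_add powr_realpow)
  have "c = (2 * pi) powr (DIM('a) / 2) * (norm x ^ (2 * m) * (fact (2 * m) / (2 ^ m * fact m))) / (2 powr (q - 1) * Gamma q)"
    using e g by simp
  also have "\<dots> = fact (2 * m) * (2 * pi) powr (DIM('a) / 2) * 2 powr (- \<nu>) * bessel_coeff \<nu> m * ((norm x)\<^sup>2 / 4) ^ m"
  proof -
    have "bessel_coeff \<nu> m = 1 / (Gamma q * fact m)" by (simp add: bessel_coeff_def q(2) rGamma_inverse_Gamma divide_inverse)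
    moreover have "((norm x)\<^sup>2 / 4) ^ m = norm x ^ (2 * m) / (2 ^ m * 2 ^ m)"
      by (simp add: power_divide power_mult power_mult_distrib[symmetric])
    moreover have "A * (B * (F / (T * G))) / (P * T * Q) = F * A * (1 / P) * (1 / (Q * G)) * (B / (T * T))"
      for A B F T G P Q :: real
      by (simp only: divide_inverse inverse_mult_distrib mult_1_left mult.assoc mult.commute mult.left_commute)
    ultimately show ?thesis unfolding p2 powr_minus_divide by (simp only:)
  qed
  finally have cc: "c = fact (2 * m) * (2 * pi) powr (DIM('a) / 2) * 2 powr (- \<nu>) * bessel_coeff \<nu> m * ((norm x)\<^sup>2 / 4) ^ m" .
  show "set_integrable lborel {0<..} (\<lambda>r. r ^ (2 * m + DIM('a) - 1) * w r) \<longrightarrow> integrable lborel (\<lambda>k. (k \<bullet> x) ^ (2 * m) * w (norm k))"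
    "(LINT k|lborel. (k \<bullet> x) ^ (2 * m) * w (norm k)) = 
     fact (2 * m) * (2 * pi) powr (DIM('a) / 2) * 2 powr (- \<nu>) * bessel_coeff \<nu> m * ((norm x)\<^sup>2 / 4) ^ m
      * (LINT r:{0<..}|lborel. r ^ (2 * m + DIM('a) - 1) * w r)"
    using c[OF w] unfolding cc by simp_all
qed

lemma bessel_coeff_nonneg: "\<nu> > -1 \<Longrightarrow> bessel_coeff \<nu> m \<ge> 0"
  unfolding bessel_coeff_def by (simp add: rGamma_inverse_Gamma less_imp_le)

lemma cos_sums_real: "(\<lambda>m. (- 1) ^ m / fact (2 * m) * t ^ (2 * m)) sums cos (t::real)"
  using cos_paired[of t] by simp

text \<open>If \<open>w\<close> has bounded support, the cosine series may be integrated term by term. The terms are those of the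
Bessel series by \<open>inner_power_polar\<close>.\<close>

lemma radial_fourier_truncated:
  fixes x :: "'a::euclidean_space" and w :: "real \<Rightarrow> real"
  assumes w [measurable]: "w \<in> borel_measurable borel"
    and I: "set_integrable lborel {0<..} (\<lambda>r. r ^ (DIM('a) - 1) * w r)" and R: "R \<ge> 0" "\<And>r. r > R \<Longrightarrow> w r = 0"
  defines "\<nu> \<equiv> real DIM('a) / 2 - 1"
  shows "(LINT k|lborel. cos (k \<bullet> x) * w (norm k)) =
     (2 * pi) powr (DIM('a) / 2) * (LINT r:{0<..}|lborel. bessel_J_quotient \<nu> (norm x * r) * (r ^ (DIM('a) - 1) * w r))"
proof -
  define K where "K = (2 * pi) powr (real DIM('a) / 2)"
  have \<nu>: "\<nu> > -1" by (simp add: \<nu>_def)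
  define b where "b m = 2 powr (- \<nu>) * bessel_coeff \<nu> m * ((norm x)\<^sup>2 / 4) ^ m" for m
  have b0: "b m \<ge> 0" for m unfolding b_def using bessel_coeff_nonneg[OF \<nu>] by simp
  have bs: "summable (\<lambda>m. b m * (R\<^sup>2) ^ m)"
    using summable_mult[OF summable_bessel_coeff[of \<nu> "(norm x)\<^sup>2 / 4 * R\<^sup>2"], of "2 powr (- \<nu>)"]
    unfolding b_def power_mult_distrib by (simp add: mult_ac)
  have pd: "r ^ (2 * m + DIM('a) - 1) = (r\<^sup>2) ^ m * r ^ (DIM('a) - 1)" for r :: real and m
  proof -
    have "2 * m + DIM('a) - 1 = 2 * m + (DIM('a) - 1)" using DIM_positive[where 'a='a] by simp
    thus ?thesis by (simp only: power_add power_mult)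
  qed
  let ?J = "LINT r:{0<..}|lborel. r ^ (DIM('a) - 1) * \<bar>w r\<bar>"
  have I': "set_integrable lborel {0<..} (\<lambda>r. r ^ (DIM('a) - 1) * \<bar>w r\<bar>)"
    using set_integrable_abs[OF I]
    by (subst set_integrable_cong[OF refl refl, where f' = "\<lambda>r. \<bar>r ^ (DIM('a) - 1) * w r\<bar>"]) (auto simp: abs_mult)
  have rb: "r ^ (2 * m + DIM('a) - 1) * \<bar>w r\<bar> \<le> (R\<^sup>2) ^ m * (r ^ (DIM('a) - 1) * \<bar>w r\<bar>)" if "r > 0" for r m
  proof (cases "r > R")
    case False
    have "(r\<^sup>2) ^ m \<le> (R\<^sup>2) ^ m" using False that by (intro power_mono) auto
    thus ?thesis unfolding pd using that by (simp add: mult.assoc mult_right_mono)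
  qed (use R in auto)
  have Im: "set_integrable lborel {0<..} (\<lambda>r. r ^ (2 * m + DIM('a) - 1) * \<bar>w r\<bar>)" for m
  proof -
    have "set_integrable lborel {0<..} (\<lambda>r. (R\<^sup>2) ^ m * (r ^ (DIM('a) - 1) * \<bar>w r\<bar>))" using I' by (rule set_integrable_mult_right)
    thus ?thesis unfolding set_integrable_def
      by (rule Bochner_Integration.integrable_bound) (use rb[of _ m] in \<open>auto simp: indicator_def\<close>)
  qed
  have Im': "set_integrable lborel {0<..} (\<lambda>r. r ^ (2 * m + DIM('a) - 1) * w r)" for m
    using Im[of m] unfolding set_integrable_def
    by (rule Bochner_Integration.integrable_bound) (auto simp: indicator_def abs_mult)
  have Jm: "(LINT r:{0<..}|lborel. r ^ (2 * m + DIM('a) - 1) * \<bar>w r\<bar>) \<le> (R\<^sup>2) ^ m * ?J" for m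
  proof -
    have "(LINT r:{0<..}|lborel. r ^ (2 * m + DIM('a) - 1) * \<bar>w r\<bar>) \<le> (LINT r:{0<..}|lborel. (R\<^sup>2) ^ m * (r ^ (DIM('a) - 1) * \<bar>w r\<bar>))"
      using Im I' rb by (intro set_integral_mono set_integrable_mult_right) auto
    thus ?thesis by simp
  qed
  have Jm0: "(LINT r:{0<..}|lborel. r ^ (2 * m + DIM('a) - 1) * \<bar>w r\<bar>) \<ge> 0" for m
    unfolding set_lebesgue_integral_def by (intro integral_nonneg_AE) (auto simp: indicator_def)
  define a where "a m = (- 1) ^ m * K * b m * (LINT r:{0<..}|lborel. r ^ (2 * m + DIM('a) - 1) * w r)" for m
  have S: "summable (\<lambda>m. K * b m * (LINT r:{0<..}|lborel. r ^ (2 * m + DIM('a) - 1) * \<bar>w r\<bar>))"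
  proof (rule summable_comparison_test')
    show "summable (\<lambda>m. (K * ?J) * (b m * (R\<^sup>2) ^ m))" using bs by (rule summable_mult)
    fix m
    have "K * b m * (LINT r:{0<..}|lborel. r ^ (2 * m + DIM('a) - 1) * \<bar>w r\<bar>) \<le> K * b m * ((R\<^sup>2) ^ m * ?J)"
      using Jm b0 by (intro mult_left_mono) (auto simp: K_def)
    thus "norm (K * b m * (LINT r:{0<..}|lborel. r ^ (2 * m + DIM('a) - 1) * \<bar>w r\<bar>)) \<le> (K * ?J) * (b m * (R\<^sup>2) ^ m)"
      using Jm0[of m] b0[of m] by (simp add: abs_mult K_def mult_ac)
  qed
  have L: "a sums (LINT k|lborel. cos (k \<bullet> x) * w (norm k))"
  proof -
    let ?f = "\<lambda>m k. ((- 1) ^ m / fact (2 * m)) * ((k \<bullet> x) ^ (2 * m) * w (norm k))"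
    have int: "integrable lborel (\<lambda>k. (k \<bullet> x) ^ (2 * m) * w (norm k))" for m
      using inner_power_polar(1)[OF w] Im' by blast
    have nrm: "(LINT k|lborel. norm (?f m k)) = K * b m * (LINT r:{0<..}|lborel. r ^ (2 * m + DIM('a) - 1) * \<bar>w r\<bar>)" for m
    proof -
      have "(LINT k|lborel. norm (?f m k)) = (LINT k|lborel. 1 / fact (2 * m) * ((k \<bullet> x) ^ (2 * m) * \<bar>w (norm k)\<bar>))"
        by (intro Bochner_Integration.integral_cong) (auto simp: abs_mult power_abs[symmetric])
      also have "\<dots> = 1 / fact (2 * m) * (LINT k|lborel. (k \<bullet> x) ^ (2 * m) * \<bar>w (norm k)\<bar>)" by (rule integral_mult_right_zero)
      also have "\<dots> = K * b m * (LINT r:{0<..}|lborel. r ^ (2 * m + DIM('a) - 1) * \<bar>w r\<bar>)"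
        by (subst inner_power_polar(2)) (simp_all add: \<nu>_def b_def K_def)
      finally show ?thesis .
    qed
    have "(\<lambda>m. LINT k|lborel. ?f m k) sums (LINT k|lborel. (\<Sum>m. ?f m k))"
    proof (rule sums_integral)
      show "integrable lborel (?f m)" for m by (intro integrable_mult_right int)
      show "AE k in lborel. summable (\<lambda>m. norm (?f m k))"
      proof (intro AE_I2)
        fix k :: 'a
        have "summable (\<lambda>m. \<bar>(k \<bullet> x)\<bar> ^ (2 * m) /\<^sub>R fact (2 * m))"
        proof (rule summable_comparison_test')
          show "summable (\<lambda>m. ((k \<bullet> x)\<^sup>2) ^ m /\<^sub>R fact m)" by (rule summable_exp_generic)
          fix m
          have "inverse (fact (2 * m)) \<le> (inverse (fact m) :: real)"
            by (intro le_imp_inverse_le fact_mono) auto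
          thus "norm (\<bar>k \<bullet> x\<bar> ^ (2 * m) /\<^sub>R fact (2 * m)) \<le> ((k \<bullet> x)\<^sup>2) ^ m /\<^sub>R fact m"
            by (simp add: power_mult mult_right_mono)
        qed
        from summable_mult2[OF this, of "\<bar>w (norm k)\<bar>"]
        show "summable (\<lambda>m. norm (?f m k))" by (simp add: abs_mult power_abs divide_inverse mult_ac)
      qed
      show "summable (\<lambda>m. LINT k|lborel. norm (?f m k))" unfolding nrm by (rule S)
    qed
    moreover have "(\<lambda>m. LINT k|lborel. ?f m k) = a"
    proof
      fix m
      have "(LINT k|lborel. ?f m k) = ((- 1) ^ m / fact (2 * m)) * (LINT k|lborel. (k \<bullet> x) ^ (2 * m) * w (norm k))"
        by (rule integral_mult_right_zero)
      also have "\<dots> = a m" by (subst inner_power_polar(2)) (simp_all add: \<nu>_def b_def K_def a_def)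
      finally show "(LINT k|lborel. ?f m k) = a m" .
    qed
    moreover have "(\<Sum>m. ?f m k) = cos (k \<bullet> x) * w (norm k)" for k
      using sums_unique[OF sums_mult2[OF cos_sums_real[of "k \<bullet> x"], of "w (norm k)"]] by (simp add: mult.assoc)
    ultimately show ?thesis by simp
  qed
  have Rs: "a sums (K * (LINT r:{0<..}|lborel. bessel_J_quotient \<nu> (norm x * r) * (r ^ (DIM('a) - 1) * w r)))"
  proof -
    let ?f = "\<lambda>m r. indicator {0<..} r *\<^sub>R (((- 1) ^ m * b m) * (r ^ (2 * m + DIM('a) - 1) * w r))"
    have nrm: "(LINT r|lborel. norm (?f m r)) = b m * (LINT r:{0<..}|lborel. r ^ (2 * m + DIM('a) - 1) * \<bar>w r\<bar>)" for m
    proof -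
      have "(LINT r|lborel. norm (?f m r)) = (LINT r|lborel. b m * (indicator {0<..} r *\<^sub>R (r ^ (2 * m + DIM('a) - 1) * \<bar>w r\<bar>)))"
        using b0[of m] by (intro Bochner_Integration.integral_cong) (auto simp: abs_mult indicator_def)
      thus ?thesis unfolding set_lebesgue_integral_def by simp
    qed
    have "(\<lambda>m. LINT r|lborel. ?f m r) sums (LINT r|lborel. (\<Sum>m. ?f m r))"
    proof (rule sums_integral)
      show "integrable lborel (?f m)" for m
        using set_integrable_mult_right[OF Im'[of m], of "(- 1) ^ m * b m"] unfolding set_integrable_def .
      show "AE r in lborel. summable (\<lambda>m. norm (?f m r))"
      proof (intro AE_I2)
        fix r :: real
        show "summable (\<lambda>m. norm (?f m r))"
        proof (cases "r > 0")
          case True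
          have "summable (\<lambda>m. b m * (r\<^sup>2) ^ m)"
            using summable_mult[OF summable_bessel_coeff[of \<nu> "(norm x)\<^sup>2 / 4 * r\<^sup>2"], of "2 powr (- \<nu>)"]
            unfolding b_def power_mult_distrib by (simp add: mult_ac)
          from summable_mult2[OF this, of "r ^ (DIM('a) - 1) * \<bar>w r\<bar>"]
          show ?thesis unfolding pd using True b0 by (simp add: abs_mult mult_ac)
        qed simp
      qed
      show "summable (\<lambda>m. LINT r|lborel. norm (?f m r))" unfolding nrm
        using summable_mult[OF S, of "1 / K"] by (simp add: K_def)
    qed
    from sums_mult[OF this, of K]
    have "(\<lambda>m. K * (LINT r|lborel. ?f m r)) sums (K * (LINT r|lborel. (\<Sum>m. ?f m r)))" .
    moreover have "K * (LINT r|lborel. ?f m r) = a m" for m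
      unfolding a_def set_lebesgue_integral_def[symmetric] set_integral_mult_right by simp
    moreover have "(\<Sum>m. ?f m r) = indicator {0<..} r *\<^sub>R (bessel_J_quotient \<nu> (norm x * r) * (r ^ (DIM('a) - 1) * w r))" for r
    proof (cases "r > 0")
      case True
      have "(\<lambda>m. 2 powr (- \<nu>) * (bessel_coeff \<nu> m * (- ((norm x * r)\<^sup>2 / 4)) ^ m)) sums bessel_J_quotient \<nu> (norm x * r)"
        using True by (subst bessel_J_quotient_eq)
          (auto simp: bessel_clifford_def intro!: sums_mult summable_sums summable_bessel_coeff)
      from sums_mult2[OF this, of "r ^ (DIM('a) - 1) * w r"]
      have "(\<lambda>m. 2 powr (- \<nu>) * (bessel_coeff \<nu> m * (- ((norm x * r)\<^sup>2 / 4)) ^ m) * (r ^ (DIM('a) - 1) * w r)) sums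
        (bessel_J_quotient \<nu> (norm x * r) * (r ^ (DIM('a) - 1) * w r))" .
      also have "(\<lambda>m. 2 powr (- \<nu>) * (bessel_coeff \<nu> m * (- ((norm x * r)\<^sup>2 / 4)) ^ m) * (r ^ (DIM('a) - 1) * w r)) = (\<lambda>m. ?f m r)"
      proof
        fix m
        have "(- ((norm x * r)\<^sup>2 / 4)) ^ m = (- 1) ^ m * (((norm x)\<^sup>2 / 4) ^ m * (r\<^sup>2) ^ m)"
          by (subst power_minus) (simp add: power_mult_distrib power_divide)
        thus "2 powr (- \<nu>) * (bessel_coeff \<nu> m * (- ((norm x * r)\<^sup>2 / 4)) ^ m) * (r ^ (DIM('a) - 1) * w r) = ?f m r"
          using True unfolding pd b_def by simp
      qed
      finally show ?thesis using True by (simp add: sums_iff)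
    qed simp
    ultimately show ?thesis unfolding set_lebesgue_integral_def by simp
  qed
  from sums_unique2[OF L Rs] show ?thesis unfolding K_def .
qed

lemma polar_integral:
  fixes w :: "real \<Rightarrow> real"
  assumes w [measurable]: "w \<in> borel_measurable borel"
  shows "set_integrable lborel {0<..} (\<lambda>r. r ^ (DIM('a) - 1) * w r) \<Longrightarrow> integrable lborel (\<lambda>k::'a::euclidean_space. w (norm k))"
    and "(LINT k|lborel. w (norm (k::'a))) = sphere_factor DIM('a) * (LINT r:{0<..}|lborel. r ^ (DIM('a) - 1) * w r)"
proof -
  let ?\<nu> = "real DIM('a) / 2 - 1"
  have "(2 * pi) powr (DIM('a) / 2) * 2 powr (- ?\<nu>) * bessel_coeff ?\<nu> 0 = sphere_factor DIM('a)"
  proof -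
    have "(2 * pi) powr (DIM('a) / 2) * 2 powr (- ?\<nu>) = 2 * pi powr (DIM('a) / 2)"
    proof -
      have 1: "(2 * pi) powr (DIM('a) / 2) = 2 powr (DIM('a) / 2) * pi powr (DIM('a) / 2)" by (rule powr_mult)
      have 2: "2 powr (DIM('a) / 2) * 2 powr (- ?\<nu>) = (2::real)" unfolding powr_add[symmetric] by simp
      have "(2 * pi) powr (DIM('a) / 2) * 2 powr (- ?\<nu>) = (2 powr (DIM('a) / 2) * 2 powr (- ?\<nu>)) * pi powr (DIM('a) / 2)"
        unfolding 1 by (simp only: mult.assoc mult.commute mult.left_commute)
      thus ?thesis unfolding 2 .
    qed
    moreover have "bessel_coeff ?\<nu> 0 = 1 / Gamma (real DIM('a) / 2)"
      by (simp add: bessel_coeff_def rGamma_inverse_Gamma inverse_eq_divide)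
    ultimately show ?thesis by (simp only: sphere_factor_def times_divide_eq_right mult_1_right)
  qed
  thus "set_integrable lborel {0<..} (\<lambda>r. r ^ (DIM('a) - 1) * w r) \<Longrightarrow> integrable lborel (\<lambda>k::'a::euclidean_space. w (norm k))"
    "(LINT k|lborel. w (norm (k::'a))) = sphere_factor DIM('a) * (LINT r:{0<..}|lborel. r ^ (DIM('a) - 1) * w r)"
    using inner_power_polar[OF w, where m = 0 and x = "0::'a"] by simp_all
qed

lemma bessel_J_quotient_continuous:
  assumes "s \<ge> 0"
  obtains b where "continuous_on UNIV b" "\<And>r. r > 0 \<Longrightarrow> bessel_J_quotient \<nu> (s * r) = b r"
proof
  let ?b = "\<lambda>r. 2 powr (- \<nu>) * bessel_clifford \<nu> (- ((s * r)\<^sup>2 / 4))"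
  have "continuous_on UNIV (bessel_clifford \<nu>)" using isCont_bessel_clifford by (simp add: continuous_at_imp_continuous_on)
  thus "continuous_on UNIV ?b"
  proof (intro continuous_on_mult continuous_on_const, rule continuous_on_compose2)
    show "continuous_on UNIV (\<lambda>r. - ((s * r)\<^sup>2 / 4))" by (intro continuous_intros) auto
  qed auto
  show "bessel_J_quotient \<nu> (s * r) = ?b r" if "r > 0" for r using that assms by (intro bessel_J_quotient_eq) simp
qed

text \<open>The Bessel factor is bounded without asymptotics. The truncated formula is applied to \<open>w\<close> with its sign
changed to that of the Bessel factor: then the Bessel integral is one of an absolute value, and it is bounded
by the Fourier side, where the cosine is at most \<open>1\<close>. The bound is uniform in the truncation.\<close>

lemma bessel_J_quotient_integrable:
  fixes x :: "'a::euclidean_space" and w :: "real \<Rightarrow> real"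
  assumes w [measurable]: "w \<in> borel_measurable borel"
    and I: "set_integrable lborel {0<..} (\<lambda>r. r ^ (DIM('a) - 1) * w r)"
  defines "\<nu> \<equiv> real DIM('a) / 2 - 1"
  shows "set_integrable lborel {0<..} (\<lambda>r. bessel_J_quotient \<nu> (norm x * r) * (r ^ (DIM('a) - 1) * w r))"
proof -
  obtain b where bc: "continuous_on UNIV b" and b: "\<And>r. r > 0 \<Longrightarrow> bessel_J_quotient \<nu> (norm x * r) = b r"
    using bessel_J_quotient_continuous[of "norm x" \<nu>] by auto
  have [measurable]: "b \<in> borel_measurable borel" using bc by (rule borel_measurable_continuous_onI)
  define K where "K = (2 * pi) powr (real DIM('a) / 2)"
  have K: "K > 0" by (simp add: K_def)
  let ?F = "\<lambda>r. indicator {0<..} r *\<^sub>R \<bar>b r * (r ^ (DIM('a) - 1) * w r)\<bar>"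
  let ?Fn = "\<lambda>(n::nat) r. ?F r * indicator {..real n} r"
  have Fn_int: "integrable lborel (?Fn n)" for n
  proof -
    have "compact (b ` {0..real n})" by (intro compact_continuous_image continuous_on_subset[OF bc]) auto
    then obtain B where B: "\<And>r. r \<in> {0..real n} \<Longrightarrow> \<bar>b r\<bar> \<le> B" using compact_imp_bounded bounded_iff by (metis imageI real_norm_def)
    show ?thesis
    proof (rule Bochner_Integration.integrable_bound[OF integrable_mult_right[OF I[unfolded set_integrable_def], of B]])
      have "\<bar>b r\<bar> * (r ^ (DIM('a) - 1) * \<bar>w r\<bar>) \<le> \<bar>B\<bar> * (r ^ (DIM('a) - 1) * \<bar>w r\<bar>)" if "0 < r" "r \<le> real n" for r
        using B[of r] that by (intro mult_right_mono) auto
      thus "AE r in lborel. norm (?Fn n r) \<le> norm (B * (indicat_real {0<..} r *\<^sub>R (r ^ (DIM('a) - 1) * w r)))"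
        by (intro AE_I2) (auto simp: indicator_def abs_mult)
    qed measurable
  qed
  let ?L = "LINT k|lborel. \<bar>w (norm (k::'a))\<bar>"
  have wi: "integrable lborel (\<lambda>k::'a. w (norm k))" by (rule polar_integral(1)[OF w I])
  have bound: "integral\<^sup>L lborel (?Fn n) \<le> ?L / K" for n
  proof -
    \<comment> \<open>Multiplying by the sign of the Bessel factor turns its product with the profile into an absolute value.\<close>
    let ?v = "\<lambda>r. sgn (b r) * \<bar>w r\<bar> * indicator {..real n} r"
    have v [measurable]: "?v \<in> borel_measurable borel" by measurable
    have vw: "\<bar>?v r\<bar> \<le> \<bar>w r\<bar>" for r by (auto simp: indicator_def abs_mult sgn_if)
    have vI: "set_integrable lborel {0<..} (\<lambda>r. r ^ (DIM('a) - 1) * ?v r)"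
      unfolding set_integrable_def
    proof (rule Bochner_Integration.integrable_bound[OF I[unfolded set_integrable_def]])
      show "AE r in lborel. norm (indicat_real {0<..} r *\<^sub>R (r ^ (DIM('a) - 1) * ?v r)) \<le> norm (indicat_real {0<..} r *\<^sub>R (r ^ (DIM('a) - 1) * w r))"
        using vw by (intro AE_I2) (auto simp: indicator_def abs_mult mult_left_mono)
    qed measurable
    have "(LINT k|lborel. cos (k \<bullet> x) * ?v (norm k)) = K * (LINT r:{0<..}|lborel. bessel_J_quotient \<nu> (norm x * r) * (r ^ (DIM('a) - 1) * ?v r))"
      unfolding K_def \<nu>_def by (rule radial_fourier_truncated[OF v vI, of "real n"]) auto
    also have "(LINT r:{0<..}|lborel. bessel_J_quotient \<nu> (norm x * r) * (r ^ (DIM('a) - 1) * ?v r)) = integral\<^sup>L lborel (?Fn n)"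
      unfolding set_lebesgue_integral_def
      by (intro Bochner_Integration.integral_cong) (auto simp: indicator_def b abs_mult sgn_if)
    finally have "K * integral\<^sup>L lborel (?Fn n) = (LINT k|lborel. cos (k \<bullet> x) * ?v (norm k))" ..
    also have "\<dots> \<le> ?L"
    proof (rule integral_mono')
      show "integrable lborel (\<lambda>k::'a. \<bar>w (norm k)\<bar>)" using wi by (rule integrable_abs)
      fix k :: 'a
      have "\<bar>cos (k \<bullet> x)\<bar> * \<bar>?v (norm k)\<bar> \<le> 1 * \<bar>w (norm k)\<bar>" by (intro mult_mono vw) auto
      hence "\<bar>cos (k \<bullet> x) * ?v (norm k)\<bar> \<le> \<bar>w (norm k)\<bar>" by (simp only: abs_mult mult_1_left)
      thus "cos (k \<bullet> x) * ?v (norm k) \<le> \<bar>w (norm k)\<bar>" by (rule order_trans[OF abs_ge_self])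
    qed auto
    finally show ?thesis using K by (simp add: field_simps)
  qed
  have inc: "incseq (\<lambda>n. integral\<^sup>L lborel (?Fn n))"
    unfolding incseq_def by (intro allI impI integral_mono Fn_int) (auto simp: indicator_def)
  obtain l where "(\<lambda>n. integral\<^sup>L lborel (?Fn n)) \<longlonglongrightarrow> l" by (rule incseq_convergent[OF inc, of "?L / K"]) (use bound in blast)+
  note lim = this
  have "integrable lborel ?F"
  proof (rule integrable_monotone_convergence[where f = ?Fn and x = l])
    show "(\<lambda>n. integral\<^sup>L lborel (?Fn n)) \<longlonglongrightarrow> l" by (rule lim)
    show "integrable lborel (?Fn n)" for n by (rule Fn_int)
    show "AE r in lborel. mono (\<lambda>n. ?Fn n r)" by (intro AE_I2) (auto simp: mono_def indicator_def)
    show "AE r in lborel. (\<lambda>n. ?Fn n r) \<longlonglongrightarrow> ?F r"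
    proof (intro AE_I2)
      fix r :: real
      have "eventually (\<lambda>n. ?Fn n r = ?F r) sequentially"
        using eventually_ge_at_top[of "nat \<lceil>r\<rceil>"]
      proof eventually_elim
        fix n assume "nat \<lceil>r\<rceil> \<le> n"
        hence "r \<le> real n" by linarith
        thus "?Fn n r = ?F r" by simp
      qed
      thus "(\<lambda>n. ?Fn n r) \<longlonglongrightarrow> ?F r" by (rule tendsto_eventually)
    qed
  qed measurable
  thus ?thesis unfolding set_integrable_def
  proof (rule Bochner_Integration.integrable_bound)
    have e: "(\<lambda>r. indicat_real {0<..} r *\<^sub>R (bessel_J_quotient \<nu> (norm x * r) * (r ^ (DIM('a) - 1) * w r)))
       = (\<lambda>r. indicat_real {0<..} r *\<^sub>R (b r * (r ^ (DIM('a) - 1) * w r)))"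
      by (auto simp: indicator_def b)
    show "(\<lambda>r. indicat_real {0<..} r *\<^sub>R (bessel_J_quotient \<nu> (norm x * r) * (r ^ (DIM('a) - 1) * w r))) \<in> borel_measurable lborel"
      unfolding e by measurable
  qed (auto simp: indicator_def b)
qed

lemma radial_fourier_cos:
  fixes x :: "'a::euclidean_space" and w :: "real \<Rightarrow> real"
  assumes w [measurable]: "w \<in> borel_measurable borel"
    and I: "set_integrable lborel {0<..} (\<lambda>r. r ^ (DIM('a) - 1) * w r)"
  defines "\<nu> \<equiv> real DIM('a) / 2 - 1"
  shows "(LINT k|lborel. cos (k \<bullet> x) * w (norm k)) =
     (2 * pi) powr (DIM('a) / 2) * (LINT r:{0<..}|lborel. bessel_J_quotient \<nu> (norm x * r) * (r ^ (DIM('a) - 1) * w r))"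
proof -
  let ?w = "\<lambda>(n::nat) r. w r * indicator {..real n} r"
  have ev: "(\<lambda>n. ?w n r) \<longlonglongrightarrow> w r" for r
  proof (rule tendsto_eventually)
    show "eventually (\<lambda>n. ?w n r = w r) sequentially"
      using eventually_ge_at_top[of "nat \<lceil>r\<rceil>"]
    proof eventually_elim
      fix n assume "nat \<lceil>r\<rceil> \<le> n"
      hence "r \<le> real n" by linarith
      thus "?w n r = w r" by simp
    qed
  qed
  have J: "set_integrable lborel {0<..} (\<lambda>r. bessel_J_quotient \<nu> (norm x * r) * (r ^ (DIM('a) - 1) * w r))"
    unfolding \<nu>_def by (rule bessel_J_quotient_integrable[OF w I])
  have wi: "integrable lborel (\<lambda>k::'a. w (norm k))" by (rule polar_integral(1)[OF w I])
  have L: "(\<lambda>n. LINT k|lborel. cos (k \<bullet> x) * ?w n (norm k)) \<longlonglongrightarrow> (LINT k|lborel. cos (k \<bullet> x) * w (norm k))"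
  proof (rule integral_dominated_convergence[where w = "\<lambda>k. \<bar>w (norm k)\<bar>"])
    show "integrable lborel (\<lambda>k::'a. \<bar>w (norm k)\<bar>)" using wi by (rule integrable_abs)
    show "AE k in lborel. (\<lambda>n. cos (k \<bullet> x) * ?w n (norm k)) \<longlonglongrightarrow> cos (k \<bullet> x) * w (norm k)"
      by (intro AE_I2 tendsto_mult tendsto_const ev)
    fix n
    have "\<bar>cos (k \<bullet> x)\<bar> * \<bar>?w n (norm k)\<bar> \<le> 1 * \<bar>w (norm k)\<bar>" for k :: 'a by (intro mult_mono) (auto simp: indicator_def)
    thus "AE k in lborel. norm (cos (k \<bullet> x) * ?w n (norm k)) \<le> \<bar>w (norm k)\<bar>" by (simp add: abs_mult)
  qed measurable
  have R: "(\<lambda>n. LINT r:{0<..}|lborel. bessel_J_quotient \<nu> (norm x * r) * (r ^ (DIM('a) - 1) * ?w n r))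
    \<longlonglongrightarrow> (LINT r:{0<..}|lborel. bessel_J_quotient \<nu> (norm x * r) * (r ^ (DIM('a) - 1) * w r))"
    unfolding set_lebesgue_integral_def
  proof (rule integral_dominated_convergence[where w = "\<lambda>r. \<bar>indicator {0<..} r *\<^sub>R (bessel_J_quotient \<nu> (norm x * r) * (r ^ (DIM('a) - 1) * w r))\<bar>"])
    let ?g = "\<lambda>r. indicator {0<..} r *\<^sub>R (bessel_J_quotient \<nu> (norm x * r) * (r ^ (DIM('a) - 1) * w r))"
    show "integrable lborel (\<lambda>r. \<bar>?g r\<bar>)" using J unfolding set_integrable_def by (rule integrable_abs)
    show m: "?g \<in> borel_measurable lborel" using J unfolding set_integrable_def by (rule borel_measurable_integrable)
    have e: "indicator {0<..} r *\<^sub>R (bessel_J_quotient \<nu> (norm x * r) * (r ^ (DIM('a) - 1) * ?w n r)) = ?g r * indicator {..real n} r" for n r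
      by simp
    show "(\<lambda>r. indicator {0<..} r *\<^sub>R (bessel_J_quotient \<nu> (norm x * r) * (r ^ (DIM('a) - 1) * ?w n r))) \<in> borel_measurable lborel" for n
      unfolding e using m by measurable
    show "AE r in lborel. (\<lambda>n. indicator {0<..} r *\<^sub>R (bessel_J_quotient \<nu> (norm x * r) * (r ^ (DIM('a) - 1) * ?w n r))) \<longlonglongrightarrow> ?g r"
      by (intro AE_I2 tendsto_intros ev)
    show "AE r in lborel. norm (indicator {0<..} r *\<^sub>R (bessel_J_quotient \<nu> (norm x * r) * (r ^ (DIM('a) - 1) * ?w n r))) \<le> \<bar>?g r\<bar>" for n
      unfolding e by (intro AE_I2) (auto simp: indicator_def)
  qed
  have eq: "(LINT k|lborel. cos (k \<bullet> x) * ?w n (norm k)) =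
     (2 * pi) powr (DIM('a) / 2) * (LINT r:{0<..}|lborel. bessel_J_quotient \<nu> (norm x * r) * (r ^ (DIM('a) - 1) * ?w n r))" for n
    unfolding \<nu>_def
  proof (rule radial_fourier_truncated[where R = "real n"])
    show "set_integrable lborel {0<..} (\<lambda>r. r ^ (DIM('a) - 1) * ?w n r)"
      unfolding set_integrable_def
      by (rule Bochner_Integration.integrable_bound[OF I[unfolded set_integrable_def]]) (measurable, auto simp: indicator_def)
  qed auto
  from L have 1: "(\<lambda>n. (2 * pi) powr (DIM('a) / 2) * (LINT r:{0<..}|lborel. bessel_J_quotient \<nu> (norm x * r) * (r ^ (DIM('a) - 1) * ?w n r)))
     \<longlonglongrightarrow> (LINT k|lborel. cos (k \<bullet> x) * w (norm k))" unfolding eq .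
  have 2: "(\<lambda>n. (2 * pi) powr (DIM('a) / 2) * (LINT r:{0<..}|lborel. bessel_J_quotient \<nu> (norm x * r) * (r ^ (DIM('a) - 1) * ?w n r)))
     \<longlonglongrightarrow> (2 * pi) powr (DIM('a) / 2) * (LINT r:{0<..}|lborel. bessel_J_quotient \<nu> (norm x * r) * (r ^ (DIM('a) - 1) * w r))"
    by (rule tendsto_mult[OF tendsto_const R])
  show ?thesis by (rule LIMSEQ_unique[OF 1 2])
qed

text \<open>The sine part of the exponential integrates to zero because \<open>w (norm k)\<close> is even.\<close>

theorem radial_fourier:
  fixes x :: "'a::euclidean_space" and w :: "real \<Rightarrow> real"
  assumes w [measurable]: "w \<in> borel_measurable borel"
    and I: "set_integrable lborel {0<..} (\<lambda>r. r ^ (DIM('a) - 1) * w r)"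
  defines "\<nu> \<equiv> real DIM('a) / 2 - 1"
  shows "(LINT k|lborel. exp (- \<i> * complex_of_real (x \<bullet> k)) * complex_of_real (w (norm k))) =
     complex_of_real ((2 * pi) powr (DIM('a) / 2) * (LINT r:{0<..}|lborel. bessel_J_quotient \<nu> (norm x * r) * (r ^ (DIM('a) - 1) * w r)))"
proof -
  have wi: "integrable lborel (\<lambda>k::'a. w (norm k))" by (rule polar_integral(1)[OF w I])
  have ci: "integrable lborel (\<lambda>k. cos (k \<bullet> x) * w (norm k))"
    by (rule Bochner_Integration.integrable_bound[OF wi]) (measurable, auto simp: abs_mult intro!: mult_left_le_one_le)
  have si: "integrable lborel (\<lambda>k. sin (k \<bullet> x) * w (norm k))"
    by (rule Bochner_Integration.integrable_bound[OF wi]) (measurable, auto simp: abs_mult intro!: mult_left_le_one_le)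
  have s0: "(LINT k|lborel. sin (k \<bullet> x) * w (norm k)) = 0"
    using lborel_integral_reflect[of "\<lambda>k. sin (k \<bullet> x) * w (norm k)"] by simp
  have e: "exp (- \<i> * complex_of_real (x \<bullet> k)) * complex_of_real (w (norm k))
    = complex_of_real (cos (k \<bullet> x) * w (norm k)) - complex_of_real (sin (k \<bullet> x) * w (norm k)) * \<i>" for k
  proof -
    have "exp (- \<i> * complex_of_real (x \<bullet> k)) = cis (- (k \<bullet> x))" by (simp add: cis_conv_exp inner_commute)
    thus ?thesis by (simp only:) (simp add: complex_eq_iff)
  qed
  have "(LINT k|lborel. exp (- \<i> * complex_of_real (x \<bullet> k)) * complex_of_real (w (norm k)))
     = (LINT k|lborel. complex_of_real (cos (k \<bullet> x) * w (norm k))) - (LINT k|lborel. complex_of_real (sin (k \<bullet> x) * w (norm k)) * \<i>)"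
    unfolding e using integrable_of_real[OF ci] integrable_mult_left[OF integrable_of_real[OF si]]
    by (rule Bochner_Integration.integral_diff)
  also have "(LINT k|lborel. complex_of_real (sin (k \<bullet> x) * w (norm k)) * \<i>) = 0"
    by (subst integral_mult_left_zero, subst integral_complex_of_real) (simp only: s0 of_real_0 mult_zero_left)
  finally have "(LINT k|lborel. exp (- \<i> * complex_of_real (x \<bullet> k)) * complex_of_real (w (norm k)))
     = complex_of_real (LINT k|lborel. cos (k \<bullet> x) * w (norm k))"
    by (simp only: integral_complex_of_real diff_zero)
  thus ?thesis unfolding \<nu>_def by (simp only: radial_fourier_cos[OF w I])
qed

section \<open>Fourier inversion\<close>

lemma norm_fourier_kernel [simp]: "norm (exp (- \<i> * complex_of_real t)) = 1"
  by (simp add: norm_exp_eq_Re)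

lemma continuous_fourier_kernel: "continuous_on UNIV (\<lambda>x::real ^ 'd. exp (- \<i> * complex_of_real (k \<bullet> x)))"
  by (intro continuous_intros)

lemma fourier_integrable:
  assumes "integrable lborel f"
  shows "integrable lborel (\<lambda>x::real ^ 'd::finite. exp (- \<i> * complex_of_real (k \<bullet> x)) * f x)"
proof (rule Bochner_Integration.integrable_bound[OF assms])
  have "(\<lambda>x::real ^ 'd. exp (- \<i> * complex_of_real (k \<bullet> x))) \<in> borel_measurable lborel"
    using borel_measurable_continuous_onI[OF continuous_fourier_kernel] by simp
  thus "(\<lambda>x. exp (- \<i> * complex_of_real (k \<bullet> x)) * f x) \<in> borel_measurable lborel"
    using borel_measurable_integrable[OF assms] by (rule borel_measurable_times)
  show "AE x in lborel. norm (exp (- \<i> * complex_of_real (k \<bullet> x)) * f x) \<le> norm (f x)"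
    by (simp only: norm_mult norm_fourier_kernel) simp
qed

lemma norm_fourier_le:
  fixes f :: "'d::finite cfun"
  assumes "integrable lborel f"
  shows "norm (fourier f k) \<le> (2 * pi) powr (- real CARD('d) / 2) * (LINT x|lborel. norm (f x))"
proof -
  have "norm (LINT x|lborel. exp (- \<i> * complex_of_real (k \<bullet> x)) * f x) \<le> (LINT x|lborel. norm (exp (- \<i> * complex_of_real (k \<bullet> x)) * f x))"
    by (rule integral_norm_bound)
  also have "\<dots> = (LINT x|lborel. norm (f x))" by (simp only: norm_mult norm_fourier_kernel mult_1_left)
  finally have "(2 * pi) powr (- real CARD('d) / 2) * norm (LINT x|lborel. exp (- \<i> * complex_of_real (k \<bullet> x)) * f x) \<le> (2 * pi) powr (- real CARD('d) / 2) * (LINT x|lborel. norm (f x))"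
    by (intro mult_left_mono) auto
  thus ?thesis unfolding fourier_def norm_mult by simp
qed

lemma continuous_fourier:
  fixes f :: "'d::finite cfun"
  assumes "integrable lborel f" shows "continuous_on UNIV (fourier f)"
proof -
  have "((\<lambda>k. LINT x|lborel. exp (- \<i> * complex_of_real (k \<bullet> x)) * f x) \<longlongrightarrow> (LINT x|lborel. exp (- \<i> * complex_of_real (k0 \<bullet> x)) * f x)) (at k0 within UNIV)" for k0
  proof (rule integral_dominated_convergence_within[where w = "\<lambda>x. norm (f x)"])
    show "(\<lambda>x. exp (- \<i> * complex_of_real (k \<bullet> x)) * f x) \<in> borel_measurable lborel" for k
      using fourier_integrable[OF assms] by (rule borel_measurable_integrable)
    thus "(\<lambda>x. exp (- \<i> * complex_of_real (k \<bullet> x)) * f x) \<in> borel_measurable lborel" for k .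
    show "integrable lborel (\<lambda>x. norm (f x))" using assms by (rule integrable_norm)
    show "AE x in lborel. ((\<lambda>k. exp (- \<i> * complex_of_real (k \<bullet> x)) * f x) \<longlongrightarrow> exp (- \<i> * complex_of_real (k0 \<bullet> x)) * f x) (at k0 within UNIV)"
      by (intro AE_I2 tendsto_intros)
    show "AE x in lborel. norm (exp (- \<i> * complex_of_real (k \<bullet> x)) * f x) \<le> norm (f x)" for k
      by (simp only: norm_mult norm_fourier_kernel) simp
  qed
  thus ?thesis unfolding fourier_def[abs_def]
    by (intro continuous_on_mult continuous_on_const) (simp add: continuous_on_def)
qed

lemma fourier_multiplication_formula:
  fixes u \<phi> :: "'d::finite cfun"
  assumes u: "integrable lborel u" and p: "integrable lborel \<phi>"
  shows "(LINT x|lborel. fourier u x * \<phi> x) = (LINT k|lborel. u k * fourier \<phi> k)"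
proof -
  let ?F = "\<lambda>x k. exp (- \<i> * complex_of_real (x \<bullet> k)) * (u k * \<phi> x)"
  let ?c = "complex_of_real ((2 * pi) powr (- real CARD('d) / 2))"
  have [measurable]: "u \<in> borel_measurable borel" "\<phi> \<in> borel_measurable borel"
    using borel_measurable_integrable[OF u] borel_measurable_integrable[OF p] by simp_all
  have "continuous_on UNIV (\<lambda>z::(real^'d) \<times> (real^'d). exp (- \<i> * complex_of_real (fst z \<bullet> snd z)))"
    by (intro continuous_intros)
  from borel_measurable_continuous_onI[OF this]
  have [measurable]: "(\<lambda>z::(real^'d) \<times> (real^'d). exp (- \<i> * complex_of_real (fst z \<bullet> snd z))) \<in> borel_measurable (borel \<Otimes>\<^sub>M borel)"
    by (simp add: borel_prod)
  have I: "integrable (lborel \<Otimes>\<^sub>M lborel) (case_prod ?F)"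
  proof (rule lborel_pair.Fubini_integrable)
    have "(\<lambda>z. exp (- \<i> * complex_of_real (fst z \<bullet> snd z)) * (u (snd z) * \<phi> (fst z))) \<in> borel_measurable (lborel \<Otimes>\<^sub>M lborel)"
      by measurable
    thus "case_prod ?F \<in> borel_measurable (lborel \<Otimes>\<^sub>M lborel)" by (simp add: case_prod_beta')
    have "(LINT k|lborel. norm (case_prod ?F (x, k))) = (LINT k|lborel. norm (u k)) * norm (\<phi> x)" for x
      by (simp only: prod.case norm_mult norm_fourier_kernel mult_1_left integral_mult_left_zero)
    thus "integrable lborel (\<lambda>x. LINT k|lborel. norm (case_prod ?F (x, k)))"
      using integrable_norm[OF p] by simp
    have "integrable lborel (\<lambda>k. exp (- \<i> * complex_of_real (x \<bullet> k)) * (u k * \<phi> x))" for x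
      by (intro fourier_integrable integrable_mult_left u)
    thus "AE x in lborel. integrable lborel (\<lambda>k. case_prod ?F (x, k))" by simp
  qed
  have "(LINT x|lborel. fourier u x * \<phi> x) = (LINT x|lborel. ?c * (LINT k|lborel. ?F x k))"
  proof (intro Bochner_Integration.integral_cong refl)
    fix x
    have "(LINT k|lborel. ?F x k) = (LINT k|lborel. (exp (- \<i> * complex_of_real (x \<bullet> k)) * u k) * \<phi> x)" by (simp only: mult.assoc)
    also have "\<dots> = (LINT k|lborel. exp (- \<i> * complex_of_real (x \<bullet> k)) * u k) * \<phi> x" by (rule integral_mult_left_zero)
    finally show "fourier u x * \<phi> x = ?c * (LINT k|lborel. ?F x k)" unfolding fourier_def by (simp only: mult.assoc)
  qed
  also have "\<dots> = ?c * (LINT x|lborel. (LINT k|lborel. ?F x k))" by (rule integral_mult_right_zero)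
  also have "(LINT x|lborel. (LINT k|lborel. ?F x k)) = (LINT k|lborel. (LINT x|lborel. ?F x k))"
    using lborel_pair.Fubini_integral[OF I] by simp
  also have "?c * \<dots> = (LINT k|lborel. ?c * (LINT x|lborel. ?F x k))" by (rule integral_mult_right_zero[symmetric])
  also have "\<dots> = (LINT k|lborel. u k * fourier \<phi> k)"
  proof (intro Bochner_Integration.integral_cong refl)
    fix k
    have "(LINT x|lborel. ?F x k) = (LINT x|lborel. u k * (exp (- \<i> * complex_of_real (k \<bullet> x)) * \<phi> x))" by (simp only: mult.left_commute inner_commute)
    also have "\<dots> = u k * (LINT x|lborel. exp (- \<i> * complex_of_real (k \<bullet> x)) * \<phi> x)" by (rule integral_mult_right_zero)
    finally show "?c * (LINT x|lborel. ?F x k) = u k * fourier \<phi> k" unfolding fourier_def by (simp only: mult.left_commute)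
  qed
  finally show ?thesis .
qed

definition gauss_damp :: "real \<Rightarrow> real ^ 'd::finite \<Rightarrow> real" where
  "gauss_damp s k = exp (- (norm (s *\<^sub>R k))\<^sup>2 / 2)"

definition gauss_kernel :: "real \<Rightarrow> real ^ 'd::finite \<Rightarrow> real" where
  "gauss_kernel s z = (1 / s) ^ CARD('d) * exp (- (norm ((1 / s) *\<^sub>R z))\<^sup>2 / 2)"

lemma gauss_damp_measurable [measurable]: "gauss_damp s \<in> borel_measurable borel"
  unfolding gauss_damp_def[abs_def] by measurable

lemma gauss_kernel_measurable [measurable]: "gauss_kernel s \<in> borel_measurable borel"
  unfolding gauss_kernel_def[abs_def] by measurable

lemma gauss_damp_integrable:
  assumes "s > 0" shows "integrable lborel (gauss_damp s :: real ^ 'd::finite \<Rightarrow> real)"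
  using lborel_integral_affine(2)[of "\<lambda>k::real^'d. exp (- (norm k)\<^sup>2 / 2)" s 0] gaussian_integral(1)[where 'a = "real^'d"] assms
  by (simp add: gauss_damp_def[abs_def])

lemma gauss_damp_bounds: "0 \<le> gauss_damp s k" "gauss_damp s k \<le> 1"
  by (simp_all add: gauss_damp_def)

lemma two_pi_powr_cancel: "(2 * pi) powr (- real d / 2) * (2 * pi) powr (real d / 2) = 1"
  by (simp add: powr_add[symmetric])

text \<open>A modulated and dilated Gaussian is the test function in the multiplication formula that localises at a
point: its transform is again a Gaussian, concentrated near \<open>- x\<close>.\<close>

lemma fourier_modulated_gaussian:
  fixes x y :: "real ^ 'd::finite"
  assumes s: "s > 0"
  shows "integrable lborel (\<lambda>k. exp (- \<i> * complex_of_real (x \<bullet> k)) * complex_of_real (gauss_damp s k))"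
    and "fourier (\<lambda>k. exp (- \<i> * complex_of_real (x \<bullet> k)) * complex_of_real (gauss_damp s k)) y = complex_of_real (gauss_kernel s (x + y))"
proof -
  let ?c = "(2 * pi) powr (- real CARD('d) / 2)" and ?K = "(2 * pi) powr (real CARD('d) / 2)"
  show "integrable lborel (\<lambda>k. exp (- \<i> * complex_of_real (x \<bullet> k)) * complex_of_real (gauss_damp s k))"
    by (intro fourier_integrable integrable_of_real gauss_damp_integrable s)
  define f where "f k = exp (\<i> * complex_of_real (k \<bullet> (- (1 / s) *\<^sub>R (x + y)))) * complex_of_real (exp (- (norm k)\<^sup>2 / 2))" for k :: "real ^ 'd"
  have f: "(LINT k|lborel. f k) = complex_of_real (?K * exp (- (norm ((1 / s) *\<^sub>R (x + y)))\<^sup>2 / 2))"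
    using gaussian_fourier(2)[of "- (1 / s) *\<^sub>R (x + y)"] unfolding f_def by simp
  have fm: "f \<in> borel_measurable borel"
    unfolding f_def[abs_def] by (intro borel_measurable_continuous_onI continuous_intros) auto
  have e: "exp (- \<i> * complex_of_real (y \<bullet> k)) * (exp (- \<i> * complex_of_real (x \<bullet> k)) * complex_of_real (gauss_damp s k)) = f (0 + s *\<^sub>R k)" for k
  proof -
    have "\<i> * complex_of_real ((0 + s *\<^sub>R k) \<bullet> (- (1 / s) *\<^sub>R (x + y))) = - \<i> * complex_of_real (y \<bullet> k) + - \<i> * complex_of_real (x \<bullet> k)"
      using s by (simp add: inner_commute inner_right_distrib algebra_simps)
    hence "f (0 + s *\<^sub>R k) = exp (- \<i> * complex_of_real (y \<bullet> k) + - \<i> * complex_of_real (x \<bullet> k)) * complex_of_real (gauss_damp s k)"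
      unfolding f_def gauss_damp_def by simp
    thus ?thesis by (simp only: exp_add mult.assoc)
  qed
  have "(LINT k|lborel. f k) = complex_of_real (s ^ CARD('d)) * (LINT k|lborel. f (0 + s *\<^sub>R k))"
    using lborel_integral_affine(1)[OF fm, of s 0] s by (simp add: scaleR_conv_of_real)
  hence "(LINT k|lborel. f (0 + s *\<^sub>R k)) = complex_of_real ((1 / s) ^ CARD('d) * (?K * exp (- (norm ((1 / s) *\<^sub>R (x + y)))\<^sup>2 / 2)))"
    unfolding f using s by (simp add: field_simps)
  hence "fourier (\<lambda>k. exp (- \<i> * complex_of_real (x \<bullet> k)) * complex_of_real (gauss_damp s k)) y
     = complex_of_real (?c * ((1 / s) ^ CARD('d) * (?K * exp (- (norm ((1 / s) *\<^sub>R (x + y)))\<^sup>2 / 2))))"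
    unfolding fourier_def e by (simp only: of_real_mult)
  also have "?c * ((1 / s) ^ CARD('d) * (?K * exp (- (norm ((1 / s) *\<^sub>R (x + y)))\<^sup>2 / 2))) = (?c * ?K) * gauss_kernel s (x + y)"
    unfolding gauss_kernel_def by (simp only: mult.assoc mult.left_commute)
  finally show "fourier (\<lambda>k. exp (- \<i> * complex_of_real (x \<bullet> k)) * complex_of_real (gauss_damp s k)) y = complex_of_real (gauss_kernel s (x + y))"
    by (simp only: two_pi_powr_cancel mult_1_left)
qed

lemma gauss_kernel_substitution:
  fixes f :: "'d::finite cfun"
  assumes s: "s > 0" and [measurable]: "f \<in> borel_measurable borel"
  shows "(LINT y|lborel. f y * complex_of_real (gauss_kernel s (x + y))) = (LINT z|lborel. f (- x + s *\<^sub>R z) * complex_of_real (exp (- (norm z)\<^sup>2 / 2)))"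
proof -
  have "(LINT y|lborel. f y * complex_of_real (gauss_kernel s (x + y)))
      = \<bar>s\<bar> ^ CARD('d) *\<^sub>R (LINT z|lborel. f (- x + s *\<^sub>R z) * complex_of_real (gauss_kernel s (x + (- x + s *\<^sub>R z))))"
    using lborel_integral_affine(1)[of "\<lambda>y. f y * complex_of_real (gauss_kernel s (x + y))" s "- x"] s by simp
  also have "(\<lambda>z. f (- x + s *\<^sub>R z) * complex_of_real (gauss_kernel s (x + (- x + s *\<^sub>R z))))
     = (\<lambda>z. complex_of_real ((1 / s) ^ CARD('d)) * (f (- x + s *\<^sub>R z) * complex_of_real (exp (- (norm z)\<^sup>2 / 2))))"
    using s by (simp add: gauss_kernel_def fun_eq_iff mult_ac)
  also have "\<bar>s\<bar> ^ CARD('d) *\<^sub>R integral\<^sup>L lborel \<dots> = (LINT z|lborel. f (- x + s *\<^sub>R z) * complex_of_real (exp (- (norm z)\<^sup>2 / 2)))"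
    using s by (subst integral_mult_right_zero) (simp add: scaleR_conv_of_real power_divide)
  finally show ?thesis .
qed

text \<open>Against a Gaussian damping the multiplication formula turns the double transform into an average of \<open>f\<close> around
\<open>- x\<close>. The damping is then removed on both sides by dominated convergence.\<close>

theorem fourier_fourier:
  fixes f :: "'d::finite cfun"
  assumes f: "integrable lborel f" and Ff: "integrable lborel (fourier f)"
    and cont: "continuous_on UNIV f" and bound: "\<And>x. norm (f x) \<le> B"
  shows "fourier (fourier f) x = f (- x)"
proof -
  let ?c = "(2 * pi) powr (- real CARD('d) / 2)" and ?K = "(2 * pi) powr (real CARD('d) / 2)"
  have [measurable]: "f \<in> borel_measurable borel" "fourier f \<in> borel_measurable borel"
    using borel_measurable_integrable[OF f] borel_measurable_integrable[OF Ff] by simp_all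
  let ?s = "\<lambda>n. inverse (real (Suc n))"
  have s0: "?s \<longlonglongrightarrow> 0" by (rule LIMSEQ_inverse_real_of_nat)
  have eq: "(LINT k|lborel. fourier f k * (exp (- \<i> * complex_of_real (x \<bullet> k)) * complex_of_real (gauss_damp s k)))
      = (LINT z|lborel. f (- x + s *\<^sub>R z) * complex_of_real (exp (- (norm z)\<^sup>2 / 2)))" if s: "s > 0" for s
    unfolding fourier_multiplication_formula[OF f fourier_modulated_gaussian(1)[OF s]] fourier_modulated_gaussian(2)[OF s]
    by (rule gauss_kernel_substitution[OF s]) measurable
  have L: "(\<lambda>n. LINT k|lborel. fourier f k * (exp (- \<i> * complex_of_real (x \<bullet> k)) * complex_of_real (gauss_damp (?s n) k)))
     \<longlonglongrightarrow> (LINT k|lborel. exp (- \<i> * complex_of_real (x \<bullet> k)) * fourier f k)"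
  proof (rule integral_dominated_convergence[where w = "\<lambda>k. norm (fourier f k)"])
    show "(\<lambda>k. exp (- \<i> * complex_of_real (x \<bullet> k)) * fourier f k) \<in> borel_measurable lborel"
      by (rule borel_measurable_integrable[OF fourier_integrable[OF Ff]])
    have [measurable]: "(\<lambda>k. exp (- \<i> * complex_of_real (x \<bullet> k))) \<in> borel_measurable borel"
      by (rule borel_measurable_continuous_onI[OF continuous_fourier_kernel])
    show "(\<lambda>k. fourier f k * (exp (- \<i> * complex_of_real (x \<bullet> k)) * complex_of_real (gauss_damp (?s n) k))) \<in> borel_measurable lborel" for n
      by measurable
    show "integrable lborel (\<lambda>k. norm (fourier f k))" using Ff by (rule integrable_norm)
    show "AE k in lborel. (\<lambda>n. fourier f k * (exp (- \<i> * complex_of_real (x \<bullet> k)) * complex_of_real (gauss_damp (?s n) k)))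
      \<longlonglongrightarrow> exp (- \<i> * complex_of_real (x \<bullet> k)) * fourier f k"
    proof (intro AE_I2)
      fix k :: "real ^ 'd"
      have "(\<lambda>n. complex_of_real (gauss_damp (?s n) k)) \<longlonglongrightarrow> complex_of_real (exp (- (norm (0 *\<^sub>R k))\<^sup>2 / 2))"
        unfolding gauss_damp_def by (intro tendsto_intros s0) auto
      hence "(\<lambda>n. fourier f k * (exp (- \<i> * complex_of_real (x \<bullet> k)) * complex_of_real (gauss_damp (?s n) k)))
       \<longlonglongrightarrow> fourier f k * (exp (- \<i> * complex_of_real (x \<bullet> k)) * complex_of_real (exp (- (norm (0 *\<^sub>R k))\<^sup>2 / 2)))"
        by (intro tendsto_mult tendsto_const)
      thus "(\<lambda>n. fourier f k * (exp (- \<i> * complex_of_real (x \<bullet> k)) * complex_of_real (gauss_damp (?s n) k)))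
       \<longlonglongrightarrow> exp (- \<i> * complex_of_real (x \<bullet> k)) * fourier f k" by (simp add: mult.commute)
    qed
    have "norm (fourier f k) * (1 * \<bar>gauss_damp (?s n) k\<bar>) \<le> norm (fourier f k) * (1 * 1)" for n and k :: "real ^ 'd"
      using gauss_damp_bounds[of "?s n" k] by (intro mult_left_mono) auto
    thus "AE k in lborel. norm (fourier f k * (exp (- \<i> * complex_of_real (x \<bullet> k)) * complex_of_real (gauss_damp (?s n) k))) \<le> norm (fourier f k)" for n
      by (intro AE_I2) (simp only: norm_mult norm_fourier_kernel norm_of_real mult_1_right)
  qed
  have R: "(\<lambda>n. LINT z|lborel. f (- x + ?s n *\<^sub>R z) * complex_of_real (exp (- (norm z)\<^sup>2 / 2)))
     \<longlonglongrightarrow> (LINT z|lborel. f (- x) * complex_of_real (exp (- (norm (z::real^'d))\<^sup>2 / 2)))"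
  proof (rule integral_dominated_convergence[where w = "\<lambda>z. B * exp (- (norm z)\<^sup>2 / 2)"])
    show "integrable lborel (\<lambda>z::real^'d. B * exp (- (norm z)\<^sup>2 / 2))"
      by (intro integrable_mult_right gaussian_integral(1))
    show "AE z in lborel. (\<lambda>n. f (- x + ?s n *\<^sub>R z) * complex_of_real (exp (- (norm z)\<^sup>2 / 2))) \<longlonglongrightarrow> f (- x) * complex_of_real (exp (- (norm z)\<^sup>2 / 2))"
    proof (intro AE_I2 tendsto_mult tendsto_const)
      fix z :: "real ^ 'd"
      have "(\<lambda>n. - x + ?s n *\<^sub>R z) \<longlonglongrightarrow> - x + 0 *\<^sub>R z" by (intro tendsto_intros s0)
      hence t: "(\<lambda>n. - x + ?s n *\<^sub>R z) \<longlonglongrightarrow> - x" by simp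
      show "(\<lambda>n. f (- x + ?s n *\<^sub>R z)) \<longlonglongrightarrow> f (- x)"
        using cont t by (auto intro: continuous_on_tendsto_compose)
    qed
    show "AE z in lborel. norm (f (- x + ?s n *\<^sub>R z) * complex_of_real (exp (- (norm z)\<^sup>2 / 2))) \<le> B * exp (- (norm z)\<^sup>2 / 2)" for n
      by (intro AE_I2) (auto simp: norm_mult intro!: mult_right_mono bound)
  qed measurable
  have "(\<lambda>n. LINT k|lborel. fourier f k * (exp (- \<i> * complex_of_real (x \<bullet> k)) * complex_of_real (gauss_damp (?s n) k)))
    = (\<lambda>n. LINT z|lborel. f (- x + ?s n *\<^sub>R z) * complex_of_real (exp (- (norm z)\<^sup>2 / 2)))"
    by (intro ext eq) simp
  note L' = L[unfolded this]
  from LIMSEQ_unique[OF L' R] have "(LINT k|lborel. exp (- \<i> * complex_of_real (x \<bullet> k)) * fourier f k) = (LINT z|lborel. f (- x) * complex_of_real (exp (- (norm (z::real^'d))\<^sup>2 / 2)))"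
    .
  also have "\<dots> = f (- x) * complex_of_real ?K"
    by (subst integral_mult_right_zero, subst integral_complex_of_real) (simp only: gaussian_integral(2) DIM_cart DIM_real mult_1_right)
  finally have "fourier (fourier f) x = complex_of_real ?c * (f (- x) * complex_of_real ?K)"
    unfolding fourier_def[of "fourier f"] by (simp only:)
  also have "\<dots> = complex_of_real (?c * ?K) * f (- x)" by (simp only: of_real_mult mult.assoc mult.commute mult.left_commute)
  finally show ?thesis by (simp only: two_pi_powr_cancel of_real_1 mult_1_left)
qed

section \<open>Square integrable Fourier transforms\<close>

lemma ennreal_norm_integral_le:
  fixes f :: "'a \<Rightarrow> 'b::{banach, second_countable_topology}"
  shows "ennreal (norm (integral\<^sup>L M f)) \<le> (\<integral>\<^sup>+x. ennreal (norm (f x)) \<partial>M)"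
proof (cases "integrable M f")
  case True
  thus ?thesis by (rule integral_norm_bound_ennreal)
qed (simp add: not_integrable_integral_eq)

lemma integrable_bounded_mult:
  fixes f g :: "'a \<Rightarrow> complex"
  assumes g: "integrable M g" and f: "f \<in> borel_measurable M" and B: "\<And>x. norm (f x) \<le> B"
  shows "integrable M (\<lambda>x. f x * g x)"
proof (rule Bochner_Integration.integrable_bound[OF integrable_mult_right[OF integrable_norm[OF g], of B]])
  show "(\<lambda>x. f x * g x) \<in> borel_measurable M" using f borel_measurable_integrable[OF g] by (rule borel_measurable_times)
  have "norm (f x * g x) \<le> norm (B * norm (g x))" for x
  proof -
    have "norm (f x * g x) \<le> B * norm (g x)" unfolding norm_mult by (intro mult_right_mono B) simp
    also have "\<dots> \<le> norm (B * norm (g x))" unfolding real_norm_def by (rule abs_ge_self)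
    finally show ?thesis .
  qed
  thus "AE x in M. norm (f x * g x) \<le> norm (B * norm (g x))" by simp
qed

text \<open>The constant that normalises the Fourier transform also makes the kernel a probability density.\<close>

lemma gauss_kernel_mass:
  fixes x :: "real ^ 'd::finite"
  assumes s: "s > 0"
  shows "(\<integral>\<^sup>+y. ennreal ((2 * pi) powr (- real CARD('d) / 2) * gauss_kernel s (x + y)) \<partial>lborel) = 1"
proof -
  let ?c = "(2 * pi) powr (- real CARD('d) / 2)"
  have "(\<integral>\<^sup>+y. ennreal (?c * gauss_kernel s (x + y)) \<partial>lborel)
     = ennreal (\<bar>s\<bar> ^ CARD('d)) * (\<integral>\<^sup>+z. ennreal (?c * gauss_kernel s (x + (- x + s *\<^sub>R z))) \<partial>lborel)"
    using nn_integral_lborel_scaleR[of "\<lambda>y. ennreal (?c * gauss_kernel s (x + y))" s "- x"] s by simp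
  also have "(\<lambda>z. ennreal (?c * gauss_kernel s (x + (- x + s *\<^sub>R z)))) = (\<lambda>z. ennreal ((1 / s) ^ CARD('d)) * ennreal (?c * exp (- (norm z)\<^sup>2 / 2)))"
    using s by (simp add: gauss_kernel_def fun_eq_iff ennreal_mult[symmetric] mult.left_commute)
  also have "integral\<^sup>N lborel \<dots> = ennreal ((1 / s) ^ CARD('d)) * (\<integral>\<^sup>+z. ennreal (?c * exp (- (norm (z::real^'d))\<^sup>2 / 2)) \<partial>lborel)"
    by (rule nn_integral_cmult) measurable
  also have "(\<integral>\<^sup>+z. ennreal (?c * exp (- (norm (z::real^'d))\<^sup>2 / 2)) \<partial>lborel) = ennreal (LINT z|lborel. ?c * exp (- (norm (z::real^'d))\<^sup>2 / 2))"
    by (intro nn_integral_eq_integral integrable_mult_right gaussian_integral(1)) auto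
  also have "(LINT z|lborel. ?c * exp (- (norm (z::real^'d))\<^sup>2 / 2)) = 1"
    unfolding integral_mult_right_zero gaussian_integral(2) DIM_cart DIM_real mult_1_right by (rule two_pi_powr_cancel)
  also have "ennreal (\<bar>s\<bar> ^ CARD('d)) * (ennreal ((1 / s) ^ CARD('d)) * ennreal 1) = 1"
    using s by (simp add: ennreal_mult[symmetric] power_mult_distrib[symmetric] del: ennreal_1)
  finally show ?thesis .
qed

text \<open>With a Gaussian damping the left-hand side becomes a double integral of \<open>u(k) v(l)\<close> against a probability
kernel, where \<open>v\<close> is the conjugate reflection of \<open>u\<close>. The inequality of arithmetic and geometric means bounds it
by the average of the two \<open>L\<^sup>2\<close> norms, which coincide. Fatou's lemma removes the damping.\<close>

theorem fourier_L2_bound: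
  fixes u :: "'d::finite cfun"
  assumes u: "integrable lborel u" and u2: "integrable lborel (\<lambda>k. (norm (u k))\<^sup>2)"
  shows "integrable lborel (\<lambda>x. (norm (fourier u x))\<^sup>2)"
    and "(LINT x|lborel. (norm (fourier u x))\<^sup>2) \<le> (LINT k|lborel. (norm (u k))\<^sup>2)"
proof -
  let ?c = "(2 * pi) powr (- real CARD('d) / 2)"
  define N where "N = (\<integral>\<^sup>+k. ennreal ((norm (u k))\<^sup>2) \<partial>lborel)"
  have [measurable]: "u \<in> borel_measurable borel" using borel_measurable_integrable[OF u] by simp
  \<comment> \<open>The transform of \<open>v\<close> is the conjugate of that of \<open>u\<close>, which makes \<open>|\<F>u|\<^sup>2\<close> accessible to the multiplication formula.\<close>
  define v where "v = (\<lambda>l. cnj (u (- l)))"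
  have ur: "integrable lborel (\<lambda>l. u (- l))" using lborel_integral_affine(2)[of u "-1" 0] u by simp
  have v: "integrable lborel v" unfolding v_def by (rule integrable_bounded_linear[OF bounded_linear_cnj ur])
  hence [measurable]: "v \<in> borel_measurable borel" using borel_measurable_integrable by force
  have Fm [measurable]: "fourier u \<in> borel_measurable borel" "fourier v \<in> borel_measurable borel"
    using continuous_fourier u v borel_measurable_continuous_onI by blast+
  have cnjF: "cnj (fourier u x) = fourier v x" for x
  proof -
    let ?h = "\<lambda>k. cnj (exp (- \<i> * complex_of_real (x \<bullet> k)) * u k)"
    have h: "?h (- l) = exp (- \<i> * complex_of_real (x \<bullet> l)) * v l" for l
      by (simp add: v_def exp_cnj)
    have hm: "?h \<in> borel_measurable borel"
      using borel_measurable_integrable[OF integrable_bounded_linear[OF bounded_linear_cnj fourier_integrable[OF u]]] by simp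
    have "cnj (fourier u x) = complex_of_real ?c * (LINT k|lborel. ?h k)"
    proof -
      have "(LINT k|lborel. ?h k) = cnj (LINT k|lborel. exp (- \<i> * complex_of_real (x \<bullet> k)) * u k)"
        by (rule integral_bounded_linear[OF bounded_linear_cnj fourier_integrable[OF u]])
      thus ?thesis by (simp only: fourier_def complex_cnj_mult complex_cnj_complex_of_real)
    qed
    also have "(LINT k|lborel. ?h k) = (LINT l|lborel. ?h (- l))"
      by (rule lborel_integral_reflect[symmetric, OF hm])
    finally show ?thesis unfolding h fourier_def .
  qed
  have N2: "(\<integral>\<^sup>+l. ennreal ((norm (v l))\<^sup>2) \<partial>lborel) = N"
    using nn_integral_lborel_scaleR[of "\<lambda>k. ennreal ((norm (u k))\<^sup>2)" "-1" 0] by (simp add: v_def N_def)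
  have step: "(\<integral>\<^sup>+x. ennreal ((norm (fourier u x))\<^sup>2 * gauss_damp s x) \<partial>lborel) \<le> N" if s: "s > 0" for s
  proof -
    obtain B where B: "\<And>x. norm (fourier v x) \<le> B" using norm_fourier_le[OF v] by blast
    let ?p = "\<lambda>x. fourier v x * complex_of_real (gauss_damp s x)"
    have p: "integrable lborel ?p"
      by (rule integrable_bounded_mult[OF integrable_of_real[OF gauss_damp_integrable[OF s]] _ B]) measurable
    have Fp: "fourier ?p k = complex_of_real ?c * (LINT l|lborel. v l * complex_of_real (gauss_kernel s (k + l)))" for k
    proof -
      have "(LINT x|lborel. exp (- \<i> * complex_of_real (k \<bullet> x)) * ?p x) = (LINT x|lborel. fourier v x * (exp (- \<i> * complex_of_real (k \<bullet> x)) * complex_of_real (gauss_damp s x)))"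
        by (simp only: mult.left_commute)
      also have "\<dots> = (LINT l|lborel. v l * complex_of_real (gauss_kernel s (k + l)))"
        unfolding fourier_multiplication_formula[OF v fourier_modulated_gaussian(1)[OF s]] fourier_modulated_gaussian(2)[OF s] ..
      finally show ?thesis unfolding fourier_def[of ?p] by (simp only:)
    qed
    have sq: "fourier u x * ?p x = complex_of_real ((norm (fourier u x))\<^sup>2 * gauss_damp s x)" for x
      by (simp only: cnjF[symmetric] mult.assoc[symmetric] complex_norm_square of_real_mult)
    have "integrable lborel (\<lambda>x. fourier u x * ?p x)"
    proof -
      obtain B' where B': "\<And>x. norm (fourier u x) \<le> B'" using norm_fourier_le[OF u] by blast
      show ?thesis
        by (rule integrable_bounded_mult[OF p _ B']) measurable
    qed
    hence I: "integrable lborel (\<lambda>x. (norm (fourier u x))\<^sup>2 * gauss_damp s x)"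
      unfolding sq by (simp only: complex_of_real_integrable_eq) 
    have "(\<integral>\<^sup>+x. ennreal ((norm (fourier u x))\<^sup>2 * gauss_damp s x) \<partial>lborel) = ennreal (LINT x|lborel. (norm (fourier u x))\<^sup>2 * gauss_damp s x)"
      by (intro nn_integral_eq_integral I) (auto simp: gauss_damp_bounds)
    also have "\<dots> \<le> ennreal (norm (complex_of_real (LINT x|lborel. (norm (fourier u x))\<^sup>2 * gauss_damp s x)))"
      by (intro ennreal_leI) simp
    also have "complex_of_real (LINT x|lborel. (norm (fourier u x))\<^sup>2 * gauss_damp s x) = (LINT x|lborel. fourier u x * ?p x)"
      unfolding sq by (rule integral_complex_of_real[symmetric])
    also have "\<dots> = (LINT k|lborel. u k * fourier ?p k)" by (rule fourier_multiplication_formula[OF u p])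
    also have "ennreal (norm \<dots>) \<le> (\<integral>\<^sup>+k. ennreal (norm (u k * fourier ?p k)) \<partial>lborel)" by (rule ennreal_norm_integral_le)
    also have "\<dots> \<le> (\<integral>\<^sup>+k. (\<integral>\<^sup>+l. ennreal (((norm (u k))\<^sup>2 / 2) * (?c * gauss_kernel s (k + l))) + ennreal (((norm (v l))\<^sup>2 / 2) * (?c * gauss_kernel s (k + l))) \<partial>lborel) \<partial>lborel)"
    proof (rule nn_integral_mono)
      fix k
      have "ennreal (norm (u k * fourier ?p k)) = ennreal (norm (u k) * ?c) * ennreal (norm (LINT l|lborel. v l * complex_of_real (gauss_kernel s (k + l))))"
        unfolding Fp norm_mult norm_of_real by (simp add: ennreal_mult[symmetric] mult.assoc)
      also have "\<dots> \<le> ennreal (norm (u k) * ?c) * (\<integral>\<^sup>+l. ennreal (norm (v l * complex_of_real (gauss_kernel s (k + l)))) \<partial>lborel)"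
        by (intro mult_left_mono ennreal_norm_integral_le) auto
      also have "\<dots> = (\<integral>\<^sup>+l. ennreal (norm (u k) * ?c) * ennreal (norm (v l * complex_of_real (gauss_kernel s (k + l)))) \<partial>lborel)"
        by (rule nn_integral_cmult[symmetric]) measurable
      also have "\<dots> \<le> (\<integral>\<^sup>+l. ennreal (((norm (u k))\<^sup>2 / 2) * (?c * gauss_kernel s (k + l))) + ennreal (((norm (v l))\<^sup>2 / 2) * (?c * gauss_kernel s (k + l))) \<partial>lborel)"
      proof (rule nn_integral_mono)
        fix l
        have g: "gauss_kernel s (k + l) \<ge> 0" using s by (simp add: gauss_kernel_def)
        have "norm (u k) * norm (v l) \<le> (norm (u k))\<^sup>2 / 2 + (norm (v l))\<^sup>2 / 2"
          using sum_squares_bound[of "norm (u k)" "norm (v l)"] by simp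
        hence "(norm (u k) * norm (v l)) * (?c * gauss_kernel s (k + l)) \<le> ((norm (u k))\<^sup>2 / 2 + (norm (v l))\<^sup>2 / 2) * (?c * gauss_kernel s (k + l))"
          using g by (intro mult_right_mono) auto
        hence "norm (u k) * ?c * (norm (v l * complex_of_real (gauss_kernel s (k + l)))) \<le> ((norm (u k))\<^sup>2 / 2) * (?c * gauss_kernel s (k + l)) + ((norm (v l))\<^sup>2 / 2) * (?c * gauss_kernel s (k + l))"
          using g by (simp add: norm_mult algebra_simps)
        thus "ennreal (norm (u k) * ?c) * ennreal (norm (v l * complex_of_real (gauss_kernel s (k + l)))) \<le> ennreal (((norm (u k))\<^sup>2 / 2) * (?c * gauss_kernel s (k + l))) + ennreal (((norm (v l))\<^sup>2 / 2) * (?c * gauss_kernel s (k + l)))"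
          using g by (simp add: ennreal_mult[symmetric] ennreal_plus[symmetric] del: ennreal_plus)
      qed
      finally show "ennreal (norm (u k * fourier ?p k)) \<le> (\<integral>\<^sup>+l. ennreal (((norm (u k))\<^sup>2 / 2) * (?c * gauss_kernel s (k + l))) + ennreal (((norm (v l))\<^sup>2 / 2) * (?c * gauss_kernel s (k + l))) \<partial>lborel)" .
    qed
    also have "\<dots> = (\<integral>\<^sup>+k. (\<integral>\<^sup>+l. ennreal (((norm (u k))\<^sup>2 / 2) * (?c * gauss_kernel s (k + l))) \<partial>lborel) \<partial>lborel)
        + (\<integral>\<^sup>+k. (\<integral>\<^sup>+l. ennreal (((norm (v l))\<^sup>2 / 2) * (?c * gauss_kernel s (k + l))) \<partial>lborel) \<partial>lborel)"
      by (subst nn_integral_add[symmetric]) (measurable, simp add: nn_integral_add)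
    also have "(\<integral>\<^sup>+k. (\<integral>\<^sup>+l. ennreal (((norm (v l))\<^sup>2 / 2) * (?c * gauss_kernel s (k + l))) \<partial>lborel) \<partial>lborel)
        = (\<integral>\<^sup>+l. (\<integral>\<^sup>+k. ennreal (((norm (v l))\<^sup>2 / 2) * (?c * gauss_kernel s (l + k))) \<partial>lborel) \<partial>lborel)"
      by (subst lborel_pair.Fubini') (measurable, simp add: add.commute)
    also have "(\<lambda>l. \<integral>\<^sup>+k. ennreal (((norm (v l))\<^sup>2 / 2) * (?c * gauss_kernel s (l + k))) \<partial>lborel) = (\<lambda>l. ennreal ((norm (v l))\<^sup>2 / 2))"
    proof
      fix l
      have "(\<integral>\<^sup>+k. ennreal (((norm (v l))\<^sup>2 / 2) * (?c * gauss_kernel s (l + k))) \<partial>lborel) = (\<integral>\<^sup>+k. ennreal ((norm (v l))\<^sup>2 / 2) * ennreal (?c * gauss_kernel s (l + k)) \<partial>lborel)"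
        using s by (intro nn_integral_cong ennreal_mult) (auto simp: gauss_kernel_def)
      also have "\<dots> = ennreal ((norm (v l))\<^sup>2 / 2) * 1"
        by (subst nn_integral_cmult) (measurable, simp only: gauss_kernel_mass[OF s])
      finally show "(\<integral>\<^sup>+k. ennreal (((norm (v l))\<^sup>2 / 2) * (?c * gauss_kernel s (l + k))) \<partial>lborel) = ennreal ((norm (v l))\<^sup>2 / 2)" by simp
    qed
    also have "(\<lambda>k. \<integral>\<^sup>+l. ennreal (((norm (u k))\<^sup>2 / 2) * (?c * gauss_kernel s (k + l))) \<partial>lborel) = (\<lambda>k. ennreal ((norm (u k))\<^sup>2 / 2))"
    proof
      fix k
      have "(\<integral>\<^sup>+l. ennreal (((norm (u k))\<^sup>2 / 2) * (?c * gauss_kernel s (k + l))) \<partial>lborel) = (\<integral>\<^sup>+l. ennreal ((norm (u k))\<^sup>2 / 2) * ennreal (?c * gauss_kernel s (k + l)) \<partial>lborel)"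
        using s by (intro nn_integral_cong ennreal_mult) (auto simp: gauss_kernel_def)
      also have "\<dots> = ennreal ((norm (u k))\<^sup>2 / 2) * 1"
        by (subst nn_integral_cmult) (measurable, simp only: gauss_kernel_mass[OF s])
      finally show "(\<integral>\<^sup>+l. ennreal (((norm (u k))\<^sup>2 / 2) * (?c * gauss_kernel s (k + l))) \<partial>lborel) = ennreal ((norm (u k))\<^sup>2 / 2)" by simp
    qed
    also have "(\<integral>\<^sup>+k. ennreal ((norm (u k))\<^sup>2 / 2) \<partial>lborel) + (\<integral>\<^sup>+l. ennreal ((norm (v l))\<^sup>2 / 2) \<partial>lborel) = N"
    proof -
      have h: "ennreal (t\<^sup>2 / 2) = ennreal (1/2) * ennreal (t\<^sup>2)" for t :: real by (subst ennreal_mult[symmetric]) simp_all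
      have "(\<integral>\<^sup>+k. ennreal ((norm (u k))\<^sup>2 / 2) \<partial>lborel) = ennreal (1/2) * N"
        unfolding h N_def by (rule nn_integral_cmult) measurable
      moreover have "(\<integral>\<^sup>+l. ennreal ((norm (v l))\<^sup>2 / 2) \<partial>lborel) = ennreal (1/2) * N"
        unfolding h N2[symmetric] by (rule nn_integral_cmult) measurable
      moreover have "ennreal (1/2) * N + ennreal (1/2) * N = N"
      proof -
        have "ennreal (1/2) + ennreal (1/2) = 1" by (subst ennreal_plus[symmetric]) auto
        thus ?thesis by (simp only: distrib_right[symmetric] mult_1_left)
      qed
      ultimately show ?thesis by (simp only:)
    qed
    finally show ?thesis .
  qed
  have "(\<integral>\<^sup>+x. ennreal ((norm (fourier u x))\<^sup>2) \<partial>lborel) \<le> N"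
  proof -
    let ?s = "\<lambda>n. inverse (real (Suc n))"
    let ?g = "\<lambda>n x. ennreal ((norm (fourier u x))\<^sup>2 * gauss_damp (?s n) x)"
    have lim: "liminf (\<lambda>n. ?g n x) = ennreal ((norm (fourier u x))\<^sup>2)" for x
    proof -
      have "(\<lambda>n. gauss_damp (?s n) x) \<longlonglongrightarrow> exp (- (norm (0 *\<^sub>R x))\<^sup>2 / 2)"
        unfolding gauss_damp_def by (intro tendsto_intros LIMSEQ_inverse_real_of_nat) auto
      hence "(\<lambda>n. (norm (fourier u x))\<^sup>2 * gauss_damp (?s n) x) \<longlonglongrightarrow> (norm (fourier u x))\<^sup>2 * exp (- (norm (0 *\<^sub>R x))\<^sup>2 / 2)"
        by (intro tendsto_mult tendsto_const)
      hence "(\<lambda>n. ?g n x) \<longlonglongrightarrow> ennreal ((norm (fourier u x))\<^sup>2)" by (intro tendsto_ennrealI) simp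
      thus ?thesis by (intro lim_imp_Liminf) auto
    qed
    have "(\<integral>\<^sup>+x. liminf (\<lambda>n. ?g n x) \<partial>lborel) \<le> liminf (\<lambda>n. integral\<^sup>N lborel (?g n))"
      by (rule nn_integral_liminf) measurable
    also have "\<dots> \<le> liminf (\<lambda>n. N)" by (intro Liminf_mono always_eventually allI step) simp
    also have "\<dots> = N" by (simp add: Liminf_const)
    finally show ?thesis unfolding lim .
  qed
  moreover have NN: "N = ennreal (LINT k|lborel. (norm (u k))\<^sup>2)"
    unfolding N_def by (intro nn_integral_eq_integral u2) auto
  ultimately have le: "(\<integral>\<^sup>+x. ennreal ((norm (fourier u x))\<^sup>2) \<partial>lborel) \<le> ennreal (LINT k|lborel. (norm (u k))\<^sup>2)" by simp
  show I: "integrable lborel (\<lambda>x. (norm (fourier u x))\<^sup>2)"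
    by (rule integrableI_bounded) (measurable, use le in \<open>auto intro: le_less_trans\<close>)
  have "ennreal (LINT x|lborel. (norm (fourier u x))\<^sup>2) \<le> ennreal (LINT k|lborel. (norm (u k))\<^sup>2)"
    using le by (subst nn_integral_eq_integral[OF I, symmetric]) auto
  thus "(LINT x|lborel. (norm (fourier u x))\<^sup>2) \<le> (LINT k|lborel. (norm (u k))\<^sup>2)"
    by (subst (asm) ennreal_le_iff) (auto intro: integral_nonneg_AE)
qed

section \<open>The Fourier transform of Schwartz functions\<close>

lemma integrable_inverse_weight:
  "integrable lborel (\<lambda>x::real ^ 'd::finite. inverse ((1 + norm x) ^ (CARD('d) + 1)))"
proof -
  let ?w = "\<lambda>r::real. inverse ((1 + \<bar>r\<bar>) ^ (CARD('d) + 1))"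
  have I1: "set_integrable lborel UNIV (\<lambda>x::real. inverse (1 + x^2))"
    using integrable_inverse_1_plus_square by (simp add: einterval_eq)
  have "set_integrable lborel {0<..} (\<lambda>r. r ^ (DIM(real ^ 'd) - 1) * ?w r)"
    unfolding set_integrable_def
  proof (rule Bochner_Integration.integrable_bound[OF I1[unfolded set_integrable_def]])
    have "r ^ (CARD('d) - 1) * ?w r \<le> inverse (1 + r\<^sup>2)" if "r > 0" for r :: real
    proof -
      have "r ^ (CARD('d) - 1) * ?w r \<le> (1 + r) ^ (CARD('d) - 1) * inverse ((1 + r) ^ ((CARD('d) - 1) + 2))"
        using that by (intro mult_mono power_mono) auto
      also have "\<dots> = inverse ((1 + r)\<^sup>2)" using that by (simp only: power_add inverse_mult_distrib) simp
      also have "\<dots> \<le> inverse (1 + r\<^sup>2)" using that by (intro le_imp_inverse_le) (auto simp: power2_sum add_pos_nonneg)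
      finally show ?thesis .
    qed
    thus "AE r in lborel. norm (indicat_real {0<..} r *\<^sub>R (r ^ (DIM(real ^ 'd) - 1) * ?w r)) \<le> norm (indicat_real UNIV r *\<^sub>R inverse (1 + r\<^sup>2))"
      by (intro AE_I2) (auto simp: indicator_def abs_mult)
  qed measurable
  from polar_integral(1)[OF _ this] show ?thesis by simp
qed

lemma integrable_decay:
  fixes f :: "'d::finite cfun"
  assumes [measurable]: "f \<in> borel_measurable borel" and B: "\<And>x. (1 + norm x) ^ (m + (CARD('d) + 1)) * norm (f x) \<le> B"
  shows "integrable lborel (\<lambda>x. norm x ^ m * norm (f x))"
proof (rule Bochner_Integration.integrable_bound[OF integrable_mult_right[OF integrable_inverse_weight, of B]])
  have "norm x ^ m * norm (f x) \<le> B * inverse ((1 + norm x) ^ (CARD('d) + 1))" for x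
  proof -
    have p: "(1 + norm x) ^ (CARD('d) + 1) > 0" by (intro zero_less_power) (simp add: add_pos_nonneg)
    have "norm x ^ m * norm (f x) \<le> (1 + norm x) ^ m * norm (f x)" by (intro mult_right_mono power_mono) auto
    hence "(1 + norm x) ^ (CARD('d) + 1) * (norm x ^ m * norm (f x)) \<le> (1 + norm x) ^ (CARD('d) + 1) * ((1 + norm x) ^ m * norm (f x))"
      using p by (intro mult_left_mono) auto
    also have "\<dots> = (1 + norm x) ^ (m + (CARD('d) + 1)) * norm (f x)" by (simp only: power_add mult.assoc mult.commute mult.left_commute)
    also have "\<dots> \<le> B" by (rule B)
    finally have "(norm x ^ m * norm (f x)) * (1 + norm x) ^ (CARD('d) + 1) \<le> B" by (simp only: mult.commute)
    hence "norm x ^ m * norm (f x) \<le> B / (1 + norm x) ^ (CARD('d) + 1)" by (simp only: pos_le_divide_eq[OF p])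
    thus ?thesis by (simp only: divide_inverse)
  qed
  note le = this
  show "AE x in lborel. norm (norm x ^ m * norm (f x)) \<le> norm (B * inverse ((1 + norm x) ^ (CARD('d) + 1)))"
  proof (intro AE_I2)
    fix x :: "real ^ 'd"
    have "norm (norm x ^ m * norm (f x)) = norm x ^ m * norm (f x)" by simp
    also note le[of x]
    also have "B * inverse ((1 + norm x) ^ (CARD('d) + 1)) \<le> norm (B * inverse ((1 + norm x) ^ (CARD('d) + 1)))"
      by (simp only: real_norm_def abs_ge_self)
    finally show "norm (norm x ^ m * norm (f x)) \<le> norm (B * inverse ((1 + norm x) ^ (CARD('d) + 1)))" .
  qed
qed measurable

lemma schwartz_flat_continuous: "f \<in> schwartz_flat_on Z \<Longrightarrow> continuous_on UNIV f"
  by (intro continuous_at_imp_continuous_on ballI differentiable_imp_continuous_within) (rule schwartz_flat_differentiable)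

lemma schwartz_flat_measurable: "f \<in> schwartz_flat_on Z \<Longrightarrow> f \<in> borel_measurable borel"
  by (rule borel_measurable_continuous_onI[OF schwartz_flat_continuous])

lemma schwartz_flat_moment_integrable:
  fixes f :: "'d::finite cfun"
  assumes "f \<in> schwartz_flat_on Z" shows "integrable lborel (\<lambda>x. norm x ^ m * norm (f x))"
  using schwartz_flat_bound[OF assms, of "m + (CARD('d) + 1)"] integrable_decay[OF schwartz_flat_measurable[OF assms], of m] by blast

lemma schwartz_flat_integrable:
  fixes f :: "'d::finite cfun"
  assumes "f \<in> schwartz_flat_on Z" shows "integrable lborel f"
  using schwartz_flat_moment_integrable[OF assms, of 0] schwartz_flat_measurable[OF assms]
  by (simp add: integrable_norm_iff)

lemma exp_i_remainder: "norm (exp (- \<i> * complex_of_real t) - 1 + \<i> * complex_of_real t) \<le> t\<^sup>2 / 2"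
  using iexp_approx1[of "- t" 1] by (simp add: algebra_simps power2_eq_square)

lemma bounded_linear_coord_sum: "bounded_linear (\<lambda>h::real ^ 'd::finite. \<Sum>i\<in>UNIV. (h $ i) *\<^sub>R (c i :: complex))"
  by (intro linear_conv_bounded_linear[THEN iffD1] linearI)
    (simp_all add: scaleR_add_left sum.distrib scaleR_sum_right)

lemma fourier_has_derivative:
  fixes f :: "'d::finite cfun"
  assumes f: "f \<in> schwartz_flat_on Z"
  shows "(fourier f has_derivative (\<lambda>h. \<Sum>i\<in>UNIV. (h $ i) *\<^sub>R fourier (\<lambda>x. - \<i> * (complex_of_real (x $ i) * f x)) k)) (at k)"
proof (rule has_derivative_from_quadratic_remainder[where \<delta> = 1 and C = "(2 * pi) powr (- real CARD('d) / 2) * ((LINT x|lborel. norm x ^ 2 * norm (f x)) / 2)"])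
  let ?c = "(2 * pi) powr (- real CARD('d) / 2)"
  let ?e = "\<lambda>k x. exp (- \<i> * complex_of_real (k \<bullet> x))"
  show "bounded_linear (\<lambda>h. \<Sum>i\<in>UNIV. (h $ i) *\<^sub>R fourier (\<lambda>x. - \<i> * (complex_of_real (x $ i) * f x)) k)"
    by (rule bounded_linear_coord_sum)
  fix h :: "real ^ 'd"
  have fi: "integrable lborel f" by (rule schwartz_flat_integrable[OF f])
  have ci: "integrable lborel (\<lambda>x. - \<i> * (complex_of_real (x $ i) * f x))" for i
    using f by (intro schwartz_flat_integrable schwartz_flat_cmult schwartz_flat_coord)
  have D: "(\<Sum>i\<in>UNIV. (h $ i) *\<^sub>R fourier (\<lambda>x. - \<i> * (complex_of_real (x $ i) * f x)) k)
      = complex_of_real ?c * (LINT x|lborel. - (\<i> * complex_of_real (h \<bullet> x)) * (?e k x * f x))"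
    and Di: "integrable lborel (\<lambda>x. - (\<i> * complex_of_real (h \<bullet> x)) * (?e k x * f x))"
  proof -
    have t: "- (\<i> * complex_of_real (h \<bullet> x)) * (?e k x * f x) = (\<Sum>i\<in>UNIV. complex_of_real (h $ i) * (?e k x * (- \<i> * (complex_of_real (x $ i) * f x))))" for x
    proof -
      have s: "complex_of_real (h $ i) * (E * (- \<i> * (complex_of_real (x $ i) * F))) = complex_of_real (h $ i * x $ i) * (- \<i> * (E * F))" for i E F
        by (simp only: of_real_mult mult.assoc mult.left_commute mult.commute)
      have "(\<Sum>i\<in>UNIV. complex_of_real (h $ i) * (?e k x * (- \<i> * (complex_of_real (x $ i) * f x)))) = complex_of_real (h \<bullet> x) * (- \<i> * (?e k x * f x))"
        unfolding s by (simp only: inner_vec_def inner_real_def of_real_sum sum_distrib_right)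
      thus ?thesis by (simp only:) simp
    qed
    show "integrable lborel (\<lambda>x. - (\<i> * complex_of_real (h \<bullet> x)) * (?e k x * f x))"
      unfolding t by (intro Bochner_Integration.integrable_sum integrable_mult_right fourier_integrable ci)
    have "(LINT x|lborel. - (\<i> * complex_of_real (h \<bullet> x)) * (?e k x * f x)) = (\<Sum>i\<in>UNIV. complex_of_real (h $ i) * (LINT x|lborel. ?e k x * (- \<i> * (complex_of_real (x $ i) * f x))))"
      unfolding t by (subst Bochner_Integration.integral_sum) (intro integrable_mult_right fourier_integrable ci, simp only: integral_mult_right_zero)
    thus "(\<Sum>i\<in>UNIV. (h $ i) *\<^sub>R fourier (\<lambda>x. - \<i> * (complex_of_real (x $ i) * f x)) k)
      = complex_of_real ?c * (LINT x|lborel. - (\<i> * complex_of_real (h \<bullet> x)) * (?e k x * f x))"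
      by (simp only: fourier_def scaleR_conv_of_real sum_distrib_left mult.left_commute)
  qed
  let ?R = "\<lambda>x. ?e (k + h) x * f x - ?e k x * f x - (- (\<i> * complex_of_real (h \<bullet> x)) * (?e k x * f x))"
  have "fourier f (k + h) - fourier f k - (\<Sum>i\<in>UNIV. (h $ i) *\<^sub>R fourier (\<lambda>x. - \<i> * (complex_of_real (x $ i) * f x)) k) = complex_of_real ?c * (LINT x|lborel. ?R x)"
  proof -
    have "(LINT x|lborel. ?R x) = (LINT x|lborel. ?e (k + h) x * f x) - (LINT x|lborel. ?e k x * f x) - (LINT x|lborel. - (\<i> * complex_of_real (h \<bullet> x)) * (?e k x * f x))"
      by (simp only: Bochner_Integration.integral_diff Bochner_Integration.integrable_diff fourier_integrable[OF fi] Di)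
    thus ?thesis unfolding D unfolding fourier_def by (simp only: right_diff_distrib)
  qed
  hence "norm (fourier f (k + h) - fourier f k - (\<Sum>i\<in>UNIV. (h $ i) *\<^sub>R fourier (\<lambda>x. - \<i> * (complex_of_real (x $ i) * f x)) k)) = ?c * norm (LINT x|lborel. ?R x)"
    by (simp only: norm_mult norm_of_real) simp
  moreover have "norm (LINT x|lborel. ?R x) \<le> (LINT x|lborel. ((norm h)\<^sup>2 / 2) * (norm x ^ 2 * norm (f x)))"
  proof (rule order_trans[OF integral_norm_bound integral_mono_AE])
    show "integrable lborel (\<lambda>x. norm (?R x))"
      using fourier_integrable[OF fi] Di by (intro integrable_norm Bochner_Integration.integrable_diff)
    show "integrable lborel (\<lambda>x. ((norm h)\<^sup>2 / 2) * (norm x ^ 2 * norm (f x)))"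
      by (intro integrable_mult_right schwartz_flat_moment_integrable[OF f])
    have "norm (?R x) \<le> ((norm h)\<^sup>2 / 2) * (norm x ^ 2 * norm (f x))" for x
    proof -
      have "?e (k + h) x = ?e (h) x * ?e k x"
        by (simp add: inner_left_distrib algebra_simps exp_add[symmetric])
      hence "?R x = (?e h x - 1 + \<i> * complex_of_real (h \<bullet> x)) * (?e k x * f x)"
        by (simp only:) (simp add: algebra_simps)
      hence "norm (?R x) = norm (?e h x - 1 + \<i> * complex_of_real (h \<bullet> x)) * norm (f x)"
        by (simp only: norm_mult norm_fourier_kernel mult_1_left)
      also have "\<dots> \<le> ((h \<bullet> x)\<^sup>2 / 2) * norm (f x)" by (intro mult_right_mono exp_i_remainder) auto
      also have "\<dots> \<le> ((norm h * norm x)\<^sup>2 / 2) * norm (f x)"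
        using Cauchy_Schwarz_ineq2[of h x] by (intro mult_right_mono divide_right_mono) (auto simp: abs_le_square_iff[symmetric])
      finally show ?thesis by (simp add: power_mult_distrib)
    qed
    thus "AE x in lborel. norm (?R x) \<le> ((norm h)\<^sup>2 / 2) * (norm x ^ 2 * norm (f x))" by simp
  qed
  moreover have "(LINT x|lborel. ((norm h)\<^sup>2 / 2) * (norm x ^ 2 * norm (f x))) = ((norm h)\<^sup>2 / 2) * (LINT x|lborel. norm x ^ 2 * norm (f x))"
    by (rule integral_mult_right_zero)
  ultimately show "norm (fourier f (k + h) - fourier f k - (\<Sum>i\<in>UNIV. (h $ i) *\<^sub>R fourier (\<lambda>x. - \<i> * (complex_of_real (x $ i) * f x)) k))
     \<le> ?c * ((LINT x|lborel. norm x ^ 2 * norm (f x)) / 2) * (norm h)\<^sup>2"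
    by (simp add: mult.assoc) (simp add: mult.commute)
qed auto

lemma partial_deriv_fourier:
  fixes f :: "'d::finite cfun"
  assumes f: "f \<in> schwartz_flat_on Z"
  shows "partial_deriv i (fourier f) = fourier (\<lambda>x. - \<i> * (complex_of_real (x $ i) * f x))"
  by (rule ext, subst partial_deriv_eqI[OF fourier_has_derivative[OF f]]) (rule sum_axis_scaleR)

lemma has_derivative_along_axis:
  fixes f :: "'d::finite cfun"
  assumes f: "f \<in> schwartz_flat_on Z"
  shows "((\<lambda>s. f (x + s *\<^sub>R axis i 1)) has_derivative (\<lambda>h. h *\<^sub>R partial_deriv i f (x + s *\<^sub>R axis i 1))) (at s within S)"
proof -
  have l: "((\<lambda>s. x + s *\<^sub>R axis i 1) has_derivative (\<lambda>h. h *\<^sub>R axis i (1::real))) (at s within S)"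
    by (auto intro!: derivative_eq_intros)
  have "((\<lambda>s. f (x + s *\<^sub>R axis i 1)) has_derivative (\<lambda>h. \<Sum>j\<in>UNIV. ((h *\<^sub>R axis i (1::real)) $ j) *\<^sub>R partial_deriv j f (x + s *\<^sub>R axis i 1))) (at s within S)"
    by (rule has_derivative_compose[OF l schwartz_flat_has_derivative[OF f]])
  moreover have "(\<Sum>j\<in>UNIV. ((h *\<^sub>R axis i (1::real)) $ j) *\<^sub>R partial_deriv j f (x + s *\<^sub>R axis i 1)) = h *\<^sub>R partial_deriv i f (x + s *\<^sub>R axis i 1)" for h
  proof -
    have "(\<Sum>j\<in>UNIV. ((h *\<^sub>R axis i (1::real)) $ j) *\<^sub>R partial_deriv j f (x + s *\<^sub>R axis i 1)) = h *\<^sub>R (\<Sum>j\<in>UNIV. (axis i (1::real) $ j) *\<^sub>R partial_deriv j f (x + s *\<^sub>R axis i 1))"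
      by (simp add: scaleR_sum_right)
    thus ?thesis by (simp only: sum_axis_scaleR)
  qed
  ultimately show ?thesis by simp
qed

lemma schwartz_flat_shift_bound:
  fixes f :: "'d::finite cfun"
  assumes f: "f \<in> schwartz_flat_on Z"
  shows "\<exists>C\<ge>0. \<forall>x s. \<bar>s\<bar> \<le> 1 \<longrightarrow> norm (f (x + s *\<^sub>R axis i 1)) \<le> C * inverse ((1 + norm x) ^ N)"
proof -
  obtain B where B: "B \<ge> 0" "\<And>x. (1 + norm x) ^ N * norm (f x) \<le> B"
    using schwartz_flat_bound[OF f, of N] by blast
  have "norm (f (x + s *\<^sub>R axis i 1)) \<le> (2 ^ N * B) * inverse ((1 + norm x) ^ N)" if "\<bar>s\<bar> \<le> 1" for x s
  proof -
    let ?y = "x + s *\<^sub>R axis i (1::real)"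
    have p: "(1 + norm x) ^ N > 0" by (intro zero_less_power) (simp add: add_pos_nonneg)
    have "norm x = norm (?y - s *\<^sub>R axis i 1)" by simp
    hence a: "norm x \<le> norm ?y + norm (s *\<^sub>R (axis i (1::real) :: real ^ 'd))" using norm_triangle_ineq4 by metis
    have b: "norm (s *\<^sub>R (axis i (1::real) :: real ^ 'd)) \<le> 1" using that by (simp add: norm_axis_1)
    have "\<And>n p q :: real. n \<le> p + q \<Longrightarrow> q \<le> 1 \<Longrightarrow> 0 \<le> p \<Longrightarrow> 1 + n \<le> 2 * (1 + p)" by argo
    from this[OF a b norm_ge_zero] have "1 + norm x \<le> 2 * (1 + norm ?y)" .
    hence "(1 + norm x) ^ N \<le> (2 * (1 + norm ?y)) ^ N" by (intro power_mono) auto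
    hence "(1 + norm x) ^ N * norm (f ?y) \<le> (2 * (1 + norm ?y)) ^ N * norm (f ?y)" by (intro mult_right_mono) auto
    also have "\<dots> = 2 ^ N * ((1 + norm ?y) ^ N * norm (f ?y))" by (simp only: power_mult_distrib mult.assoc)
    also have "\<dots> \<le> 2 ^ N * B" by (intro mult_left_mono B) auto
    finally have "norm (f ?y) * (1 + norm x) ^ N \<le> 2 ^ N * B" by (simp only: mult.commute)
    thus ?thesis by (simp only: pos_le_divide_eq[OF p, symmetric] divide_inverse)
  qed
  thus ?thesis using B(1) by (intro exI[of _ "2 ^ N * B"]) auto
qed

text \<open>The remainder of second order along a coordinate axis, with a bound that decreases rapidly in \<open>x\<close>: the mean value
inequality is applied twice, and decay is uniform under shifts of length at most one.\<close>

lemma schwartz_flat_taylor: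
  fixes f :: "'d::finite cfun"
  assumes f: "f \<in> schwartz_flat_on Z"
  shows "\<exists>C\<ge>0. \<forall>x t. \<bar>t\<bar> \<le> 1 \<longrightarrow> norm (f (x + t *\<^sub>R axis i 1) - f x - t *\<^sub>R partial_deriv i f x) \<le> C * inverse ((1 + norm x) ^ N) * t\<^sup>2"
proof -
  let ?e = "axis i (1::real) :: real ^ 'd" and ?g = "partial_deriv i f"
  have g: "?g \<in> schwartz_flat_on Z" by (rule schwartz_flat_partial[OF f])
  obtain C where C: "C \<ge> 0" "\<And>x s. \<bar>s\<bar> \<le> 1 \<Longrightarrow> norm (partial_deriv i ?g (x + s *\<^sub>R ?e)) \<le> C * inverse ((1 + norm x) ^ N)"
    using schwartz_flat_shift_bound[OF schwartz_flat_partial[OF g, of i], of i N] by blast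
  have 1: "norm (?g (x + s *\<^sub>R ?e) - ?g x) \<le> C * inverse ((1 + norm x) ^ N) * \<bar>s\<bar>" if s: "\<bar>s\<bar> \<le> 1" for x s
  proof -
    have "norm (?g (x + s *\<^sub>R ?e) - ?g (x + 0 *\<^sub>R ?e)) \<le> (C * inverse ((1 + norm x) ^ N)) * norm (s - 0)"
    proof (rule differentiable_bound[of "{-1..1::real}"])
      fix r :: real assume r: "r \<in> {-1..1}"
      show "((\<lambda>s. ?g (x + s *\<^sub>R ?e)) has_derivative (\<lambda>h. h *\<^sub>R partial_deriv i ?g (x + r *\<^sub>R ?e))) (at r within {-1..1})"
        by (rule has_derivative_along_axis[OF g])
      have "norm (h *\<^sub>R partial_deriv i ?g (x + r *\<^sub>R ?e)) \<le> (C * inverse ((1 + norm x) ^ N)) * norm h" for h :: real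
        using mult_left_mono[OF C(2)[of r x], of "\<bar>h\<bar>"] r by (simp add: abs_le_iff mult.commute)
      thus "onorm (\<lambda>h. h *\<^sub>R partial_deriv i ?g (x + r *\<^sub>R ?e)) \<le> C * inverse ((1 + norm x) ^ N)"
        by (rule onorm_le)
    qed (use s in \<open>auto simp: abs_le_iff\<close>)
    thus ?thesis by simp
  qed
  have "norm (f (x + t *\<^sub>R ?e) - f x - t *\<^sub>R ?g x) \<le> C * inverse ((1 + norm x) ^ N) * t\<^sup>2" if t: "\<bar>t\<bar> \<le> 1" for x t
  proof -
    have "norm ((f (x + t *\<^sub>R ?e) - t *\<^sub>R ?g x) - (f (x + 0 *\<^sub>R ?e) - 0 *\<^sub>R ?g x)) \<le> (C * inverse ((1 + norm x) ^ N) * \<bar>t\<bar>) * norm (t - 0)"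
    proof (rule differentiable_bound[of "{-\<bar>t\<bar>..\<bar>t\<bar>}"])
      fix r :: real assume r: "r \<in> {-\<bar>t\<bar>..\<bar>t\<bar>}"
      show "((\<lambda>s. f (x + s *\<^sub>R ?e) - s *\<^sub>R ?g x) has_derivative (\<lambda>h. h *\<^sub>R ?g (x + r *\<^sub>R ?e) - h *\<^sub>R ?g x)) (at r within {-\<bar>t\<bar>..\<bar>t\<bar>})"
        by (intro has_derivative_diff has_derivative_along_axis[OF f] has_derivative_scaleR_left has_derivative_ident)
      have "norm (h *\<^sub>R ?g (x + r *\<^sub>R ?e) - h *\<^sub>R ?g x) \<le> (C * inverse ((1 + norm x) ^ N) * \<bar>t\<bar>) * norm h" for h :: real
      proof -
        have "norm (h *\<^sub>R ?g (x + r *\<^sub>R ?e) - h *\<^sub>R ?g x) = \<bar>h\<bar> * norm (?g (x + r *\<^sub>R ?e) - ?g x)"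
          by (simp only: scaleR_diff_right[symmetric] norm_scaleR)
        also have "\<dots> \<le> \<bar>h\<bar> * (C * inverse ((1 + norm x) ^ N) * \<bar>r\<bar>)"
          using r t by (intro mult_left_mono 1) auto
        also have "\<dots> \<le> \<bar>h\<bar> * (C * inverse ((1 + norm x) ^ N) * \<bar>t\<bar>)"
          using r C(1) by (intro mult_left_mono) auto
        finally show ?thesis by (simp only: mult.commute real_norm_def)
      qed
      thus "onorm (\<lambda>h. h *\<^sub>R ?g (x + r *\<^sub>R ?e) - h *\<^sub>R ?g x) \<le> C * inverse ((1 + norm x) ^ N) * \<bar>t\<bar>"
        by (rule onorm_le)
    qed auto
    moreover have "(C * inverse ((1 + norm x) ^ N) * \<bar>t\<bar>) * norm (t - 0) = C * inverse ((1 + norm x) ^ N) * t\<^sup>2"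
      by (simp only: mult.assoc) (simp add: power2_eq_square)
    moreover have "(f (x + t *\<^sub>R ?e) - t *\<^sub>R ?g x) - (f (x + 0 *\<^sub>R ?e) - 0 *\<^sub>R ?g x) = f (x + t *\<^sub>R ?e) - f x - t *\<^sub>R ?g x" by simp
    ultimately show ?thesis by (simp only:)
  qed
  thus ?thesis using C(1) by blast
qed

text \<open>Instead of integrating by parts, \<open>\<integral> exp(-\<i>k\<bullet>x) f(x + t e\<^sub>i) dx\<close> is differentiated at \<open>t = 0\<close> in two ways:
under the integral sign, and after translating the variable of integration.\<close>

lemma fourier_partial_deriv:
  fixes f :: "'d::finite cfun"
  assumes f: "f \<in> schwartz_flat_on Z"
  shows "fourier (partial_deriv i f) k = \<i> * complex_of_real (k $ i) * fourier f k"
proof -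
  let ?e = "axis i (1::real) :: real ^ 'd" and ?g = "partial_deriv i f"
  let ?E = "\<lambda>x. exp (- \<i> * complex_of_real (k \<bullet> x))"
  let ?c = "complex_of_real ((2 * pi) powr (- real CARD('d) / 2))"
  let ?I = "LINT x|lborel. ?E x * f x" and ?J = "LINT x|lborel. ?E x * ?g x"
  have g: "?g \<in> schwartz_flat_on Z" by (rule schwartz_flat_partial[OF f])
  have fi: "integrable lborel (\<lambda>x. ?E x * f x)" and gi: "integrable lborel (\<lambda>x. ?E x * ?g x)"
    by (rule fourier_integrable[OF schwartz_flat_integrable[OF f]], rule fourier_integrable[OF schwartz_flat_integrable[OF g]])
  have shift: "integrable lborel (\<lambda>x. ?E x * f (x + t *\<^sub>R ?e))"
    "(LINT x|lborel. ?E x * f (x + t *\<^sub>R ?e)) = exp (\<i> * complex_of_real (t * k $ i)) * ?I" for t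
  proof -
    have ke: "?E (t *\<^sub>R ?e + 1 *\<^sub>R x) * f (t *\<^sub>R ?e + 1 *\<^sub>R x) = exp (- (\<i> * complex_of_real (t * k $ i))) * (?E x * f (x + t *\<^sub>R ?e))" for x
      by (simp add: inner_right_distrib inner_axis algebra_simps exp_add[symmetric])
    have m: "(\<lambda>x. ?E x * f x) \<in> borel_measurable borel" using borel_measurable_integrable[OF fi] by simp
    have "integrable lborel (\<lambda>x. exp (- (\<i> * complex_of_real (t * k $ i))) * (?E x * f (x + t *\<^sub>R ?e)))"
      using lborel_integral_affine(2)[OF m, of 1 "t *\<^sub>R ?e"] fi unfolding ke by simp
    from integrable_mult_right[OF this, of "exp (\<i> * complex_of_real (t * k $ i))"]
    show "integrable lborel (\<lambda>x. ?E x * f (x + t *\<^sub>R ?e))" by (simp only: mult.assoc[symmetric] exp_minus_inverse mult_1_left)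
    have "?I = (LINT x|lborel. exp (- (\<i> * complex_of_real (t * k $ i))) * (?E x * f (x + t *\<^sub>R ?e)))"
      using lborel_integral_affine(1)[OF m, of 1 "t *\<^sub>R ?e"] unfolding ke by simp
    also have "\<dots> = exp (- (\<i> * complex_of_real (t * k $ i))) * (LINT x|lborel. ?E x * f (x + t *\<^sub>R ?e))" by (rule integral_mult_right_zero)
    finally have "exp (\<i> * complex_of_real (t * k $ i)) * ?I = (exp (\<i> * complex_of_real (t * k $ i)) * exp (- (\<i> * complex_of_real (t * k $ i)))) * (LINT x|lborel. ?E x * f (x + t *\<^sub>R ?e))"
      by (simp only: mult.assoc)
    thus "(LINT x|lborel. ?E x * f (x + t *\<^sub>R ?e)) = exp (\<i> * complex_of_real (t * k $ i)) * ?I"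
      by (simp only: exp_minus_inverse mult_1_left)
  qed
  obtain C where C: "C \<ge> 0" "\<And>x t. \<bar>t\<bar> \<le> 1 \<Longrightarrow> norm (f (x + t *\<^sub>R ?e) - f x - t *\<^sub>R ?g x) \<le> C * inverse ((1 + norm x) ^ (CARD('d) + 1)) * t\<^sup>2"
    using schwartz_flat_taylor[OF f, of i "CARD('d) + 1"] by blast
  define M where "M = (LINT x|lborel. inverse ((1 + norm (x::real ^ 'd)) ^ (CARD('d) + 1)))"
  define \<phi> where "\<phi> t = exp (\<i> * complex_of_real (t * k $ i)) * ?I" for t
  have "(\<phi> has_derivative (\<lambda>t. t *\<^sub>R ?J)) (at 0)"
  proof (rule has_derivative_from_quadratic_remainder[where \<delta> = 1 and C = "C * M"])
    fix t :: real assume t: "norm t \<le> 1"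
    let ?R = "\<lambda>x. ?E x * f (x + t *\<^sub>R ?e) - ?E x * f x - t *\<^sub>R (?E x * ?g x)"
    have Ri: "integrable lborel ?R"
      by (intro Bochner_Integration.integrable_diff shift fi integrable_scaleR_right gi)
    have "\<phi> (0 + t) - \<phi> 0 - t *\<^sub>R ?J = (LINT x|lborel. ?R x)"
      by (simp only: \<phi>_def Bochner_Integration.integral_diff Bochner_Integration.integrable_diff shift fi integrable_scaleR_right gi integral_scaleR_right) simp
    also have "norm \<dots> \<le> (LINT x|lborel. (C * t\<^sup>2) * inverse ((1 + norm (x :: real ^ 'd)) ^ (CARD('d) + 1)))"
    proof (rule order_trans[OF integral_norm_bound integral_mono_AE])
      show "integrable lborel (\<lambda>x. norm (?R x))" using Ri by (rule integrable_norm)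
      show "integrable lborel (\<lambda>x::real ^ 'd. (C * t\<^sup>2) * inverse ((1 + norm x) ^ (CARD('d) + 1)))"
        by (intro integrable_mult_right integrable_inverse_weight)
      have "norm (?R x) \<le> (C * t\<^sup>2) * inverse ((1 + norm x) ^ (CARD('d) + 1))" for x
      proof -
        have "?R x = ?E x * (f (x + t *\<^sub>R ?e) - f x - t *\<^sub>R ?g x)"
          by (simp only: right_diff_distrib mult_scaleR_right)
        hence "norm (?R x) = norm (f (x + t *\<^sub>R ?e) - f x - t *\<^sub>R ?g x)"
          by (simp only: norm_mult norm_fourier_kernel mult_1_left)
        also have "\<dots> \<le> C * inverse ((1 + norm x) ^ (CARD('d) + 1)) * t\<^sup>2" using t by (intro C(2)) simp
        finally show ?thesis by (simp only: mult.assoc mult.commute mult.left_commute)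
      qed
      thus "AE x in lborel. norm (?R x) \<le> (C * t\<^sup>2) * inverse ((1 + norm x) ^ (CARD('d) + 1))" by simp
    qed
    also have "\<dots> = (C * t\<^sup>2) * M" unfolding M_def by (rule integral_mult_right_zero)
    finally show "norm (\<phi> (0 + t) - \<phi> 0 - t *\<^sub>R ?J) \<le> C * M * (norm t)\<^sup>2" by (simp add: mult_ac)
  qed (auto intro: bounded_linear_scaleR_left)
  moreover have "(\<phi> has_derivative (\<lambda>t. t *\<^sub>R (\<i> * complex_of_real (k $ i) * ?I))) (at 0)"
  proof -
    have "((\<lambda>t. exp (\<i> * complex_of_real (t * k $ i))) has_vector_derivative \<i> * complex_of_real (k $ i)) (at 0)"
      using exp_scaleR_has_vector_derivative_right[of "\<i> * complex_of_real (k $ i)" 0 UNIV]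
      by (simp add: scaleR_conv_of_real mult_ac)
    from has_vector_derivative_mult_left[OF this, of ?I]
    show ?thesis unfolding \<phi>_def[abs_def] has_vector_derivative_def .
  qed
  ultimately have "(\<lambda>t::real. t *\<^sub>R ?J) = (\<lambda>t. t *\<^sub>R (\<i> * complex_of_real (k $ i) * ?I))"
    by (rule has_derivative_unique)
  from fun_cong[OF this, of 1] have "?J = \<i> * complex_of_real (k $ i) * ?I" by simp
  thus ?thesis unfolding fourier_def by (simp only: mult.left_commute)
qed

text \<open>Transforms of Schwartz functions are closed under derivatives. They decay since a factor \<open>norm k\<close> is
controlled by the transforms of the first partial derivatives.\<close>

theorem fourier_schwartz:
  fixes f :: "'d::finite cfun"
  assumes "f \<in> schwartz_flat_on {}" shows "fourier f \<in> schwartz_flat_on {}"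
proof (rule schwartz_flat_coinduct[where C = "fourier ` schwartz_flat_on {}"])
  show "fourier f \<in> fourier ` schwartz_flat_on {}" using assms by blast
  show "h differentiable (at x)" if "h \<in> fourier ` schwartz_flat_on {}" for h :: "'d cfun" and x
    using that fourier_has_derivative differentiableI by blast
  show "partial_deriv i h \<in> fourier ` schwartz_flat_on {}" if "h \<in> fourier ` schwartz_flat_on {}" for h :: "'d cfun" and i
  proof -
    from that obtain g where g: "h = fourier g" "g \<in> schwartz_flat_on {}" by blast
    show ?thesis unfolding g(1) partial_deriv_fourier[OF g(2)]
      by (intro imageI schwartz_flat_cmult schwartz_flat_coord g)
  qed
  show "\<exists>B. \<forall>x. (1 + norm x) ^ m * norm (h x) \<le> B" if "h \<in> fourier ` schwartz_flat_on {}" for h :: "'d cfun" and m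
  proof -
    have "\<exists>B. \<forall>x. (1 + norm x) ^ m * norm (fourier g x) \<le> B" if "g \<in> schwartz_flat_on {}" for g :: "'d cfun"
      using that
    proof (induction m arbitrary: g)
      case 0
      thus ?case using norm_fourier_le[OF schwartz_flat_integrable] by auto
    next
      case (Suc m)
      obtain B where B: "\<And>x. (1 + norm x) ^ m * norm (fourier g x) \<le> B" using Suc.IH[OF Suc.prems] by blast
      have "\<exists>B. \<forall>i x. (1 + norm x) ^ m * norm (fourier (partial_deriv i g) x) \<le> B i"
        using Suc.IH[OF schwartz_flat_partial[OF Suc.prems]] by (intro choice allI)
      then obtain Bi where Bi: "\<And>i x. (1 + norm x) ^ m * norm (fourier (partial_deriv i g) x) \<le> Bi i" by blast
      have "(1 + norm x) ^ Suc m * norm (fourier g x) \<le> B + (\<Sum>i\<in>UNIV. Bi i)" for x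
      proof -
        have "norm x * norm (fourier g x) \<le> (\<Sum>i\<in>UNIV. \<bar>x $ i\<bar>) * norm (fourier g x)"
          by (intro mult_right_mono norm_le_l1_cart) auto
        also have "\<dots> = (\<Sum>i\<in>UNIV. norm (fourier (partial_deriv i g) x))"
          unfolding fourier_partial_deriv[OF Suc.prems] by (simp add: norm_mult sum_distrib_right)
        finally have "(1 + norm x) ^ m * (norm (fourier g x) + norm x * norm (fourier g x)) \<le> (1 + norm x) ^ m * (norm (fourier g x) + (\<Sum>i\<in>UNIV. norm (fourier (partial_deriv i g) x)))"
          by (intro mult_left_mono add_left_mono) auto
        also have "\<dots> = (1 + norm x) ^ m * norm (fourier g x) + (\<Sum>i\<in>UNIV. (1 + norm x) ^ m * norm (fourier (partial_deriv i g) x))"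
          by (simp only: distrib_left sum_distrib_left)
        also have "\<dots> \<le> B + (\<Sum>i\<in>UNIV. Bi i)" by (intro add_mono sum_mono B Bi)
        finally show ?thesis by (simp add: algebra_simps)
      qed
      thus ?case by blast
    qed
    thus ?thesis using that by blast
  qed
qed auto

lemma fourier_fourier_schwartz:
  assumes "f \<in> schwartz_flat_on {}" shows "fourier (fourier f) = (\<lambda>x. f (- x))"
proof
  fix x
  obtain B where "\<And>x. (1 + norm x) ^ 0 * norm (f x) \<le> B" using schwartz_flat_bound[OF assms, of 0] by blast
  thus "fourier (fourier f) x = f (- x)"
    by (intro fourier_fourier[where B = B] schwartz_flat_integrable[OF assms] schwartz_flat_integrable[OF fourier_schwartz[OF assms]] schwartz_flat_continuous[OF assms]) simp
qed

lemma inj_on_fourier_schwartz: "inj_on fourier (schwartz :: 'd::finite cfun set)"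
proof (rule inj_onI)
  fix f g :: "'d cfun" assume fg: "f \<in> schwartz" "g \<in> schwartz" "fourier f = fourier g"
  hence "(\<lambda>x. f (- x)) = (\<lambda>x. g (- x))"
    using fourier_fourier_schwartz[of f] fourier_fourier_schwartz[of g] by (simp add: schwartz_eq_flat)
  hence "f (- (- x)) = g (- (- x))" for x by metis
  thus "f = g" by (simp add: fun_eq_iff)
qed

text \<open>The choice of a preimage in \<^const>\<open>fourier_inv\<close> is harmless because inversion makes the transform injective.\<close>

lemma fourier_inv_reflect:
  assumes "f \<in> schwartz" shows "fourier_inv (\<lambda>k. f (- k)) = fourier f"
  unfolding fourier_inv_def fourier_fourier_schwartz[OF assms[unfolded schwartz_eq_flat], symmetric]
  by (rule inv_into_f_f[OF inj_on_fourier_schwartz]) (use fourier_schwartz assms in \<open>simp add: schwartz_eq_flat\<close>)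

lemma schwartz_monomial:
  fixes f :: "'d::finite cfun"
  assumes "f \<in> schwartz_flat_on Z" shows "(\<lambda>x. complex_of_real (monomial is x) * f x) \<in> schwartz_flat_on Z"
proof (induction "is")
  case Nil
  thus ?case using assms by (simp add: monomial_def)
next
  case (Cons i "is")
  from schwartz_flat_coord[OF this, of i] show ?case by (simp add: monomial_def mult.assoc)
qed

lemma iter_partial_fourier:
  fixes f :: "'d::finite cfun"
  assumes "f \<in> schwartz_flat_on {}"
  shows "iter_partial is (fourier f) = fourier (\<lambda>x. (- \<i>) ^ length is * (complex_of_real (monomial is x) * f x))"
proof (induction "is")
  case Nil
  show ?case by (simp add: monomial_def)
next
  case (Cons i "is")
  have S: "(\<lambda>x. (- \<i>) ^ length is * (complex_of_real (monomial is x) * f x)) \<in> schwartz_flat_on {}"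
    by (intro schwartz_flat_cmult schwartz_monomial assms)
  show ?case unfolding iter_partial_Cons Cons.IH partial_deriv_fourier[OF S]
    by (simp add: monomial_def mult_ac)
qed

text \<open>Moments of \<open>f\<close> are derivatives of its transform at the origin. This links \<open>\<Phi>\<close> with \<open>\<Psi>\<close>.\<close>

lemma iter_partial_fourier_0:
  fixes f :: "'d::finite cfun"
  assumes "f \<in> schwartz_flat_on {}"
  shows "iter_partial is (fourier f) 0 = 0 \<longleftrightarrow> (LINT x|lborel. complex_of_real (monomial is x) * f x) = 0"
  unfolding iter_partial_fourier[OF assms] fourier_def by simp

theorem fourier_Phi_Psi: "f \<in> Phi \<Longrightarrow> fourier f \<in> Psi"
  unfolding Phi_def Psi_def mem_Collect_eq schwartz_eq_flat
  by (intro conjI fourier_schwartz) (auto simp: iter_partial_fourier_0)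

theorem fourier_Psi_Phi:
  assumes "f \<in> Psi" shows "fourier f \<in> Phi"
proof -
  have f: "f \<in> schwartz_flat_on {}" using assms by (simp add: Psi_def schwartz_eq_flat)
  have "iter_partial is (fourier (fourier f)) 0 = 0" for "is"
    using Psi_reflect[OF assms] unfolding fourier_fourier_schwartz[OF f] Psi_def by simp
  thus ?thesis unfolding Phi_def using fourier_schwartz[OF f] by (simp add: schwartz_eq_flat iter_partial_fourier_0)
qed

section \<open>A cutoff constant to infinite order at the origin\<close>

lemma poly_exp_bounded: "\<exists>C\<ge>0. \<forall>u\<ge>0. \<bar>poly p u\<bar> * exp (- u) \<le> (C::real)"
proof -
  have pw: "u ^ i * exp (- u) \<le> fact i" if "u \<ge> 0" for u :: real and i
  proof -
    have "u ^ i / fact i \<le> exp u"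
    proof (cases i)
      case 0 thus ?thesis using that by simp
    next
      case (Suc m)
      have "summable (\<lambda>n. u ^ n / fact n)" using summable_exp_generic[of u] by (simp add: divide_inverse mult.commute)
      hence "(\<Sum>n\<in>{i}. u ^ n / fact n) \<le> (\<Sum>n. u ^ n / fact n)" using that by (intro sum_le_suminf) auto
      thus ?thesis by (simp add: exp_def divide_inverse mult.commute)
    qed
    hence "u ^ i \<le> fact i * exp u" by (simp add: pos_divide_le_eq mult.commute)
    hence "u ^ i * exp (- u) \<le> (fact i * exp u) * exp (- u)" by (intro mult_right_mono) auto
    also have "\<dots> = fact i" by (simp add: mult.assoc exp_minus_inverse)
    finally show ?thesis .
  qed
  have "\<bar>poly p u\<bar> * exp (- u) \<le> (\<Sum>i\<le>degree p. \<bar>coeff p i\<bar> * fact i)" if "u \<ge> 0" for u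
  proof -
    have "\<bar>poly p u\<bar> * exp (- u) \<le> (\<Sum>i\<le>degree p. \<bar>coeff p i * u ^ i\<bar>) * exp (- u)"
      unfolding poly_altdef by (intro mult_right_mono sum_abs) auto
    also have "\<dots> = (\<Sum>i\<le>degree p. \<bar>coeff p i\<bar> * (u ^ i * exp (- u)))"
      using that by (simp add: sum_distrib_right abs_mult mult.assoc)
    also have "\<dots> \<le> (\<Sum>i\<le>degree p. \<bar>coeff p i\<bar> * fact i)"
      using that by (intro sum_mono mult_left_mono pw) auto
    finally show ?thesis .
  qed
  thus ?thesis by (intro exI[of _ "\<Sum>i\<le>degree p. \<bar>coeff p i\<bar> * fact i"]) (auto intro: sum_nonneg)
qed

text \<open>The factors in \<open>d\<^sup>n/dt\<^sup>n exp(-1/t - t) = P\<^sub>n(1/t) exp(-1/t - t)\<close>; the derivative of \<open>1/t\<close> is \<open>-(1/t)\<^sup>2\<close>.\<close>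

primrec bump_poly :: "nat \<Rightarrow> real poly" where
  "bump_poly 0 = 1"
| "bump_poly (Suc n) = [:0, 0, -1:] * pderiv (bump_poly n) + [:-1, 0, 1:] * bump_poly n"

text \<open>The exponent \<open>- t\<close> makes all derivatives decay at infinity, in addition to vanishing to infinite order
at \<open>0\<close>.\<close>

definition flat_bump :: "nat \<Rightarrow> real \<Rightarrow> real" where
  "flat_bump n t = (if t > 0 then poly (bump_poly n) (1 / t) * exp (- (1 / t) - t) else 0)"

lemma flat_bump_bound: "\<exists>C\<ge>0. \<forall>t. \<bar>flat_bump n t\<bar> \<le> C * t\<^sup>2 * exp (- t)"
proof -
  obtain C where C: "C \<ge> 0" "\<And>u. u \<ge> 0 \<Longrightarrow> \<bar>poly ([:0, 0, 1:] * bump_poly n) u\<bar> * exp (- u) \<le> C"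
    using poly_exp_bounded[of "[:0, 0, 1:] * bump_poly n"] by blast
  have "\<bar>flat_bump n t\<bar> \<le> C * t\<^sup>2 * exp (- t)" for t
  proof (cases "t > 0")
    case True
    have "(1 / t)\<^sup>2 * (\<bar>poly (bump_poly n) (1 / t)\<bar> * exp (- (1 / t))) \<le> C"
      using C(2)[of "1 / t"] True by (simp add: abs_mult power2_eq_square mult.assoc)
    hence "t\<^sup>2 * ((1 / t)\<^sup>2 * (\<bar>poly (bump_poly n) (1 / t)\<bar> * exp (- (1 / t)))) \<le> t\<^sup>2 * C"
      by (intro mult_left_mono) auto
    moreover have "t\<^sup>2 * ((1 / t)\<^sup>2 * X) = X" for X :: real using True by (simp add: power_divide)
    ultimately have "\<bar>poly (bump_poly n) (1 / t)\<bar> * exp (- (1 / t)) \<le> t\<^sup>2 * C" by simp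
    hence "(\<bar>poly (bump_poly n) (1 / t)\<bar> * exp (- (1 / t))) * exp (- t) \<le> (t\<^sup>2 * C) * exp (- t)"
      by (intro mult_right_mono) auto
    moreover have "exp (- (1 / t) - t) = exp (- (1 / t)) * exp (- t)" by (simp add: exp_add[symmetric])
    ultimately show ?thesis using True by (simp add: flat_bump_def abs_mult mult_ac)
  next
    case False
    thus ?thesis using C(1) by (simp add: flat_bump_def)
  qed
  thus ?thesis using C(1) by blast
qed

lemma flat_bump_has_derivative: "(flat_bump n has_real_derivative flat_bump (Suc n) t) (at t)"
proof (rule linorder_cases[of t 0])
  assume t: "t < 0"
  have d: "((\<lambda>t. 0) has_real_derivative 0) (at t)" by simp
  have ev: "eventually (\<lambda>t. 0 = flat_bump n t) (nhds t)"
    using eventually_nhds_in_open[of "{..<0}" t] t by (auto elim!: eventually_mono simp: flat_bump_def)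
  have "(flat_bump n has_real_derivative 0) (at t)"
    by (rule iffD1[OF DERIV_cong_ev[OF refl ev refl] d])
  thus ?thesis using t by (simp add: flat_bump_def)
next
  assume t: "t = 0"
  obtain C where C: "C \<ge> 0" "\<And>t. \<bar>flat_bump n t\<bar> \<le> C * t\<^sup>2 * exp (- t)" using flat_bump_bound by blast
  have "(flat_bump n has_derivative (\<lambda>h. 0)) (at 0)"
  proof (rule has_derivative_from_quadratic_remainder[where \<delta> = 1 and C = "C * exp 1"])
    fix h :: real assume "norm h \<le> 1"
    hence "C * h\<^sup>2 * exp (- h) \<le> C * h\<^sup>2 * exp 1" using C(1) by (intro mult_left_mono) auto
    with C(2)[of h] show "norm (flat_bump n (0 + h) - flat_bump n 0 - 0) \<le> C * exp 1 * (norm h)\<^sup>2"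
      by (simp add: flat_bump_def mult_ac)
  qed auto
  thus ?thesis using t by (simp add: has_field_derivative_def flat_bump_def lambda_zero)
next
  assume t: "t > 0"
  let ?u = "1 / t" and ?p = "bump_poly n"
  have inv: "((\<lambda>t. 1 / t) has_real_derivative - (?u\<^sup>2)) (at t)"
    using t by (auto intro!: derivative_eq_intros simp: power2_eq_square divide_simps)
  have 1: "((\<lambda>t. poly ?p (1 / t)) has_real_derivative poly (pderiv ?p) ?u * - (?u\<^sup>2)) (at t)"
    by (rule DERIV_chain2[OF poly_DERIV inv])
  have 2: "((\<lambda>t. exp (- (1 / t) - t)) has_real_derivative exp (- ?u - t) * (?u\<^sup>2 - 1)) (at t)"
    using DERIV_chain2[OF DERIV_exp DERIV_diff[OF DERIV_minus[OF inv] DERIV_ident]] by simp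
  have d: "((\<lambda>t. poly ?p (1 / t) * exp (- (1 / t) - t)) has_real_derivative flat_bump (Suc n) t) (at t)"
    using DERIV_mult[OF 1 2] t by (simp add: flat_bump_def algebra_simps power2_eq_square)
  have ev: "eventually (\<lambda>t. poly ?p (1 / t) * exp (- (1 / t) - t) = flat_bump n t) (nhds t)"
    using eventually_nhds_in_open[of "{0<..}" t] t by (auto elim!: eventually_mono simp: flat_bump_def)
  show ?thesis by (rule iffD1[OF DERIV_cong_ev[OF refl ev refl] d])
qed

text \<open>The lower limit is \<open>-1\<close>, where the integrand vanishes, so that \<open>0\<close> is an interior point and two-sided derivatives
exist there.\<close>

definition bump_integral :: "real \<Rightarrow> real" where
  "bump_integral q = integral {-1..q} (flat_bump 0)"

lemma flat_bump_0: "0 \<le> flat_bump 0 t" "t > 0 \<Longrightarrow> flat_bump 0 t > 0" "t \<ge> 0 \<Longrightarrow> flat_bump 0 t \<le> exp (- t)"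
  by (auto simp: flat_bump_def)

lemma bump_integral_has_derivative:
  assumes "q > -1" shows "(bump_integral has_real_derivative flat_bump 0 q) (at q)"
proof -
  have "continuous_on {-1..q + 1} (flat_bump 0)"
    using DERIV_isCont[OF flat_bump_has_derivative] by (intro continuous_at_imp_continuous_on) auto
  hence "(bump_integral has_real_derivative flat_bump 0 q) (at q within {-1..q + 1})"
    unfolding bump_integral_def[abs_def] by (rule integral_has_real_derivative) (use assms in auto)
  moreover have "at q within {-1..q + 1} = at q" by (rule at_within_interior) (use assms in auto)
  ultimately show ?thesis by simp
qed

lemma bump_integral_0: "bump_integral 0 = 0"
proof -
  have "bump_integral 0 = integral {-1..0} (\<lambda>t::real. 0::real)"
    unfolding bump_integral_def by (intro Henstock_Kurzweil_Integration.integral_cong) (auto simp: flat_bump_def)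
  thus ?thesis by simp
qed

lemma bump_integral_mono: "0 \<le> q \<Longrightarrow> q \<le> q' \<Longrightarrow> bump_integral q \<le> bump_integral q'"
  by (rule DERIV_nonneg_imp_nondecreasing) (use bump_integral_has_derivative flat_bump_0(1) in \<open>force+\<close>)

lemma bump_integral_tail: assumes "0 \<le> q" "q \<le> q'" shows "bump_integral q' \<le> bump_integral q + exp (- q)"
proof -
  have "bump_integral q' + exp (- q') \<le> bump_integral q + exp (- q)"
  proof (rule DERIV_nonpos_imp_nonincreasing[where f = "\<lambda>q. bump_integral q + exp (- q)", OF assms(2)])
    fix x assume "q \<le> x" "x \<le> q'"
    hence x: "x \<ge> 0" using assms by simp
    have "((\<lambda>q. bump_integral q + exp (- q)) has_real_derivative flat_bump 0 x + exp (- x) * - 1) (at x)"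
      using x by (intro DERIV_add bump_integral_has_derivative DERIV_chain2[OF DERIV_exp] DERIV_minus DERIV_ident) auto
    thus "\<exists>y. ((\<lambda>q. bump_integral q + exp (- q)) has_real_derivative y) (at x) \<and> y \<le> 0"
      using flat_bump_0(3)[OF x] by (intro exI[of _ "flat_bump 0 x + exp (- x) * - 1"]) auto
  qed
  thus ?thesis using exp_gt_zero[of "- q'"] by linarith
qed

definition cutoff_height :: real where "cutoff_height = (SUP q\<in>{0..}. bump_integral q)"

lemma cutoff_height: 
  assumes "q \<ge> 0" shows "bump_integral q \<le> cutoff_height" "cutoff_height \<le> bump_integral q + exp (- q)"
proof -
  have "bump_integral q' \<le> 1" if "q' \<ge> 0" for q'
    using bump_integral_tail[of 0 q'] that bump_integral_0 by simp
  hence b: "bdd_above (bump_integral ` {0..})" by (intro bdd_aboveI[of _ 1]) auto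
  show "bump_integral q \<le> cutoff_height" unfolding cutoff_height_def using assms by (intro cSUP_upper b) auto
  have "bump_integral q' \<le> bump_integral q + exp (- q)" if "q' \<ge> 0" for q'
    using bump_integral_tail[of q q'] bump_integral_mono[of q' q] assms that exp_gt_zero[of "- q"] by (cases "q \<le> q'") linarith+
  thus "cutoff_height \<le> bump_integral q + exp (- q)" unfolding cutoff_height_def by (intro cSUP_least) auto
qed

lemma cutoff_height_pos: "cutoff_height > 0"
proof -
  have "bump_integral 0 < bump_integral 1"
  proof (rule DERIV_pos_imp_increasing_open[where f = bump_integral])
    fix x :: real assume "0 < x" "x < 1"
    thus "\<exists>y. (bump_integral has_real_derivative y) (at x) \<and> y > 0"
      using bump_integral_has_derivative[of x] flat_bump_0(2)[of x] by (intro exI[of _ "flat_bump 0 x"]) auto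
  next
    show "continuous_on {0..1} bump_integral"
      using DERIV_isCont[OF bump_integral_has_derivative] by (intro continuous_at_imp_continuous_on) auto
  qed simp
  thus ?thesis using bump_integral_0 cutoff_height(1)[of 1] by simp
qed

text \<open>The cutoff \<open>\<integral>\<^bsub>q\<^esub>\<^bsup>\<infinity>\<^esup> exp(-1/t - t) dt\<close> together with its derivatives. It is positive at \<open>0\<close>, and all derivatives
vanish there.\<close>

primrec cutoff :: "nat \<Rightarrow> real \<Rightarrow> real" where
  "cutoff 0 q = cutoff_height - bump_integral q"
| "cutoff (Suc n) q = - flat_bump n q"

lemma cutoff_at_0: "cutoff 0 0 = cutoff_height" "cutoff (Suc n) 0 = 0"
  by (simp_all add: bump_integral_0 flat_bump_def)

lemma cutoff_has_derivative:
  assumes "q \<ge> 0" shows "(cutoff n has_real_derivative cutoff (Suc n) q) (at q)"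
proof (cases n)
  case 0
  have "((\<lambda>q. cutoff_height - bump_integral q) has_real_derivative 0 - flat_bump 0 q) (at q)"
    using assms by (intro DERIV_diff DERIV_const bump_integral_has_derivative) auto
  thus ?thesis using 0 by (simp add: cutoff.simps(1)[abs_def])
next
  case (Suc m)
  thus ?thesis using DERIV_minus[OF flat_bump_has_derivative[of m q]] by (simp add: cutoff.simps(2)[abs_def])
qed

lemma power_exp_bounded: "\<exists>C\<ge>0. \<forall>q\<ge>0. (1 + q) ^ m * exp (- q) \<le> (C::real)"
proof -
  obtain C where C: "C \<ge> 0" "\<And>u. u \<ge> 0 \<Longrightarrow> \<bar>poly ([:1, 1::real:] ^ m) u\<bar> * exp (- u) \<le> C"
    using poly_exp_bounded[of "[:1, 1:] ^ m"] by blast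
  have "(1 + q) ^ m * exp (- q) \<le> C" if "q \<ge> 0" for q
    using C(2)[OF that] that by (simp add: poly_power power_abs)
  thus ?thesis using C(1) by blast
qed

lemma cutoff_decay: "\<exists>B\<ge>0. \<forall>q\<ge>0. (1 + q) ^ m * \<bar>cutoff n q\<bar> \<le> B"
proof (cases n)
  case 0
  obtain C :: real where C: "C \<ge> 0" "\<And>q. q \<ge> 0 \<Longrightarrow> (1 + q) ^ m * exp (- q) \<le> C" using power_exp_bounded[of m] by blast
  have "(1 + q) ^ m * \<bar>cutoff n q\<bar> \<le> C" if q: "q \<ge> 0" for q
  proof -
    have "\<bar>cutoff n q\<bar> \<le> exp (- q)" using cutoff_height[OF q] 0 by simp
    hence "(1 + q) ^ m * \<bar>cutoff n q\<bar> \<le> (1 + q) ^ m * exp (- q)" using q by (intro mult_left_mono) auto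
    thus ?thesis using C(2)[OF q] by simp
  qed
  thus ?thesis using C(1) by blast
next
  case (Suc k)
  obtain C :: real where C: "C \<ge> 0" "\<And>q. q \<ge> 0 \<Longrightarrow> (1 + q) ^ (m + 2) * exp (- q) \<le> C" using power_exp_bounded[of "m + 2"] by blast
  obtain D where D: "D \<ge> 0" "\<And>t. \<bar>flat_bump k t\<bar> \<le> D * t\<^sup>2 * exp (- t)" using flat_bump_bound by blast
  have "(1 + q) ^ m * \<bar>cutoff n q\<bar> \<le> D * C" if q: "q \<ge> 0" for q
  proof -
    have "\<bar>cutoff n q\<bar> \<le> D * q\<^sup>2 * exp (- q)" using D(2)[of q] Suc by simp
    also have "\<dots> \<le> D * (1 + q)\<^sup>2 * exp (- q)" using q D(1) by (intro mult_right_mono mult_left_mono power_mono) auto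
    finally have "(1 + q) ^ m * \<bar>cutoff n q\<bar> \<le> (1 + q) ^ m * (D * (1 + q)\<^sup>2 * exp (- q))" using q by (intro mult_left_mono) auto
    also have "\<dots> = D * ((1 + q) ^ (m + 2) * exp (- q))" by (simp only: power_add mult.assoc mult.commute mult.left_commute)
    also have "\<dots> \<le> D * C" using C(2)[OF q] D(1) by (intro mult_left_mono) auto
    finally show ?thesis .
  qed
  thus ?thesis using C(1) D(1) by (intro exI[of _ "D * C"]) auto
qed

definition modulated_cutoff :: "real ^ 'd::finite \<Rightarrow> real \<Rightarrow> nat \<Rightarrow> 'd cfun" where
  "modulated_cutoff y a n k = exp (- \<i> * complex_of_real (y \<bullet> k)) * complex_of_real (cutoff n ((norm (a *\<^sub>R k))\<^sup>2))"

lemma modulated_cutoff_has_derivative: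
  fixes k :: "real ^ 'd::finite"
  shows "(modulated_cutoff y a n has_derivative (\<lambda>h. complex_of_real (- (y \<bullet> h)) * (\<i> * modulated_cutoff y a n k)
      + complex_of_real (2 * a\<^sup>2 * (k \<bullet> h)) * modulated_cutoff y a (Suc n) k)) (at k)"
proof -
  have 1: "((\<lambda>k. exp (- \<i> * complex_of_real (y \<bullet> k))) has_derivative (\<lambda>h. exp (- \<i> * complex_of_real (y \<bullet> k)) * (- \<i> * complex_of_real (y \<bullet> h)))) (at k)"
  proof -
    have "((\<lambda>k. - \<i> * complex_of_real (y \<bullet> k)) has_derivative (\<lambda>h. - \<i> * complex_of_real (y \<bullet> h))) (at k)"
      by (intro has_derivative_mult_right bounded_linear.has_derivative[OF bounded_linear_of_real] has_derivative_inner_right has_derivative_ident)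
    from has_derivative_compose[OF this, of exp] show ?thesis
      using DERIV_exp[of "- \<i> * complex_of_real (y \<bullet> k)"] unfolding has_field_derivative_def by blast
  qed
  have 2: "((\<lambda>k. (norm (a *\<^sub>R k))\<^sup>2) has_derivative (\<lambda>h. 2 * a\<^sup>2 * (k \<bullet> h))) (at k)"
    unfolding power2_norm_eq_inner
    by (auto intro!: derivative_eq_intros simp: inner_commute power2_eq_square algebra_simps)
  have "((\<lambda>k. cutoff n ((norm (a *\<^sub>R k))\<^sup>2)) has_derivative (\<lambda>h. cutoff (Suc n) ((norm (a *\<^sub>R k))\<^sup>2) * (2 * a\<^sup>2 * (k \<bullet> h)))) (at k)"
    by (rule has_derivative_compose[OF 2 cutoff_has_derivative[unfolded has_field_derivative_def]]) simp
  from bounded_linear.has_derivative[OF bounded_linear_of_real this]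
  have 3: "((\<lambda>k. complex_of_real (cutoff n ((norm (a *\<^sub>R k))\<^sup>2))) has_derivative (\<lambda>h. complex_of_real (cutoff (Suc n) ((norm (a *\<^sub>R k))\<^sup>2) * (2 * a\<^sup>2 * (k \<bullet> h))))) (at k)" .
  have "(modulated_cutoff y a n has_derivative (\<lambda>h. exp (- \<i> * complex_of_real (y \<bullet> k)) * complex_of_real (cutoff (Suc n) ((norm (a *\<^sub>R k))\<^sup>2) * (2 * a\<^sup>2 * (k \<bullet> h)))
     + (exp (- \<i> * complex_of_real (y \<bullet> k)) * (- \<i> * complex_of_real (y \<bullet> h))) * complex_of_real (cutoff n ((norm (a *\<^sub>R k))\<^sup>2)))) (at k)"
    unfolding modulated_cutoff_def[abs_def] by (rule has_derivative_mult[OF 1 3])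
  moreover have "(\<lambda>h. exp (- \<i> * complex_of_real (y \<bullet> k)) * complex_of_real (cutoff (Suc n) ((norm (a *\<^sub>R k))\<^sup>2) * (2 * a\<^sup>2 * (k \<bullet> h)))
     + (exp (- \<i> * complex_of_real (y \<bullet> k)) * (- \<i> * complex_of_real (y \<bullet> h))) * complex_of_real (cutoff n ((norm (a *\<^sub>R k))\<^sup>2)))
    = (\<lambda>h. complex_of_real (- (y \<bullet> h)) * (\<i> * modulated_cutoff y a n k)
      + complex_of_real (2 * a\<^sup>2 * (k \<bullet> h)) * modulated_cutoff y a (Suc n) k)"
    unfolding modulated_cutoff_def by (rule ext) (simp del: cutoff.simps add: algebra_simps)
  ultimately show ?thesis by simp
qed

lemma partial_deriv_modulated_cutoff:
  "partial_deriv i (modulated_cutoff y a n) = (\<lambda>k. (- \<i> * complex_of_real (y $ i)) * modulated_cutoff y a n k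
     + complex_of_real (2 * a\<^sup>2) * (complex_of_real (k $ i) * modulated_cutoff y a (Suc n) k))"
  by (rule ext, subst partial_deriv_eqI[OF modulated_cutoff_has_derivative]) (simp add: inner_axis algebra_simps)

lemma modulated_cutoff_decay:
  assumes "a > 0" shows "\<exists>B. \<forall>k. (1 + norm k) ^ m * norm (modulated_cutoff y a n k) \<le> B"
proof -
  obtain B where B: "B \<ge> 0" "\<And>q. q \<ge> 0 \<Longrightarrow> (1 + q) ^ m * \<bar>cutoff n q\<bar> \<le> B" using cutoff_decay by blast
  define c where "c = max 1 (1 / a) + 1"
  have c: "c \<ge> 1" "1 / a \<le> c - 1" by (auto simp: c_def)
  have "(1 + norm k) ^ m * norm (modulated_cutoff y a n k) \<le> (2 * c) ^ m * B" for k
  proof -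
    let ?r = "norm (a *\<^sub>R k)"
    have "norm k = (1 / a) * ?r" using assms by simp
    also have "\<dots> \<le> (c - 1) * ?r" using c by (intro mult_right_mono) auto
    finally have 1: "norm k \<le> (c - 1) * ?r" .
    have "r \<le> 1 + r\<^sup>2" if "r \<ge> 0" for r :: real using sum_squares_bound[of r 1] that by simp
    hence "(c - 1) * ?r \<le> (c - 1) * (1 + ?r\<^sup>2)" using c by (intro mult_left_mono) auto
    with 1 have "1 + norm k \<le> (1 + ?r\<^sup>2) + (c - 1) * (1 + ?r\<^sup>2)"
      by (intro add_mono order_trans[OF 1]) auto
    also have "(1 + ?r\<^sup>2) + (c - 1) * (1 + ?r\<^sup>2) = c * (1 + ?r\<^sup>2)" by (simp add: left_diff_distrib)
    also have "\<dots> \<le> (2 * c) * (1 + ?r\<^sup>2)" using c by (intro mult_right_mono) auto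
    finally have "(1 + norm k) ^ m \<le> ((2 * c) * (1 + ?r\<^sup>2)) ^ m" by (intro power_mono) auto
    hence "(1 + norm k) ^ m * \<bar>cutoff n (?r\<^sup>2)\<bar> \<le> ((2 * c) * (1 + ?r\<^sup>2)) ^ m * \<bar>cutoff n (?r\<^sup>2)\<bar>" by (intro mult_right_mono) auto
    also have "\<dots> = (2 * c) ^ m * ((1 + ?r\<^sup>2) ^ m * \<bar>cutoff n (?r\<^sup>2)\<bar>)" by (simp only: power_mult_distrib mult.assoc)
    also have "\<dots> \<le> (2 * c) ^ m * B" using c by (intro mult_left_mono B) auto
    finally have 1: "(1 + norm k) ^ m * \<bar>cutoff n (?r\<^sup>2)\<bar> \<le> (2 * c) ^ m * B" .
    have "norm (modulated_cutoff y a n k) = \<bar>cutoff n (?r\<^sup>2)\<bar>"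
      unfolding modulated_cutoff_def norm_mult by (simp add: norm_exp_eq_Re)
    thus ?thesis using 1 by (simp only:)
  qed
  thus ?thesis by blast
qed

lemma modulated_cutoff_schwartz:
  assumes "a > 0" shows "modulated_cutoff y a n \<in> schwartz_flat_on {}"
proof -
  let ?G = "range (modulated_cutoff y a)"
  have "coord_span ?G \<subseteq> schwartz_flat_on {}"
  proof (rule coord_span_subset_schwartz_flat)
    fix g assume "g \<in> ?G"
    then obtain n where g: "g = modulated_cutoff y a n" by blast
    show "g differentiable (at x)" for x unfolding g using modulated_cutoff_has_derivative differentiableI by blast
    show "partial_deriv i g \<in> coord_span ?G" for i unfolding g partial_deriv_modulated_cutoff
      by (intro coord_span.lincomb coord_span.coord coord_span.base rangeI)
    show "\<exists>B. \<forall>x. (1 + norm x) ^ m * norm (g x) \<le> B" for m unfolding g by (rule modulated_cutoff_decay[OF assms])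
  qed simp
  thus ?thesis using coord_span.base[of "modulated_cutoff y a n" ?G] by blast
qed

text \<open>Each cutoff is the same constant at the origin to infinite order, whatever the dilation \<open>a\<close>. The common
phase keeps the difference flat, and after the transform it becomes a translation by \<open>y\<close>.\<close>

theorem modulated_cutoff_diff_Psi:
  fixes y :: "real ^ 'd::finite"
  assumes "a > 0" "b > 0" shows "(\<lambda>k. modulated_cutoff y a 0 k - modulated_cutoff y b 0 k) \<in> Psi"
proof -
  define d where "d = (\<lambda>k. 1 * modulated_cutoff y a 0 k + (- 1) * modulated_cutoff y b 0 k)"
  \<comment> \<open>The difference itself and all proper derivatives of both cutoffs, which vanish at the origin separately.\<close>
  let ?G = "{d} \<union> range (\<lambda>n. modulated_cutoff y a (Suc n)) \<union> range (\<lambda>n. modulated_cutoff y b (Suc n))"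
  have "coord_span ?G \<subseteq> schwartz_flat_on {0}"
  proof (rule coord_span_subset_schwartz_flat)
    fix g assume g: "g \<in> ?G"
    have sa: "modulated_cutoff y a n \<in> schwartz_flat_on {}" and sb: "modulated_cutoff y b n \<in> schwartz_flat_on {}" for n
      using assms by (simp_all add: modulated_cutoff_schwartz)
    have "g \<in> schwartz_flat_on {}" using g sa sb schwartz_flat_lincomb[OF sa sb, of 1 0 "- 1" 0] unfolding d_def by blast
    thus "g differentiable (at x)" "\<exists>B. \<forall>x. (1 + norm x) ^ m * norm (g x) \<le> B" for x m
      using schwartz_flat_differentiable schwartz_flat_bound by blast+
    have S: "modulated_cutoff y a (Suc n) \<in> coord_span ?G" "modulated_cutoff y b (Suc n) \<in> coord_span ?G" for n
      by (auto intro: coord_span.base)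
    show "partial_deriv i g \<in> coord_span ?G" for i
    proof -
      consider "g = d" | n where "g = modulated_cutoff y a (Suc n)" | n where "g = modulated_cutoff y b (Suc n)" using g by blast
      thus ?thesis
      proof cases
        case 1
        have D: "(d has_derivative (\<lambda>h. 1 * (complex_of_real (- (y \<bullet> h)) * (\<i> * modulated_cutoff y a 0 k)
            + complex_of_real (2 * a\<^sup>2 * (k \<bullet> h)) * modulated_cutoff y a (Suc 0) k)
          + (- 1) * (complex_of_real (- (y \<bullet> h)) * (\<i> * modulated_cutoff y b 0 k)
            + complex_of_real (2 * b\<^sup>2 * (k \<bullet> h)) * modulated_cutoff y b (Suc 0) k))) (at k)" for k
          unfolding d_def by (intro has_derivative_add has_derivative_mult_right modulated_cutoff_has_derivative)
        have "partial_deriv i g = (\<lambda>k. (- \<i> * complex_of_real (y $ i)) * d k + 1 * (complex_of_real (2 * a\<^sup>2) * (complex_of_real (k $ i) * modulated_cutoff y a (Suc 0) k)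
            + complex_of_real (- 2 * b\<^sup>2) * (complex_of_real (k $ i) * modulated_cutoff y b (Suc 0) k)))"
          unfolding 1 by (rule ext, subst partial_deriv_eqI[OF D]) (simp add: d_def inner_axis algebra_simps)
        moreover have "d \<in> coord_span ?G" by (intro coord_span.base) blast
        ultimately show ?thesis using S[of 0] by (simp only:) (intro coord_span.lincomb coord_span.coord)
      next
        case (2 n)
        show ?thesis unfolding 2 partial_deriv_modulated_cutoff by (intro coord_span.lincomb coord_span.coord S)
      next
        case (3 n)
        show ?thesis unfolding 3 partial_deriv_modulated_cutoff by (intro coord_span.lincomb coord_span.coord S)
      qed
    qed
    show "g z = 0" if "z \<in> {0}" for z
      using g that by (auto simp: d_def modulated_cutoff_def cutoff_at_0 simp del: cutoff.simps)
  qed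
  moreover have "d \<in> coord_span ?G" by (intro coord_span.base) blast
  ultimately have "d \<in> Psi" unfolding Psi_eq_flat by blast
  thus ?thesis by (simp add: d_def)
qed

section \<open>Approximate identities from test functions\<close>

text \<open>The kernel of the approximate identity, up to a nonzero factor. By inversion its integral is proportional to the
value of the cutoff at the origin, which is positive.\<close>

definition bump_kernel :: "'d::finite cfun" where
  "bump_kernel = fourier (modulated_cutoff 0 1 0)"

lemma bump_kernel_schwartz: "bump_kernel \<in> schwartz_flat_on {}"
  unfolding bump_kernel_def by (intro fourier_schwartz modulated_cutoff_schwartz) simp

lemma fourier_modulated_cutoff:
  fixes x y :: "real ^ 'd::finite"
  assumes a: "a > 0"
  shows "fourier (modulated_cutoff y a 0) x = complex_of_real ((1 / a) ^ CARD('d)) * bump_kernel ((1 / a) *\<^sub>R (x + y))"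
proof -
  let ?g = "\<lambda>k. exp (- \<i> * complex_of_real (((1 / a) *\<^sub>R (x + y)) \<bullet> k)) * modulated_cutoff 0 1 0 k"
  have i: "integrable lborel (modulated_cutoff 0 1 0 :: 'd cfun)"
    by (intro schwartz_flat_integrable[OF modulated_cutoff_schwartz]) simp
  have gm: "?g \<in> borel_measurable borel" using borel_measurable_integrable[OF fourier_integrable[OF i, of "(1 / a) *\<^sub>R (x + y)"]] measurable_cong_sets[OF sets_lborel refl] by blast
  have e: "exp (- \<i> * complex_of_real (x \<bullet> k)) * modulated_cutoff y a 0 k = ?g (0 + a *\<^sub>R k)" for k
  proof -
    have "((1 / a) *\<^sub>R (x + y)) \<bullet> (0 + a *\<^sub>R k) = x \<bullet> k + y \<bullet> k" using a by (simp add: inner_left_distrib)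
    hence "exp (- \<i> * complex_of_real (((1 / a) *\<^sub>R (x + y)) \<bullet> (0 + a *\<^sub>R k))) = exp (- \<i> * complex_of_real (x \<bullet> k)) * exp (- \<i> * complex_of_real (y \<bullet> k))"
      by (simp only:) (simp add: exp_add[symmetric] algebra_simps)
    moreover have "modulated_cutoff 0 1 0 (0 + a *\<^sub>R k) = complex_of_real (cutoff 0 ((norm (a *\<^sub>R k))\<^sup>2))"
      unfolding modulated_cutoff_def by (simp del: cutoff.simps)
    ultimately show ?thesis unfolding modulated_cutoff_def[of y a] by (simp only: mult.assoc)
  qed
  have "(LINT k|lborel. ?g k) = complex_of_real (a ^ CARD('d)) * (LINT k|lborel. ?g (0 + a *\<^sub>R k))"
    using lborel_integral_affine(1)[OF gm, of a 0] a by (simp add: scaleR_conv_of_real)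
  hence "complex_of_real ((1 / a) ^ CARD('d)) * (LINT k|lborel. ?g k) = complex_of_real ((1 / a) ^ CARD('d) * a ^ CARD('d)) * (LINT k|lborel. ?g (0 + a *\<^sub>R k))"
    by (simp only: of_real_mult mult.assoc)
  moreover have "(1 / a) ^ CARD('d) * a ^ CARD('d) = 1" using a by (simp add: power_mult_distrib[symmetric])
  ultimately have "(LINT k|lborel. ?g (0 + a *\<^sub>R k)) = complex_of_real ((1 / a) ^ CARD('d)) * (LINT k|lborel. ?g k)"
    by (simp only: of_real_1 mult_1_left)
  thus ?thesis unfolding bump_kernel_def fourier_def e by (simp only: mult.left_commute)
qed

lemma bump_kernel_integral_nonzero: "(LINT x|lborel. bump_kernel (x :: real ^ 'd::finite)) \<noteq> 0"
proof
  assume "(LINT x|lborel. bump_kernel (x :: real ^ 'd::finite)) = 0"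
  hence "fourier (bump_kernel :: 'd cfun) 0 = 0" unfolding fourier_def by simp
  moreover have "fourier (bump_kernel :: 'd cfun) 0 = modulated_cutoff 0 1 0 (0 :: real ^ 'd)"
    unfolding bump_kernel_def by (subst fourier_fourier_schwartz[OF modulated_cutoff_schwartz]) simp_all
  moreover have "modulated_cutoff 0 1 0 (0 :: real ^ 'd) = complex_of_real cutoff_height"
    unfolding modulated_cutoff_def by (simp add: bump_integral_0)
  ultimately show False using cutoff_height_pos by simp
qed

section \<open>Functions determined by their action on test functions\<close>

text \<open>A common generalisation of \<open>L\<^sup>p\<close> for finite \<open>p \<ge> 2\<close> and of continuous functions vanishing at infinity. It is
closed under differences, so representatives from different spaces can be compared.\<close>

definition weakly_vanishing :: "'d::finite cfun \<Rightarrow> bool" where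
  "weakly_vanishing h \<longleftrightarrow> h \<in> borel_measurable borel \<and>
     (\<forall>\<tau>>0. integrable lborel (\<lambda>x. if norm (h x) > \<tau> then norm (h x) else 0))"

lemma weakly_vanishing_diff:
  assumes "weakly_vanishing f" "weakly_vanishing g" shows "weakly_vanishing (\<lambda>x. f x - g x)"
  unfolding weakly_vanishing_def
proof (intro conjI allI impI)
  have [measurable]: "f \<in> borel_measurable borel" "g \<in> borel_measurable borel" using assms by (auto simp: weakly_vanishing_def)
  show "(\<lambda>x. f x - g x) \<in> borel_measurable borel" by measurable
  fix \<tau> :: real assume \<tau>: "\<tau> > 0"
  let ?F = "\<lambda>x. if norm (f x) > \<tau> / 2 then norm (f x) else 0" and ?G = "\<lambda>x. if norm (g x) > \<tau> / 2 then norm (g x) else 0"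
  have "integrable lborel ?F" "integrable lborel ?G" using assms \<tau> unfolding weakly_vanishing_def by (metis half_gt_zero)+
  hence I: "integrable lborel (\<lambda>x. 2 * (?F x + ?G x))" by (intro integrable_mult_right Bochner_Integration.integrable_add)
  show "integrable lborel (\<lambda>x. if norm (f x - g x) > \<tau> then norm (f x - g x) else 0)"
  proof (rule Bochner_Integration.integrable_bound[OF I])
    have "norm (if norm (f x - g x) > \<tau> then norm (f x - g x) else 0) \<le> norm (2 * (?F x + ?G x))" for x
    proof -
      have "c \<le> F + G \<Longrightarrow> 0 \<le> c \<Longrightarrow> 0 \<le> F \<Longrightarrow> 0 \<le> G \<Longrightarrow> norm (if c > \<tau> then c else 0) \<le> norm (2 * ((if F > \<tau> / 2 then F else 0) + (if G > \<tau> / 2 then G else 0)))"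
        for c F G :: real using \<tau> by (auto split: if_splits)
      from this[OF norm_triangle_ineq4 norm_ge_zero norm_ge_zero norm_ge_zero] show ?thesis .
    qed
    thus "AE x in lborel. norm (if norm (f x - g x) > \<tau> then norm (f x - g x) else 0) \<le> norm (2 * (?F x + ?G x))" by simp
  qed measurable
qed

lemma weakly_vanishing_Lp:
  assumes f: "f \<in> Lp_fun p" and p: "2 \<le> p"
  shows "weakly_vanishing (f :: 'd::finite cfun)"
proof (cases "p = \<infinity>")
  case True
  hence c: "continuous_on UNIV f" and l: "(f \<longlongrightarrow> 0) at_infinity" using f by (auto simp: Lp_fun_def)
  have [measurable]: "f \<in> borel_measurable borel" using c by (rule borel_measurable_continuous_onI)
  show ?thesis unfolding weakly_vanishing_def
  proof (intro conjI allI impI)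
    fix \<tau> :: real assume \<tau>: "\<tau> > 0"
    have "eventually (\<lambda>x. norm (f x) < \<tau>) at_infinity" using tendstoD[OF l \<tau>] by simp
    then obtain R where R: "\<And>x. norm x \<ge> R \<Longrightarrow> norm (f x) < \<tau>" unfolding eventually_at_infinity by blast
    have "compact (f ` cball 0 R)" by (intro compact_continuous_image continuous_on_subset[OF c]) auto
    then obtain B where B: "\<And>x. x \<in> cball 0 R \<Longrightarrow> norm (f x) \<le> B" using compact_imp_bounded bounded_iff by (metis imageI)
    show "integrable lborel (\<lambda>x. if norm (f x) > \<tau> then norm (f x) else 0)"
    proof (rule Bochner_Integration.integrable_bound)
      have "emeasure lborel (cball (0::real^'d) R) < \<infinity>" using emeasure_compact_finite[OF compact_cball] by simp
      thus "integrable lborel (\<lambda>x::real^'d. B * indicator (cball 0 R) x)"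
        by (intro integrable_mult_right integrable_real_indicator) auto
      have "norm (if norm (f x) > \<tau> then norm (f x) else 0) \<le> norm (B * indicator (cball 0 R) x)" for x
      proof (cases "norm (f x) > \<tau>")
        case True
        hence "x \<in> cball 0 R" using R[of x] by (auto simp: not_le) (meson less_asym linear)
        thus ?thesis using True B[of x] by simp
      qed simp
      thus "AE x in lborel. norm (if norm (f x) > \<tau> then norm (f x) else 0) \<le> norm (B * indicator (cball 0 R) x)" by simp
    qed measurable
  qed measurable
next
  case False
  define q where "q = enn2real p"
  have "enn2real 2 \<le> q" unfolding q_def using p False by (intro enn2real_mono) (auto simp: less_top)
  hence q: "q \<ge> 1" by simp
  have fm [measurable]: "f \<in> borel_measurable borel" and fi: "integrable lborel (\<lambda>x. norm (f x) powr q)"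
    using f False by (auto simp: Lp_fun_def q_def)
  show ?thesis unfolding weakly_vanishing_def
  proof (intro conjI allI impI fm)
    fix \<tau> :: real assume \<tau>: "\<tau> > 0"
    show "integrable lborel (\<lambda>x. if norm (f x) > \<tau> then norm (f x) else 0)"
    proof (rule Bochner_Integration.integrable_bound[OF integrable_mult_right[OF fi, of "\<tau> powr (1 - q)"]])
      have "norm (if norm (f x) > \<tau> then norm (f x) else 0) \<le> norm (\<tau> powr (1 - q) * norm (f x) powr q)" for x
      proof (cases "norm (f x) > \<tau>")
        case True
        have "norm (f x) = norm (f x) powr (1 - q) * norm (f x) powr q" using True \<tau> by (simp add: powr_add[symmetric])
        also have "\<dots> \<le> \<tau> powr (1 - q) * norm (f x) powr q"
          using True \<tau> q by (intro mult_right_mono powr_mono2') auto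
        finally show ?thesis using True by simp
      qed simp
      thus "AE x in lborel. norm (if norm (f x) > \<tau> then norm (f x) else 0) \<le> norm (\<tau> powr (1 - q) * norm (f x) powr q)" by simp
    qed measurable
  qed
qed

text \<open>The part of \<open>h\<close> below the level \<open>\<tau>\<close> is paired with the \<open>L\<^sup>1\<close> norm of \<open>g\<close>, the rest with its supremum. For a
dilated kernel that spreads out, the norm stays fixed and the supremum tends to zero.\<close>

lemma weakly_vanishing_mult:
  fixes h g :: "'d::finite cfun"
  assumes h: "weakly_vanishing h" and g: "integrable lborel g" and M: "\<And>x. norm (g x) \<le> M" and \<tau>: "\<tau> > 0"
  shows "integrable lborel (\<lambda>x. h x * g x)"
    and "norm (LINT x|lborel. h x * g x) \<le> \<tau> * (LINT x|lborel. norm (g x)) + M * (LINT x|lborel. (if norm (h x) > \<tau> then norm (h x) else 0))"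
proof -
  let ?H = "\<lambda>x. if norm (h x) > \<tau> then norm (h x) else 0"
  have [measurable]: "h \<in> borel_measurable borel" "g \<in> borel_measurable borel"
    using h borel_measurable_integrable[OF g] by (auto simp: weakly_vanishing_def)
  have H: "integrable lborel ?H" using h \<tau> by (auto simp: weakly_vanishing_def)
  have M0: "M \<ge> 0" using M[of 0] norm_ge_zero order_trans by blast
  have I: "integrable lborel (\<lambda>x. \<tau> * norm (g x) + M * ?H x)"
    by (intro Bochner_Integration.integrable_add integrable_mult_right integrable_norm g H)
  have b: "norm (h x * g x) \<le> \<tau> * norm (g x) + M * ?H x" for x
  proof (cases "norm (h x) > \<tau>")
    case True
    have "norm (h x) * norm (g x) \<le> norm (h x) * M" by (intro mult_left_mono M) auto
    moreover have "0 \<le> \<tau> * norm (g x)" using \<tau> by simp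
    ultimately show ?thesis using True by (simp add: norm_mult mult.commute)
  next
    case False
    thus ?thesis by (simp add: norm_mult mult_right_mono)
  qed
  show J: "integrable lborel (\<lambda>x. h x * g x)"
  proof (rule Bochner_Integration.integrable_bound[OF I])
    show "AE x in lborel. norm (h x * g x) \<le> norm (\<tau> * norm (g x) + M * ?H x)"
      by (intro AE_I2 order_trans[OF b]) (simp only: real_norm_def abs_ge_self)
  qed measurable
  have "norm (LINT x|lborel. h x * g x) \<le> (LINT x|lborel. \<tau> * norm (g x) + M * ?H x)"
    by (rule order_trans[OF integral_norm_bound integral_mono[OF integrable_norm[OF J] I b]])
  also have "\<dots> = \<tau> * (LINT x|lborel. norm (g x)) + M * (LINT x|lborel. ?H x)"
    by (subst Bochner_Integration.integral_add[OF integrable_mult_right[OF integrable_norm[OF g]] integrable_mult_right[OF H]]) (simp only: integral_mult_right_zero)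
  finally show "norm (LINT x|lborel. h x * g x) \<le> \<tau> * (LINT x|lborel. norm (g x)) + M * (LINT x|lborel. ?H x)" .
qed

text \<open>Differences of dilated kernels lie in \<open>\<Phi>\<close>, so the pairing of \<open>h\<close> with the normalised kernel does not depend on
the dilation. It tends to zero as the kernel spreads out, hence it vanishes.\<close>

lemma annihilator_bump_kernel:
  fixes h :: "'d::finite cfun"
  assumes h: "weakly_vanishing h" and ann: "\<And>\<phi>. \<phi> \<in> Phi \<Longrightarrow> (LINT x|lborel. h x * \<phi> x) = 0" and a: "a > 0"
  shows "(LINT x|lborel. h x * bump_kernel ((1 / a) *\<^sub>R (x + y))) = 0"
proof -
  define e where "e b = fourier (modulated_cutoff y b 0 :: 'd cfun)" for b
  have ms: "modulated_cutoff y b 0 \<in> schwartz_flat_on {}" if "b > 0" for b using that by (rule modulated_cutoff_schwartz)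
  have es: "e b \<in> schwartz_flat_on {}" if "b > 0" for b unfolding e_def using ms[OF that] by (rule fourier_schwartz)
  have ei: "integrable lborel (e b)" if "b > 0" for b using es[OF that] by (rule schwartz_flat_integrable)
  have ee: "e b x = complex_of_real ((1 / b) ^ CARD('d)) * bump_kernel ((1 / b) *\<^sub>R (x + y))" if "b > 0" for b x
    unfolding e_def by (rule fourier_modulated_cutoff[OF that])
  obtain M where M: "M \<ge> 0" "\<And>x. (1 + norm x) ^ 0 * norm (bump_kernel (x :: real ^ 'd)) \<le> M"
    using schwartz_flat_bound[OF bump_kernel_schwartz, of 0] by blast
  define L where "L = (LINT x|lborel. norm (bump_kernel (x :: real ^ 'd)))"
  have L0: "L \<ge> 0" unfolding L_def by (intro integral_nonneg_AE) auto
  have bm: "(bump_kernel :: 'd cfun) \<in> borel_measurable borel" by (rule schwartz_flat_measurable[OF bump_kernel_schwartz])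
  have eL: "(LINT x|lborel. norm (e b x)) = L" if b: "b > 0" for b
  proof -
    have "L = \<bar>1 / b\<bar> ^ CARD('d) *\<^sub>R (LINT x|lborel. norm (bump_kernel ((1 / b) *\<^sub>R y + (1 / b) *\<^sub>R x)))"
      unfolding L_def using lborel_integral_affine(1)[of "\<lambda>x. norm (bump_kernel (x :: real ^ 'd))" "1 / b" "(1 / b) *\<^sub>R y"] bm b by simp
    also have "\<dots> = (LINT x|lborel. \<bar>1 / b\<bar> ^ CARD('d) *\<^sub>R norm (bump_kernel ((1 / b) *\<^sub>R y + (1 / b) *\<^sub>R x)))"
      by (rule integral_scaleR_right[symmetric])
    also have "\<dots> = (LINT x|lborel. norm (e b x))"
      unfolding ee[OF b] norm_mult norm_of_real using b
      by (intro Bochner_Integration.integral_cong refl) (simp add: scaleR_add_right add.commute)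
    finally show ?thesis ..
  qed
  have eM: "norm (e b x) \<le> (1 / b) ^ CARD('d) * M" if "b > 0" for b x
    unfolding ee[OF that] norm_mult norm_of_real using that M(2)[of "(1 / b) *\<^sub>R (x + y)"] by (intro mult_mono) auto
  have same: "(LINT x|lborel. h x * e a x) = (LINT x|lborel. h x * e b x)" if b: "b > 0" for b
  proof -
    have "(\<lambda>x. e a x - e b x) = fourier (\<lambda>k. modulated_cutoff y a 0 k - modulated_cutoff y b 0 k)"
      unfolding e_def fourier_def right_diff_distrib
      using fourier_integrable[OF schwartz_flat_integrable[OF ms[OF a]]] fourier_integrable[OF schwartz_flat_integrable[OF ms[OF b]]]
      by (subst Bochner_Integration.integral_diff) (auto simp: right_diff_distrib)
    hence "(\<lambda>x. e a x - e b x) \<in> Phi" using fourier_Psi_Phi[OF modulated_cutoff_diff_Psi[OF a b, of y]] by simp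
    hence "0 = (LINT x|lborel. h x * (e a x - e b x))" using ann by simp
    also have "\<dots> = (LINT x|lborel. h x * e a x) - (LINT x|lborel. h x * e b x)"
      unfolding right_diff_distrib
      by (rule Bochner_Integration.integral_diff; rule weakly_vanishing_mult(1)[OF h ei eM zero_less_one]) (use a b in simp_all)
    finally show ?thesis by simp
  qed
  have "norm (LINT x|lborel. h x * e a x) \<le> \<tau> * L" if \<tau>: "\<tau> > 0" for \<tau>
  proof (rule tendsto_le[OF _ _ tendsto_const])
    \<comment> \<open>As \<open>b\<close> grows, only the part of \<open>h\<close> below the level \<open>\<tau>\<close> survives in the estimate.\<close>
    let ?T = "LINT x|lborel. (if norm (h x) > \<tau> then norm (h x) else 0)"
    have A: "((\<lambda>b. (1 / b) ^ CARD('d)) \<longlongrightarrow> 0 ^ CARD('d)) (at_top :: real filter)"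
      by (intro tendsto_power tendsto_divide_0[OF tendsto_const] filterlim_at_top_imp_at_infinity filterlim_ident)
    have "((\<lambda>b. \<tau> * L + (1 / b) ^ CARD('d) * M * ?T) \<longlongrightarrow> \<tau> * L + 0 ^ CARD('d) * M * ?T) (at_top :: real filter)"
      by (rule tendsto_add[OF tendsto_const tendsto_mult[OF tendsto_mult[OF A tendsto_const] tendsto_const]])
    moreover have "(0::real) ^ CARD('d) = 0" by simp
    ultimately show "((\<lambda>b. \<tau> * L + (1 / b) ^ CARD('d) * M * ?T) \<longlongrightarrow> \<tau> * L) (at_top :: real filter)"
      by (simp only: mult_zero_left add_0_right)
    show "\<forall>\<^sub>F b in at_top. norm (LINT x|lborel. h x * e a x) \<le> \<tau> * L + (1 / b) ^ CARD('d) * M * ?T"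
      using eventually_gt_at_top[of "0::real"]
    proof eventually_elim
      fix b :: real assume b: "b > 0"
      show "norm (LINT x|lborel. h x * e a x) \<le> \<tau> * L + (1 / b) ^ CARD('d) * M * ?T"
        using weakly_vanishing_mult(2)[OF h ei[OF b] eM[OF b] \<tau>] unfolding same[OF b] eL[OF b] .
    qed
  qed simp
  hence le: "norm (LINT x|lborel. h x * e a x) \<le> \<tau> * L" if "\<tau> > 0" for \<tau> using that .
  have "norm (LINT x|lborel. h x * e a x) \<le> 0"
  proof (rule field_le_epsilon)
    fix \<epsilon> :: real assume \<epsilon>: "\<epsilon> > 0"
    have "norm (LINT x|lborel. h x * e a x) \<le> (\<epsilon> / (L + 1)) * L" using \<epsilon> L0 by (intro le) simp
    also have "\<dots> \<le> \<epsilon>" using \<epsilon> L0 by (simp add: field_simps)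
    finally show "norm (LINT x|lborel. h x * e a x) \<le> 0 + \<epsilon>" by simp
  qed
  hence "0 = (LINT x|lborel. complex_of_real ((1 / a) ^ CARD('d)) * (h x * bump_kernel ((1 / a) *\<^sub>R (x + y))))"
    unfolding ee[OF a] by (simp add: mult.left_commute)
  also have "\<dots> = complex_of_real ((1 / a) ^ CARD('d)) * (LINT x|lborel. h x * bump_kernel ((1 / a) *\<^sub>R (x + y)))"
    by (rule integral_mult_right_zero)
  finally show ?thesis using a by simp
qed

text \<open>The positive and negative parts define measures that agree on boxes, and boxes generate the Borel sets.\<close>

lemma AE_zero_if_box_integrals_zero_real:
  fixes g :: "'a::euclidean_space \<Rightarrow> real"
  assumes [measurable]: "g \<in> borel_measurable borel"
    and int: "\<And>l u. integrable lborel (\<lambda>x. g x * indicator (box l u) x)"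
    and zero: "\<And>l u. (LINT x|lborel. g x * indicator (box l u) x) = 0"
  shows "AE x in lborel. g x = 0"
proof -
  let ?p = "\<lambda>x. ennreal (g x)" and ?n = "\<lambda>x. ennreal (- g x)"
  have bm: "box l u \<in> sets borel" for l u :: 'a by simp
  have val: "emeasure (density lborel ?p) (box l u) = emeasure (density lborel ?n) (box l u) \<and> emeasure (density lborel ?p) (box l u) \<noteq> \<infinity>" for l u
  proof -
    let ?gp = "\<lambda>x. max 0 (g x * indicator (box l u) x)" and ?gn = "\<lambda>x. max 0 (- (g x * indicator (box l u) x))"
    have ip: "integrable lborel ?gp" by (intro integrable_max Bochner_Integration.integrable_zero int)
    have i_n: "integrable lborel ?gn" by (intro integrable_max Bochner_Integration.integrable_zero Bochner_Integration.integrable_minus int)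
    have "(\<lambda>x. ?gp x - ?gn x) = (\<lambda>x. g x * indicator (box l u) x)" by (auto simp: fun_eq_iff max_def)
    hence "(LINT x|lborel. ?gp x) - (LINT x|lborel. ?gn x) = 0"
      using Bochner_Integration.integral_diff[OF ip i_n] zero by simp
    moreover have "emeasure (density lborel ?p) (box l u) = ennreal (LINT x|lborel. ?gp x)"
    proof -
      have "emeasure (density lborel ?p) (box l u) = (\<integral>\<^sup>+x. ennreal (g x) * indicator (box l u) x \<partial>lborel)"
        by (rule emeasure_density) (use bm in simp_all)
      also have "\<dots> = (\<integral>\<^sup>+x. ennreal (?gp x) \<partial>lborel)"
        by (intro nn_integral_cong) (auto simp: indicator_def max_def ennreal_neg)
      also have "\<dots> = ennreal (LINT x|lborel. ?gp x)" by (intro nn_integral_eq_integral ip) auto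
      finally show ?thesis .
    qed
    moreover have "emeasure (density lborel ?n) (box l u) = ennreal (LINT x|lborel. ?gn x)"
    proof -
      have "emeasure (density lborel ?n) (box l u) = (\<integral>\<^sup>+x. ennreal (- g x) * indicator (box l u) x \<partial>lborel)"
        by (rule emeasure_density) (use bm in simp_all)
      also have "\<dots> = (\<integral>\<^sup>+x. ennreal (?gn x) \<partial>lborel)"
        by (intro nn_integral_cong) (auto simp: indicator_def max_def ennreal_neg)
      also have "\<dots> = ennreal (LINT x|lborel. ?gn x)" by (intro nn_integral_eq_integral i_n) auto
      finally show ?thesis .
    qed
    ultimately show ?thesis by simp
  qed
  have "density lborel ?p = density lborel ?n"
  proof (rule measure_eqI_generator_eq[where E = "range (\<lambda>(a, b). box a b)" and \<Omega> = UNIV and A = "\<lambda>i::nat. box (- (real i *\<^sub>R One)) (real i *\<^sub>R One)"])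
    show "Int_stable (range (\<lambda>(a, b). box a b :: 'a set))"
      by (auto simp: Int_stable_def box_Int_box)
    show "\<And>X. X \<in> range (\<lambda>(a, b). box a b) \<Longrightarrow> emeasure (density lborel ?p) X = emeasure (density lborel ?n) X"
      using val by auto
    show "sets (density lborel ?p) = sigma_sets UNIV (range (\<lambda>(a, b). box a b))" "sets (density lborel ?n) = sigma_sets UNIV (range (\<lambda>(a, b). box a b))"
      by (simp_all add: borel_eq_box)
    show "(\<Union>i::nat. box (- (real i *\<^sub>R One)) (real i *\<^sub>R One)) = (UNIV :: 'a set)" by (rule UN_box_eq_UNIV)
    show "emeasure (density lborel ?p) (box (- (real i *\<^sub>R One)) (real i *\<^sub>R One)) \<noteq> \<infinity>" for i using val by blast
  qed auto
  hence "AE x in lborel. ?p x = ?n x" by (intro sigma_finite_measure.density_unique[OF sigma_finite_lborel]) measurable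
  thus ?thesis
  proof eventually_elim
    fix x assume e: "ennreal (g x) = ennreal (- g x)"
    show "g x = 0"
    proof (cases "g x \<ge> 0")
      case True
      hence "ennreal (g x) = 0" using e ennreal_neg[of "- g x"] by simp
      thus ?thesis using True by simp
    next
      case False
      hence "ennreal (- g x) = 0" using e ennreal_neg[of "g x"] by simp
      thus ?thesis using False by simp
    qed
  qed
qed

lemma AE_zero_if_box_integrals_zero:
  fixes h :: "'a::euclidean_space \<Rightarrow> complex"
  assumes [measurable]: "h \<in> borel_measurable borel"
    and int: "\<And>l u. integrable lborel (\<lambda>x. h x * indicator (box l u) x)"
    and zero: "\<And>l u. (LINT x|lborel. h x * indicator (box l u) x) = 0"
  shows "AE x in lborel. h x = 0"
proof -
  have re: "Re (h x) * indicator (box l u) x = Re (h x * indicator (box l u) x)"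
   and im: "Im (h x) * indicator (box l u) x = Im (h x * indicator (box l u) x)" for x l u
    by (auto simp: indicator_def)
  have "AE x in lborel. Re (h x) = 0"
  proof (rule AE_zero_if_box_integrals_zero_real)
    show "integrable lborel (\<lambda>x. Re (h x) * indicator (box l u) x)" for l u unfolding re using int by (rule integrable_Re)
    show "(LINT x|lborel. Re (h x) * indicator (box l u) x) = 0" for l u unfolding re using integral_Re[OF int] zero by simp
  qed measurable
  moreover have "AE x in lborel. Im (h x) = 0"
  proof (rule AE_zero_if_box_integrals_zero_real)
    show "integrable lborel (\<lambda>x. Im (h x) * indicator (box l u) x)" for l u unfolding im using int by (rule integrable_Im)
    show "(LINT x|lborel. Im (h x) * indicator (box l u) x) = 0" for l u unfolding im using integral_Im[OF int] zero by simp
  qed measurable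
  ultimately show ?thesis by eventually_elim (simp add: complex_eq_iff)
qed

text \<open>The convolution of the indicator of a box with the kernel at scale \<open>a\<close>, written with the kernel variable scaled
to size one, which suits the limit \<open>a \<rightarrow> 0\<close>.\<close>

definition box_average :: "real \<Rightarrow> real ^ 'd::finite \<Rightarrow> real ^ 'd \<Rightarrow> real ^ 'd \<Rightarrow> complex" where
  "box_average a l u x = (LINT z|lborel. bump_kernel z * indicator (box l u) (x - a *\<^sub>R z))"

lemma bump_kernel_measurable [measurable]: "(bump_kernel :: 'd::finite cfun) \<in> borel_measurable borel"
  by (rule schwartz_flat_measurable[OF bump_kernel_schwartz])

lemma bump_kernel_integrable: "integrable lborel (bump_kernel :: 'd::finite cfun)"
  by (rule schwartz_flat_integrable[OF bump_kernel_schwartz])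

text \<open>The bound is uniform for \<open>a \<le> 1\<close>, as a dominating function for the limit \<open>a \<rightarrow> 0\<close> is needed. If \<open>x - a z\<close> is in the
box, then \<open>1 + norm x\<close> is at most a constant times \<open>1 + norm z\<close>, and the kernel decays rapidly in \<open>z\<close>.\<close>

lemma box_average_bound:
  fixes l u :: "real ^ 'd::finite"
  shows "\<exists>C\<ge>0. \<forall>a x. 0 < a \<longrightarrow> a \<le> 1 \<longrightarrow> (LINT z|lborel. norm (bump_kernel z) * indicator (box l u) (x - a *\<^sub>R z)) \<le> C * inverse ((1 + norm x) ^ (CARD('d) + 1))"
proof -
  let ?N = "CARD('d) + 1"
  have "bounded (box l u)" by (rule bounded_box)
  then obtain R where R: "R > 0" "\<And>y. y \<in> box l u \<Longrightarrow> norm y \<le> R" using bounded_pos by metis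
  obtain B where B: "\<And>x :: real ^ 'd. (1 + norm x) ^ (?N + ?N) * norm (bump_kernel x) \<le> B"
    using schwartz_flat_bound[OF bump_kernel_schwartz, of "?N + ?N"] by blast
  let ?k = "\<lambda>z :: real ^ 'd. (1 + norm z) ^ ?N * norm (bump_kernel z)"
  have ki: "integrable lborel ?k"
  proof -
    let ?f = "\<lambda>z :: real ^ 'd. complex_of_real (?k z)"
    have "integrable lborel (\<lambda>z. norm z ^ 0 * norm (?f z))"
    proof (rule integrable_decay)
      show "?f \<in> borel_measurable borel" by measurable
      show "(1 + norm x) ^ (0 + ?N) * norm (?f x) \<le> B" for x
      proof -
        have "norm (?f x) = ?k x" unfolding norm_of_real by (simp add: abs_mult power_abs)
        thus ?thesis using B[of x] by (simp only: power_add mult.assoc add_0)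
      qed
    qed
    moreover have "norm (?f z) = ?k z" for z unfolding norm_of_real by (simp add: abs_mult power_abs)
    ultimately show ?thesis by (simp only: power_0 mult_1_left)
  qed
  define C where "C = (1 + R) ^ ?N * (LINT z|lborel. ?k z)"
  have "C \<ge> 0" unfolding C_def using R by (intro mult_nonneg_nonneg integral_nonneg_AE) auto
  moreover have "(LINT z|lborel. norm (bump_kernel z) * indicator (box l u) (x - a *\<^sub>R z)) \<le> C * inverse ((1 + norm x) ^ ?N)"
    if a: "0 < a" "a \<le> 1" for a and x :: "real ^ 'd"
  proof -
    have p: "(1 + norm x) ^ ?N > 0" by (intro zero_less_power) (simp add: add_pos_nonneg)
    have bxm: "(\<lambda>z. indicator (box l u) (x - a *\<^sub>R z) :: real) \<in> borel_measurable borel"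
      by (rule borel_measurable_indicator') measurable
    have "(LINT z|lborel. norm (bump_kernel z) * indicator (box l u) (x - a *\<^sub>R z)) \<le> (LINT z|lborel. ((1 + R) ^ ?N * inverse ((1 + norm x) ^ ?N)) * ?k z)"
    proof (rule integral_mono')
      show "integrable lborel (\<lambda>z. ((1 + R) ^ ?N * inverse ((1 + norm x) ^ ?N)) * ?k z)" by (intro integrable_mult_right ki)
      fix z :: "real ^ 'd"
      show "0 \<le> ((1 + R) ^ ?N * inverse ((1 + norm x) ^ ?N)) * ?k z" using R p by (intro mult_nonneg_nonneg) auto
      show "norm (bump_kernel z) * indicator (box l u) (x - a *\<^sub>R z) \<le> ((1 + R) ^ ?N * inverse ((1 + norm x) ^ ?N)) * ?k z"
      proof (cases "x - a *\<^sub>R z \<in> box l u")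
        case True
        have "norm x \<le> norm (x - a *\<^sub>R z) + norm (a *\<^sub>R z)" using norm_triangle_ineq[of "x - a *\<^sub>R z" "a *\<^sub>R z"] by simp
        also have "\<dots> \<le> R + norm z" using R(2)[OF True] a by (intro add_mono) (auto intro: mult_left_le_one_le)
        finally have "1 + norm x \<le> 1 + R + norm z" by simp
        also have "\<dots> \<le> (1 + R) * (1 + norm z)" using R(1) by (simp add: algebra_simps)
        finally have "(1 + norm x) ^ ?N \<le> ((1 + R) * (1 + norm z)) ^ ?N" by (intro power_mono) auto
        hence "(1 + norm x) ^ ?N * norm (bump_kernel z) \<le> ((1 + R) * (1 + norm z)) ^ ?N * norm (bump_kernel z)" by (intro mult_right_mono) auto
        hence "norm (bump_kernel z) * (1 + norm x) ^ ?N \<le> (1 + R) ^ ?N * ?k z" by (simp only: power_mult_distrib mult.assoc mult.commute mult.left_commute)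
        hence "norm (bump_kernel z) \<le> ((1 + R) ^ ?N * ?k z) / (1 + norm x) ^ ?N" by (simp only: pos_le_divide_eq[OF p])
        hence "norm (bump_kernel z) \<le> ((1 + R) ^ ?N * inverse ((1 + norm x) ^ ?N)) * ?k z"
          by (simp only: divide_inverse mult.assoc mult.commute mult.left_commute)
        thus ?thesis using True by simp
      next
        case False
        have "0 \<le> ((1 + R) ^ ?N * inverse ((1 + norm x) ^ ?N)) * ?k z" using R p by (intro mult_nonneg_nonneg) auto
        thus ?thesis using False by simp
      qed
    qed
    also have "\<dots> = ((1 + R) ^ ?N * inverse ((1 + norm x) ^ ?N)) * (LINT z|lborel. ?k z)" by (rule integral_mult_right_zero)
    also have "\<dots> = C * inverse ((1 + norm x) ^ ?N)" unfolding C_def by (simp only: mult.assoc mult.commute mult.left_commute)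
    finally show ?thesis .
  qed
  ultimately show ?thesis by blast
qed

lemma indicator_box_measurable [measurable]:
  "(\<lambda>p. indicator (box l u) (fst p - a *\<^sub>R snd p) :: real) \<in> borel_measurable (borel \<Otimes>\<^sub>M (borel :: (real ^ 'd::finite) measure))"
proof -
  have "(\<lambda>p. fst p - a *\<^sub>R snd p) \<in> measurable (borel \<Otimes>\<^sub>M borel) (borel :: (real ^ 'd) measure)" by measurable
  from measurable_compose[OF this borel_measurable_indicator[of "box l u"]] show ?thesis by simp
qed

lemma box_average_measurable:
  fixes l u :: "real ^ 'd::finite"
  shows "box_average a l u \<in> borel_measurable borel"
    and "(\<lambda>x. LINT z|lborel. norm (bump_kernel z) * indicator (box l u) (x - a *\<^sub>R z)) \<in> borel_measurable borel"
proof -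
  have "(\<lambda>p. bump_kernel (snd p) * complex_of_real (indicator (box l u) (fst p - a *\<^sub>R snd p))) \<in> borel_measurable (borel \<Otimes>\<^sub>M lborel)"
    by measurable
  hence "(\<lambda>(x, z). bump_kernel z * complex_of_real (indicator (box l u) (x - a *\<^sub>R z))) \<in> borel_measurable (borel \<Otimes>\<^sub>M lborel)"
    by (simp add: case_prod_beta')
  from lborel.borel_measurable_lebesgue_integral[OF this]
  show "box_average a l u \<in> borel_measurable borel" unfolding box_average_def[abs_def] by (simp add: of_real_indicator)
  have "(\<lambda>p. norm (bump_kernel (snd p)) * indicator (box l u) (fst p - a *\<^sub>R snd p)) \<in> borel_measurable (borel \<Otimes>\<^sub>M lborel)"
    by measurable
  hence "(\<lambda>(x, z). norm (bump_kernel z) * indicator (box l u) (x - a *\<^sub>R z)) \<in> borel_measurable (borel \<Otimes>\<^sub>M lborel)"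
    by (simp add: case_prod_beta')
  from lborel.borel_measurable_lebesgue_integral[OF this]
  show "(\<lambda>x. LINT z|lborel. norm (bump_kernel z) * indicator (box l u) (x - a *\<^sub>R z)) \<in> borel_measurable borel" .
qed

lemma indicator_complex_measurable [measurable]:
  assumes "A \<in> sets M" shows "(indicator A :: _ \<Rightarrow> complex) \<in> borel_measurable M"
proof -
  have "(\<lambda>x. complex_of_real (indicator A x)) \<in> borel_measurable M" using assms by measurable
  thus ?thesis by (simp add: of_real_indicator)
qed

text \<open>By Fubini the pairing is an integral over the box of pairings of \<open>h\<close> with translates of one dilated kernel, all of
which vanish.\<close>

lemma annihilator_box_average:
  fixes h :: "'d::finite cfun"
  assumes h: "weakly_vanishing h" and ann: "\<And>\<phi>. \<phi> \<in> Phi \<Longrightarrow> (LINT x|lborel. h x * \<phi> x) = 0"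
    and a: "0 < a" "a \<le> 1"
  shows "(LINT x|lborel. h x * box_average a l u x) = 0"
proof -
  let ?f = "\<lambda>x y :: real ^ 'd. bump_kernel ((1 / a) *\<^sub>R (x - y)) * indicator (box l u) y"
  let ?W = "\<lambda>x :: real ^ 'd. LINT z|lborel. norm (bump_kernel z) * indicator (box l u) (x - a *\<^sub>R z)"
  let ?K = "\<lambda>x y. h x * ?f x y"
  have hm [measurable]: "h \<in> borel_measurable borel" using h by (simp add: weakly_vanishing_def)
  have fm [measurable]: "?f x \<in> borel_measurable borel" for x by measurable
  have fnm: "(\<lambda>y. norm (?f x y)) \<in> borel_measurable borel" for x by measurable
  have fz: "?f x (x + (- a) *\<^sub>R z) = bump_kernel z * indicator (box l u) (x - a *\<^sub>R z)" for x z using a by simp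
  have fnz: "norm (?f x (x + (- a) *\<^sub>R z)) = norm (bump_kernel z) * indicator (box l u) (x - a *\<^sub>R z)" for x z
    unfolding fz by (simp add: norm_mult indicator_def)
  have na: "- a \<noteq> 0" "\<bar>- a\<bar> ^ DIM(real ^ 'd) = a ^ CARD('d)" using a by simp_all
  \<comment> \<open>Substituting \<open>y = x - a z\<close> relates the kernel at scale \<open>a\<close> to \<^const>\<open>box_average\<close>.\<close>
  have f1: "(LINT y|lborel. ?f x y) = complex_of_real (a ^ CARD('d)) * box_average a l u x" for x
    unfolding lborel_integral_affine(1)[OF fm na(1), of x x] fz na(2) box_average_def scaleR_conv_of_real[where 'a = complex] ..
  have f2: "(LINT y|lborel. norm (?f x y)) = a ^ CARD('d) * ?W x" for x
    unfolding lborel_integral_affine(1)[OF fnm na(1), of x x] fnz na(2) real_scaleR_def ..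
  have f3: "integrable lborel (?f x)" for x
    unfolding lborel_integral_affine(2)[OF fm na(1), of x x] fz
  proof (rule Bochner_Integration.integrable_bound[OF bump_kernel_integrable])
    have "(\<lambda>z::real^'d. x - a *\<^sub>R z) \<in> measurable lborel borel" by measurable
    hence "(\<lambda>z. indicator (box l u) (x - a *\<^sub>R z) :: complex) \<in> borel_measurable lborel"
      by (rule measurable_compose) measurable
    thus "(\<lambda>z. bump_kernel z * indicator (box l u) (x - a *\<^sub>R z)) \<in> borel_measurable lborel" by measurable
    show "AE z in lborel. norm (bump_kernel z * indicator (box l u) (x - a *\<^sub>R z)) \<le> norm (bump_kernel z)"
      by (intro AE_I2) (auto simp: indicator_def)
  qed
  obtain C where C: "C \<ge> 0" "\<And>x. ?W x \<le> C * inverse ((1 + norm x) ^ (CARD('d) + 1))" using box_average_bound[of l u] a by blast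
  have W0: "?W x \<ge> 0" for x by (intro integral_nonneg_AE) auto
  have Wi: "integrable lborel ?W"
  proof (rule Bochner_Integration.integrable_bound[OF integrable_mult_right[OF integrable_inverse_weight, of C]])
    show "?W \<in> borel_measurable lborel" using box_average_measurable(2) by simp
    show "AE x in lborel. norm (?W x) \<le> norm (C * inverse ((1 + norm x) ^ (CARD('d) + 1)))"
      using W0 C by (intro AE_I2) (auto intro: order_trans)
  qed
  have WC: "?W x \<le> C" for x
  proof -
    have "inverse ((1 + norm x) ^ (CARD('d) + 1)) \<le> 1" by (intro inverse_le_1_iff[THEN iffD2] disjI2 one_le_power) simp
    hence "C * inverse ((1 + norm x) ^ (CARD('d) + 1)) \<le> C * 1" using C(1) by (intro mult_left_mono)
    thus ?thesis using C(2)[of x] by simp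
  qed
  have I: "integrable (lborel \<Otimes>\<^sub>M lborel) (case_prod ?K)"
  proof (rule lborel_pair.Fubini_integrable)
    have "(\<lambda>z. h (fst z) * (bump_kernel ((1 / a) *\<^sub>R (fst z - snd z)) * indicator (box l u) (snd z))) \<in> borel_measurable (lborel \<Otimes>\<^sub>M lborel)"
      by measurable
    thus "case_prod ?K \<in> borel_measurable (lborel \<Otimes>\<^sub>M lborel)" by (simp add: case_prod_beta')
    have "integrable lborel (\<lambda>x. h x * complex_of_real (a ^ CARD('d) * ?W x))"
    proof (rule weakly_vanishing_mult(1)[OF h _ _ zero_less_one])
      show "integrable lborel (\<lambda>x. complex_of_real (a ^ CARD('d) * ?W x))"
        unfolding complex_of_real_integrable_eq by (intro integrable_mult_right Wi)
      show "norm (complex_of_real (a ^ CARD('d) * ?W x)) \<le> a ^ CARD('d) * C" for x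
        unfolding norm_of_real abs_mult using W0[of x] WC[of x] a by (intro mult_mono) auto
    qed
    from integrable_norm[OF this]
    show "integrable lborel (\<lambda>x. LINT y|lborel. norm (case_prod ?K (x, y)))"
      unfolding prod.case norm_mult[of "h _"] integral_mult_right_zero f2 norm_of_real
      using a W0 by (simp only: abs_of_nonneg mult_nonneg_nonneg zero_le_power less_imp_le)
    show "AE x in lborel. integrable lborel (\<lambda>y. case_prod ?K (x, y))"
      unfolding prod.case by (intro AE_I2 integrable_mult_right f3)
  qed
  have "complex_of_real (a ^ CARD('d)) * (LINT x|lborel. h x * box_average a l u x) = (LINT x|lborel. (LINT y|lborel. ?K x y))"
    unfolding integral_mult_right_zero f1 mult.left_commute[of "h _" "complex_of_real (a ^ CARD('d))"] ..
  also have "\<dots> = (LINT y|lborel. (LINT x|lborel. ?K x y))" using lborel_pair.Fubini_integral[OF I] by simp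
  also have "\<dots> = (LINT y::real^'d|lborel. 0)"
  proof (intro Bochner_Integration.integral_cong refl)
    fix y
    have "(LINT x|lborel. ?K x y) = (LINT x|lborel. h x * bump_kernel ((1 / a) *\<^sub>R (x + (- y)))) * indicator (box l u) y"
      unfolding mult.assoc[symmetric] integral_mult_left_zero by simp
    thus "(LINT x|lborel. ?K x y) = 0" by (simp only: annihilator_bump_kernel[OF h ann a(1)] mult_zero_left)
  qed
  finally show ?thesis using a by simp
qed

lemma box_average_tendsto:
  fixes l u :: "real ^ 'd::finite"
  shows "AE x in lborel. (\<lambda>m. box_average (1 / real (Suc m)) l u x) \<longlonglongrightarrow> (LINT z|lborel. bump_kernel (z :: real ^ 'd)) * indicator (box l u) x"
proof -
  have "frontier (box l u) \<in> null_sets lborel"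
    using negligible_convex_frontier[OF convex_box(2), of l u] unfolding negligible_iff_null_sets
    by (subst (asm) null_sets_completion_iff) auto
  hence "AE x in lborel. x \<notin> frontier (box l u)" by (rule AE_not_in)
  thus ?thesis
  proof eventually_elim
    fix x :: "real ^ 'd" assume x: "x \<notin> frontier (box l u)"
    have "(\<lambda>m. LINT z|lborel. bump_kernel z * indicator (box l u) (x - (1 / real (Suc m)) *\<^sub>R z))
        \<longlonglongrightarrow> (LINT z|lborel. bump_kernel (z :: real ^ 'd) * indicator (box l u) x)"
    proof (rule integral_dominated_convergence)
      show "integrable lborel (\<lambda>z. norm (bump_kernel (z :: real ^ 'd)))" by (intro integrable_norm bump_kernel_integrable)
      show "(\<lambda>z::real^'d. bump_kernel z * indicator (box l u) x) \<in> borel_measurable lborel" by measurable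
      fix m :: nat
      have "(\<lambda>z::real^'d. x - (1 / real (Suc m)) *\<^sub>R z) \<in> measurable lborel borel" by measurable
      hence "(\<lambda>z. indicator (box l u) (x - (1 / real (Suc m)) *\<^sub>R z) :: complex) \<in> borel_measurable lborel"
        by (rule measurable_compose) measurable
      thus "(\<lambda>z. bump_kernel z * indicator (box l u) (x - (1 / real (Suc m)) *\<^sub>R z)) \<in> borel_measurable lborel" by measurable
      show "AE z in lborel. norm (bump_kernel z * indicator (box l u) (x - (1 / real (Suc m)) *\<^sub>R z)) \<le> norm (bump_kernel z)"
        by (intro AE_I2) (auto simp: indicator_def)
    next
      have "(\<lambda>m. bump_kernel z * indicator (box l u) (x - (1 / real (Suc m)) *\<^sub>R z)) \<longlonglongrightarrow> bump_kernel z * indicator (box l u) x" for z :: "real ^ 'd"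
      proof (rule tendsto_eventually)
        have "(\<lambda>m. x - (1 / real (Suc m)) *\<^sub>R z) \<longlonglongrightarrow> x - 0 *\<^sub>R z"
          by (intro tendsto_diff tendsto_const tendsto_scaleR LIMSEQ_Suc lim_1_over_n)
        hence L: "(\<lambda>m. x - (1 / real (Suc m)) *\<^sub>R z) \<longlonglongrightarrow> x" by simp
        show "\<forall>\<^sub>F m in sequentially. bump_kernel z * indicator (box l u) (x - (1 / real (Suc m)) *\<^sub>R z) = bump_kernel z * indicator (box l u) x"
        proof (cases "x \<in> box l u")
          case True
          from topological_tendstoD[OF L open_box True] show ?thesis by eventually_elim (use True in simp)
        next
          case False
          hence "x \<in> - closure (box l u)" using x by (simp add: frontier_def interior_open[OF open_box])
          from topological_tendstoD[OF L open_Compl[OF closed_closure] this] have "\<forall>\<^sub>F m in sequentially. x - (1 / real (Suc m)) *\<^sub>R z \<in> - closure (box l u)" .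
          thus ?thesis
          proof eventually_elim
            case (elim m)
            hence "x - (1 / real (Suc m)) *\<^sub>R z \<notin> box l u" using closure_subset by blast
            thus ?case using False by simp
          qed
        qed
      qed
      thus "AE z in lborel. (\<lambda>m. bump_kernel z * indicator (box l u) (x - (1 / real (Suc m)) *\<^sub>R z)) \<longlonglongrightarrow> bump_kernel z * indicator (box l u) x" by simp
    qed
    thus "(\<lambda>m. box_average (1 / real (Suc m)) l u x) \<longlonglongrightarrow> (LINT z|lborel. bump_kernel (z :: real ^ 'd)) * indicator (box l u) x"
      unfolding box_average_def integral_mult_left_zero .
  qed
qed

text \<open>Letting the scale of the box averages tend to zero shows that the integral of \<open>h\<close> over every box vanishes.\<close>

lemma annihilator_of_Phi_AE_zero:
  fixes h :: "'d::finite cfun"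
  assumes h: "weakly_vanishing h" and ann: "\<And>\<phi>. \<phi> \<in> Phi \<Longrightarrow> (LINT x|lborel. h x * \<phi> x) = 0"
  shows "AE x in lborel. h x = 0"
proof (rule AE_zero_if_box_integrals_zero)
  show hm [measurable]: "h \<in> borel_measurable borel" using h by (simp add: weakly_vanishing_def)
  fix l u :: "real ^ 'd"
  show int: "integrable lborel (\<lambda>x. h x * indicator (box l u) x)"
  proof (rule weakly_vanishing_mult(1)[OF h _ _ zero_less_one])
    have "emeasure lborel (box l u) < \<infinity>" using emeasure_bounded_finite[OF bounded_box] by simp
    hence "integrable lborel (indicator (box l u) :: _ \<Rightarrow> real)" by (intro integrable_real_indicator) auto
    hence "integrable lborel (\<lambda>x. complex_of_real (indicator (box l u) x))" by (simp only: complex_of_real_integrable_eq)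
    thus "integrable lborel (indicator (box l u) :: 'd cfun)" unfolding of_real_indicator .
    show "norm (indicator (box l u) x :: complex) \<le> 1" for x by (simp add: indicator_def)
  qed
  obtain C where C: "C \<ge> 0" "\<And>a x. 0 < a \<Longrightarrow> a \<le> 1 \<Longrightarrow> (LINT z|lborel. norm (bump_kernel z) * indicator (box l u) (x - a *\<^sub>R z)) \<le> C * inverse ((1 + norm x) ^ (CARD('d) + 1))"
    using box_average_bound[of l u] by blast
  let ?E = "LINT z|lborel. bump_kernel (z :: real ^ 'd)"
  let ?w = "\<lambda>x :: real ^ 'd. C * inverse ((1 + norm x) ^ (CARD('d) + 1))"
  have "(\<lambda>m. LINT x|lborel. h x * box_average (1 / real (Suc m)) l u x) \<longlonglongrightarrow> (LINT x|lborel. h x * (?E * indicator (box l u) x))"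
  proof (rule integral_dominated_convergence)
    have "integrable lborel (\<lambda>x. h x * complex_of_real (?w x))"
    proof (rule weakly_vanishing_mult(1)[OF h _ _ zero_less_one])
      show "integrable lborel (\<lambda>x. complex_of_real (?w x))"
        unfolding complex_of_real_integrable_eq by (intro integrable_mult_right integrable_inverse_weight)
      show "norm (complex_of_real (?w x)) \<le> C * 1" for x :: "real ^ 'd"
      proof -
        have "inverse ((1 + norm x) ^ (CARD('d) + 1)) \<le> 1" by (intro inverse_le_1_iff[THEN iffD2] disjI2 one_le_power) simp
        moreover have "inverse ((1 + norm x) ^ (CARD('d) + 1)) \<ge> 0" by simp
        ultimately show ?thesis using C(1) unfolding norm_of_real abs_mult by (intro mult_mono) simp_all
      qed
    qed
    from integrable_norm[OF this] show "integrable lborel (\<lambda>x. norm (h x) * \<bar>?w x\<bar>)" unfolding norm_mult norm_of_real .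
    show "(\<lambda>x. h x * (?E * indicator (box l u) x)) \<in> borel_measurable lborel" by measurable
    show "(\<lambda>x. h x * box_average (1 / real (Suc m)) l u x) \<in> borel_measurable lborel" for m
      using box_average_measurable(1)[of "1 / real (Suc m)" l u] by measurable
    show "AE x in lborel. norm (h x * box_average (1 / real (Suc m)) l u x) \<le> norm (h x) * \<bar>?w x\<bar>" for m
    proof (rule AE_I2)
      fix x :: "real ^ 'd"
      have "norm (box_average (1 / real (Suc m)) l u x) \<le> (LINT z|lborel. norm (bump_kernel z * indicator (box l u) (x - (1 / real (Suc m)) *\<^sub>R z)))"
        unfolding box_average_def by (rule integral_norm_bound)
      also have "\<dots> = (LINT z|lborel. norm (bump_kernel z) * indicator (box l u) (x - (1 / real (Suc m)) *\<^sub>R z))"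
        by (intro Bochner_Integration.integral_cong refl) (simp add: norm_mult indicator_def)
      also have "\<dots> \<le> ?w x" by (intro C(2)) auto
      finally have "norm (box_average (1 / real (Suc m)) l u x) \<le> \<bar>?w x\<bar>" by simp
      thus "norm (h x * box_average (1 / real (Suc m)) l u x) \<le> norm (h x) * \<bar>?w x\<bar>"
        unfolding norm_mult by (rule mult_left_mono) simp
    qed
    show "AE x in lborel. (\<lambda>m. h x * box_average (1 / real (Suc m)) l u x) \<longlonglongrightarrow> h x * (?E * indicator (box l u) x)"
      using box_average_tendsto[of l u] by eventually_elim (intro tendsto_mult tendsto_const)
  qed
  moreover have "(LINT x|lborel. h x * box_average (1 / real (Suc m)) l u x) = 0" for m
    by (rule annihilator_box_average[OF h ann]) auto
  ultimately have "(LINT x|lborel. h x * (?E * indicator (box l u) x)) = 0"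
    using LIMSEQ_unique[OF _ tendsto_const[of "0::complex" sequentially]] by simp
  hence "?E * (LINT x|lborel. h x * indicator (box l u) x) = 0"
    unfolding mult.left_commute[of "h _" ?E] integral_mult_right_zero .
  thus "(LINT x|lborel. h x * indicator (box l u) x) = 0" using bump_kernel_integral_nonzero[where 'd = 'd] by simp
qed

lemma functional_of_eq_imp_AE_eq:
  fixes f g :: "'d::finite cfun"
  assumes f: "weakly_vanishing f" and g: "weakly_vanishing g" and e: "functional_of f = functional_of g"
  shows "AE x in lborel. f x = g x"
proof -
  have "AE x in lborel. f x - g x = 0"
  proof (rule annihilator_of_Phi_AE_zero[OF weakly_vanishing_diff[OF f g]])
    fix \<phi> :: "'d cfun" assume p: "\<phi> \<in> Phi"
    hence s: "\<phi> \<in> schwartz_flat_on {}" by (simp add: Phi_def schwartz_eq_flat)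
    obtain M where M: "\<And>x. (1 + norm x) ^ 0 * norm (\<phi> x) \<le> M" using schwartz_flat_bound[OF s, of 0] by blast
    hence M': "norm (\<phi> x) \<le> M" for x by simp
    note i = weakly_vanishing_mult(1)[OF _ schwartz_flat_integrable[OF s] M' zero_less_one]
    have "(LINT x|lborel. f x * \<phi> x) = (LINT x|lborel. g x * \<phi> x)"
      using fun_cong[OF e, of \<phi>] p by (simp add: functional_of_def)
    thus "(LINT x|lborel. (f x - g x) * \<phi> x) = 0"
      unfolding left_diff_distrib by (subst Bochner_Integration.integral_diff[OF i[OF f] i[OF g]]) simp
  qed
  thus ?thesis by simp
qed

section \<open>Fractional derivatives of functionals\<close>

lemma Phi_lincomb:
  fixes f g :: "'d::finite cfun"
  assumes f: "f \<in> Phi" and g: "g \<in> Phi"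
  shows "(\<lambda>x. a * f x + b * g x) \<in> Phi"
proof -
  have S: "f \<in> schwartz_flat_on {}" "g \<in> schwartz_flat_on {}" using f g by (auto simp: Phi_def schwartz_eq_flat)
  have "(LINT x|lborel. complex_of_real (monomial is x) * (a * f x + b * g x)) = 0" for "is"
  proof -
    note i = schwartz_flat_integrable[OF schwartz_monomial[OF S(1), of "is"]] schwartz_flat_integrable[OF schwartz_monomial[OF S(2), of "is"]]
    have "(LINT x|lborel. complex_of_real (monomial is x) * (a * f x + b * g x)) =
        (LINT x|lborel. a * (complex_of_real (monomial is x) * f x) + b * (complex_of_real (monomial is x) * g x))"
      by (simp only: distrib_left mult.left_commute)
    also have "\<dots> = a * (LINT x|lborel. complex_of_real (monomial is x) * f x) + b * (LINT x|lborel. complex_of_real (monomial is x) * g x)"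
      by (subst Bochner_Integration.integral_add[OF integrable_mult_right[OF i(1)] integrable_mult_right[OF i(2)]]) (simp only: integral_mult_right_zero)
    finally show ?thesis using f g by (simp add: Phi_def)
  qed
  thus ?thesis using schwartz_flat_lincomb[OF S] by (simp add: Phi_def schwartz_eq_flat)
qed

lemma schwartz_seminorm_upper:
  assumes "f \<in> schwartz_flat_on {}"
  shows "(1 + norm x) ^ m * norm (f x) \<le> schwartz_seminorm m [] f"
proof -
  obtain B where "\<And>x. (1 + norm x) ^ m * norm (f x) \<le> B" using schwartz_flat_bound[OF assms, of m] by blast
  thus ?thesis unfolding schwartz_seminorm_def iter_partial.simps by (intro cSUP_upper bdd_aboveI2) auto
qed

text \<open>The seminorm of order \<open>d + 1\<close> controls the \<open>L\<^sup>1\<close> norm. This is what makes integration against a bounded function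
continuous on the Schwartz space.\<close>

lemma integral_norm_le_seminorm:
  fixes f :: "'d::finite cfun"
  assumes f: "f \<in> schwartz_flat_on {}"
  shows "(LINT x|lborel. norm (f x)) \<le> (LINT x|lborel. inverse ((1 + norm (x :: real ^ 'd)) ^ (CARD('d) + 1))) * schwartz_seminorm (CARD('d) + 1) [] f"
proof -
  let ?N = "CARD('d) + 1" and ?s = "schwartz_seminorm (CARD('d) + 1) [] f"
  have "(LINT x|lborel. norm (f x)) \<le> (LINT x|lborel. inverse ((1 + norm (x :: real ^ 'd)) ^ ?N) * ?s)"
  proof (rule integral_mono)
    show "integrable lborel (\<lambda>x. norm (f x))" by (intro integrable_norm schwartz_flat_integrable[OF f])
    show "integrable lborel (\<lambda>x :: real ^ 'd. inverse ((1 + norm x) ^ ?N) * ?s)" by (intro integrable_mult_left integrable_inverse_weight)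
    fix x :: "real ^ 'd"
    have p: "(1 + norm x) ^ ?N > 0" by (intro zero_less_power) (simp add: add_pos_nonneg)
    hence "norm (f x) = inverse ((1 + norm x) ^ ?N) * ((1 + norm x) ^ ?N * norm (f x))" by (simp only: mult.assoc[symmetric] left_inverse less_imp_neq[symmetric] not_False_eq_True mult_1_left)
    also have "\<dots> \<le> inverse ((1 + norm x) ^ ?N) * ?s" using p by (intro mult_left_mono schwartz_seminorm_upper[OF f]) auto
    finally show "norm (f x) \<le> inverse ((1 + norm x) ^ ?N) * ?s" .
  qed
  also have "\<dots> = (LINT x|lborel. inverse ((1 + norm (x :: real ^ 'd)) ^ ?N)) * ?s" by (rule integral_mult_left_zero)
  finally show ?thesis .
qed

lemma bounded_mult_Phi_integrable:
  fixes g :: "'d::finite cfun"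
  assumes [measurable]: "g \<in> borel_measurable borel" and B: "\<And>x. norm (g x) \<le> B" and f: "f \<in> Phi"
  shows "integrable lborel (\<lambda>x. g x * f x)" and "norm (LINT x|lborel. g x * f x) \<le> B * (LINT x|lborel. norm (f x))"
proof -
  have i: "integrable lborel f" by (rule schwartz_flat_integrable[of _ "{}"]) (use f in \<open>simp add: Phi_def schwartz_eq_flat\<close>)
  have [measurable]: "f \<in> borel_measurable borel" using borel_measurable_integrable[OF i] by simp
  have I: "integrable lborel (\<lambda>x. B * norm (f x))" by (intro integrable_mult_right integrable_norm i)
  have b: "norm (g x * f x) \<le> B * norm (f x)" for x unfolding norm_mult by (intro mult_right_mono B) auto
  show J: "integrable lborel (\<lambda>x. g x * f x)"
  proof (rule Bochner_Integration.integrable_bound[OF I])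
    show "AE x in lborel. norm (g x * f x) \<le> norm (B * norm (f x))"
      by (intro AE_I2 order_trans[OF b]) (simp only: real_norm_def abs_ge_self)
  qed measurable
  have "norm (LINT x|lborel. g x * f x) \<le> (LINT x|lborel. B * norm (f x))"
    by (rule order_trans[OF integral_norm_bound integral_mono[OF integrable_norm[OF J] I b]])
  thus "norm (LINT x|lborel. g x * f x) \<le> B * (LINT x|lborel. norm (f x))" by (simp only: integral_mult_right_zero)
qed

lemma functional_of_dual:
  fixes g :: "'d::finite cfun"
  assumes g: "g \<in> borel_measurable borel" and B: "\<And>x. norm (g x) \<le> B"
  shows "functional_of g \<in> dual Phi"
proof -
  let ?F = "functional_of g" and ?N = "CARD('d) + 1" and ?X = "subtopology schwartz_topology (Phi :: 'd cfun set)"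
  define C where "C = B * (LINT x|lborel. inverse ((1 + norm (x :: real ^ 'd)) ^ ?N))"
  have B0: "B \<ge> 0" using B[of 0] norm_ge_zero order_trans by blast
  have C0: "C \<ge> 0" unfolding C_def by (intro mult_nonneg_nonneg B0 integral_nonneg_AE) auto
  have Fe: "?F f = (LINT x|lborel. g x * f x)" if "f \<in> Phi" for f using that by (simp add: functional_of_def)
  note i = bounded_mult_Phi_integrable[OF g B]
  have lin: "?F (\<lambda>x. a * f x + b * h x) = a * ?F f + b * ?F h" if "f \<in> Phi" "h \<in> Phi" for a b f h
  proof -
    have "(LINT x|lborel. g x * (a * f x + b * h x)) = (LINT x|lborel. a * (g x * f x) + b * (g x * h x))"
      by (simp only: distrib_left mult.left_commute)
    also have "\<dots> = a * (LINT x|lborel. g x * f x) + b * (LINT x|lborel. g x * h x)"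
      by (subst Bochner_Integration.integral_add[OF integrable_mult_right[OF i(1)[OF that(1)]] integrable_mult_right[OF i(1)[OF that(2)]]]) (simp only: integral_mult_right_zero)
    finally show ?thesis using that by (simp add: Fe Phi_lincomb)
  qed
  have est: "norm (?F h - ?F f) \<le> C * schwartz_seminorm ?N [] (\<lambda>x. h x - f x)" if "f \<in> Phi" "h \<in> Phi" for f h
  proof -
    have d: "(\<lambda>x. h x - f x) \<in> Phi" using Phi_lincomb[OF that(2,1), of 1 "-1"] by simp
    have "?F h - ?F f = ?F (\<lambda>x. h x - f x)" using lin[OF that(2,1), of 1 "-1"] by simp
    also have "norm \<dots> \<le> B * (LINT x|lborel. norm (h x - f x))" unfolding Fe[OF d] by (rule i(2)[OF d])
    also have "\<dots> \<le> B * ((LINT x|lborel. inverse ((1 + norm (x :: real ^ 'd)) ^ ?N)) * schwartz_seminorm ?N [] (\<lambda>x. h x - f x))"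
      by (intro mult_left_mono B0 integral_norm_le_seminorm) (use d in \<open>simp add: Phi_def schwartz_eq_flat\<close>)
    finally show ?thesis unfolding C_def by (simp only: mult.assoc)
  qed
  have "continuous_map ?X euclidean ?F"
    unfolding continuous_map_def
  proof (intro conjI allI impI)
    show "?F \<in> topspace ?X \<rightarrow> topspace euclidean" by simp
    fix U :: "complex set" assume "openin euclidean U"
    hence U: "open U" by simp
    show "openin ?X {x \<in> topspace ?X. ?F x \<in> U}"
    proof (subst openin_subopen, intro ballI)
      fix f assume f: "f \<in> {x \<in> topspace ?X. ?F x \<in> U}"
      hence fP: "f \<in> Phi" and fU: "?F f \<in> U" by auto
      from fP have fS: "f \<in> schwartz" by (simp add: Phi_def)
      obtain \<delta> where \<delta>: "\<delta> > 0" "ball (?F f) \<delta> \<subseteq> U" using U fU open_contains_ball by metis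
      \<comment> \<open>The summand \<open>1\<close> covers the case \<open>C = 0\<close>.\<close>
      define e where "e = \<delta> / (C + 1)"
      have e: "e > 0" using \<delta> C0 by (simp add: e_def)
      let ?V = "{h \<in> schwartz. schwartz_seminorm ?N [] (\<lambda>x. h x - f x) < e}"
      have "openin schwartz_topology ?V" unfolding schwartz_topology_def
        by (rule topology_generated_by_Basis) (use fS e in blast)
      hence o: "openin ?X (Phi \<inter> ?V)" by (rule openin_subtopology_Int2)
      have "schwartz_seminorm ?N [] (\<lambda>x. f x - f x) = 0" unfolding schwartz_seminorm_def by simp
      hence "f \<in> Phi \<inter> ?V" using fP fS e by simp
      moreover have "Phi \<inter> ?V \<subseteq> {x \<in> topspace ?X. ?F x \<in> U}"
      proof
        fix h assume h: "h \<in> Phi \<inter> ?V"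
        have "norm (?F h - ?F f) \<le> C * schwartz_seminorm ?N [] (\<lambda>x. h x - f x)" using h by (intro est fP) auto
        also have "\<dots> \<le> C * e" using h C0 by (intro mult_left_mono) auto
        also have "\<dots> < \<delta>" using \<delta>(1) C0 by (simp add: e_def field_simps)
        finally have "?F h \<in> U" using \<delta>(2) by (auto simp: dist_norm norm_minus_commute subset_iff)
        moreover have "h \<in> topspace ?X" using openin_subset[OF o] h by blast
        ultimately show "h \<in> {x \<in> topspace ?X. ?F x \<in> U}" by simp
      qed
      ultimately show "\<exists>T. openin ?X T \<and> f \<in> T \<and> T \<subseteq> {x \<in> topspace ?X. ?F x \<in> U}" using o by blast
    qed
  qed
  moreover have "?F (\<lambda>x. f x + h x) = ?F f + ?F h" if "f \<in> Phi" "h \<in> Phi" for f h using lin[OF that, of 1 1] by simp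
  moreover have "?F (\<lambda>x. c * f x) = c * ?F f" if "f \<in> Phi" for c f using lin[OF that that, of c 0] by simp
  moreover have "?F \<in> extensional Phi" by (simp add: functional_of_def)
  ultimately show ?thesis by (simp add: dual_def)
qed

lemma fourier_dual_Psi: "\<psi> \<in> Psi \<Longrightarrow> fourier_dual F \<psi> = F (fourier \<psi>)"
  using fourier_inv_reflect[of \<psi>] by (simp add: fourier_dual_def Psi_def)

text \<open>Every test function in \<open>\<Phi>\<close> is the transform of one in \<open>\<Psi>\<close>, namely of its own reflected transform.\<close>

lemma inj_on_fourier_dual: "inj_on fourier_dual (dual (Phi :: 'd::finite cfun set))"
proof (rule inj_onI, rule ext)
  fix F G :: "'d functional" and \<phi> :: "'d cfun"
  assume FG: "F \<in> dual Phi" "G \<in> dual Phi" "fourier_dual F = fourier_dual G"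
  show "F \<phi> = G \<phi>"
  proof (cases "\<phi> \<in> Phi")
    case False
    thus ?thesis using FG by (simp add: dual_def extensional_def)
  next
    case True
    define \<psi> where "\<psi> = (\<lambda>k. fourier \<phi> (- k))"
    have \<psi>: "\<psi> \<in> Psi" unfolding \<psi>_def by (intro Psi_reflect fourier_Phi_Psi True)
    have s: "\<phi> \<in> schwartz_flat_on {}" using True by (simp add: Phi_def schwartz_eq_flat)
    have "fourier \<psi> = \<phi>"
    proof
      fix x
      have "(\<lambda>k. exp (- \<i> * complex_of_real (- x \<bullet> k)) * fourier \<phi> k) \<in> borel_measurable borel"
        using borel_measurable_integrable[OF fourier_integrable[OF schwartz_flat_integrable[OF fourier_schwartz[OF s]], of "- x"]] by simp
      from lborel_integral_reflect[OF this]
      have "fourier \<psi> x = fourier (fourier \<phi>) (- x)" unfolding \<psi>_def fourier_def[of "\<lambda>k. fourier \<phi> (- k)"] fourier_def[of "fourier \<phi>"] by simp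
      thus "fourier \<psi> x = \<phi> x" using fourier_fourier_schwartz[OF s] by simp
    qed
    hence "F \<phi> = fourier_dual F \<psi>" "G \<phi> = fourier_dual G \<psi>" using fourier_dual_Psi[OF \<psi>] by simp_all
    thus ?thesis using FG(3) by simp
  qed
qed

lemma functional_of_fourier_dual:
  fixes u :: "'d::finite cfun"
  assumes u: "integrable lborel u" shows "functional_of (fourier u) \<in> dual Phi"
proof (rule functional_of_dual)
  show "fourier u \<in> borel_measurable borel" by (intro borel_measurable_continuous_onI continuous_fourier u)
qed (rule norm_fourier_le[OF u])

text \<open>The multiplication formula moves the transform to the test function, and inversion cancels the two.\<close>

lemma fourier_dual_functional_of_fourier:
  fixes u :: "'d::finite cfun"
  assumes u: "integrable lborel u" and \<psi>: "\<psi> \<in> Psi"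
  shows "fourier_dual (functional_of (fourier u)) \<psi> = (LINT k|lborel. u k * \<psi> (- k))"
proof -
  have s: "\<psi> \<in> schwartz_flat_on {}" using \<psi> by (simp add: Psi_def schwartz_eq_flat)
  have "fourier_dual (functional_of (fourier u)) \<psi> = (LINT x|lborel. fourier u x * fourier \<psi> x)"
    using fourier_Psi_Phi[OF \<psi>] by (simp add: fourier_dual_Psi[OF \<psi>] functional_of_def)
  also have "\<dots> = (LINT k|lborel. u k * fourier (fourier \<psi>) k)"
    by (intro fourier_multiplication_formula u schwartz_flat_integrable[OF fourier_schwartz[OF s]])
  finally show ?thesis unfolding fourier_fourier_schwartz[OF s] .
qed

text \<open>In Fourier space the functional is integration against the reflection of \<open>u\<close>, and \<open>|k|\<^sup>s\<close> is even. Applying the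
injective \<^const>\<open>fourier_dual\<close> backwards identifies the preimage that defines \<^const>\<open>frac_deriv\<close>.\<close>

theorem frac_deriv_functional_of_fourier:
  fixes u :: "'d::finite cfun"
  assumes u: "integrable lborel u" and su: "integrable lborel (norm_powr_mult s u)"
  shows "frac_deriv s (functional_of (fourier u)) = functional_of (fourier (norm_powr_mult s u))"
proof -
  have "abs_power_mult s (fourier_dual (functional_of (fourier u))) = fourier_dual (functional_of (fourier (norm_powr_mult s u)))"
  proof
    fix \<psi> :: "'d cfun"
    show "abs_power_mult s (fourier_dual (functional_of (fourier u))) \<psi> = fourier_dual (functional_of (fourier (norm_powr_mult s u))) \<psi>"
    proof (cases "\<psi> \<in> Psi")
      case True
      have "abs_power_mult s (fourier_dual (functional_of (fourier u))) \<psi> = (LINT k|lborel. u k * norm_powr_mult s \<psi> (- k))"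
        using fourier_dual_functional_of_fourier[OF u norm_powr_mult_Psi[OF True]] True
        by (simp add: abs_power_mult_def norm_powr_mult_def[abs_def])
      also have "\<dots> = (LINT k|lborel. norm_powr_mult s u k * \<psi> (- k))"
        unfolding norm_powr_mult_def by (simp only: norm_minus_cancel mult.assoc mult.left_commute)
      finally show ?thesis using fourier_dual_functional_of_fourier[OF su True] by simp
    qed (simp add: abs_power_mult_def fourier_dual_def)
  qed
  thus ?thesis unfolding frac_deriv_def
    by (simp only:) (rule inv_into_f_f[OF inj_on_fourier_dual functional_of_fourier_dual[OF su]])
qed

section \<open>Radial profiles\<close>

text \<open>The norm in \<open>L\<^sup>p\<close> of \<open>x \<mapsto> m (norm x)\<close> in dimension \<open>d\<close>.\<close>

definition radial_norm :: "nat \<Rightarrow> ennreal \<Rightarrow> (real \<Rightarrow> real) \<Rightarrow> real" where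
  "radial_norm d p m =
     (if p = \<infinity> then (SUP \<rho>\<in>{0..}. \<bar>m \<rho>\<bar>)
      else (sphere_factor d * (LINT \<rho>:{0<..}|lborel. \<rho> powr (real d - 1) * \<bar>m \<rho>\<bar> powr enn2real p)) powr (1 / enn2real p))"

text \<open>The squared \<open>L\<^sup>2\<close> norm of \<open>|k|\<^sup>s w(|k|)\<close> in dimension \<open>d\<close>.\<close>

definition profile_square :: "nat \<Rightarrow> real \<Rightarrow> (real \<Rightarrow> real) \<Rightarrow> real" where
  "profile_square d s w = sphere_factor d * (LINT r:{0<..}|lborel. r ^ (d - 1) * (r powr s * w r)\<^sup>2)"

text \<open>The profile of the Fourier transform of \<open>|k|\<^sup>s w(|k|)\<close>.\<close>

definition profile_transform :: "nat \<Rightarrow> real \<Rightarrow> (real \<Rightarrow> real) \<Rightarrow> real \<Rightarrow> real" where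
  "profile_transform d s w \<rho> = (LINT \<xi>:{0<..}|lborel. bessel_J_quotient (real d / 2 - 1) (\<rho> * \<xi>) * (\<xi> ^ (d - 1) * (\<xi> powr s * w \<xi>)))"

definition profile_integrable :: "nat \<Rightarrow> real \<Rightarrow> (real \<Rightarrow> real) \<Rightarrow> bool" where
  "profile_integrable d s w \<longleftrightarrow>
     w \<in> borel_measurable borel \<and>
     set_integrable lborel {0<..} (\<lambda>r. r ^ (d - 1) * (r powr s * w r)) \<and>
     set_integrable lborel {0<..} (\<lambda>r. r ^ (d - 1) * (r powr s * w r)\<^sup>2)"

definition radial_symbol :: "real \<Rightarrow> (real \<Rightarrow> real) \<Rightarrow> 'd::finite cfun" where
  "radial_symbol s w = norm_powr_mult s (\<lambda>k. complex_of_real (w (norm k)))"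

lemma radial_symbol_eq: "radial_symbol s w k = complex_of_real (norm k powr s * w (norm k))"
  by (simp add: radial_symbol_def norm_powr_mult_def)

text \<open>The value \<open>0 powr 0 = 0\<close> makes \<open>radial_symbol 0 w\<close> vanish at the origin. The identity holds at that point too,
so all powers of the norm can be treated alike.\<close>

lemma norm_powr_mult_radial_symbol: "norm_powr_mult s (radial_symbol 0 w) = radial_symbol s w"
  by (rule ext) (simp add: radial_symbol_def norm_powr_mult_def)

lemma radial_symbol_integrable:
  assumes "profile_integrable CARD('d) s w"
  shows "integrable lborel (radial_symbol s w :: 'd::finite cfun)"
    and "integrable lborel (\<lambda>k :: real ^ 'd. (norm (radial_symbol s w k))\<^sup>2)"
    and "(LINT k|lborel. (norm (radial_symbol s w (k :: real ^ 'd)))\<^sup>2) = profile_square CARD('d) s w"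
proof -
  have [measurable]: "w \<in> borel_measurable borel" using assms by (simp add: profile_integrable_def)
  have m1: "(\<lambda>r. r powr s * w r) \<in> borel_measurable borel" and m2: "(\<lambda>r. (r powr s * w r)\<^sup>2) \<in> borel_measurable borel" by measurable
  have "integrable lborel (\<lambda>k :: real ^ 'd. norm k powr s * w (norm k))"
    by (rule polar_integral(1)[OF m1]) (use assms in \<open>simp add: profile_integrable_def\<close>)
  thus "integrable lborel (radial_symbol s w :: 'd cfun)"
    unfolding radial_symbol_eq[abs_def] complex_of_real_integrable_eq .
  have e: "(norm (radial_symbol s w k))\<^sup>2 = (norm k powr s * w (norm k))\<^sup>2" for k :: "real ^ 'd"
    unfolding radial_symbol_eq norm_of_real power2_abs ..
  show "integrable lborel (\<lambda>k :: real ^ 'd. (norm (radial_symbol s w k))\<^sup>2)"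
    unfolding e by (rule polar_integral(1)[OF m2]) (use assms in \<open>simp add: profile_integrable_def\<close>)
  show "(LINT k|lborel. (norm (radial_symbol s w (k :: real ^ 'd)))\<^sup>2) = profile_square CARD('d) s w"
    unfolding e profile_square_def using polar_integral(2)[OF m2, where 'a = "real ^ 'd"] by simp
qed

lemma fourier_radial_symbol:
  fixes x :: "real ^ 'd::finite"
  assumes "profile_integrable CARD('d) s w"
  shows "fourier (radial_symbol s w) x = complex_of_real (profile_transform CARD('d) s w (norm x))"
proof -
  have [measurable]: "w \<in> borel_measurable borel" using assms by (simp add: profile_integrable_def)
  have m1: "(\<lambda>r. r powr s * w r) \<in> borel_measurable borel" by measurable
  have I: "set_integrable lborel {0<..} (\<lambda>r. r ^ (DIM(real ^ 'd) - 1) * (r powr s * w r))" using assms by (simp add: profile_integrable_def)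
  let ?T = "profile_transform CARD('d) s w (norm x)"
  have "fourier (radial_symbol s w) x = complex_of_real ((2 * pi) powr (- real CARD('d) / 2)) * complex_of_real ((2 * pi) powr (real CARD('d) / 2) * ?T)"
    unfolding fourier_def radial_symbol_eq radial_fourier[OF m1 I] profile_transform_def by simp
  also have "\<dots> = complex_of_real (((2 * pi) powr (- real CARD('d) / 2) * (2 * pi) powr (real CARD('d) / 2)) * ?T)"
    by (simp only: of_real_mult mult.assoc)
  finally show ?thesis unfolding two_pi_powr_cancel by simp
qed

lemma profile_transform_continuous_bounded:
  assumes "profile_integrable CARD('d::finite) s w"
  shows "continuous_on {0..} (profile_transform CARD('d) s w)" and "\<exists>B. \<forall>\<rho>\<ge>0. \<bar>profile_transform CARD('d) s w \<rho>\<bar> \<le> B"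
    and "\<exists>m. continuous_on UNIV m \<and> (\<forall>\<rho>\<ge>0. profile_transform CARD('d) s w \<rho> = m \<rho>)"
proof -
  let ?e = "axis undefined 1 :: real ^ 'd" and ?g = "fourier (radial_symbol s w) :: 'd cfun"
  define m where "m \<rho> = Re (?g (\<rho> *\<^sub>R ?e))" for \<rho>
  note i = radial_symbol_integrable(1)[OF assms]
  have m: "profile_transform CARD('d) s w \<rho> = m \<rho>" if "\<rho> \<ge> 0" for \<rho>
    unfolding m_def fourier_radial_symbol[OF assms] using that by (simp add: norm_axis_1)
  have mc: "continuous_on UNIV m" unfolding m_def
    by (intro continuous_on_Re continuous_on_compose2[OF continuous_fourier[OF i]] continuous_intros) auto
  have "continuous_on {0..} (profile_transform CARD('d) s w) = continuous_on {0..} m"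
    by (rule continuous_on_cong[OF refl]) (use m in auto)
  thus "continuous_on {0..} (profile_transform CARD('d) s w)"
    using continuous_on_subset[OF mc subset_UNIV] by simp
  have "\<bar>profile_transform CARD('d) s w \<rho>\<bar> \<le> (2 * pi) powr (- real CARD('d) / 2) * (LINT k|lborel. norm (radial_symbol s w (k :: real ^ 'd)))" if "\<rho> \<ge> 0" for \<rho>
    unfolding m[OF that] m_def by (rule order_trans[OF abs_Re_le_cmod norm_fourier_le[OF i]])
  thus "\<exists>B. \<forall>\<rho>\<ge>0. \<bar>profile_transform CARD('d) s w \<rho>\<bar> \<le> B" by blast
  show "\<exists>m. continuous_on UNIV m \<and> (\<forall>\<rho>\<ge>0. profile_transform CARD('d) s w \<rho> = m \<rho>)" using m mc by blast
qed

lemma fourier_radial_symbol_L2: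
  assumes "profile_integrable CARD('d::finite) s w"
  shows "(fourier (radial_symbol s w) :: 'd cfun) \<in> Lp_fun 2"
    and "(Lp_fun_norm 2 (fourier (radial_symbol s w) :: 'd cfun))\<^sup>2 \<le> profile_square CARD('d) s w"
proof -
  let ?g = "fourier (radial_symbol s w) :: 'd cfun"
  note i = radial_symbol_integrable[OF assms]
  note L = fourier_L2_bound[OF i(1,2)]
  have e: "norm (?g x) powr enn2real 2 = (norm (?g x))\<^sup>2" for x by (simp add: powr_numeral)
  have "?g \<in> borel_measurable borel" by (intro borel_measurable_continuous_onI continuous_fourier i)
  thus "?g \<in> Lp_fun 2" unfolding Lp_fun_def using L(1) e by simp
  have "Lp_fun_norm 2 ?g = sqrt (LINT x|lborel. (norm (?g x))\<^sup>2)"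
    unfolding Lp_fun_norm_def e using powr_half_sqrt[of "LINT x|lborel. (norm (?g x))\<^sup>2"] by (simp add: integral_nonneg_AE)
  thus "(Lp_fun_norm 2 ?g)\<^sup>2 \<le> profile_square CARD('d) s w"
    using L(2) i(3) by (simp add: integral_nonneg_AE)
qed

section \<open>Independence of the representative\<close>

lemma AE_eq_imp_eq_if_continuous:
  fixes f g :: "'d::finite cfun"
  assumes "continuous_on UNIV f" "continuous_on UNIV g" "AE x in lborel. f x = g x" shows "f = g"
proof -
  let ?S = "{x. f x \<noteq> g x}"
  have o: "open ?S" by (intro open_Collect_neq assms)
  hence "?S \<in> sets lborel" by simp
  from AE_iff_null_sets[OF this] have "?S \<in> null_sets lborel" using assms(3) by simp
  hence "negligible ?S" unfolding negligible_iff_null_sets by (rule null_sets_completionI)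
  hence "?S = {}" using open_not_negligible[OF o] by blast
  thus ?thesis by auto
qed

text \<open>Membership in \<open>L\<^sup>p\<close> is assumed of the functional, hence of some representative. It agrees with \<open>f\<close> almost
everywhere, and for \<open>p = \<infinity>\<close> everywhere, by continuity of both.\<close>

lemma Lp_norm_functional_of:
  fixes f :: "'d::finite cfun"
  assumes F: "functional_of f \<in> Lp p" and f: "weakly_vanishing f" and c: "continuous_on UNIV f" and p: "2 \<le> p"
  shows "Lp_norm p (functional_of f) = Lp_fun_norm p f"
proof -
  define h where "h = (SOME h. h \<in> Lp_fun p \<and> functional_of h = functional_of f)"
  from F obtain h0 where h0: "functional_of f = functional_of h0" "h0 \<in> Lp_fun p" unfolding Lp_def by (rule imageE)
  have "h \<in> Lp_fun p \<and> functional_of h = functional_of f" unfolding h_def by (rule someI[of _ h0]) (use h0 in simp)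
  hence h: "h \<in> Lp_fun p" "functional_of h = functional_of f" by auto
  have ae: "AE x in lborel. h x = f x" by (rule functional_of_eq_imp_AE_eq[OF weakly_vanishing_Lp[OF h(1) p] f h(2)])
  have "Lp_fun_norm p h = Lp_fun_norm p f"
  proof (cases "p = \<infinity>")
    case True
    hence "continuous_on UNIV h" using h(1) by (simp add: Lp_fun_def)
    thus ?thesis using AE_eq_imp_eq_if_continuous[OF _ c ae] by simp
  next
    case False
    have [measurable]: "h \<in> borel_measurable borel" "f \<in> borel_measurable borel" using h(1) f False by (auto simp: Lp_fun_def weakly_vanishing_def)
    have "(LINT x|lborel. norm (h x) powr enn2real p) = (LINT x|lborel. norm (f x) powr enn2real p)"
      by (rule integral_cong_AE) (use ae in \<open>measurable, auto\<close>)
    thus ?thesis using False by (simp add: Lp_fun_norm_def)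
  qed
  thus ?thesis unfolding Lp_norm_def h_def .
qed

section \<open>The Sobolev inequality for radial profiles\<close>

lemma Lp_fun_norm_radial:
  fixes f :: "'d::finite cfun"
  assumes f: "\<And>x. f x = complex_of_real (m (norm x))" and m: "continuous_on UNIV m'" "\<And>\<rho>. \<rho> \<ge> 0 \<Longrightarrow> m \<rho> = m' \<rho>"
  shows "Lp_fun_norm p f = radial_norm CARD('d) p m"
proof (cases "p = \<infinity>")
  case True
  have "range (\<lambda>x :: real ^ 'd. norm x) = {0..}"
  proof (intro equalityI subsetI)
    fix \<rho> :: real assume "\<rho> \<in> {0..}"
    hence "\<rho> = norm (\<rho> *\<^sub>R (axis undefined 1 :: real ^ 'd))" by (simp add: norm_axis_1)
    thus "\<rho> \<in> range (\<lambda>x :: real ^ 'd. norm x)" by (rule range_eqI)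
  qed auto
  hence "range (\<lambda>x. norm (f x)) = (\<lambda>\<rho>. \<bar>m \<rho>\<bar>) ` {0..}"
    unfolding f norm_of_real using image_image[of "\<lambda>\<rho>. \<bar>m \<rho>\<bar>" norm "UNIV :: (real ^ 'd) set"] by simp
  thus ?thesis unfolding Lp_fun_norm_def radial_norm_def True by simp
next
  case False
  have [measurable]: "m' \<in> borel_measurable borel" by (rule borel_measurable_continuous_onI[OF m(1)])
  have w: "(\<lambda>\<rho>. \<bar>m' \<rho>\<bar> powr enn2real p) \<in> borel_measurable borel" by measurable
  have "(LINT x|lborel. norm (f x) powr enn2real p) = (LINT x|lborel. \<bar>m' (norm (x :: real ^ 'd))\<bar> powr enn2real p)"
    unfolding f norm_of_real by (simp add: m(2))
  also have "\<dots> = sphere_factor CARD('d) * (LINT \<rho>:{0<..}|lborel. \<rho> ^ (CARD('d) - 1) * \<bar>m' \<rho>\<bar> powr enn2real p)"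
    using polar_integral(2)[OF w, where 'a = "real ^ 'd"] by simp
  also have "(LINT \<rho>:{0<..}|lborel. \<rho> ^ (CARD('d) - 1) * \<bar>m' \<rho>\<bar> powr enn2real p) = (LINT \<rho>:{0<..}|lborel. \<rho> powr (real CARD('d) - 1) * \<bar>m \<rho>\<bar> powr enn2real p)"
  proof (intro set_lebesgue_integral_cong allI impI)
    fix \<rho> :: real assume "\<rho> \<in> {0<..}"
    thus "\<rho> ^ (CARD('d) - 1) * \<bar>m' \<rho>\<bar> powr enn2real p = \<rho> powr (real CARD('d) - 1) * \<bar>m \<rho>\<bar> powr enn2real p"
      using powr_realpow[of \<rho> "CARD('d) - 1"] m(2)[of \<rho>] by (simp add: of_nat_diff)
  qed simp
  finally show ?thesis unfolding Lp_fun_norm_def radial_norm_def using False by simp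
qed

text \<open>The inequality is applied to the functional of the transform of \<open>w(|k|)\<close>. That its derivative of order \<open>j\<close> has a
finite \<open>L\<^sup>r\<close> norm is part of the hypothesis on \<open>S\<close>.\<close>

theorem sobolev_inequality_profile:
  assumes S: "sobolev_inequality TYPE('d::finite) j n r S" "0 \<le> S" and r: "2 \<le> r"
    and w0: "profile_integrable CARD('d) 0 w" and wj: "profile_integrable CARD('d) j w" and wn: "profile_integrable CARD('d) n w"
  shows "radial_norm CARD('d) r (profile_transform CARD('d) j w) \<le> S * sqrt (profile_square CARD('d) 0 w + profile_square CARD('d) n w)"
proof -
  define g where "g s = (fourier (radial_symbol s w) :: 'd cfun)" for s
  define F where "F = functional_of (g 0)"
  have fd: "frac_deriv s F = functional_of (g s)" if "profile_integrable CARD('d) s w" for s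
    unfolding F_def g_def using frac_deriv_functional_of_fourier[of "radial_symbol 0 w :: 'd cfun" s]
      radial_symbol_integrable(1)[OF w0] radial_symbol_integrable(1)[OF that] by (simp add: norm_powr_mult_radial_symbol)
  have gL: "g s \<in> Lp_fun 2" if "profile_integrable CARD('d) s w" for s unfolding g_def by (rule fourier_radial_symbol_L2(1)[OF that])
  have gw: "weakly_vanishing (g s)" if "profile_integrable CARD('d) s w" for s by (rule weakly_vanishing_Lp[OF gL[OF that]]) simp
  have gc: "continuous_on UNIV (g s)" if "profile_integrable CARD('d) s w" for s
    unfolding g_def by (intro continuous_fourier radial_symbol_integrable(1)[OF that])
  have "F \<in> Lp 2" unfolding F_def Lp_def using gL[OF w0] by blast
  moreover have "frac_deriv n F \<in> Lp 2" unfolding fd[OF wn] Lp_def using gL[OF wn] by blast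
  ultimately have FH: "F \<in> H_space n" by (simp add: H_space_def)
  hence Fr: "functional_of (g j) \<in> Lp r" using S(1) unfolding sobolev_inequality_def L2_space_def fd[OF wj, symmetric] by blast
  have N2: "(Lp_norm 2 (functional_of (g s)))\<^sup>2 \<le> profile_square CARD('d) s w" if "profile_integrable CARD('d) s w" for s
  proof -
    have "functional_of (g s) \<in> Lp 2" using gL[OF that] by (simp add: Lp_def)
    from Lp_norm_functional_of[OF this gw[OF that] gc[OF that]] show ?thesis
      unfolding g_def using fourier_radial_symbol_L2(2)[OF that] by simp
  qed
  obtain m where m: "continuous_on UNIV m" "\<And>\<rho>. \<rho> \<ge> 0 \<Longrightarrow> profile_transform CARD('d) j w \<rho> = m \<rho>"
    using profile_transform_continuous_bounded(3)[OF wj] by blast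
  have "radial_norm CARD('d) r (profile_transform CARD('d) j w) = Lp_fun_norm r (g j)"
    unfolding g_def by (rule Lp_fun_norm_radial[OF fourier_radial_symbol[OF wj] m, symmetric])
  also have "\<dots> = Lp_norm r (frac_deriv j F)" unfolding fd[OF wj] by (rule Lp_norm_functional_of[OF Fr gw[OF wj] gc[OF wj] r, symmetric])
  also have "\<dots> \<le> S * sqrt ((Lp_norm 2 F)\<^sup>2 + (Lp_norm 2 (frac_deriv n F))\<^sup>2)" using S(1) FH unfolding sobolev_inequality_def by blast
  also have "\<dots> \<le> S * sqrt (profile_square CARD('d) 0 w + profile_square CARD('d) n w)"
    unfolding fd[OF wn] unfolding F_def by (intro mult_left_mono real_sqrt_le_mono add_mono N2 w0 wn S(2))
  finally show ?thesis .
qed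

section \<open>Dilations\<close>

lemma half_line_dilation:
  fixes f :: "real \<Rightarrow> real"
  assumes c: "c > 0"
  shows "(LINT r:{0<..}|lborel. f (c * r)) = (1 / c) * (LINT r:{0<..}|lborel. f r)"
    and "set_integrable lborel {0<..} (\<lambda>r. f (c * r)) \<longleftrightarrow> set_integrable lborel {0<..} f"
proof -
  have i: "indicator {0<..} (0 + c * r) = (indicator {0<..} r :: real)" for r using c by (simp add: indicator_def zero_less_mult_iff)
  show "(LINT r:{0<..}|lborel. f (c * r)) = (1 / c) * (LINT r:{0<..}|lborel. f r)"
    using lborel_integral_real_affine[of c "\<lambda>r. indicator {0<..} r *\<^sub>R f r" 0] c unfolding i set_lebesgue_integral_def by simp
  show "set_integrable lborel {0<..} (\<lambda>r. f (c * r)) \<longleftrightarrow> set_integrable lborel {0<..} f"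
    using lborel_integrable_real_affine_iff[of c "\<lambda>r. indicator {0<..} r *\<^sub>R f r" 0] c unfolding i set_integrable_def by simp
qed

lemma dilated_weight:
  assumes c: "c > (0::real)" and r: "r > 0"
  shows "r ^ (d - 1) * (r powr s * w (c * r)) = inverse (c ^ (d - 1) * c powr s) * ((c * r) ^ (d - 1) * ((c * r) powr s * w (c * r)))"
    and "r ^ (d - 1) * (r powr s * w (c * r))\<^sup>2 = inverse (c ^ (d - 1) * (c powr s)\<^sup>2) * ((c * r) ^ (d - 1) * ((c * r) powr s * w (c * r))\<^sup>2)"
proof -
  have p: "(c * r) powr s = c powr s * r powr s" using c r by (simp add: powr_mult)
  have K: "inverse k * (k * z) = z" if "k \<noteq> 0" for k z :: real using that by simp
  have n: "c ^ (d - 1) * c powr s \<noteq> 0" "c ^ (d - 1) * (c powr s)\<^sup>2 \<noteq> 0" using c by simp_all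
  have "(c * r) ^ (d - 1) * ((c * r) powr s * w (c * r)) = (c ^ (d - 1) * c powr s) * (r ^ (d - 1) * (r powr s * w (c * r)))"
    unfolding p power_mult_distrib by (simp only: mult.assoc mult.commute mult.left_commute)
  thus "r ^ (d - 1) * (r powr s * w (c * r)) = inverse (c ^ (d - 1) * c powr s) * ((c * r) ^ (d - 1) * ((c * r) powr s * w (c * r)))"
    by (simp only: K[OF n(1)])
  have "(c * r) ^ (d - 1) * ((c * r) powr s * w (c * r))\<^sup>2 = (c ^ (d - 1) * (c powr s)\<^sup>2) * (r ^ (d - 1) * (r powr s * w (c * r))\<^sup>2)"
    unfolding p power_mult_distrib by (simp only: mult.assoc mult.commute mult.left_commute)
  thus "r ^ (d - 1) * (r powr s * w (c * r))\<^sup>2 = inverse (c ^ (d - 1) * (c powr s)\<^sup>2) * ((c * r) ^ (d - 1) * ((c * r) powr s * w (c * r))\<^sup>2)"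
    by (simp only: K[OF n(2)])
qed

lemma profile_dilation:
  assumes c: "c > 0" and d: "d > 0"
  shows "profile_integrable d s w \<Longrightarrow> profile_integrable d s (\<lambda>r. w (c * r))"
    and "profile_square d s (\<lambda>r. w (c * r)) = inverse (c ^ d * (c powr s)\<^sup>2) * profile_square d s w"
    and "profile_transform d s (\<lambda>r. w (c * r)) \<rho> = inverse (c ^ d * c powr s) * profile_transform d s w (\<rho> / c)"
proof -
  let ?h1 = "\<lambda>r. r ^ (d - 1) * (r powr s * w r)" and ?h2 = "\<lambda>r. r ^ (d - 1) * (r powr s * w r)\<^sup>2"
  have cd: "c ^ d = c ^ (d - 1) * c" using d by (cases d) (simp_all add: mult.commute)
  have e1: "r ^ (d - 1) * (r powr s * w (c * r)) = inverse (c ^ (d - 1) * c powr s) * ?h1 (c * r)" if "r \<in> {0<..}" for r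
    using dilated_weight(1)[OF c] that by auto
  have e2: "r ^ (d - 1) * (r powr s * w (c * r))\<^sup>2 = inverse (c ^ (d - 1) * (c powr s)\<^sup>2) * ?h2 (c * r)" if "r \<in> {0<..}" for r
    using dilated_weight(2)[OF c] that by auto
  show "profile_integrable d s (\<lambda>r. w (c * r))" if P: "profile_integrable d s w"
    unfolding profile_integrable_def
  proof (intro conjI)
    have [measurable]: "w \<in> borel_measurable borel" using P by (simp add: profile_integrable_def)
    show "(\<lambda>r. w (c * r)) \<in> borel_measurable borel" by measurable
    have "set_integrable lborel {0<..} (\<lambda>r. inverse (c ^ (d - 1) * c powr s) * ?h1 (c * r))"
      by (intro set_integrable_mult_right iffD2[OF half_line_dilation(2)[OF c, of ?h1]]) (use P in \<open>simp add: profile_integrable_def\<close>)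
    moreover have "set_integrable lborel {0<..} (\<lambda>r. r ^ (d - 1) * (r powr s * w (c * r))) = set_integrable lborel {0<..} (\<lambda>r. inverse (c ^ (d - 1) * c powr s) * ?h1 (c * r))"
      by (rule set_integrable_cong[OF refl refl]) (rule e1)
    ultimately show "set_integrable lborel {0<..} (\<lambda>r. r ^ (d - 1) * (r powr s * w (c * r)))" by (simp only:)
    have "set_integrable lborel {0<..} (\<lambda>r. inverse (c ^ (d - 1) * (c powr s)\<^sup>2) * ?h2 (c * r))"
      by (intro set_integrable_mult_right iffD2[OF half_line_dilation(2)[OF c, of ?h2]]) (use P in \<open>simp add: profile_integrable_def\<close>)
    moreover have "set_integrable lborel {0<..} (\<lambda>r. r ^ (d - 1) * (r powr s * w (c * r))\<^sup>2) = set_integrable lborel {0<..} (\<lambda>r. inverse (c ^ (d - 1) * (c powr s)\<^sup>2) * ?h2 (c * r))"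
      by (rule set_integrable_cong[OF refl refl]) (rule e2)
    ultimately show "set_integrable lborel {0<..} (\<lambda>r. r ^ (d - 1) * (r powr s * w (c * r))\<^sup>2)" by (simp only:)
  qed
  have "(LINT r:{0<..}|lborel. r ^ (d - 1) * (r powr s * w (c * r))\<^sup>2) = (LINT r:{0<..}|lborel. inverse (c ^ (d - 1) * (c powr s)\<^sup>2) * ?h2 (c * r))"
    by (intro set_lebesgue_integral_cong allI impI e2) auto
  also have "\<dots> = inverse (c ^ (d - 1) * (c powr s)\<^sup>2) * ((1 / c) * (LINT r:{0<..}|lborel. ?h2 r))"
    unfolding set_integral_mult_right half_line_dilation(1)[OF c, of ?h2] ..
  finally have sq: "(LINT r:{0<..}|lborel. r ^ (d - 1) * (r powr s * w (c * r))\<^sup>2) = inverse (c ^ (d - 1) * (c powr s)\<^sup>2) * ((1 / c) * (LINT r:{0<..}|lborel. ?h2 r))" .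
  show "profile_square d s (\<lambda>r. w (c * r)) = inverse (c ^ d * (c powr s)\<^sup>2) * profile_square d s w"
    unfolding profile_square_def cd sq by (simp only: inverse_mult_distrib inverse_eq_divide[symmetric] mult.assoc mult.commute mult.left_commute)
  let ?B = "bessel_J_quotient (real d / 2 - 1)"
  let ?t = "\<lambda>r. ?B (\<rho> / c * r) * ?h1 r"
  have "(LINT r:{0<..}|lborel. ?B (\<rho> * r) * (r ^ (d - 1) * (r powr s * w (c * r)))) = (LINT r:{0<..}|lborel. inverse (c ^ (d - 1) * c powr s) * ?t (c * r))"
  proof (intro set_lebesgue_integral_cong allI impI)
    fix r :: real assume r: "r \<in> {0<..}"
    have "\<rho> * r = \<rho> / c * (c * r)" using c by simp
    thus "?B (\<rho> * r) * (r ^ (d - 1) * (r powr s * w (c * r))) = inverse (c ^ (d - 1) * c powr s) * ?t (c * r)"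
      unfolding e1[OF r] by (simp only: mult.left_commute)
  qed simp
  also have "\<dots> = inverse (c ^ (d - 1) * c powr s) * ((1 / c) * (LINT r:{0<..}|lborel. ?t r))"
    unfolding set_integral_mult_right half_line_dilation(1)[OF c, of ?t] ..
  finally have tr: "(LINT r:{0<..}|lborel. ?B (\<rho> * r) * (r ^ (d - 1) * (r powr s * w (c * r)))) = inverse (c ^ (d - 1) * c powr s) * ((1 / c) * (LINT r:{0<..}|lborel. ?t r))" .
  show "profile_transform d s (\<lambda>r. w (c * r)) \<rho> = inverse (c ^ d * c powr s) * profile_transform d s w (\<rho> / c)"
    unfolding profile_transform_def cd tr by (simp only: inverse_mult_distrib inverse_eq_divide[symmetric] mult.assoc mult.commute mult.left_commute)
qed

text \<open>By the substitution \<open>\<rho> = c \<sigma>\<close>, each of the \<open>d\<close> dimensions contributes \<open>c\<^bsup>1/p\<^esup>\<close>. For \<open>p = \<infinity>\<close> the exponent is zero,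
and the bound on \<open>m\<close> makes the supremum commute with the factor \<open>a\<close>.\<close>

lemma radial_norm_dilation:
  assumes d: "d > 0" and c: "c > 0" and a: "a \<ge> 0" and b: "\<And>\<rho>. \<rho> \<ge> 0 \<Longrightarrow> \<bar>m \<rho>\<bar> \<le> B" and p: "2 \<le> p" "1 / p = ennreal \<kappa>" "\<kappa> \<ge> 0"
  shows "radial_norm d p (\<lambda>\<rho>. a * m (\<rho> / c)) = a * c powr (real d * \<kappa>) * radial_norm d p m"
proof (cases p)
  case top
  hence "ennreal \<kappa> = 0" using p(2) by simp
  hence k: "\<kappa> = 0" using p(3) by simp
  have im: "(\<lambda>\<rho>. \<bar>a * m (\<rho> / c)\<bar>) ` {0..} = (*) a ` ((\<lambda>\<rho>. \<bar>m \<rho>\<bar>) ` {0..})"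
  proof -
    have "(\<lambda>\<rho>. \<rho> / c) ` {0..} = {0..}"
    proof (intro equalityI subsetI)
      fix x :: real assume "x \<in> {0..}"
      thus "x \<in> (\<lambda>\<rho>. \<rho> / c) ` {0..}" using c by (intro image_eqI[of _ _ "c * x"]) auto
    qed (use c in auto)
    from arg_cong[OF this, of "\<lambda>A. (\<lambda>\<rho>. a * \<bar>m \<rho>\<bar>) ` A"] show ?thesis using a by (simp add: image_image abs_mult)
  qed
  have "a * (SUP \<rho>\<in>{0..}. \<bar>m \<rho>\<bar>) = (SUP y\<in>(\<lambda>\<rho>. \<bar>m \<rho>\<bar>) ` {0..}. a * y)"
  proof (rule continuous_at_Sup_mono)
    show "mono ((*) a)" using a by (intro monoI mult_left_mono)
    show "continuous (at_left (SUP \<rho>\<in>{0..}. \<bar>m \<rho>\<bar>)) ((*) a)" by (intro continuous_intros)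
    show "bdd_above ((\<lambda>\<rho>. \<bar>m \<rho>\<bar>) ` {0..})" using b by (intro bdd_aboveI2[where M = B]) auto
  qed auto
  thus ?thesis unfolding radial_norm_def im[symmetric] top k using c im by simp
next
  case (real q)
  have "ennreal 2 \<le> ennreal q" using p(1) real by simp
  hence q: "q \<ge> 2" using real by (simp add: ennreal_le_iff del: ennreal_numeral)
  have "ennreal (1 / q) = ennreal \<kappa>" using p(2) q unfolding real(2) by (simp add: divide_ennreal[symmetric])
  hence k: "\<kappa> = 1 / q" using p(3) q by (simp add: ennreal_inj)
  have pe: "p \<noteq> \<infinity>" "enn2real p = q" using real by auto
  let ?h = "\<lambda>\<rho>. \<rho> powr (real d - 1) * \<bar>m \<rho>\<bar> powr q"
  have c': "1 / c > 0" using c by simp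
  have "(LINT \<rho>:{0<..}|lborel. \<rho> powr (real d - 1) * \<bar>a * m (\<rho> / c)\<bar> powr q) = (LINT \<rho>:{0<..}|lborel. (a powr q * c powr (real d - 1)) * ?h (1 / c * \<rho>))"
  proof (intro set_lebesgue_integral_cong allI impI)
    fix \<rho> :: real assume "\<rho> \<in> {0<..}"
    hence r: "\<rho> > 0" by simp
    have "c powr (real d - 1) * (1 / c * \<rho>) powr (real d - 1) = (c * (1 / c * \<rho>)) powr (real d - 1)"
      using c r by (simp only: powr_mult)
    hence 1: "c powr (real d - 1) * (1 / c * \<rho>) powr (real d - 1) = \<rho> powr (real d - 1)" using c by simp
    have 2: "\<bar>a * m (\<rho> / c)\<bar> powr q = a powr q * \<bar>m (1 / c * \<rho>)\<bar> powr q" using a by (simp add: abs_mult powr_mult)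
    show "\<rho> powr (real d - 1) * \<bar>a * m (\<rho> / c)\<bar> powr q = (a powr q * c powr (real d - 1)) * ?h (1 / c * \<rho>)"
      unfolding 2 1[symmetric] by (simp only: mult.assoc mult.left_commute)
  qed simp
  also have "\<dots> = (a powr q * c powr (real d - 1)) * ((1 / (1 / c)) * (LINT \<rho>:{0<..}|lborel. ?h \<rho>))"
    unfolding set_integral_mult_right half_line_dilation(1)[OF c', of ?h] ..
  also have "\<dots> = a powr q * c powr real d * (LINT \<rho>:{0<..}|lborel. ?h \<rho>)"
    using c powr_add[of c "real d - 1" 1] by simp
  finally have "(LINT \<rho>:{0<..}|lborel. \<rho> powr (real d - 1) * \<bar>a * m (\<rho> / c)\<bar> powr q) = a powr q * c powr real d * (LINT \<rho>:{0<..}|lborel. ?h \<rho>)" .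
  hence "radial_norm d p (\<lambda>\<rho>. a * m (\<rho> / c)) = (sphere_factor d * (a powr q * c powr real d * (LINT \<rho>:{0<..}|lborel. ?h \<rho>))) powr (1 / q)"
    unfolding radial_norm_def using pe by simp
  also have "\<dots> = ((a powr q * c powr real d) * (sphere_factor d * (LINT \<rho>:{0<..}|lborel. ?h \<rho>))) powr (1 / q)"
    by (simp only: mult.left_commute mult.assoc)
  also have "\<dots> = (a powr q * c powr real d) powr (1 / q) * radial_norm d p m"
  proof -
    have "sphere_factor d \<ge> 0" unfolding sphere_factor_def by (intro divide_nonneg_nonneg mult_nonneg_nonneg Gamma_real_nonneg) (use d in auto)
    moreover have "(LINT \<rho>:{0<..}|lborel. ?h \<rho>) \<ge> 0" unfolding set_lebesgue_integral_def by (intro integral_nonneg_AE) auto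
    ultimately show ?thesis unfolding radial_norm_def using pe a by (simp add: powr_mult)
  qed
  also have "(a powr q * c powr real d) powr (1 / q) = a * c powr (real d * \<kappa>)"
    using a c q by (simp add: powr_mult powr_powr k)
  finally show ?thesis .
qed

section \<open>Optimisation over dilations\<close>

lemma powr_power2: "(x powr a)\<^sup>2 = x powr (2 * a :: real)"
  by (simp add: power2_eq_square powr_add[symmetric])

lemma sqrt_powr_power2: "X \<ge> 0 \<Longrightarrow> (sqrt X powr a)\<^sup>2 = X powr a"
  by (simp add: power2_eq_square powr_mult[symmetric])

text \<open>In the interior case the minimum is attained at \<open>t = (1-\<theta>) B / (\<theta> A)\<close>. At \<open>\<theta> = 0\<close> and \<open>\<theta> = 1\<close> it is
approached for \<open>t \<rightarrow> \<infinity>\<close> and \<open>t \<rightarrow> 0\<close>. If the denominator is zero, the left-hand side is zero by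
convention.\<close>

lemma optimize_dilation:
  fixes \<theta> A B S Y :: real
  assumes \<theta>: "0 \<le> \<theta>" "\<theta> \<le> 1" and A: "A \<ge> 0" and B: "B \<ge> 0" and S: "S \<ge> 0"
    and H: "\<And>t. t > 0 \<Longrightarrow> Y \<le> S * sqrt (t powr \<theta> * A + t powr (\<theta> - 1) * B)"
  shows "sqrt (rpow (1 - \<theta>) (1 - \<theta>) * rpow \<theta> \<theta>) * (Y / (rpow (sqrt A) (1 - \<theta>) * rpow (sqrt B) \<theta>)) \<le> S"
proof -
  consider "\<theta> = 0" | "\<theta> = 1" | "0 < \<theta>" "\<theta> < 1" using \<theta> by linarith
  thus ?thesis
  proof cases
    case 1
    have "Y \<le> S * sqrt (A + 0)"
    proof (rule tendsto_lowerbound)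
      show "((\<lambda>t. S * sqrt (A + B / t)) \<longlongrightarrow> S * sqrt (A + 0)) at_top"
        by (intro tendsto_intros tendsto_divide_0[OF tendsto_const] filterlim_at_top_imp_at_infinity filterlim_ident)
      show "\<forall>\<^sub>F t in at_top. Y \<le> S * sqrt (A + B / t)"
        using eventually_gt_at_top[of "0::real"]
      proof eventually_elim
        case (elim t)
        thus ?case using H[of t] 1 by (simp add: powr_minus_divide)
      qed
    qed simp
    thus ?thesis using 1 A S by (cases "A = 0") (simp_all add: rpow_def pos_divide_le_eq)
  next
    case 2
    have "Y \<le> S * sqrt (0 * A + B)"
    proof (rule tendsto_lowerbound)
      show "((\<lambda>t. S * sqrt (t * A + B)) \<longlongrightarrow> S * sqrt (0 * A + B)) (at_right 0)"
        by (intro tendsto_intros)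
      show "\<forall>\<^sub>F t in at_right 0. Y \<le> S * sqrt (t * A + B)"
        using eventually_at_right_less[of "0::real"]
      proof eventually_elim
        case (elim t)
        thus ?case using H[of t] 2 by simp
      qed
    qed simp
    thus ?thesis using 2 B S by (cases "B = 0") (simp_all add: rpow_def pos_divide_le_eq)
  next
    case 3
    show ?thesis
    proof (cases "A = 0 \<or> B = 0")
      case True
      thus ?thesis using 3 S by (auto simp: rpow_def)
    next
      case False
      hence AB: "A > 0" "B > 0" using A B by auto
      define t where "t = (1 - \<theta>) * B / (\<theta> * A)"
      have t: "t > 0" using 3 AB by (simp add: t_def)
      let ?X = "t powr \<theta> * A + t powr (\<theta> - 1) * B" and ?G = "(1 - \<theta>) powr (1 - \<theta>) * \<theta> powr \<theta>"
      let ?W = "sqrt A powr (1 - \<theta>) * sqrt B powr \<theta>"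
      have lt: "ln t = ln (1 - \<theta>) + ln B - ln \<theta> - ln A" using 3 AB by (simp add: t_def ln_mult ln_div)
      have "t powr \<theta> = t powr (\<theta> - 1) * t" using t powr_add[of t "\<theta> - 1" 1] by simp
      moreover have "t * A + B = B / \<theta>" using 3 AB by (simp add: t_def field_simps)
      ultimately have "?X = t powr (\<theta> - 1) * (B / \<theta>)" by (simp only: mult.assoc distrib_left[symmetric])
      also have "\<dots> = exp ((\<theta> - 1) * (ln (1 - \<theta>) + ln B - ln \<theta> - ln A)) * exp (ln B - ln \<theta>)"
        using t 3 AB by (simp add: powr_def lt exp_diff)
      finally have "?X * ?G = exp ((\<theta> - 1) * (ln (1 - \<theta>) + ln B - ln \<theta> - ln A)) * exp (ln B - ln \<theta>) * (exp ((1 - \<theta>) * ln (1 - \<theta>)) * exp (\<theta> * ln \<theta>))"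
        using 3 by (simp add: powr_def)
      also have "\<dots> = exp ((1 - \<theta>) * ln A + \<theta> * ln B)"
        unfolding exp_add[symmetric] by (rule arg_cong[of _ _ exp]) algebra
      also have "\<dots> = A powr (1 - \<theta>) * B powr \<theta>" using AB by (simp add: powr_def exp_add)
      also have "\<dots> = ?W\<^sup>2"
        using AB by (simp only: power_mult_distrib sqrt_powr_power2 less_imp_le)
      finally have XG: "sqrt ?X * sqrt ?G = ?W" using AB by (simp add: real_sqrt_mult[symmetric])
      have W: "?W > 0" using AB by simp
      have G: "sqrt ?G \<ge> 0" by simp
      have "sqrt ?G * Y \<le> sqrt ?G * (S * sqrt ?X)" by (intro mult_left_mono H t G)
      also have "\<dots> = S * ?W" unfolding XG[symmetric] by (simp only: mult.left_commute mult.commute)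
      finally have "sqrt ?G * Y / ?W \<le> S" using W by (simp only: pos_divide_le_eq)
      thus ?thesis using 3 by (simp add: rpow_def)
    qed
  qed
qed

section \<open>The trial profile\<close>

text \<open>The dominating function is a sum of a Gamma integrand, for the origin, and of \<open>1/(1+r\<^sup>2)\<close>, for infinity.\<close>

lemma set_integrable_of_endpoint_bounds:
  fixes f :: "real \<Rightarrow> real"
  assumes m: "f \<in> borel_measurable borel"
    and small: "\<And>r. 0 < r \<Longrightarrow> r \<le> 1 \<Longrightarrow> \<bar>f r\<bar> \<le> K * r powr (- (1 / 2))"
    and large: "\<And>r. 1 \<le> r \<Longrightarrow> \<bar>f r\<bar> \<le> K * r powr (- 2)"
  shows "set_integrable lborel {0<..} f"
proof -
  let ?e = "\<lambda>r::real. r powr (1 / 2 - 1) * exp (- r) + inverse (1 + r\<^sup>2)"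
  have K: "K \<ge> 0" using large[of 1] by simp
  have e: "set_integrable lborel {0<..} ?e"
  proof (rule set_integral_add(1))
    show "set_integrable lborel {0<..} (\<lambda>r::real. r powr (1 / 2 - 1) * exp (- r))" by (rule Gamma_set_integral(1)) simp
    have "set_integrable lborel UNIV (\<lambda>x::real. inverse (1 + x\<^sup>2))"
      using integrable_inverse_1_plus_square by (simp add: einterval_eq)
    thus "set_integrable lborel {0<..} (\<lambda>x::real. inverse (1 + x\<^sup>2))" by (rule set_integrable_subset) auto
  qed
  have b: "\<bar>f r\<bar> \<le> (3 * K) * ?e r" if r: "r > 0" for r
  proof (cases "r \<le> 1")
    case True
    have "exp r \<le> 3" using True exp_le by (meson exp_le_cancel_iff order_trans)
    hence "1 / 3 \<le> exp (- r)" by (simp add: exp_minus inverse_eq_divide divide_simps)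
    hence "r powr (1 / 2 - 1) * (1 / 3) \<le> r powr (1 / 2 - 1) * exp (- r)" by (intro mult_left_mono) auto
    moreover have "0 \<le> inverse (1 + r\<^sup>2)" by simp
    moreover have "r powr (- (1 / 2)) = r powr (1 / 2 - 1)" by simp
    ultimately have "r powr (- (1 / 2)) \<le> 3 * ?e r" by argo
    from mult_left_mono[OF this K] small[OF r True] show ?thesis by (simp only: mult.assoc mult.left_commute[of K]) 
  next
    case False
    have "inverse (r\<^sup>2 + r\<^sup>2) \<le> inverse (1 + r\<^sup>2)" using False by (intro le_imp_inverse_le add_right_mono) (auto simp: add_pos_nonneg one_le_power)
    moreover have "r powr (- 2) = 2 * inverse (r\<^sup>2 + r\<^sup>2)" using r by (simp add: powr_minus powr_numeral)
    moreover have "0 \<le> r powr (1 / 2 - 1) * exp (- r)" by simp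
    moreover have "0 \<le> inverse (1 + r\<^sup>2)" by simp
    ultimately have "r powr (- 2) \<le> 3 * ?e r" by argo
    from mult_left_mono[OF this K] large[of r] False show ?thesis by (simp only: mult.assoc mult.left_commute[of K]) linarith
  qed
  show ?thesis
    unfolding set_integrable_def
  proof (rule Bochner_Integration.integrable_bound)
    show "integrable lborel (\<lambda>r. (3 * K) *\<^sub>R (indicator {0<..} r *\<^sub>R ?e r))"
      using e unfolding set_integrable_def by (rule integrable_scaleR_right)
    show "(\<lambda>r. indicator {0<..} r *\<^sub>R f r) \<in> borel_measurable lborel" using m by measurable
    have "norm (indicator {0<..} r *\<^sub>R f r) \<le> norm ((3 * K) *\<^sub>R (indicator {0<..} r *\<^sub>R ?e r))" for r :: real
    proof (cases "r > 0")
      case True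
      have "\<bar>f r\<bar> \<le> \<bar>(3 * K) * ?e r\<bar>" using b[OF True] by (rule order_trans) simp
      thus ?thesis using True by simp
    qed simp
    thus "AE r in lborel. norm (indicator {0<..} r *\<^sub>R f r) \<le> norm ((3 * K) *\<^sub>R (indicator {0<..} r *\<^sub>R ?e r))" by simp
  qed
qed

text \<open>The exponent \<open>1/4\<close> at the origin leaves the square integrable in dimension one; \<open>d + 1\<close> at infinity beats the weight
\<open>r\<^bsup>d-1\<^esup>\<close> in both integrals.\<close>

lemma profile_integrable_of_endpoint_bounds:
  assumes d: "d > 0" and [measurable]: "w \<in> borel_measurable borel"
    and small: "\<And>r. 0 < r \<Longrightarrow> r \<le> 1 \<Longrightarrow> \<bar>r powr s * w r\<bar> \<le> C * r powr (- (1 / 4))"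
    and large: "\<And>r. 1 \<le> r \<Longrightarrow> \<bar>r powr s * w r\<bar> \<le> C * r powr (- (real d + 1))"
  shows "profile_integrable d s w"
proof -
  have C: "C \<ge> 0" using large[of 1] by simp
  have rd: "r ^ (d - 1) = r powr (real d - 1)" if "r > 0" for r using powr_realpow[OF that, of "d - 1"] d by (simp add: of_nat_diff)
  have sq: "\<bar>r powr s * w r\<bar>\<^sup>2 \<le> (C * b)\<^sup>2" if "\<bar>r powr s * w r\<bar> \<le> C * b" for r b using that by (intro power_mono) auto
  have "set_integrable lborel {0<..} (\<lambda>r. r ^ (d - 1) * (r powr s * w r))"
  proof (rule set_integrable_of_endpoint_bounds)
    show "(\<lambda>r. r ^ (d - 1) * (r powr s * w r)) \<in> borel_measurable borel" by measurable
    fix r :: real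
    {
      assume r: "0 < r" "r \<le> 1"
      have "\<bar>r ^ (d - 1) * (r powr s * w r)\<bar> \<le> 1 * (C * r powr (- (1 / 4)))"
        unfolding abs_mult[of "r ^ (d - 1)"] using r C by (intro mult_mono small) (auto simp: power_le_one)
      also have "\<dots> \<le> C * r powr (- (1 / 2))" unfolding mult_1_left using r by (intro mult_left_mono C powr_mono') auto
      finally show "\<bar>r ^ (d - 1) * (r powr s * w r)\<bar> \<le> C * r powr (- (1 / 2))" .
    next
      assume r: "1 \<le> r"
      have "\<bar>r ^ (d - 1) * (r powr s * w r)\<bar> \<le> r powr (real d - 1) * (C * r powr (- (real d + 1)))"
        unfolding abs_mult[of "r ^ (d - 1)"] using r C by (intro mult_mono large) (auto simp: rd[unfolded One_nat_def])
      also have "\<dots> = C * r powr ((real d - 1) + - (real d + 1))" unfolding powr_add by (simp only: mult.left_commute)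
      finally show "\<bar>r ^ (d - 1) * (r powr s * w r)\<bar> \<le> C * r powr (- 2)" by simp
    }
  qed
  moreover have "set_integrable lborel {0<..} (\<lambda>r. r ^ (d - 1) * (r powr s * w r)\<^sup>2)"
  proof (rule set_integrable_of_endpoint_bounds)
    show "(\<lambda>r. r ^ (d - 1) * (r powr s * w r)\<^sup>2) \<in> borel_measurable borel" by measurable
    fix r :: real
    {
      assume r: "0 < r" "r \<le> 1"
      have "\<bar>r ^ (d - 1) * (r powr s * w r)\<^sup>2\<bar> \<le> 1 * (C * r powr (- (1 / 4)))\<^sup>2"
        unfolding abs_mult[of "r ^ (d - 1)"] power_abs using r by (intro mult_mono sq[OF small, unfolded power_abs]) (auto simp: power_le_one)
      thus "\<bar>r ^ (d - 1) * (r powr s * w r)\<^sup>2\<bar> \<le> C\<^sup>2 * r powr (- (1 / 2))" by (simp add: power_mult_distrib powr_power2)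
    next
      assume r: "1 \<le> r"
      have "\<bar>r ^ (d - 1) * (r powr s * w r)\<^sup>2\<bar> \<le> r powr (real d - 1) * (C * r powr (- (real d + 1)))\<^sup>2"
        unfolding abs_mult[of "r ^ (d - 1)"] power_abs using r by (intro mult_mono sq[OF large, unfolded power_abs]) (auto simp: rd[unfolded One_nat_def])
      also have "\<dots> = C\<^sup>2 * r powr ((real d - 1) + 2 * - (real d + 1))" unfolding power_mult_distrib powr_power2 powr_add by (simp only: mult.left_commute)
      also have "\<dots> \<le> C\<^sup>2 * r powr (- 2)" using r by (intro mult_left_mono powr_mono) auto
      finally show "\<bar>r ^ (d - 1) * (r powr s * w r)\<^sup>2\<bar> \<le> C\<^sup>2 * r powr (- 2)" .
    }
  qed
  ultimately show ?thesis by (simp add: profile_integrable_def)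
qed

text \<open>The indicator function discards negative arguments, so that the profile is measurable on the whole line.\<close>

definition macdonald_profile :: "real \<Rightarrow> real \<Rightarrow> real \<Rightarrow> real \<Rightarrow> real" where
  "macdonald_profile j n \<epsilon> \<xi> = (indicator {0<..} \<xi> * macdonald_K (n - j) \<xi>) * (\<xi> powr (n - j) / (\<xi>\<^sup>2 + \<epsilon>\<^sup>2) powr (n - j / 2))"

lemma macdonald_profile_integrable:
  assumes d: "d > 0" and jn: "0 \<le> j" "j \<le> n" "0 < n" and \<epsilon>: "\<epsilon> > 0" and s: "0 \<le> s"
  shows "profile_integrable d s (macdonald_profile j n \<epsilon>)"
proof -
  let ?w = "macdonald_profile j n \<epsilon>" and ?q = "inverse ((\<epsilon>\<^sup>2) powr (n - j / 2))"
  have m: "?w \<in> borel_measurable borel"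
  proof -
    have [measurable]: "(\<lambda>\<xi>. indicator {0<..} \<xi> * macdonald_K (n - j) \<xi>) \<in> borel_measurable borel"
      using borel_measurable_macdonald_K[of "n - j"] jn by (simp add: set_borel_measurable_def)
    show ?thesis unfolding macdonald_profile_def[abs_def] by measurable
  qed
  have bound: "\<exists>C\<ge>0. \<forall>r>0. \<bar>r powr s * ?w r\<bar> \<le> C * r powr (s + (n - j) - p)" if p: "p \<ge> n - j" "p > 0" for p
  proof -
    obtain C where C: "C \<ge> 0" "\<And>x. x > 0 \<Longrightarrow> \<bar>macdonald_K (n - j) x\<bar> \<le> C * x powr (- p)"
      using macdonald_K_bound[of "n - j" p] p jn by auto
    have "\<bar>r powr s * ?w r\<bar> \<le> (C * ?q) * r powr (s + (n - j) - p)" if r: "r > 0" for r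
    proof -
      have "(\<epsilon>\<^sup>2) powr (n - j / 2) \<le> (r\<^sup>2 + \<epsilon>\<^sup>2) powr (n - j / 2)" using jn by (intro powr_mono2) auto
      hence "inverse ((r\<^sup>2 + \<epsilon>\<^sup>2) powr (n - j / 2)) \<le> ?q" using \<epsilon> by (intro le_imp_inverse_le) auto
      hence "\<bar>macdonald_K (n - j) r\<bar> * inverse ((r\<^sup>2 + \<epsilon>\<^sup>2) powr (n - j / 2)) \<le> (C * r powr (- p)) * ?q"
        using C(1) by (intro mult_mono C(2) r) auto
      hence "(r powr s * r powr (n - j)) * (\<bar>macdonald_K (n - j) r\<bar> * inverse ((r\<^sup>2 + \<epsilon>\<^sup>2) powr (n - j / 2))) \<le> (r powr s * r powr (n - j)) * ((C * r powr (- p)) * ?q)"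
        by (intro mult_left_mono) auto
      moreover have "r powr s * ?w r = (r powr s * r powr (n - j)) * (macdonald_K (n - j) r * inverse ((r\<^sup>2 + \<epsilon>\<^sup>2) powr (n - j / 2)))"
        using r unfolding macdonald_profile_def divide_inverse
        by (simp only: indicator_simps greaterThan_iff mult_1_left mult.assoc mult.commute mult.left_commute)
      hence "\<bar>r powr s * ?w r\<bar> = (r powr s * r powr (n - j)) * (\<bar>macdonald_K (n - j) r\<bar> * inverse ((r\<^sup>2 + \<epsilon>\<^sup>2) powr (n - j / 2)))"
        by (simp only: abs_mult abs_inverse abs_of_nonneg[OF powr_ge_zero])
      moreover have "(r powr s * r powr (n - j)) * ((C * r powr (- p)) * ?q) = (C * ?q) * r powr (s + (n - j) + - p)"
        unfolding powr_add by (simp only: mult.assoc mult.commute mult.left_commute)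
      ultimately show ?thesis by simp
    qed
    moreover have "C * ?q \<ge> 0" using C(1) by simp
    ultimately show ?thesis by blast
  qed
  \<comment> \<open>The order \<open>n - j + 1/4\<close> governs the origin and also covers the logarithmic singularity for \<open>j = n\<close>.\<close>
  obtain C1 where C1: "C1 \<ge> 0" "\<And>r. r > 0 \<Longrightarrow> \<bar>r powr s * ?w r\<bar> \<le> C1 * r powr (s + (n - j) - (n - j + 1 / 4))"
    using bound[of "n - j + 1 / 4"] jn by auto
  obtain C2 where C2: "C2 \<ge> 0" "\<And>r. r > 0 \<Longrightarrow> \<bar>r powr s * ?w r\<bar> \<le> C2 * r powr (s + (n - j) - (n - j + s + real d + 1))"
    using bound[of "n - j + s + real d + 1"] jn s by auto
  show ?thesis
  proof (rule profile_integrable_of_endpoint_bounds[OF d m])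
    fix r :: real
    {
      assume r: "0 < r" "r \<le> 1"
      note C1(2)[OF r(1)]
      also have "C1 * r powr (s + (n - j) - (n - j + 1 / 4)) \<le> (C1 + C2) * r powr (- (1 / 4))"
        using C1(1) C2(1) r s by (intro mult_mono powr_mono') auto
      finally show "\<bar>r powr s * ?w r\<bar> \<le> (C1 + C2) * r powr (- (1 / 4))" .
    next
      assume r: "1 \<le> r"
      note C2(2)[of r]
      also have "C2 * r powr (s + (n - j) - (n - j + s + real d + 1)) \<le> (C1 + C2) * r powr (- (real d + 1))"
        using C1(1) C2(1) r by (intro mult_mono powr_mono) auto
      finally show "\<bar>r powr s * ?w r\<bar> \<le> (C1 + C2) * r powr (- (real d + 1))" using r by simp
    }
  qed
qed

lemma macdonald_profile_square:
  assumes d: "d > 0" and \<xi>: "\<xi> > 0"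
  shows "\<xi> ^ (d - 1) * (\<xi> powr s * macdonald_profile j n \<epsilon> \<xi>)\<^sup>2 =
    \<xi> powr (2 * s + 2 * n - 2 * j + real d - 1) * (macdonald_K (n - j) \<xi>)\<^sup>2 / (\<xi>\<^sup>2 + \<epsilon>\<^sup>2) powr (2 * n - j)"
proof -
  let ?K = "macdonald_K (n - j) \<xi>" and ?Q = "\<xi>\<^sup>2 + \<epsilon>\<^sup>2"
  have rd: "\<xi> ^ (d - 1) = \<xi> powr (real d - 1)" using powr_realpow[OF \<xi>, of "d - 1"] d by (simp add: of_nat_diff)
  have e: "2 * s + 2 * n - 2 * j + real d - 1 = (real d - 1) + (2 * s + 2 * (n - j))" by (simp add: algebra_simps)
  have q: "2 * n - j = 2 * (n - j / 2)" by simp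
  have "\<xi> ^ (d - 1) * (\<xi> powr s * macdonald_profile j n \<epsilon> \<xi>)\<^sup>2 =
      \<xi> powr (real d - 1) * ((\<xi> powr s)\<^sup>2 * (?K\<^sup>2 * ((\<xi> powr (n - j))\<^sup>2 / (?Q powr (n - j / 2))\<^sup>2)))"
    unfolding rd macdonald_profile_def power_mult_distrib power_divide using \<xi> by simp
  also have "\<dots> = \<xi> powr (2 * s + 2 * n - 2 * j + real d - 1) * ?K\<^sup>2 / ?Q powr (2 * n - j)"
    unfolding powr_power2 e q powr_add[of \<xi>] divide_inverse by (simp only: mult.assoc mult.commute mult.left_commute)
  finally show ?thesis .
qed

lemma profile_square_macdonald:
  assumes "d > 0"
  shows "U_bound d j n \<epsilon> = sqrt (profile_square d 0 (macdonald_profile j n \<epsilon>))"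
    and "V_bound d j n \<epsilon> = sqrt (profile_square d n (macdonald_profile j n \<epsilon>))"
proof -
  have "profile_square d s (macdonald_profile j n \<epsilon>) = sphere_factor d *
      (LINT \<xi>:{0<..}|lborel. \<xi> powr (2 * s + 2 * n - 2 * j + real d - 1) * (macdonald_K (n - j) \<xi>)\<^sup>2 / (\<xi>\<^sup>2 + \<epsilon>\<^sup>2) powr (2 * n - j))" for s
    unfolding profile_square_def
    by (intro arg_cong[of _ _ "(*) (sphere_factor d)"] set_lebesgue_integral_cong allI impI macdonald_profile_square assms) auto
  from this[of 0] this[of n]
  show "U_bound d j n \<epsilon> = sqrt (profile_square d 0 (macdonald_profile j n \<epsilon>))"
    "V_bound d j n \<epsilon> = sqrt (profile_square d n (macdonald_profile j n \<epsilon>))"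
    by (simp_all add: U_bound_def V_bound_def)
qed

lemma profile_transform_macdonald:
  assumes d: "d > 0" shows "M_fun d j n \<epsilon> = profile_transform d j (macdonald_profile j n \<epsilon>)"
proof
  fix \<rho>
  show "M_fun d j n \<epsilon> \<rho> = profile_transform d j (macdonald_profile j n \<epsilon>) \<rho>"
    unfolding M_fun_def profile_transform_def
  proof (intro set_lebesgue_integral_cong allI impI)
    fix \<xi> :: real assume "\<xi> \<in> {0<..}"
    hence \<xi>: "\<xi> > 0" by simp
    have rd: "\<xi> ^ (d - 1) = \<xi> powr (real d - 1)" using powr_realpow[OF \<xi>, of "d - 1"] d by (simp add: of_nat_diff)
    have e: "n + real d - 1 = (real d - 1) + (j + (n - j))" by simp
    have "\<xi> powr (n + real d - 1) * macdonald_K (n - j) \<xi> / (\<xi>\<^sup>2 + \<epsilon>\<^sup>2) powr (n - j / 2) = \<xi> ^ (d - 1) * (\<xi> powr j * macdonald_profile j n \<epsilon> \<xi>)"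
      unfolding e powr_add[of \<xi>] rd macdonald_profile_def divide_inverse using \<xi>
      by (simp only: indicator_simps greaterThan_iff mult_1_left mult.assoc mult.commute mult.left_commute)
    thus "bessel_J_quotient (real d / 2 - 1) (\<rho> * \<xi>) * (\<xi> powr (n + real d - 1) * macdonald_K (n - j) \<xi> / (\<xi>\<^sup>2 + \<epsilon>\<^sup>2) powr (n - j / 2)) =
        bessel_J_quotient (real d / 2 - 1) (\<rho> * \<xi>) * (\<xi> ^ (d - 1) * (\<xi> powr j * macdonald_profile j n \<epsilon> \<xi>))" by (simp only:)
  qed simp
qed

section \<open>The lower bound\<close>

text \<open>The inequality for dilated profiles is turned into the hypothesis of \<open>optimize_dilation\<close>. With the dilation written
as \<open>exp a\<close>, all powers become exponentials of multiples of \<open>a\<close>.\<close>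

lemma S_minus_le_sobolev_constant:
  fixes j n \<theta> :: real and r :: ennreal
  assumes \<theta>: "0 \<le> \<theta>" "\<theta> \<le> 1" and n: "0 < n" and j: "0 \<le> j"
    and \<kappa>: "0 \<le> \<theta> * n - j" "\<theta> * n - j \<le> real CARD('d::finite) / 2"
    and r: "2 \<le> r" "1 / r = ennreal (1 / 2 - (\<theta> * n - j) / real CARD('d))"
    and \<epsilon>: "\<epsilon> > 0" and S: "0 \<le> S" "sobolev_inequality TYPE('d) j n r S"
  shows "S_minus CARD('d) j n \<theta> r \<epsilon> \<le> S"
proof -
  let ?d = "CARD('d)" and ?w = "macdonald_profile j n \<epsilon>"
  define \<kappa>' where "\<kappa>' = 1 / 2 - (\<theta> * n - j) / real ?d"
  have d: "?d > 0" by simp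
  have k0: "\<kappa>' \<ge> 0" using \<kappa>(2) by (simp add: \<kappa>'_def field_simps)
  have dk: "real ?d * \<kappa>' = real ?d / 2 - (\<theta> * n - j)"
  proof -
    have "real ?d * ((\<theta> * n - j) / real ?d) = \<theta> * n - j" by simp
    thus ?thesis unfolding \<kappa>'_def right_diff_distrib[of "real ?d" "1 / 2"] by linarith
  qed
  have "\<theta> * n \<le> 1 * n" using \<theta> n by (intro mult_right_mono) auto
  hence jn: "j \<le> n" using \<kappa>(1) by simp
  have P: "profile_integrable ?d s ?w" if "s \<ge> 0" for s by (rule macdonald_profile_integrable[OF d j jn n \<epsilon> that])
  let ?A = "profile_square ?d 0 ?w" and ?B = "profile_square ?d n ?w" and ?Y = "Y_bound ?d j n r \<epsilon>"
  have Y: "?Y = radial_norm ?d r (profile_transform ?d j ?w)"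
    unfolding Y_bound_def radial_norm_def profile_transform_macdonald[OF d] ..
  have nonneg: "profile_square ?d s ?w \<ge> 0" if "s \<ge> 0" for s
    unfolding radial_symbol_integrable(3)[OF P[OF that], symmetric] by (intro integral_nonneg_AE) auto
  obtain M where M: "\<And>\<rho>. \<rho> \<ge> 0 \<Longrightarrow> \<bar>profile_transform ?d j ?w \<rho>\<bar> \<le> M"
    using profile_transform_continuous_bounded(2)[OF P[OF j]] by blast
  have "?Y \<le> S * sqrt (t powr \<theta> * ?A + t powr (\<theta> - 1) * ?B)" if t: "t > 0" for t
  proof -
    define a where "a = ln t / (2 * n)"
    define c where "c = exp a"
    have c: "c > 0" by (simp add: c_def)
    have cp: "c powr s = exp (s * a)" and cd: "c ^ ?d = exp (real ?d * a)" for s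
      by (simp_all add: c_def powr_def exp_of_nat_mult)
    have tp: "t powr s = exp (2 * n * s * a)" for s using t n by (simp add: powr_def a_def)
    let ?v = "\<lambda>r. ?w (c * r)" and ?q = "inverse (c ^ ?d * c powr j)"
    have tr: "profile_transform ?d j ?v = (\<lambda>\<rho>. ?q * profile_transform ?d j ?w (\<rho> / c))"
      by (rule ext) (rule profile_dilation(3)[OF c d])
    have q0: "?q \<ge> 0" using c by simp
    have "radial_norm ?d r (profile_transform ?d j ?v) = ?q * c powr (real ?d * \<kappa>') * ?Y"
      unfolding tr Y by (rule radial_norm_dilation[OF d c q0 M r(1) r(2)[folded \<kappa>'_def] k0])
    moreover have "radial_norm ?d r (profile_transform ?d j ?v) \<le> S * sqrt (profile_square ?d 0 ?v + profile_square ?d n ?v)"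
      by (intro sobolev_inequality_profile[OF S(2,1) r(1)] profile_dilation(1)[OF c d] P) (use j n in auto)
    ultimately have le: "?q * c powr (real ?d * \<kappa>') * ?Y \<le> S * sqrt (inverse (c ^ ?d * (c powr 0)\<^sup>2) * ?A + inverse (c ^ ?d * (c powr n)\<^sup>2) * ?B)"
      by (simp only: profile_dilation(2)[OF c d])
    \<comment> \<open>The factor that isolates \<open>Y\<close> on the left; squared and moved under the root it produces the powers of \<open>t\<close>.\<close>
    define E where "E = exp ((real ?d + j - real ?d * \<kappa>') * a)"
    have E0: "E \<ge> 0" by (simp add: E_def)
    have "E * (?q * c powr (real ?d * \<kappa>')) = 1"
      unfolding E_def cp cd exp_add[symmetric] exp_minus[symmetric] by (simp add: algebra_simps)
    hence "?Y = E * (?q * c powr (real ?d * \<kappa>') * ?Y)" by (simp only: mult.assoc[symmetric] mult_1_left)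
    also have "\<dots> \<le> E * (S * sqrt (inverse (c ^ ?d * (c powr 0)\<^sup>2) * ?A + inverse (c ^ ?d * (c powr n)\<^sup>2) * ?B))"
      by (intro mult_left_mono le E0)
    also have "\<dots> = S * sqrt (E\<^sup>2 * (inverse (c ^ ?d * (c powr 0)\<^sup>2) * ?A + inverse (c ^ ?d * (c powr n)\<^sup>2) * ?B))"
      using E0 by (simp add: real_sqrt_mult)
    also have "E\<^sup>2 * (inverse (c ^ ?d * (c powr 0)\<^sup>2) * ?A + inverse (c ^ ?d * (c powr n)\<^sup>2) * ?B) =
        (E\<^sup>2 * inverse (c ^ ?d * (c powr 0)\<^sup>2)) * ?A + (E\<^sup>2 * inverse (c ^ ?d * (c powr n)\<^sup>2)) * ?B"
      by (simp only: distrib_left mult.assoc)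
    also have "E\<^sup>2 * inverse (c ^ ?d * (c powr 0)\<^sup>2) = t powr \<theta>"
      unfolding E_def cp cd tp power2_eq_square exp_add[symmetric] exp_minus[symmetric] dk
      by (rule arg_cong[of _ _ exp]) (simp add: algebra_simps)
    also have "E\<^sup>2 * inverse (c ^ ?d * (c powr n)\<^sup>2) = t powr (\<theta> - 1)"
      unfolding E_def cp cd tp power2_eq_square exp_add[symmetric] exp_minus[symmetric] dk
      by (rule arg_cong[of _ _ exp]) (simp add: algebra_simps)
    finally show ?thesis .
  qed
  from optimize_dilation[OF \<theta> nonneg nonneg S(1) this] n
  show ?thesis unfolding S_minus_def profile_square_macdonald[OF d] by simp
qed

theorem corollary5p18:
  fixes j n \<theta> :: real and r :: ennreal
  assumes "0 \<le> \<theta>" "\<theta> \<le> 1" "0 < n" "0 \<le> j"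
    and "0 \<le> \<theta> * n - j" "\<theta> * n - j \<le> real CARD('d::finite) / 2"
    and "n = j + real CARD('d) / 2 \<Longrightarrow> \<theta> \<noteq> 1"
    and "2 \<le> r" "1 / r = ennreal (1 / 2 - (\<theta> * n - j) / real CARD('d))"
  shows "(\<forall>\<epsilon>>0. continuous_on {0..} (M_fun CARD('d) j n \<epsilon>)) \<and>
    (\<forall>\<epsilon>>0. ereal (S_minus CARD('d) j n \<theta> r \<epsilon>) \<le> sobolev_sharp_constant TYPE('d) j n r) \<and>
    (SUP \<epsilon>\<in>{0<..}. ereal (S_minus CARD('d) j n \<theta> r \<epsilon>)) \<le> sobolev_sharp_constant TYPE('d) j n r"
proof -
  have d: "CARD('d) > 0" by simp
  have "\<theta> * n \<le> 1 * n" using assms by (intro mult_right_mono) auto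
  hence jn: "j \<le> n" using assms(5) by simp
  have cont: "continuous_on {0..} (M_fun CARD('d) j n \<epsilon>)" if "\<epsilon> > 0" for \<epsilon>
    unfolding profile_transform_macdonald[OF d]
    by (rule profile_transform_continuous_bounded(1)[OF macdonald_profile_integrable[OF d assms(4) jn assms(3) that assms(4)]])
  have le: "ereal (S_minus CARD('d) j n \<theta> r \<epsilon>) \<le> sobolev_sharp_constant TYPE('d) j n r" if "\<epsilon> > 0" for \<epsilon>
    unfolding sobolev_sharp_constant_def
  proof (rule Inf_greatest)
    fix s assume "s \<in> {ereal S |S. 0 \<le> S \<and> sobolev_inequality TYPE('d) j n r S}"
    then obtain S where S: "s = ereal S" "0 \<le> S" "sobolev_inequality TYPE('d) j n r S" by blast
    from S_minus_le_sobolev_constant[OF assms(1-6) assms(8,9) that S(2,3)]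
    show "ereal (S_minus CARD('d) j n \<theta> r \<epsilon>) \<le> s" unfolding S(1) by simp
  qed
  show ?thesis using cont le by (auto intro: SUP_least)
qed

end
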